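(* There is a deterministic algorithm that computes a reachability forest of any input $n$-node directed graph $\mathcal{G}=(\mathcal{V},\mathcal{E})$ in $\tilde{O}(n^\omega)$ time.
   Context: $\omega$ is the matrix multiplication exponent; $\tilde O$ hides polylogarithmic factors in $n$. For a directed graph $\mathcal{G}=(\mathcal{V},\mathcal{E})$ and $s\in\mathcal{V}$, $T\subseteq\mathcal{E}$ is a reachability tree from $s$ in $\mathcal{G}$ if $(\mathcal{V},T)$ is an arborescence rooted at $s$ and, for every $t\in\mathcal{V}$, $s$ can reach $t$ in $(\mathcal{V},T)$ if and only if $s$ can reach $t$ in $\mathcal{G}$. A family $\{T_a\}_{a\in\mathcal{V}}$ is a reachability forest in $\mathcal{G}$ if each $T_a$ is a reachability tree from $a$.
   Formalization: Nodes not reachable from the root are left isolated: the arborescence condition is imposed only on the root and the endpoints of tree arcs. The time bound is Õ(n^(ω+ε)) for every ε>0, and Õ(n^ω) provided that matrix multiplication itself takes Õ(n^ω). *)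

theory Defs
  imports
    Complex_Main
    "HOL-Library.Landau_Symbols"
    "HOL-Library.Log_Nat"
    "Graph_Theory.Pair_Digraph"
begin

section \<open>Reachability forests\<close>

text \<open>
  Vertices that cannot be reached from the root must stay isolated in \<open>(V, T)\<close>, since a
  reachability tree spans exactly the reachable vertices.  So the arborescence condition is
  imposed on the root and the endpoints of arcs: each of them is the end of exactly one
  directed walk from the root.
\<close>

definition arborescence :: "'a pair_pre_digraph \<Rightarrow> 'a \<Rightarrow> bool" where
  "arborescence D s \<longleftrightarrow>
     pair_wf_digraph D \<and> s \<in> pverts D \<and>
     (\<forall>v \<in> {s} \<union> fst ` parcs D \<union> snd ` parcs D.
        \<exists>!p. pre_digraph.awalk (with_proj D) s p v)"

definition reachability_tree :: "'a pair_pre_digraph \<Rightarrow> 'a \<Rightarrow> ('a \<times> 'a) set \<Rightarrow> bool" where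
  "reachability_tree G s T \<longleftrightarrow>
     (let D = \<lparr> pverts = pverts G, parcs = T \<rparr> in
        T \<subseteq> parcs G \<and> arborescence D s \<and>
        (\<forall>t \<in> pverts G. reachable (with_proj D) s t \<longleftrightarrow> reachable (with_proj G) s t))"

definition reachability_forest :: "'a pair_pre_digraph \<Rightarrow> ('a \<Rightarrow> ('a \<times> 'a) set) \<Rightarrow> bool" where
  "reachability_forest G F \<longleftrightarrow> (\<forall>a \<in> pverts G. reachability_tree G a (F a))"

section \<open>Deterministic random access programs with logarithmic cost\<close>

text \<open>
  A program works on finitely many arrays of integers; \<open>s a i\<close> is entry \<open>i\<close> of array \<open>a\<close> in
  store \<open>s\<close>.  Scalar variables are entries at a fixed index.  Array names are fixed in the
  program text, indices are computed.  Every value that occurs during evaluation (constants,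
  indices, entries read, results of operations) is charged its bit length.  For integers of
  \<open>O(log n)\<close> bits this agrees with the unit-cost word RAM with \<open>O(log n)\<close>-bit words up to
  polylogarithmic factors.
\<close>

type_synonym store = "nat \<Rightarrow> int \<Rightarrow> int"

datatype expr =
    Const int
  | Entry nat expr
  | Add expr expr
  | Sub expr expr
  | Mul expr expr
  | Div expr expr

primrec val :: "store \<Rightarrow> expr \<Rightarrow> int" where
  "val s (Const c) = c"
| "val s (Entry a e) = s a (val s e)"
| "val s (Add e f) = val s e + val s f"
| "val s (Sub e f) = val s e - val s f"
| "val s (Mul e f) = val s e * val s f"
| "val s (Div e f) = val s e div val s f"

definition bits :: "int \<Rightarrow> nat" where
  "bits x = 1 + floorlog 2 (nat \<bar>x\<bar>)"

primrec cost :: "store \<Rightarrow> expr \<Rightarrow> nat" where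
  "cost s (Const c) = bits c"
| "cost s (Entry a e) = cost s e + bits (val s (Entry a e))"
| "cost s (Add e f) = cost s e + cost s f + bits (val s (Add e f))"
| "cost s (Sub e f) = cost s e + cost s f + bits (val s (Sub e f))"
| "cost s (Mul e f) = cost s e + cost s f + bits (val s (Mul e f))"
| "cost s (Div e f) = cost s e + cost s f + bits (val s (Div e f))"

datatype prog =
    Assign nat expr expr
  | Seq prog prog
  | If expr prog prog
  | While expr prog

text \<open>
  \<open>exec P s t s'\<close>: started in \<open>s\<close>, program \<open>P\<close> halts in \<open>s'\<close> after time \<open>t\<close>.
  \<open>Assign a e f\<close> writes the value of \<open>f\<close> to entry \<open>e\<close> of array \<open>a\<close>; a guard holds iff its
  value is positive.
\<close>

inductive exec :: "prog \<Rightarrow> store \<Rightarrow> nat \<Rightarrow> store \<Rightarrow> bool" where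
  Assign: "exec (Assign a e f) s (1 + cost s e + cost s f) (s(a := (s a)(val s e := val s f)))"
| Seq: "exec P s t s' \<Longrightarrow> exec Q s' u s'' \<Longrightarrow> exec (Seq P Q) s (t + u) s''"
| IfTrue: "val s b > 0 \<Longrightarrow> exec P s t s' \<Longrightarrow> exec (If b P Q) s (1 + cost s b + t) s'"
| IfFalse: "val s b \<le> 0 \<Longrightarrow> exec Q s t s' \<Longrightarrow> exec (If b P Q) s (1 + cost s b + t) s'"
| WhileFalse: "val s b \<le> 0 \<Longrightarrow> exec (While b P) s (1 + cost s b) s"
| WhileTrue: "val s b > 0 \<Longrightarrow> exec P s t s' \<Longrightarrow> exec (While b P) s' u s''
    \<Longrightarrow> exec (While b P) s (1 + cost s b + t + u) s''"

lemma exec_deterministic: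
  "exec P s t s' \<Longrightarrow> exec P s u s'' \<Longrightarrow> u = t \<and> s'' = s'"
proof (induction arbitrary: u s'' rule: exec.induct)
  case (Assign a e f s)
  from Assign.prems show ?case by (rule exec.cases) simp_all
next
  case (Seq P s t s' Q v r)
  from Seq.prems obtain t' r' v' where "exec P s t' r'" "exec Q r' v' s''" "u = t' + v'"
    by (rule exec.cases) simp_all
  with Seq.IH show ?case by metis
next
  case (IfTrue s b P t s' Q)
  from IfTrue.prems obtain t' where "exec P s t' s''" "u = 1 + cost s b + t'"
    by (rule exec.cases) (use IfTrue.hyps(1) in simp_all)
  with IfTrue.IH show ?case by metis
next
  case (IfFalse s b Q t s' P)
  from IfFalse.prems obtain t' where "exec Q s t' s''" "u = 1 + cost s b + t'"
    by (rule exec.cases) (use IfFalse.hyps(1) in simp_all)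
  with IfFalse.IH show ?case by metis
next
  case (WhileFalse s b P)
  from WhileFalse.prems show ?case by (rule exec.cases) (use WhileFalse.hyps(1) in simp_all)
next
  case (WhileTrue s b P t s' v r)
  from WhileTrue.prems obtain t' r' v'
    where "exec P s t' r'" "exec (While b P) r' v' s''" "u = 1 + cost s b + t' + v'"
    by (rule exec.cases) (use WhileTrue.hyps(1) in simp_all)
  with WhileTrue.IH show ?case by metis
qed

definition soft_O :: "(nat \<Rightarrow> real) \<Rightarrow> (nat \<Rightarrow> real) set" where
  "soft_O g = (\<Union>k::nat. O(\<lambda>n. g n * ln (real n) ^ k))"

text \<open>
  \<open>inst n x\<close>: \<open>x\<close> is an instance of size parameter \<open>n\<close>; \<open>inp n x s\<close>: store \<open>s\<close> contains the
  input \<open>x\<close>; \<open>out n x s\<close>: store \<open>s\<close> contains a correct output for \<open>x\<close>.  Nothing is assumed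
  about the part of the initial store that does not hold the input.
\<close>

definition solvable_in ::
  "(nat \<Rightarrow> 'i \<Rightarrow> bool) \<Rightarrow> (nat \<Rightarrow> 'i \<Rightarrow> store \<Rightarrow> bool) \<Rightarrow> (nat \<Rightarrow> 'i \<Rightarrow> store \<Rightarrow> bool)
     \<Rightarrow> (nat \<Rightarrow> real) set \<Rightarrow> bool" where
  "solvable_in inst inp out B \<longleftrightarrow>
     (\<exists>P. \<exists>T \<in> B. \<forall>n x s. inst n x \<longrightarrow> inp n x s \<longrightarrow>
        (\<exists>t s'. exec P s t s' \<and> real t \<le> T n \<and> out n x s'))"

definition holds_matrix :: "store \<Rightarrow> nat \<Rightarrow> nat \<Rightarrow> (nat \<Rightarrow> nat \<Rightarrow> int) \<Rightarrow> bool" where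
  "holds_matrix s a n M \<longleftrightarrow> (\<forall>i<n. \<forall>j<n. s a (int (i * n + j)) = M i j)"

section \<open>The matrix multiplication exponent\<close>

text \<open>
  Multiplication of \<open>n \<times> n\<close> integer matrices whose entries are bounded by a fixed power of
  \<open>n\<close>, i.e. have \<open>O(log n)\<close> bits.
\<close>

definition matmul_solvable_in :: "(nat \<Rightarrow> real) set \<Rightarrow> bool" where
  "matmul_solvable_in B \<longleftrightarrow>
     (\<forall>c::nat. solvable_in
        (\<lambda>n (X, Y). \<forall>i<n. \<forall>j<n. \<bar>X i j\<bar> \<le> int n ^ c \<and> \<bar>Y i j\<bar> \<le> int n ^ c)
        (\<lambda>n (X, Y) s. s 0 0 = int n \<and> holds_matrix s 1 n X \<and> holds_matrix s 2 n Y)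
        (\<lambda>n (X, Y) s. holds_matrix s 3 n (\<lambda>i j. \<Sum>k<n. X i k * Y k j))
        B)"

definition omega :: real where
  "omega = Inf {w. matmul_solvable_in (soft_O (\<lambda>n. real n powr w))}"

section \<open>Computing reachability forests\<close>

text \<open>
  The input is the adjacency matrix of a digraph (loops allowed) with vertices \<open>0, \<dots>, n - 1\<close>.
  The output is the table of parents: entry \<open>(a, v)\<close> equals \<open>u + 1\<close> iff \<open>(u, v)\<close> is an arc
  of \<open>T\<^sub>a\<close>.
\<close>

definition reachability_forest_solvable_in :: "(nat \<Rightarrow> real) set \<Rightarrow> bool" where
  "reachability_forest_solvable_in B \<longleftrightarrow>
     solvable_in
       (\<lambda>n G. pair_wf_digraph G \<and> pverts G = {..<n})
       (\<lambda>n G s. s 0 0 = int n \<and> holds_matrix s 1 n (\<lambda>u v. if (u, v) \<in> parcs G then 1 else 0))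
       (\<lambda>n G s. reachability_forest G
          (\<lambda>a. {(u, v). v < n \<and> s 2 (int (a * n + v)) = int u + 1}))
       B"

end

theory Submission
  imports Defs "HOL-Computational_Algebra.Primes" "HOL-Real_Asymp.Real_Asymp"
begin

text \<open>
  After transitive closure, a reachability tree from \<open>a\<close> consists of one entry arc into every
  strong component reachable from \<open>a\<close> (other than that of \<open>a\<close>) and a spanning
      tree of that
  component rooted at the head of the entry arc.  Spanning trees for all roots of a component come
  from a single in-tree and a single out-tree of a representative: follow the in-tree from the root
  to the representative and use the out-tree off this path.  Choosing the entry arcs is the problem
  of finding witnesses for a Boolean matrix product.

  Witnesses are found deterministically with polylogarithmically many integer matrix products.
  For pairs with about \<open>x\<close> witnesses, repeatedly replace the set \<open>S\<close> of candidate
      witnesses by a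
  part of it, chosen among polylogarithmically many hash functions \<open>k \<mapsto> \<langle>k mod q,
      r\<rangle> mod 2\<close> (inner
  product of bit vectors).  If \<open>q\<close> ranges over the primes below a power of \<open>log
      n\<close>, such a hash
  function is almost pairwise independent, so some choice does not decrease a potential of the
  form \<open>\<Sum>(\<alpha> X - \<beta> X (X - 1))\<close>, where \<open>X\<close> counts the witnesses
      of a pair in \<open>S\<close>; the potential of
  a candidate is evaluated by one matrix product.  In the end a constant fraction of the pairs has
  exactly one witness in \<open>S\<close>, which can be read off a weighted product.

  The bound absorbs quadratic work since every admissible exponent is at least \<open>2\<close>: a program for
  matrix multiplication may have to change all \<open>n\<^sup>2\<close> cells of its output array.
\<close>

section \<open>Time bounds for programs\<close>

text \<open>One search per root takes quadratic time each and cubic time in all. Instead, an entry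
  arc is chosen per root and component, so all vertices of a component see the same choice and have
  one parent each. Any arc into the component with a reachable tail will do: the tail lies in a
  strictly earlier component, which excludes cycles. Hence arbitrary witnesses suffice.

  The obstacle to finding them is the size of the family of hash functions. Masks applied to k
  itself would number 2^L > n, too many at one product each. Reducing k modulo a prime first leaves
  O(log log n) bits and polylogarithmically many masks. The price is that numbers below 2^L may
  coincide modulo a prime, but only for at most L primes. With at least E L primes a pair stays
  together with probability at most (1 + 1/E) / 2, and over l \<le> L + 2 halvings the loss is (1 +
  1/E)^l \<le> 2 for E = 2 L + 4. That so many primes lie below a polylogarithmic bound is
  Chebyshev's estimate, obtained here from the size of lcm(1, ..., N).\<close>

lemma bits_le_iff: "bits x \<le> Suc k \<longleftrightarrow> \<bar>x\<bar> < 2 ^ k"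
proof -
  have "bits x \<le> Suc k \<longleftrightarrow> nat \<bar>x\<bar> < 2 ^ k" by (simp add: bits_def
      floorlog_le_iff)
  also have "\<dots> \<longleftrightarrow> \<bar>x\<bar> < 2 ^ k" by (simp add: nat_less_iff)
  finally show ?thesis .
qed

lemma bits_pos: "0 < bits x" by (simp add: bits_def)

lemma bits_obtain:
  obtains k where "bits x = Suc k" "\<bar>x\<bar> < 2 ^ k"
proof -
  have "bits x = Suc (bits x - 1)" using bits_pos[of x] by simp
  with bits_le_iff[of x "bits x - 1"] that show thesis by simp
qed

lemma bits_mono: "\<bar>x\<bar> \<le> \<bar>y\<bar> \<Longrightarrow> bits x \<le> bits y"
  by (simp add: bits_def floorlog_mono nat_mono)

lemma bits_mult: "bits (x * y) \<le> bits x + bits y"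
proof -
  obtain k where k: "bits x = Suc k" "\<bar>x\<bar> < 2 ^ k" by (rule bits_obtain)
  obtain l where l: "bits y = Suc l" "\<bar>y\<bar> < 2 ^ l" by (rule bits_obtain)
  from k l have "\<bar>x * y\<bar> < 2 ^ (k + l)"
    by (simp add: abs_mult power_add mult_strict_mono')
  moreover have "(2::int) ^ (k + l) \<le> 2 ^ (k + l + 1)" by simp
  ultimately show ?thesis using k l bits_le_iff[of "x * y" "k + l + 1"] by simp
qed

lemma bits_add: "bits (x + y) \<le> bits x + bits y"
proof -
  obtain k where k: "bits x = Suc k" "\<bar>x\<bar> < 2 ^ k" by (rule bits_obtain)
  obtain l where l: "bits y = Suc l" "\<bar>y\<bar> < 2 ^ l" by (rule bits_obtain)
  note * = k l
  have "(2::int) ^ k \<le> 2 ^ (k + l)" "(2::int) ^ l \<le> 2 ^ (k + l)" by simp_all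
  moreover have "(2::int) ^ (k + l + 1) = 2 * 2 ^ (k + l)" by simp
  ultimately have "\<bar>x\<bar> + \<bar>y\<bar> < 2 ^ (k + l + 1)" using * by linarith
  then have "\<bar>x + y\<bar> < 2 ^ (k + l + 1)" by linarith
  with * show ?thesis using bits_le_iff[of "x + y" "k + l + 1"] by simp
qed

lemma bits_uminus [simp]: "bits (- x) = bits x" by (simp add: bits_def)

lemma bits_diff: "bits (x - y) \<le> bits x + bits y"
  using bits_add[of x "- y"] by simp

text \<open>For y > 0 divide x \<le> x y (or x y \<le> x if x is negative) by y. A negative divisor
  reduces to this by negating both arguments, and x div 0 = 0.\<close>

lemma abs_div_le: "\<bar>x div y\<bar> \<le> \<bar>x\<bar>" for x y :: int
proof (cases "y = 0")
  case False
  have *: "\<bar>x div y\<bar> \<le> \<bar>x\<bar>" if "y > 0" for x y :: int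
  proof (cases "x \<ge> 0")
    case True
    have "x * 1 \<le> x * y" using True that by (intro mult_left_mono) auto
    then have "x div y \<le> x" using zdiv_mono1[of x "x * y" y] that by simp
    then show ?thesis using True that by (simp add: pos_imp_zdiv_nonneg_iff)
  next
    case False
    have "x * y \<le> x * 1" using False that by (intro mult_left_mono_neg) auto
    then have "x \<le> x div y" using zdiv_mono1[of "x * y" x y] that by simp
    moreover have "x div y < 0" using False that by (simp add: div_neg_pos_less0)
    ultimately show ?thesis using False by simp
  qed
  show ?thesis
  proof (cases "y > 0")
    case True then show ?thesis by (rule *)
  next
    case False
    with \<open>y \<noteq> 0\<close> have "- y > 0" by simp
    from *[OF this, of "- x"] show ?thesis by simp
  qed
qed simp

lemma bits_div: "bits (x div y) \<le> bits x"
  by (simp add: bits_mono abs_div_le)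

text \<open>Constants contribute their bit length to \<open>cost_weight\<close>; with these values
  simp computes the weight of a concrete statement.\<close>

lemma bits_simps [simp]:
  "bits 0 = 1" "bits 1 = 2" "bits 2 = 3" "bits 4 = 4" "bits 8 = 5" "bits 16 = 6" "bits 32 = 7"
proof -
  have 1: "floorlog 2 1 = 1" by (simp add: floorlog_def)
  show "bits 0 = 1" "bits 1 = 2" using 1 by (simp_all add: bits_def floorlog_eq_zero_iff)
  show "bits 2 = 3" using floorlog_power[of 1 2 1] 1 by (simp add: bits_def)
  show "bits 4 = 4" using floorlog_power[of 1 2 2] 1 by (simp add: bits_def)
  show "bits 8 = 5" using floorlog_power[of 1 2 3] 1 by (simp add: bits_def)
  show "bits 16 = 6" using floorlog_power[of 1 2 4] 1 by (simp add: bits_def)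
  show "bits 32 = 7" using floorlog_power[of 1 2 5] 1 by (simp add: bits_def)
qed

text \<open>Only the entries read need a bound in advance. All intermediate values are then
  controlled by the two syntactic weights that follow, so the time of a statement is obtained
  without estimating its arithmetic.\<close>

primrec reads_le :: "int \<Rightarrow> store \<Rightarrow> expr \<Rightarrow> bool" where
  "reads_le M s (Const c) = True"
| "reads_le M s (Entry a e) = (reads_le M s e \<and> \<bar>s a (val s e)\<bar> \<le> M)"
| "reads_le M s (Add e f) = (reads_le M s e \<and> reads_le M s f)"
| "reads_le M s (Sub e f) = (reads_le M s e \<and> reads_le M s f)"
| "reads_le M s (Mul e f) = (reads_le M s e \<and> reads_le M s f)"
| "reads_le M s (Div e f) = (reads_le M s e \<and> reads_le M s f)"

text \<open>An entry has weight 1 however its index was computed, as \<open>reads_le\<close> bounds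
  it by M. The divisor does not count, since a quotient is never longer than the dividend.\<close>

primrec val_weight :: "expr \<Rightarrow> nat" where
  "val_weight (Const c) = bits c"
| "val_weight (Entry a e) = 1"
| "val_weight (Add e f) = val_weight e + val_weight f"
| "val_weight (Sub e f) = val_weight e + val_weight f"
| "val_weight (Mul e f) = val_weight e + val_weight f"
| "val_weight (Div e f) = val_weight e"

primrec cost_weight :: "expr \<Rightarrow> nat" where
  "cost_weight (Const c) = bits c"
| "cost_weight (Entry a e) = cost_weight e + 1"
| "cost_weight (Add e f) = cost_weight e + cost_weight f + (val_weight e + val_weight f)"
| "cost_weight (Sub e f) = cost_weight e + cost_weight f + (val_weight e + val_weight f)"
| "cost_weight (Mul e f) = cost_weight e + cost_weight f + (val_weight e + val_weight f)"
| "cost_weight (Div e f) = cost_weight e + cost_weight f + val_weight e"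

lemma bits_val_le: "reads_le M s e \<Longrightarrow> bits (val s e) \<le> val_weight e * bits M"
proof (induction e)
  case (Const c) then show ?case using bits_pos[of M] by simp
next
  case (Entry a e) then show ?case using bits_mono[of "s a (val s e)" M] by auto
next
  case (Add e f) then show ?case using bits_add[of "val s e" "val s f"] by (simp add: algebra_simps)
next
  case (Sub e f) then show ?case using bits_diff[of "val s e" "val s f"] by (simp add: algebra_simps)
next
  case (Mul e f) then show ?case using bits_mult[of "val s e" "val s f"] by (simp add: algebra_simps)
next
  case (Div e f) then show ?case using bits_div[of "val s e" "val s f"] by simp
qed

lemma cost_le: "reads_le M s e \<Longrightarrow> cost s e \<le> cost_weight e * bits M"
proof (induction e)
  case (Const c) then show ?case using bits_pos[of M] by simp
next
  case (Entry a e) then show ?case using bits_mono[of "s a (val s e)" M] by (auto simp: algebra_simps)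
next
  case (Add e f)
  then show ?case using bits_val_le[of M s "Add e f"] by (simp add: algebra_simps)
next
  case (Sub e f)
  then show ?case using bits_val_le[of M s "Sub e f"] by (simp add: algebra_simps)
next
  case (Mul e f)
  then show ?case using bits_val_le[of M s "Mul e f"] by (simp add: algebra_simps)
next
  case (Div e f)
  then show ?case using bits_val_le[of M s "Div e f"] by (simp add: algebra_simps)
qed

section \<open>Timed total correctness\<close>

primrec written :: "prog \<Rightarrow> nat set" where
  "written (Assign a e f) = {a}"
| "written (Seq P Q) = written P \<union> written Q"
| "written (If b P Q) = written P \<union> written Q"
| "written (While b P) = written P"

lemma exec_frame: "exec P s t s' \<Longrightarrow> a \<notin> written P \<Longrightarrow> s' a = s a"
  by (induction rule: exec.induct) auto

text \<open>A total correctness triple for one initial store, with the exact time of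
  \<open>exec\<close> relaxed to an upper bound.\<close>

definition runs :: "prog \<Rightarrow> store \<Rightarrow> nat \<Rightarrow> (store \<Rightarrow> bool)
    \<Rightarrow> bool" where
  "runs P s T Q \<longleftrightarrow> (\<exists>t s'. exec P s t s' \<and> t \<le> T \<and> Q s')"

text \<open>The consequence rule also hands over the frame. As every continuation knows that arrays
  outside \<open>written P\<close> are unchanged, postconditions need only describe what a program
  writes.\<close>

lemma runs_weaken:
  assumes "runs P s T Q" "T \<le> T'"
    and "\<And>s'. Q s' \<Longrightarrow> (\<And>a. a \<notin> written P \<Longrightarrow> s' a = s a)
        \<Longrightarrow> Q' s'"
  shows "runs P s T' Q'"
proof -
  obtain t s' where "exec P s t s'" "t \<le> T" "Q s'" using assms(1) unfolding runs_def by blast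
  with assms(2,3) exec_frame have "exec P s t s'" "t \<le> T'" "Q' s'" by auto
  then show ?thesis unfolding runs_def by blast
qed

lemma runs_Seq:
  assumes "runs P s T Q"
    and "\<And>s'. Q s' \<Longrightarrow> (\<And>a. a \<notin> written P \<Longrightarrow> s' a = s a)
        \<Longrightarrow> runs P' s' T' Q'"
    and "T + T' \<le> T''"
  shows "runs (Seq P P') s T'' Q'"
proof -
  obtain t s' where 1: "exec P s t s'" "t \<le> T" "Q s'" using assms(1) unfolding runs_def by blast
  obtain t' s'' where 2: "exec P' s' t' s''" "t' \<le> T'" "Q' s''"
    using assms(2)[OF 1(3)] exec_frame[OF 1(1)] unfolding runs_def by blast
  have "exec (Seq P P') s (t + t') s''" using 1(1) 2(1) by (rule exec.Seq)
  moreover have "t + t' \<le> T''" using 1 2 assms(3) by linarith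
  ultimately show ?thesis using 2(3) unfolding runs_def by blast
qed

abbreviation Var :: "nat \<Rightarrow> expr" where "Var a \<equiv> Entry a (Const 0)"
abbreviation SetVar :: "nat \<Rightarrow> expr \<Rightarrow> prog" where "SetVar a e \<equiv> Assign a
    (Const 0) e"

text \<open>The factor \<open>1000\<close> exceeds the weight of every assignment and guard of the programs
    below.\<close>

definition step_cost :: "int \<Rightarrow> nat" where "step_cost M = 1000 * bits M"

text \<open>The unit charge of a statement is covered by one more \<open>bits M\<close>, which
  leaves 999 of the 1000 for the expressions.\<close>

lemma runs_Assign:
  assumes "reads_le M s e" "reads_le M s f" "cost_weight e + cost_weight f \<le> 999"
    and "Q (s(a := (s a)(val s e := val s f)))"
  shows "runs (Assign a e f) s (step_cost M) Q"
proof -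
  have "1 + cost s e + cost s f \<le> bits M + cost_weight e * bits M + cost_weight f * bits M"
    using cost_le[OF assms(1)] cost_le[OF assms(2)] bits_pos[of M] by simp
  also have "\<dots> = (1 + (cost_weight e + cost_weight f)) * bits M" by (simp add: algebra_simps)
  also have "\<dots> \<le> step_cost M" unfolding step_cost_def using assms(3) by (intro mult_right_mono)
      simp_all
  finally show ?thesis using assms(4) exec.Assign[of a e f s] unfolding runs_def by blast
qed

lemma runs_If:
  assumes "reads_le M s b" "cost_weight b \<le> 999"
    and "val s b > 0 \<Longrightarrow> runs P s T R" "val s b \<le> 0 \<Longrightarrow> runs Q s T R"
  shows "runs (If b P Q) s (step_cost M + T) R"
proof -
  have "1 + cost s b \<le> bits M + cost_weight b * bits M"
    using cost_le[OF assms(1)] bits_pos[of M] by simp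
  also have "\<dots> = (1 + cost_weight b) * bits M" by (simp add: algebra_simps)
  also have "\<dots> \<le> step_cost M" unfolding step_cost_def using assms(2) by (intro mult_right_mono)
      simp_all
  finally have *: "1 + cost s b \<le> step_cost M" .
  show ?thesis
  proof (cases "val s b > 0")
    case True
    with assms(3) obtain t s' where "exec P s t s'" "t \<le> T" "R s'" unfolding runs_def by auto
    moreover from this True have "exec (If b P Q) s (1 + cost s b + t) s'" by (intro exec.IfTrue)
    moreover have "1 + cost s b + t \<le> step_cost M + T" using * \<open>t \<le> T\<close> by linarith
    ultimately show ?thesis unfolding runs_def by blast
  next
    case False
    with assms(4) obtain t s' where "exec Q s t s'" "t \<le> T" "R s'" unfolding runs_def by auto
    moreover from this False have "exec (If b P Q) s (1 + cost s b + t) s'" by (intro exec.IfFalse) auto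
    moreover have "1 + cost s b + t \<le> step_cost M + T" using * \<open>t \<le> T\<close> by linarith
    ultimately show ?thesis unfolding runs_def by blast
  qed
qed

text \<open>Induction over the rounds still to go. Tying the guard to the index of the invariant
  excludes an early exit, so the time bound and \<open>Inv n\<close> come out together.\<close>

lemma runs_While:
  assumes "Inv 0 s"
    and guard: "\<And>i s. i \<le> n \<Longrightarrow> Inv i s \<Longrightarrow> reads_le M s b \<and> (val
        s b > 0 \<longleftrightarrow> i < n)"
    and "cost_weight b \<le> 999"
    and step: "\<And>i s. i < n \<Longrightarrow> Inv i s \<Longrightarrow> runs P s C (Inv (Suc i))"
  shows "runs (While b P) s (n * (C + step_cost M) + step_cost M) (Inv n)"
proof -
  have c: "1 + cost s b \<le> step_cost M" if "reads_le M s b" for s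
  proof -
    have "1 + cost s b \<le> bits M + cost_weight b * bits M"
      using cost_le[OF that] bits_pos[of M] by simp
    also have "\<dots> = (1 + cost_weight b) * bits M" by (simp add: algebra_simps)
    also have "\<dots> \<le> step_cost M" unfolding step_cost_def using assms(3) by (intro mult_right_mono)
        simp_all
    finally show ?thesis .
  qed
  have "Inv i s \<Longrightarrow> i \<le> n \<Longrightarrow> n - i = k \<Longrightarrow> runs (While b P)
      s (k * (C + step_cost M) + step_cost M) (Inv n)" for k i s
  proof (induction k arbitrary: i s)
    case 0
    then have "val s b \<le> 0" "reads_le M s b" using guard[of i s] by auto
    then have "exec (While b P) s (1 + cost s b) s" "1 + cost s b \<le> step_cost M"
      using c exec.WhileFalse[of s b P] by auto
    moreover have "Inv n s" using 0 by simp
    ultimately show ?case unfolding runs_def by auto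
  next
    case (Suc k)
    then have g: "val s b > 0" "reads_le M s b" "i < n" using guard[of i s] by auto
    obtain t s' where 1: "exec P s t s'" "t \<le> C" "Inv (Suc i) s'"
      using step[of i s] Suc.prems g unfolding runs_def by auto
    obtain u s'' where 2: "exec (While b P) s' u s''" "u \<le> k * (C + step_cost M) + step_cost M" "Inv n s''"
      using Suc.IH[OF 1(3)] Suc.prems(3) g(3) unfolding runs_def by force
    have "exec (While b P) s (1 + cost s b + t + u) s''" using g 1 2 by (intro exec.WhileTrue)
    moreover have "1 + cost s b + t + u \<le> Suc k * (C + step_cost M) + step_cost M"
      using c[OF g(2)] 1(2) 2(2) by simp
    ultimately show ?case using 2(3) unfolding runs_def by blast
  qed
  from this[OF assms(1), of n] show ?thesis by simp
qed

definition For :: "nat \<Rightarrow> nat \<Rightarrow> prog \<Rightarrow> prog" where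
  "For v a P = Seq (SetVar v (Const 0))
     (While (Sub (Var a) (Var v)) (Seq P (SetVar v (Add (Var v) (Const 1)))))"

lemma written_For [simp]: "written (For v a P) = insert v (written P)"
  by (auto simp: For_def)

text \<open>The counter is written outside the body, before the first round and after each one,
  whence \<open>indep\<close>. The step may use every array that the loop does not write, with its
  value from before the loop.\<close>

lemma runs_For:
  assumes "s a 0 = int n" "int n \<le> M" "a \<noteq> v" "a \<notin> written P" "v \<notin> written P"
    and init: "Inv 0 s"
    and indep: "\<And>i s x. Inv i s \<Longrightarrow> Inv i (s(v := x))"
    and step: "\<And>i s'. i < n \<Longrightarrow> Inv i s' \<Longrightarrow> s' v 0 = int i \<Longrightarrow>
       (\<And>c. c \<noteq> v \<Longrightarrow> c \<notin> written P \<Longrightarrow> s' c = s c)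
           \<Longrightarrow> runs P s' C (Inv (Suc i))"
  shows "runs (For v a P) s (Suc n * (C + 2 * step_cost M)) (Inv n)"
proof -
  define J where "J i s' \<longleftrightarrow> Inv i s' \<and> s' v 0 = int i \<and>
    (\<forall>c. c \<noteq> v \<longrightarrow> c \<notin> written P \<longrightarrow> s' c = s c)" for i s'
  have "runs (While (Sub (Var a) (Var v)) (Seq P (SetVar v (Add (Var v) (Const 1))))) s1
      (n * ((C + step_cost M) + step_cost M) + step_cost M) (J n)" if "J 0 s1" for s1
  proof (rule runs_While)
    show "J 0 s1" by fact
    show "reads_le M s (Sub (Var a) (Var v)) \<and> (0 < val s (Sub (Var a) (Var v))) = (i < n)"
      if "i \<le> n" "J i s" for i s
      using that assms(1-4) unfolding J_def by auto
    show "cost_weight (Sub (Var a) (Var v)) \<le> 999" by simp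
    fix i s'
    assume i: "i < n" and J: "J i s'"
    show "runs (Seq P (SetVar v (Add (Var v) (Const 1)))) s' (C + step_cost M) (J (Suc i))"
    proof (rule runs_Seq[OF _ _ order_refl])
      show "runs P s' C (Inv (Suc i))" using J i by (intro step) (auto simp: J_def)
      fix s2
      assume 2: "Inv (Suc i) s2" "\<And>a. a \<notin> written P \<Longrightarrow> s2 a = s' a"
      have "s2 v = s' v" using 2(2) assms(5) by blast
      moreover have "s2 c = s c" if "c \<noteq> v" "c \<notin> written P" for c using that J 2(2) by (simp
          add: J_def)
      ultimately show "runs (SetVar v (Add (Var v) (Const 1))) s2 (step_cost M) (J (Suc i))"
        using J i assms(2) indep[OF 2(1)] by (intro runs_Assign) (simp_all add: J_def)
    qed
  qed
  moreover have "runs (SetVar v (Const 0)) s (step_cost M) (J 0)"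
    using indep[OF init] by (intro runs_Assign) (simp_all add: J_def)
  ultimately have "runs (For v a P) s (Suc n * (C + 2 * step_cost M)) (J n)"
    unfolding For_def by (elim runs_Seq) (auto simp: algebra_simps)
  then show ?thesis by (rule runs_weaken) (auto simp: J_def)
qed

section \<open>Loops over vectors and matrices\<close>

text \<open>The row-major index in the integer form in which \<open>val\<close> delivers it.\<close>

abbreviation cell :: "nat \<Rightarrow> nat \<Rightarrow> nat \<Rightarrow> int" where
  "cell n i j \<equiv> int i * int n + int j"

definition mat :: "nat \<Rightarrow> (int \<Rightarrow> int) \<Rightarrow> (nat \<Rightarrow> nat
    \<Rightarrow> int) \<Rightarrow> bool" where
  "mat n A f \<longleftrightarrow> (\<forall>i<n. \<forall>j<n. A (cell n i j) = f i j)"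

definition vec :: "nat \<Rightarrow> (int \<Rightarrow> int) \<Rightarrow> (nat \<Rightarrow> int)
    \<Rightarrow> bool" where
  "vec n A f \<longleftrightarrow> (\<forall>i<n. A (int i) = f i)"

lemma matD: "mat n A f \<Longrightarrow> i < n \<Longrightarrow> j < n \<Longrightarrow> A (cell n i j) = f i j"
  by (simp add: mat_def)

lemma vecD: "vec n A f \<Longrightarrow> i < n \<Longrightarrow> A (int i) = f i"
  by (simp add: vec_def)

lemma holds_matrix_iff_mat: "holds_matrix s a n f \<longleftrightarrow> mat n (s a) f"
  by (simp add: holds_matrix_def mat_def)

lemma cell_eq_iff:
  assumes "j < n" "j' < n"
  shows "cell n i j = cell n i' j' \<longleftrightarrow> i = i' \<and> j = j'"
proof
  assume "cell n i j = cell n i' j'"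
  then have *: "i * n + j = i' * n + j'" by (metis of_nat_add of_nat_mult of_nat_eq_iff)
  from arg_cong[OF this, of "\<lambda>x. x div n"] arg_cong[OF *, of "\<lambda>x. x mod n"] assms
  show "i = i' \<and> j = j'" by simp
qed simp

definition For2 :: "prog \<Rightarrow> prog" where "For2 P = For 90 0 (For 91 0 P)"

lemma written_For2 [simp]: "written (For2 P) = {90, 91} \<union> written P"
  by (auto simp: For2_def)

text \<open>Indexing the invariant by the set of finished cells hides the order of the loops; the
  body learns only that its own cell is not among them.\<close>

lemma runs_For2:
  assumes n: "s 0 0 = int n" "int n \<le> M" and w: "0 \<notin> written P" "90 \<notin> written P" "91
      \<notin> written P"
    and init: "Inv {} s"
    and indep: "\<And>D s x. Inv D s \<Longrightarrow> Inv D (s(90 := x))" "\<And>D s x. Inv D s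
        \<Longrightarrow> Inv D (s(91 := x))"
    and step: "\<And>D i j s'. i < n \<Longrightarrow> j < n \<Longrightarrow> D \<subseteq> {..<n}
        \<times> {..<n} \<Longrightarrow> (i, j) \<notin> D \<Longrightarrow> Inv D s' \<Longrightarrow>
       s' 90 0 = int i \<Longrightarrow> s' 91 0 = int j \<Longrightarrow>
       (\<And>c. c \<noteq> 90 \<Longrightarrow> c \<noteq> 91 \<Longrightarrow> c \<notin> written P
           \<Longrightarrow> s' c = s c) \<Longrightarrow> runs P s' C (Inv (insert (i, j) D))"
  shows "runs (For2 P) s ((Suc n)\<^sup>2 * (C + 4 * step_cost M)) (Inv ({..<n} \<times> {..<n}))"
proof -
  have "runs (For 90 0 (For 91 0 P)) s (Suc n * (Suc n * (C + 2 * step_cost M) + 2 * step_cost M))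
     (Inv ({..<n} \<times> {..<n}))"
  proof (rule runs_For[where Inv = "\<lambda>i. Inv ({..<i} \<times> {..<n})"])
    fix i s1
    assume i: "i < n" and I: "Inv ({..<i} \<times> {..<n}) s1" "s1 90 0 = int i"
      and f: "\<And>c. c \<noteq> 90 \<Longrightarrow> c \<notin> written (For 91 0 P) \<Longrightarrow> s1
          c = s c"
    have "runs (For 91 0 P) s1 (Suc n * (C + 2 * step_cost M)) (Inv ({..<i} \<times> {..<n} \<union> {i}
        \<times> {..<n}))"
    proof (rule runs_For[where Inv = "\<lambda>j. Inv ({..<i} \<times> {..<n} \<union> {i} \<times> {..<j})"])
      fix j s2
      assume j: "j < n" and I2: "Inv ({..<i} \<times> {..<n} \<union> {i} \<times> {..<j}) s2" "s2 91 0 = int j"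
        and f2: "\<And>c. c \<noteq> 91 \<Longrightarrow> c \<notin> written P \<Longrightarrow> s2 c = s1 c"
      have "{..<i} \<times> {..<n} \<union> {i} \<times> {..<Suc j} = insert (i, j) ({..<i} \<times> {..<n}
          \<union> {i} \<times> {..<j})"
        by auto
      moreover have "runs P s2 C (Inv (insert (i, j) ({..<i} \<times> {..<n} \<union> {i} \<times> {..<j})))"
      proof (rule step)
        show "s2 90 0 = int i" using f2[of 90] I(2) w by simp
        show "s2 c = s c" if "c \<noteq> 90" "c \<noteq> 91" "c \<notin> written P" for c
          using f2[of c] f[of c] that by simp
      qed (use i j I2 in auto)
      ultimately show "runs P s2 C (Inv ({..<i} \<times> {..<n} \<union> {i} \<times> {..<Suc j}))" by simp
    next
      show "s1 0 0 = int n" using f[of 0] w n by simp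
    qed (use n w I indep in auto)
    moreover have "{..<Suc i} \<times> {..<n} = {..<i} \<times> {..<n} \<union> {i} \<times> {..<n}" by auto
    ultimately show "runs (For 91 0 P) s1 (Suc n * (C + 2 * step_cost M)) (Inv ({..<Suc i} \<times> {..<n}))"
      by simp
  qed (use n w init indep in auto)
  then show ?thesis unfolding For2_def
    by (rule runs_weaken) (auto simp: power2_eq_square algebra_simps)
qed

abbreviation Cell :: "nat \<Rightarrow> expr" where
  "Cell a \<equiv> Entry a (Add (Mul (Var 90) (Var 0)) (Var 91))"

abbreviation Cell_T :: "nat \<Rightarrow> expr" where
  "Cell_T a \<equiv> Entry a (Add (Mul (Var 91) (Var 0)) (Var 90))"

text \<open>The invariant records that unfinished cells keep their initial content, so the body may
  read the old value of its own cell. This permits in-place updates of a matrix.\<close>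

lemma runs_fill_body:
  assumes n: "s 0 0 = int n" "int n \<le> M" and w: "0 \<notin> written P" "90 \<notin> written P" "91
      \<notin> written P"
    and Z: "Z \<noteq> 90" "Z \<noteq> 91"
    and step: "\<And>i j s'. i < n \<Longrightarrow> j < n \<Longrightarrow>
       (\<And>c. c \<noteq> 90 \<Longrightarrow> c \<noteq> 91 \<Longrightarrow> c \<notin> written P
           \<Longrightarrow> s' c = s c) \<Longrightarrow>
       s' 90 0 = int i \<Longrightarrow> s' 91 0 = int j \<Longrightarrow> s' Z (cell n i j) = s Z (cell n
           i j) \<Longrightarrow>
       runs P s' C (\<lambda>s''. s'' Z = (s' Z)(cell n i j := f i j))"
  shows "runs (For2 P) s ((Suc n)\<^sup>2 * (C + 4 * step_cost M)) (\<lambda>s'. mat n (s' Z) f)"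
proof -
  define Inv where "Inv D s' \<longleftrightarrow> (\<forall>i<n. \<forall>j<n. s' Z (cell n i j) =
    (if (i, j) \<in> D then f i j else s Z (cell n i j)))" for D s'
  have "runs (For2 P) s ((Suc n)\<^sup>2 * (C + 4 * step_cost M)) (Inv ({..<n} \<times> {..<n}))"
  proof (rule runs_For2[where s = s and Inv = Inv, OF n w])
    fix D i j s'
    assume *: "i < n" "j < n" "(i, j) \<notin> D" "Inv D s'" "s' 90 0 = int i" "s' 91 0 = int j"
       "\<And>c. c \<noteq> 90 \<Longrightarrow> c \<noteq> 91 \<Longrightarrow> c \<notin> written P
           \<Longrightarrow> s' c = s c"
    have "runs P s' C (\<lambda>s''. s'' Z = (s' Z)(cell n i j := f i j))"
      using * by (intro step) (auto simp: Inv_def)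
    then show "runs P s' C (Inv (insert (i, j) D))"
    proof (rule runs_weaken)
      fix s'' assume **: "s'' Z = (s' Z)(cell n i j := f i j)"
      show "Inv (insert (i, j) D) s''"
        unfolding Inv_def ** using *(1,2,4) by (auto simp: cell_eq_iff Inv_def)
    qed simp
  qed (use Z in \<open>auto simp: Inv_def\<close>)
  then show ?thesis by (rule runs_weaken) (auto simp: Inv_def mat_def)
qed

definition Fill :: "nat \<Rightarrow> expr \<Rightarrow> prog" where
  "Fill Z e = For2 (Assign Z (Add (Mul (Var 90) (Var 0)) (Var 91)) e)"

lemma written_Fill [simp]: "written (Fill Z e) = {90, 91, Z}" by (auto simp: Fill_def)

lemma runs_Fill:
  assumes n: "s 0 0 = int n" "int n \<le> M" and Z: "Z \<noteq> 0" "Z \<noteq> 90" "Z \<noteq> 91"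
    and e: "cost_weight e \<le> 900"
    and step: "\<And>i j s'. i < n \<Longrightarrow> j < n \<Longrightarrow>
       (\<And>c. c \<noteq> 90 \<Longrightarrow> c \<noteq> 91 \<Longrightarrow> c \<noteq> Z
           \<Longrightarrow> s' c = s c) \<Longrightarrow>
       s' 90 0 = int i \<Longrightarrow> s' 91 0 = int j \<Longrightarrow> s' Z (cell n i j) = s Z (cell n
           i j) \<Longrightarrow>
       reads_le M s' e \<and> val s' e = f i j"
  shows "runs (Fill Z e) s ((Suc n)\<^sup>2 * (5 * step_cost M)) (\<lambda>s'. mat n (s' Z) f)"
proof -
  have "runs (Fill Z e) s ((Suc n)\<^sup>2 * (step_cost M + 4 * step_cost M)) (\<lambda>s'. mat n (s' Z) f)"
    unfolding Fill_def
  proof (rule runs_fill_body[where s = s, OF n])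
    fix i j s'
    assume *: "i < n" "j < n" "s' 90 0 = int i" "s' 91 0 = int j" "s' Z (cell n i j) = s Z (cell n i j)"
      and f: "\<And>c. c \<noteq> 90 \<Longrightarrow> c \<noteq> 91 \<Longrightarrow> c \<notin> written
          (Assign Z (Add (Mul (Var 90) (Var 0)) (Var 91)) e)
           \<Longrightarrow> s' c = s c"
    have "reads_le M s' e \<and> val s' e = f i j" using * f by (intro step) auto
    moreover have "s' 0 0 = int n" using f[of 0] Z n by simp
    ultimately show "runs (Assign Z (Add (Mul (Var 90) (Var 0)) (Var 91)) e) s' (step_cost M)
            (\<lambda>s''. s'' Z = (s' Z)(cell n i j := f i j))"
      using * n e by (intro runs_Assign) auto
  qed (use Z in auto)
  then show ?thesis by simp
qed

lemma runs_fill_vec_body: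
  assumes n: "s a 0 = int n" "int n \<le> M" and w: "a \<noteq> v" "a \<notin> written P" "v \<notin> written P"
    and Z: "Z \<noteq> v"
    and step: "\<And>i s'. i < n \<Longrightarrow> (\<And>c. c \<noteq> v \<Longrightarrow> c \<notin>
        written P \<Longrightarrow> s' c = s c) \<Longrightarrow>
       s' v 0 = int i \<Longrightarrow> s' Z (int i) = s Z (int i) \<Longrightarrow>
       runs P s' C (\<lambda>s''. s'' Z = (s' Z)(int i := f i))"
  shows "runs (For v a P) s (Suc n * (C + 2 * step_cost M)) (\<lambda>s'. vec n (s' Z) f)"
proof -
  define Inv where "Inv k s' \<longleftrightarrow> (\<forall>i<n. s' Z (int i) = (if i < k then f i else s
      Z (int i)))" for k s'
  have "runs (For v a P) s (Suc n * (C + 2 * step_cost M)) (Inv n)"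
  proof (rule runs_For[where s = s and Inv = Inv, OF n w])
    fix i s'
    assume *: "i < n" "Inv i s'" "s' v 0 = int i" "\<And>c. c \<noteq> v \<Longrightarrow> c \<notin>
        written P \<Longrightarrow> s' c = s c"
    have "runs P s' C (\<lambda>s''. s'' Z = (s' Z)(int i := f i))"
      using * by (intro step) (auto simp: Inv_def)
    then show "runs P s' C (Inv (Suc i))"
    proof (rule runs_weaken)
      fix s'' assume **: "s'' Z = (s' Z)(int i := f i)"
      show "Inv (Suc i) s''"
        unfolding Inv_def ** using *(1,2) by (auto simp: Inv_def less_Suc_eq)
    qed simp
  qed (use Z in \<open>auto simp: Inv_def\<close>)
  then show ?thesis by (rule runs_weaken) (auto simp: Inv_def vec_def)
qed

definition Fill_vec :: "nat \<Rightarrow> nat \<Rightarrow> expr \<Rightarrow> prog" where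
  "Fill_vec a Z e = For 92 a (Assign Z (Var 92) e)"

lemma written_Fill_vec [simp]: "written (Fill_vec a Z e) = {92, Z}" by (auto simp: Fill_vec_def)

lemma runs_Fill_vec:
  assumes n: "s a 0 = int n" "int n \<le> M" and Z: "Z \<noteq> a" "Z \<noteq> 92" "a \<noteq> 92"
    and e: "cost_weight e \<le> 900"
    and step: "\<And>i s'. i < n \<Longrightarrow> (\<And>c. c \<noteq> 92 \<Longrightarrow> c \<noteq> Z
        \<Longrightarrow> s' c = s c) \<Longrightarrow>
       s' 92 0 = int i \<Longrightarrow> s' Z (int i) = s Z (int i) \<Longrightarrow>
       reads_le M s' e \<and> val s' e = f i"
  shows "runs (Fill_vec a Z e) s (Suc n * (3 * step_cost M)) (\<lambda>s'. vec n (s' Z) f)"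
proof -
  have "runs (Fill_vec a Z e) s (Suc n * (step_cost M + 2 * step_cost M)) (\<lambda>s'. vec n (s' Z) f)"
    unfolding Fill_vec_def
  proof (rule runs_fill_vec_body[where s = s, OF n])
    fix i s'
    assume *: "i < n" "s' 92 0 = int i" "s' Z (int i) = s Z (int i)"
      and f: "\<And>c. c \<noteq> 92 \<Longrightarrow> c \<notin> written (Assign Z (Var 92) e)
          \<Longrightarrow> s' c = s c"
    have "reads_le M s' e \<and> val s' e = f i" using * f by (intro step) auto
    then show "runs (Assign Z (Var 92) e) s' (step_cost M) (\<lambda>s''. s'' Z = (s' Z)(int i := f i))"
      using * n e by (intro runs_Assign) auto
  qed (use Z in auto)
  then show ?thesis by simp
qed

definition Sum_cells :: "nat \<Rightarrow> expr \<Rightarrow> prog" where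
  "Sum_cells Z e = Seq (SetVar Z (Const 0)) (For2 (SetVar Z (Add (Var Z) e)))"

lemma written_Sum_cells [simp]: "written (Sum_cells Z e) = {90, 91, Z}" by (auto simp: Sum_cells_def)

text \<open>M has to dominate every partial sum over finished cells; the sum of all absolute values
  does so for any set of them.\<close>

lemma runs_Sum_cells:
  assumes n: "s 0 0 = int n" "int n \<le> M" and Z: "Z \<noteq> 0" "Z \<noteq> 90" "Z \<noteq> 91"
    and e: "cost_weight e \<le> 800" "val_weight e \<le> 100"
    and bnd: "(\<Sum>i<n. \<Sum>j<n. \<bar>f i j\<bar>) \<le> M"
    and step: "\<And>i j s'. i < n \<Longrightarrow> j < n \<Longrightarrow>
       (\<And>c. c \<noteq> 90 \<Longrightarrow> c \<noteq> 91 \<Longrightarrow> c \<noteq> Z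
           \<Longrightarrow> s' c = s c) \<Longrightarrow>
       s' 90 0 = int i \<Longrightarrow> s' 91 0 = int j \<Longrightarrow> reads_le M s' e \<and> val s' e
           = f i j"
  shows "runs (Sum_cells Z e) s ((Suc n)\<^sup>2 * (6 * step_cost M)) (\<lambda>s'. s' Z 0 = (\<Sum>i<n.
      \<Sum>j<n. f i j))"
  unfolding Sum_cells_def
proof (rule runs_Seq)
  show "runs (SetVar Z (Const 0)) s (step_cost M) (\<lambda>s'. s' Z 0 = 0)"
    by (intro runs_Assign) auto
  show "step_cost M + (Suc n)\<^sup>2 * (step_cost M + 4 * step_cost M) \<le> (Suc n)\<^sup>2 * (6 *
      step_cost M)"
    by (simp add: algebra_simps power2_eq_square)
  fix s1 assume s1: "s1 Z 0 = 0" "\<And>a. a \<notin> written (SetVar Z (Const 0)) \<Longrightarrow> s1 a = s a"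
  have abs_le: "\<bar>sum (\<lambda>(i,j). f i j) D\<bar> \<le> M" if "D \<subseteq> {..<n} \<times>
      {..<n}" for D
  proof -
    have "\<bar>sum (\<lambda>(i,j). f i j) D\<bar> \<le> (\<Sum>(i,j)\<in>D. \<bar>f i j\<bar>)"
      using sum_abs[of "\<lambda>(i,j). f i j" D] by (simp add: case_prod_unfold)
    also have "\<dots> \<le> (\<Sum>(i,j)\<in>{..<n} \<times> {..<n}. \<bar>f i j\<bar>)"
      using that by (intro sum_mono2) auto
    also have "\<dots> \<le> M" using bnd by (simp add: sum.cartesian_product)
    finally show ?thesis .
  qed
  have "runs (For2 (SetVar Z (Add (Var Z) e))) s1 ((Suc n)\<^sup>2 * (step_cost M + 4 * step_cost M))
    (\<lambda>s'. s' Z 0 = (\<Sum>(i,j)\<in>{..<n} \<times> {..<n}. f i j))"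
  proof (rule runs_For2[where Inv = "\<lambda>D s'. s' Z 0 = (\<Sum>(i,j)\<in>D. f i j)"])
    fix D i j s'
    assume *: "i < n" "j < n" "D \<subseteq> {..<n} \<times> {..<n}" "(i, j) \<notin> D" "s' Z 0 =
        (\<Sum>(i,j)\<in>D. f i j)"
      "s' 90 0 = int i" "s' 91 0 = int j"
      and f: "\<And>c. c \<noteq> 90 \<Longrightarrow> c \<noteq> 91 \<Longrightarrow> c \<notin> written
          (SetVar Z (Add (Var Z) e)) \<Longrightarrow> s' c = s1 c"
    have "reads_le M s' e \<and> val s' e = f i j" using * f s1(2) by (intro step) auto
    moreover have "finite D" using *(3) finite_subset by blast
    ultimately show "runs (SetVar Z (Add (Var Z) e)) s' (step_cost M)
        (\<lambda>s'. s' Z 0 = (\<Sum>(i,j)\<in>insert (i, j) D. f i j))"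
      using * e abs_le[of D] by (intro runs_Assign) auto
  qed (use n Z s1 in auto)
  then show "runs (For2 (SetVar Z (Add (Var Z) e))) s1 ((Suc n)\<^sup>2 * (step_cost M + 4 * step_cost M))
    (\<lambda>s'. s' Z 0 = (\<Sum>i<n. \<Sum>j<n. f i j))"
    by (simp add: sum.cartesian_product)
qed

text \<open>
  The given program for matrix multiplication is moved to the arrays from \<open>100\<close> on, which separates
  it from the arrays of the calling program.
\<close>

primrec shift_expr :: "expr \<Rightarrow> expr" where
  "shift_expr (Const c) = Const c"
| "shift_expr (Entry a e) = Entry (a + 100) (shift_expr e)"
| "shift_expr (Add e f) = Add (shift_expr e) (shift_expr f)"
| "shift_expr (Sub e f) = Sub (shift_expr e) (shift_expr f)"
| "shift_expr (Mul e f) = Mul (shift_expr e) (shift_expr f)"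
| "shift_expr (Div e f) = Div (shift_expr e) (shift_expr f)"

primrec shift :: "prog \<Rightarrow> prog" where
  "shift (Assign a e f) = Assign (a + 100) (shift_expr e) (shift_expr f)"
| "shift (Seq P Q) = Seq (shift P) (shift Q)"
| "shift (If b P Q) = If (shift_expr b) (shift P) (shift Q)"
| "shift (While b P) = While (shift_expr b) (shift P)"

lemma written_shift: "a < 100 \<Longrightarrow> a \<notin> written (shift P)"
  by (induction P) auto

lemma val_shift: "val s (shift_expr e) = val (\<lambda>a. s (a + 100)) e"
  by (induction e) auto

lemma cost_shift: "cost s (shift_expr e) = cost (\<lambda>a. s (a + 100)) e"
  by (induction e) (auto simp: val_shift)

lemma exec_shift:
  "exec P r t r' \<Longrightarrow> r = (\<lambda>a. s (a + 100)) \<Longrightarrow>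
     \<exists>s'. exec (shift P) s t s' \<and> (\<lambda>a. s' (a + 100)) = r'"
proof (induction arbitrary: s rule: exec.induct)
  case (Assign a e f r)
  let ?s = "s(a + 100 := (s (a + 100))(val r e := val r f))"
  have "exec (shift (Assign a e f)) s (1 + cost r e + cost r f) ?s"
    using exec.Assign[of "a + 100" "shift_expr e" "shift_expr f" s] Assign
    by (simp add: val_shift cost_shift)
  moreover have "(\<lambda>c. ?s (c + 100)) = r(a := (r a)(val r e := val r f))"
    using Assign by (auto simp: fun_eq_iff)
  ultimately show ?case by blast
next
  case (Seq P r t r' Q u r'')
  then obtain s' where "exec (shift P) s t s'" "(\<lambda>a. s' (a + 100)) = r'" by blast
  moreover from this Seq.IH(2)[of s'] obtain s'' where "exec (shift Q) s' u s''" "(\<lambda>a. s'' (a +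
      100)) = r''"
    by auto
  ultimately show ?case by (auto intro: exec.Seq)
next
  case (IfTrue r b P t r' Q)
  then obtain s' where "exec (shift P) s t s'" "(\<lambda>a. s' (a + 100)) = r'" by blast
  with IfTrue exec.IfTrue[of s "shift_expr b" "shift P" t s'] show ?case
    by (auto simp: val_shift cost_shift)
next
  case (IfFalse r b P t r' Q)
  then obtain s' where "exec (shift P) s t s'" "(\<lambda>a. s' (a + 100)) = r'" by blast
  with IfFalse exec.IfFalse[of s "shift_expr b" "shift P" t s'] show ?case
    by (auto simp: val_shift cost_shift)
next
  case (WhileFalse r b P)
  with exec.WhileFalse[of s "shift_expr b" "shift P"] show ?case by (auto simp: val_shift cost_shift)
next
  case (WhileTrue r b P t r' u r'')
  then obtain s' where 1: "exec (shift P) s t s'" "(\<lambda>a. s' (a + 100)) = r'" by blast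
  with WhileTrue.IH(2)[of s'] obtain s'' where "exec (shift (While b P)) s' u s''" "(\<lambda>a. s'' (a +
      100)) = r''"
    by auto
  with 1 WhileTrue exec.WhileTrue[of s "shift_expr b" "shift P" t s' u s''] show ?case
    by (auto simp: val_shift cost_shift)
qed

definition Matmul :: "prog \<Rightarrow> nat \<Rightarrow> nat \<Rightarrow> nat \<Rightarrow> prog" where
  "Matmul mp X Y Z = Seq (SetVar 100 (Var 0)) (Seq (Fill 101 (Cell X)) (Seq (Fill 102 (Cell Y))
     (Seq (shift mp) (Fill Z (Cell 103)))))"

text \<open>The given program may write any array from 100 on, so frames are stated only below
  100.\<close>

lemma written_Matmul [simp]: "a < 100 \<Longrightarrow> a \<in> written (Matmul mp X Y Z)
    \<longleftrightarrow> a \<in> {90, 91, Z}"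
  by (auto simp: Matmul_def written_shift)

text \<open>The instance \<open>c = 1\<close> of the multiplication task at a single size. Entries
  up to n suffice below: the factors are 0/1 matrices, one of them at times weighted by its column
  index.\<close>

definition multiplies :: "nat \<Rightarrow> prog \<Rightarrow> nat \<Rightarrow> bool" where
  "multiplies n mp T \<longleftrightarrow> (\<forall>f g s. (\<forall>i<n. \<forall>j<n. \<bar>f i j\<bar>
      \<le> int n \<and> \<bar>g i j\<bar> \<le> int n) \<longrightarrow>
     s 0 0 = int n \<longrightarrow> mat n (s 1) f \<longrightarrow> mat n (s 2) g \<longrightarrow>
     runs mp s T (\<lambda>s'. mat n (s' 3) (\<lambda>i j. \<Sum>k<n. f i k * g k j)))"

lemma runs_shift:
  assumes "runs P (\<lambda>a. s (a + 100)) T Q"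
  shows "runs (shift P) s T (\<lambda>s'. Q (\<lambda>a. s' (a + 100)))"
proof -
  obtain t r where 1: "exec P (\<lambda>a. s (a + 100)) t r" "t \<le> T" "Q r" using assms unfolding
      runs_def by blast
  from exec_shift[OF 1(1) refl] obtain s' where "exec (shift P) s t s'" "(\<lambda>a. s' (a + 100)) = r" by
      blast
  with 1 show ?thesis unfolding runs_def by blast
qed

text \<open>Three matrix copies with factor 5 and one assignment give the 16. Parts that take
  quadratic time are measured in this unit as well.\<close>

definition mm_cost :: "nat \<Rightarrow> int \<Rightarrow> nat \<Rightarrow> nat" where
  "mm_cost n M T = T + (Suc n)\<^sup>2 * (16 * step_cost M)"

lemma runs_Matmul:
  assumes mp: "multiplies n mp T"
    and n: "s 0 0 = int n" "int n ^ 3 \<le> M"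
    and X: "mat n (s X) f" "X < 90" and Y: "mat n (s Y) g" "Y < 90"
    and b: "\<And>i j. i < n \<Longrightarrow> j < n \<Longrightarrow> \<bar>f i j\<bar> \<le> int n"
        "\<And>i j. i < n \<Longrightarrow> j < n \<Longrightarrow> \<bar>g i j\<bar> \<le> int n"
    and Z: "0 < Z" "Z < 90"
  shows "runs (Matmul mp X Y Z) s (mm_cost n M T) (\<lambda>s'. mat n (s' Z) (\<lambda>i j. \<Sum>k<n. f i
      k * g k j))"
proof -
  have "int n \<le> int n ^ 3" by (cases "n = 0") (auto intro: self_le_power)
  then have nM: "int n \<le> M" using n(2) by linarith
  let ?u = "(Suc n)\<^sup>2 * (5 * step_cost M)"
  \<comment> \<open>A sum of n products, each at most n * n in absolute value; this is why M must
    reach the cube.\<close>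
  have prod: "\<bar>\<Sum>k<n. f i k * g k j\<bar> \<le> M" if "i < n" "j < n" for i j
  proof -
    have "\<bar>\<Sum>k<n. f i k * g k j\<bar> \<le> (\<Sum>k<n. \<bar>f i k * g k j\<bar>)" by (rule sum_abs)
    also have "\<dots> \<le> (\<Sum>k<n. int n * int n)"
      using b that by (intro sum_mono) (auto simp: abs_mult intro!: mult_mono)
    also have "\<dots> = int n ^ 3" by (simp add: power3_eq_cube)
    finally show ?thesis using n(2) by simp
  qed
  show ?thesis unfolding Matmul_def
  proof (rule runs_Seq)
    show "runs (SetVar 100 (Var 0)) s (step_cost M) (\<lambda>s1. s1 100 0 = int n)"
      using n nM by (intro runs_Assign) auto
    show "step_cost M + (?u + (?u + (T + ?u))) \<le> mm_cost n M T"
      by (simp add: mm_cost_def power2_eq_square algebra_simps)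
    fix s1 assume s1: "s1 100 0 = int n" "\<And>a. a \<notin> written (SetVar 100 (Var 0))
        \<Longrightarrow> s1 a = s a"
    show "runs (Seq (Fill 101 (Cell X)) (Seq (Fill 102 (Cell Y)) (Seq (shift mp) (Fill Z (Cell 103))))) s1
       (?u + (?u + (T + ?u))) (\<lambda>s'. mat n (s' Z) (\<lambda>i j. \<Sum>k<n. f i k * g k j))"
    proof (rule runs_Seq[OF _ _ order_refl])
      show "runs (Fill 101 (Cell X)) s1 ?u (\<lambda>s2. mat n (s2 101) f)"
        by (rule runs_Fill) (use s1 n nM X b in \<open>auto simp: matD order_trans[OF b(1)]\<close>)
      fix s2 assume s2: "mat n (s2 101) f" "\<And>a. a \<notin> written (Fill 101 (Cell X))
          \<Longrightarrow> s2 a = s1 a"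
      show "runs (Seq (Fill 102 (Cell Y)) (Seq (shift mp) (Fill Z (Cell 103)))) s2
         (?u + (T + ?u)) (\<lambda>s'. mat n (s' Z) (\<lambda>i j. \<Sum>k<n. f i k * g k j))"
      proof (rule runs_Seq[OF _ _ order_refl])
        show "runs (Fill 102 (Cell Y)) s2 ?u (\<lambda>s3. mat n (s3 102) g)"
          by (rule runs_Fill) (use s1 s2 n nM Y b in \<open>auto simp: matD order_trans[OF b(2)]\<close>)
        fix s3 assume s3: "mat n (s3 102) g" "\<And>a. a \<notin> written (Fill 102 (Cell Y))
            \<Longrightarrow> s3 a = s2 a"
        show "runs (Seq (shift mp) (Fill Z (Cell 103))) s3 (T + ?u)
            (\<lambda>s'. mat n (s' Z) (\<lambda>i j. \<Sum>k<n. f i k * g k j))"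
        proof (rule runs_Seq[OF _ _ order_refl])
          have "runs (shift mp) s3 T (\<lambda>s'. (\<lambda>r. mat n (r 3) (\<lambda>i j. \<Sum>k<n. f i k
              * g k j)) (\<lambda>a. s' (a + 100)))"
            using mp s1 s2 s3 b unfolding multiplies_def by (intro runs_shift) simp
          then show "runs (shift mp) s3 T (\<lambda>s'. mat n (s' 103) (\<lambda>i j. \<Sum>k<n. f i k * g
              k j))"
            by simp
          fix s4 assume s4: "mat n (s4 103) (\<lambda>i j. \<Sum>k<n. f i k * g k j)"
            "\<And>a. a \<notin> written (shift mp) \<Longrightarrow> s4 a = s3 a"
          show "runs (Fill Z (Cell 103)) s4 ?u (\<lambda>s'. mat n (s' Z) (\<lambda>i j. \<Sum>k<n. f i k *
              g k j))"
            by (rule runs_Fill) (use s1 s2 s3 s4 n nM Z prod in \<open>auto simp: matD written_shift\<close>)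
        qed
      qed
    qed
  qed
qed

section \<open>Many small primes\<close>

text \<open>Both sides equal the Beta integral of t^(x-1) (1-t)^m over [0, 1]. Pascal's rule gives
  the recursion F(m+1, x) = F(m, x) - F(m, x+1) for the left side, and the quotient on the right
  satisfies it too.\<close>

lemma alternating_binomial_sum:
  fixes x :: real
  assumes "x > 0"
  shows "(\<Sum>k\<le>m. (-1) ^ k * real (m choose k) / (x + real k)) = fact m / (\<Prod>k\<le>m. x + real k)"
  using assms
proof (induction m arbitrary: x)
  case 0 then show ?case by simp
next
  case (Suc m)
  let ?f = "\<lambda>m x. \<Sum>k\<le>m. (-1) ^ k * real (m choose k) / (x + real k)"
  let ?g = "1 / x + (\<Sum>k\<le>m. (-1) ^ Suc k * real (m choose Suc k) / (x + real (Suc k)))"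
  have "?f (Suc m) x = 1 / x + (\<Sum>k\<le>m. (-1) ^ Suc k * real (Suc m choose Suc k) / (x + real (Suc k)))"
    by (subst sum.atMost_Suc_shift) simp
  also have "\<dots> = 1 / x + ((\<Sum>k\<le>m. (-1) ^ Suc k * real (m choose Suc k) / (x + real (Suc k)))
      - ?f m (x + 1))"
  proof -
    have "(-1) ^ Suc k * real (Suc m choose Suc k) / (x + real (Suc k)) =
      (-1) ^ Suc k * real (m choose Suc k) / (x + real (Suc k)) - (-1) ^ k * real (m choose k) / (x + 1 +
          real k)" for k
      by (simp add: diff_divide_distrib add_ac distrib_left)
    then show ?thesis by (simp only: sum_subtractf)
  qed
  finally have 1: "?f (Suc m) x = ?g - ?f m (x + 1)" by simp
  have "?f m x = (\<Sum>k\<le>Suc m. (-1) ^ k * real (m choose k) / (x + real k))" by simp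
  also have "\<dots> = ?g" by (subst sum.atMost_Suc_shift) simp
  finally have "?f (Suc m) x = ?f m x - ?f m (x + 1)" using 1 by (rule subst[OF sym])
  also have "\<dots> = fact m / (\<Prod>k\<le>m. x + real k) - fact m / (\<Prod>k\<le>m. x + 1 + real k)"
    using Suc.prems by (simp add: Suc.IH)
  also have "\<dots> = fact (Suc m) / (\<Prod>k\<le>Suc m. x + real k)"
  proof -
    have *: "(\<Prod>k\<le>Suc m. x + real k) = x * (\<Prod>k\<le>m. x + 1 + real k)"
      by (subst prod.atMost_Suc_shift) (simp add: add_ac)
    have pos: "(\<Prod>k\<le>m. x + real k) > 0" "(\<Prod>k\<le>m. x + 1 + real k) > 0"
      using Suc.prems by (auto intro!: prod_pos)
    have 2: "(\<Prod>k\<le>Suc m. x + real k) = (\<Prod>k\<le>m. x + real k) * (x + real (Suc m))" by simp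
    have "fact m / (\<Prod>k\<le>m. x + real k) = fact m * (x + real (Suc m)) / (\<Prod>k\<le>Suc m. x +
        real k)"
    proof -
      have "x + real (Suc m) \<noteq> 0" using Suc.prems by simp
      then show ?thesis unfolding 2 by (rule nonzero_mult_divide_mult_cancel_right[symmetric])
    qed
    moreover have "fact m / (\<Prod>k\<le>m. x + 1 + real k) = fact m * x / (\<Prod>k\<le>Suc m. x + real k)"
      unfolding * using Suc.prems pos by simp
    ultimately show ?thesis by (simp add: diff_divide_distrib[symmetric] algebra_simps)
  qed
  finally show ?case .
qed

text \<open>Nair's argument. At x = m + 1 the denominators of the alternating sum are m + 1, ..., 2
  m + 1, so multiplying it by the lcm D gives an integer, which is positive by the closed form.
  Hence D is at least (2 m + 1)! / (m!)^2 = (2 m + 1) binom(2 m, m). The central coefficient is the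
  largest of 2 m + 1 numbers with sum 4^m.\<close>

lemma Lcm_atLeastAtMost_ge: "4 ^ m \<le> Lcm {1..2 * m + 1 :: nat}"
proof -
  define D where "D = Lcm {1..2 * m + 1 :: nat}"
  have "D \<noteq> 0" unfolding D_def by (simp add: Lcm_0_iff)
  have dvd: "(m + 1 + k) dvd D" if "k \<le> m" for k
    unfolding D_def using that by (intro dvd_Lcm) auto
  define N :: int where "N = (\<Sum>k\<le>m. (-1) ^ k * int (m choose k) * int (D div (m + 1 + k)))"
  have P: "(\<Prod>k\<le>m. real (m + 1) + real k) * fact m = fact (2 * m + 1)"
  proof -
    have "(\<Prod>k\<le>j. real (m + 1) + real k) * fact m = fact (m + j + 1)" for j
    proof (induction j)
      case (Suc j)
      have "(\<Prod>k\<le>Suc j. real (m + 1) + real k) * fact m =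
          ((\<Prod>k\<le>j. real (m + 1) + real k) * fact m) * (real (m + 1) + real (Suc j))" by simp
      also have "\<dots> = fact (m + Suc j + 1)" unfolding Suc by (simp add: algebra_simps)
      finally show ?case .
    qed simp
    from this[of m] show ?thesis by (simp only: mult_2)
  qed
  then have P': "(\<Prod>k\<le>m. real (m + 1) + real k) = fact (2 * m + 1) / fact m"
    by (metis nonzero_mult_div_cancel_right fact_nonzero)
  have "real_of_int N = real D * (\<Sum>k\<le>m. (-1) ^ k * real (m choose k) / (real (m + 1) + real k))"
    unfolding N_def sum_distrib_left of_int_sum
  proof (rule sum.cong)
    fix k assume "k \<in> {..m}"
    then have "real (D div (m + 1 + k)) = real D / (real (m + 1) + real k)"
      using dvd[of k] by (subst real_of_nat_div) auto
    then show "real_of_int ((- 1) ^ k * int (m choose k) * int (D div (m + 1 + k))) =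
         real D * ((- 1) ^ k * real (m choose k) / (real (m + 1) + real k))" by simp
  qed simp
  also have "\<dots> = real D * (fact m * fact m / fact (2 * m + 1))"
  proof -
    have "(\<Sum>k\<le>m. (-1) ^ k * real (m choose k) / (real (m + 1) + real k)) = fact m / (fact (2 * m +
        1) / fact m)"
      unfolding P'[symmetric] by (rule alternating_binomial_sum) simp
    then show ?thesis by (simp only: divide_divide_eq_right)
  qed
  finally have N: "real_of_int N = real D * (fact m * fact m / fact (2 * m + 1))" .
  then have "real_of_int N > 0" using \<open>D \<noteq> 0\<close> by simp
  then have "N > 0" by (simp only: of_int_0_less_iff)
  then have "1 \<le> real_of_int N" by simp
  then have "fact (2 * m + 1) / (fact m * fact m) \<le> real D"
  proof -
    have "b / a \<le> d" if "1 \<le> d * (a / b)" "a > 0" "b > 0" for a b d :: real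
      using that by (simp add: field_simps)
    from this[OF \<open>1 \<le> real_of_int N\<close>[unfolded N]] show ?thesis by (simp only: fact_gt_zero
        mult_pos_pos)
  qed
  moreover have "real (2 * m + 1) * real ((2 * m) choose m) = fact (2 * m + 1) / (fact m * fact m)"
  proof -
    have "real ((2 * m) choose m) = fact (2 * m) / (fact m * fact (2 * m - m))" by (rule binomial_fact) simp
    moreover have "2 * m - m = m" by simp
    moreover have "(fact (2 * m + 1) :: real) = real (2 * m + 1) * fact (2 * m)"
      by (metis Suc_eq_plus1 fact_Suc)
    ultimately show ?thesis by (simp only: times_divide_eq_right)
  qed
  moreover have "4 ^ m \<le> (2 * m + 1) * ((2 * m) choose m)"
  proof -
    have "(4::nat) ^ m = 2 ^ (2 * m)" by (simp add: power_mult)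
    also have "\<dots> = (\<Sum>k\<le>2 * m. (2 * m) choose k)" by (simp only: choose_row_sum)
    also have "\<dots> \<le> (\<Sum>k\<le>2 * m. (2 * m) choose m)" by (intro sum_mono binomial_maximum')
    finally show ?thesis by simp
  qed
  then have "real (4 ^ m) \<le> real ((2 * m + 1) * ((2 * m) choose m))"
    by (simp only: of_nat_le_iff)
  ultimately have "real (4 ^ m) \<le> real D" by (simp only: of_nat_mult)
  then show ?thesis unfolding D_def by (simp only: of_nat_le_iff)
qed

text \<open>The multiplicity of p in an lcm is the maximum over the members, so this power of p
  divides one of them. The 1 in \<open>insert 1 A\<close> serves the empty set.\<close>

lemma prime_power_multiplicity_Lcm_le:
  fixes p :: nat
  assumes "prime p" "N \<ge> 1"
  shows "p ^ multiplicity p (Lcm {1..N}) \<le> N"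
proof -
  have "\<exists>a\<in>insert 1 A. p ^ multiplicity p (Lcm A) dvd a" if "finite A" "0 \<notin> A" for A ::
      "nat set"
    using that
  proof (induction A rule: finite_induct)
    case (insert a A)
    then have "a \<noteq> 0" "Lcm A \<noteq> 0" by (auto simp: Lcm_0_iff)
    then have "multiplicity p (Lcm (insert a A)) = max (multiplicity p a) (multiplicity p (Lcm A))"
      unfolding Lcm_insert using assms(1) by (intro multiplicity_lcm) auto
    then have "multiplicity p (Lcm (insert a A)) = multiplicity p a \<or>
        multiplicity p (Lcm (insert a A)) = multiplicity p (Lcm A)" by linarith
    moreover have "p ^ multiplicity p a dvd a" by (rule multiplicity_dvd)
    moreover have "\<exists>b\<in>insert 1 A. p ^ multiplicity p (Lcm A) dvd b" using insert by simp
    ultimately show ?case by (elim disjE bexE) (simp_all only: insert_iff bex_simps, blast+)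
  qed simp
  from this[of "{1..N}"] obtain a where a: "a \<in> insert 1 {1..N}" "p ^ multiplicity p (Lcm {1..N}) dvd a"
    by (meson atLeastAtMost_iff finite_atLeastAtMost not_one_le_zero)
  then have "p ^ multiplicity p (Lcm {1..N}) \<le> a" by (intro dvd_imp_le) auto
  with a(1) assms(2) show ?thesis by auto
qed

lemma Lcm_atLeastAtMost_le:
  assumes "N \<ge> 1"
  shows "Lcm {1..N} \<le> N ^ card {p::nat. prime p \<and> p \<le> N}"
proof -
  let ?D = "Lcm {1..N}" and ?P = "{p::nat. prime p \<and> p \<le> N}"
  have D: "?D \<noteq> 0" by (simp add: Lcm_0_iff)
  have fin: "finite ?P" by (rule finite_subset[of _ "{..N}"]) auto
  have "?D = (\<Prod>p\<in>prime_factors ?D. p ^ multiplicity p ?D)"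
    using D by (intro prime_factorization_nat) (simp only: neq0_conv)
  also have "\<dots> \<le> (\<Prod>p\<in>prime_factors ?D. N)"
    by (intro prod_mono conjI prime_power_multiplicity_Lcm_le assms) auto
  also have "\<dots> = N ^ card (prime_factors ?D)" by simp
  also have "\<dots> \<le> N ^ card ?P"
  proof (intro power_increasing card_mono)
    show "prime_factors ?D \<subseteq> ?P"
    proof
      fix p assume p: "p \<in> prime_factors ?D"
      then have pr: "prime p" by auto
      have "multiplicity p ?D > 0" using p D by (auto simp: prime_factors_multiplicity)
      then have "p \<le> p ^ multiplicity p ?D" using pr prime_gt_0_nat by (intro self_le_power) (auto
          simp: Suc_le_eq)
      with prime_power_multiplicity_Lcm_le[OF pr assms] pr show "p \<in> ?P" by simp
    qed
  qed (use fin assms in auto)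
  finally show ?thesis .
qed

text \<open>Chebyshev's lower bound at powers of two, from the two estimates for the lcm of 1, ...,
  2^m - 1. The upper end is odd, as the lower estimate requires. For m = 0 the truncated difference
  is 0.\<close>

lemma card_primes_ge: "2 ^ m - 2 \<le> m * card {p::nat. prime p \<and> p \<le> 2 ^ m}"
proof (cases m)
  case (Suc k)
  define j where "j = 2 ^ k - (1::nat)"
  have "(2::nat) ^ k \<ge> 1" by simp
  then have j: "2 * j + 1 = 2 ^ m - 1" "2 ^ m - 2 = 2 * j" unfolding Suc j_def power_Suc by linarith+
  have le: "card {p::nat. prime p \<and> p \<le> 2 * j + 1} \<le> card {p::nat. prime p \<and> p \<le> 2 ^ m}"
    using j by (intro card_mono) (auto intro: finite_subset[of _ "{..2^m}"])
  have "(2::nat) ^ (2 * j) = 4 ^ j" by (simp add: power_mult)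
  also have "\<dots> \<le> Lcm {1..2 * j + 1}" by (rule Lcm_atLeastAtMost_ge)
  also have "\<dots> \<le> (2 * j + 1) ^ card {p::nat. prime p \<and> p \<le> 2 * j + 1}"
    by (rule Lcm_atLeastAtMost_le) simp
  also have "\<dots> \<le> (2 ^ m) ^ card {p::nat. prime p \<and> p \<le> 2 * j + 1}"
    using j by (intro power_mono) auto
  also have "\<dots> \<le> (2 ^ m) ^ card {p::nat. prime p \<and> p \<le> 2 ^ m}"
    using le by (intro power_increasing) auto
  finally have "(2::nat) ^ (2 * j) \<le> 2 ^ (m * card {p::nat. prime p \<and> p \<le> 2 ^ m})"
    by (simp add: power_mult)
  then show ?thesis using j(2) using power_le_imp_le_exp[of "2::nat" "2 * j"] by simp
qed simp

text \<open>A number is at least 2 to the number of its prime divisors.\<close>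

lemma card_primes_dvd_le:
  fixes d :: nat
  assumes "0 < d" "d < 2 ^ L"
  shows "card {p. prime p \<and> p dvd d} \<le> L"
proof -
  have eq: "{p. prime p \<and> p dvd d} = prime_factors d" using assms by (auto simp: prime_factors_dvd)
  have "2 ^ card (prime_factors d) = (\<Prod>p\<in>prime_factors d. 2::nat)" by simp
  also have "\<dots> \<le> (\<Prod>p\<in>prime_factors d. p ^ multiplicity p d)"
  proof (intro prod_mono conjI)
    fix p assume p: "p \<in> prime_factors d"
    then have "2 \<le> p" "multiplicity p d > 0" using prime_ge_2_nat by (auto simp: prime_factors_multiplicity)
    then show "2 \<le> p ^ multiplicity p d" using self_le_power[of p "multiplicity p d"] by linarith
  qed simp
  also have "\<dots> = d" using prime_factorization_nat[OF assms(1)] by (rule sym)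
  finally have "(2::nat) ^ card (prime_factors d) < 2 ^ L" using assms by linarith
  then show ?thesis unfolding eq by simp
qed

section \<open>Averaging over hash functions\<close>

text \<open>The parity of the number of common binary ones of y and r. The test for 0 only ends the
  recursion; \<open>ip_rec\<close> shows that the recursive equation holds there as well.\<close>

fun ip :: "nat \<Rightarrow> nat \<Rightarrow> nat" where
  "ip y r = (if y = 0 then 0 else (ip (y div 2) (r div 2) + (y mod 2) * (r mod 2)) mod 2)"

declare ip.simps [simp del]

lemma ip_0 [simp]: "ip 0 r = 0" by (simp add: ip.simps)

lemma ip_less_2: "ip y r < 2" by (subst ip.simps) simp

lemma ip_rec: "ip y r = (ip (y div 2) (r div 2) + (y mod 2) * (r mod 2)) mod 2"
  by (cases "y = 0") (simp_all add: ip.simps[of y])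

section \<open>Walsh characters\<close>

lemma neg_one_power_ip: "(-1::int) ^ ip y r = (-1) ^ ip (y div 2) (r div 2) * (-1) ^ ((y mod 2) * (r mod 2))"
  by (subst ip_rec) (simp add: minus_one_power_iff)

lemma sum_lessThan_double: "(\<Sum>r<2 * m. g r) = (\<Sum>r<m. g (2 * r) + g (2 * r + 1 :: nat) :: int)"
  by (induction m) (simp_all add: add_ac)

text \<open>Orthogonality of characters. Summing over the lowest digit of r first splits off a
  factor \<open>1 + ?s\<close>. If the higher digits of y and y' agree, the lowest ones differ and
  this factor vanishes; otherwise the sum over the higher digits vanishes by induction.\<close>

lemma sum_neg_one_power_ip:
  assumes "y \<noteq> y'" "y < 2 ^ m" "y' < 2 ^ m"
  shows "(\<Sum>r<2 ^ m. (-1::int) ^ (ip y r + ip y' r)) = 0"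
  using assms
proof (induction m arbitrary: y y')
  case (Suc m)
  let ?g = "\<lambda>y y' r. (-1::int) ^ (ip y r + ip y' r)"
  let ?s = "(-1::int) ^ (y mod 2 + y' mod 2)"
  have "(\<Sum>r<2 ^ Suc m. ?g y y' r) = (\<Sum>r<2 ^ m. ?g (y div 2) (y' div 2) r * (1 + ?s))"
    unfolding power_Suc sum_lessThan_double
  proof (intro sum.cong refl)
    fix r
    have "?g y y' (2 * r) = ?g (y div 2) (y' div 2) r"
      by (simp add: power_add neg_one_power_ip[of y] neg_one_power_ip[of y'])
    moreover have "(2 * r + 1) div 2 = r" "(2 * r + 1) mod 2 = 1" by simp_all
    then have "?g y y' (2 * r + 1) = ?g (y div 2) (y' div 2) r * ?s"
      unfolding power_add neg_one_power_ip[of y "2 * r + 1"] neg_one_power_ip[of y' "2 * r + 1"] by simp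
    ultimately show "?g y y' (2 * r) + ?g y y' (2 * r + 1) = ?g (y div 2) (y' div 2) r * (1 + ?s)"
      by (simp only: distrib_left mult_1_right)
  qed
  also have "\<dots> = (\<Sum>r<2 ^ m. ?g (y div 2) (y' div 2) r) * (1 + ?s)" by (simp only: sum_distrib_right)
  also have "\<dots> = 0"
  proof (cases "y div 2 = y' div 2")
    case True
    then have "y mod 2 \<noteq> y' mod 2" using Suc.prems(1) by (metis div_mult_mod_eq)
    then have "odd (y mod 2 + y' mod 2)" by presburger
    then show ?thesis by (simp only: minus_one_power_iff if_False) simp
  next
    case False
    then show ?thesis using Suc.IH[of "y div 2" "y' div 2"] Suc.prems by simp
  qed
  finally show ?case .
qed simp

text \<open>For bits, 2 [a = b] = 1 + (-1)^(a + b), so by orthogonality distinct vectors agree on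
  exactly half of the masks. The factor 2 keeps the identity integral.\<close>

lemma sum_ip_eq:
  assumes "y < 2 ^ m" "y' < 2 ^ m"
  shows "2 * (\<Sum>r<2 ^ m. of_bool (ip y r = ip y' r)) = (if y = y' then 2 * 2 ^ m else 2 ^ m :: int)"
proof -
  have "2 * of_bool (ip y r = ip y' r) = 1 + (-1::int) ^ (ip y r + ip y' r)" for r
    using ip_less_2[of y r] ip_less_2[of y' r] by (auto simp: less_2_cases_iff)
  then have "2 * (\<Sum>r<2 ^ m. of_bool (ip y r = ip y' r)) = (\<Sum>r<2 ^ m. 1 + (-1::int) ^ (ip y r + ip
      y' r))"
    by (simp only: sum_distrib_left)
  also have "\<dots> = 2 ^ m + (\<Sum>r<2 ^ m. (-1::int) ^ (ip y r + ip y' r))" by (simp add: sum.distrib)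
  finally show ?thesis
    using sum_neg_one_power_ip[of y y' m] assms by (auto simp: mult_2[symmetric])
qed

text \<open>
  Potential of a pair with \<open>x\<close> surviving candidates when \<open>c\<close> halvings are still
      to come, scaled by
  \<open>(4 E)\<^sup>c\<close>.  The factor \<open>(E + 1) / E\<close> per halving pays for the imperfect
      pairwise independence.
\<close>

definition weight :: "nat \<Rightarrow> nat \<Rightarrow> nat \<Rightarrow> int" where
  "weight E c x = (2 * int E) ^ c * int x - (int E + 1) ^ c * (int x * (int x - 1))"

text \<open>For a class of size c the product c (c - 1) counts its ordered pairs of distinct
  elements; over both classes this counts the collisions of h.\<close>

lemma card_pairs_eq:
  fixes h :: "nat \<Rightarrow> nat"
  assumes "finite W" "\<And>k. h k < 2"
  shows "(\<Sum>\<beta><2. int (card {k\<in>W. h k = \<beta>}) * (int (card {k\<in>W. h k = \<beta>}) - 1)) =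
    (\<Sum>k\<in>W. \<Sum>k'\<in>W - {k}. of_bool (h k = h k'))"
proof -
  have "int (card {k\<in>W. h k = \<beta>}) * (int (card {k\<in>W. h k = \<beta>}) - 1) =
     (\<Sum>k\<in>W. \<Sum>k'\<in>W - {k}. of_bool (h k = \<beta> \<and> h k' = \<beta>))" for \<beta>
  proof -
    let ?B = "{k\<in>W. h k = \<beta>}"
    have "(\<Sum>k\<in>W. \<Sum>k'\<in>W - {k}. of_bool (h k = \<beta> \<and> h k' = \<beta>)) =
        (\<Sum>k\<in>?B. \<Sum>k'\<in>W - {k}. of_bool (h k = \<beta> \<and> h k' = \<beta>) :: int)"
      using assms(1) by (intro sum.mono_neutral_right) auto
    also have "\<dots> = (\<Sum>k\<in>?B. \<Sum>k'\<in>?B - {k}. 1)"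
    proof (rule sum.cong[OF refl])
      fix k assume k: "k \<in> ?B"
      have "(\<Sum>k'\<in>W - {k}. of_bool (h k = \<beta> \<and> h k' = \<beta>)) = (\<Sum>k'\<in>?B - {k}.
          of_bool (h k = \<beta> \<and> h k' = \<beta>) :: int)"
        using assms(1) by (intro sum.mono_neutral_right) auto
      then show "(\<Sum>k'\<in>W - {k}. of_bool (h k = \<beta> \<and> h k' = \<beta>)) = (\<Sum>k'\<in>?B -
          {k}. 1 :: int)"
        using k by simp
    qed
    also have "\<dots> = (\<Sum>k\<in>?B. int (card ?B) - 1)"
    proof (rule sum.cong[OF refl])
      fix k assume "k \<in> ?B"
      moreover have "finite ?B" using assms(1) by simp
      ultimately have "Suc (card (?B - {k})) = card ?B" using card_Suc_Diff1[of ?B k] by blast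
      then show "(\<Sum>k'\<in>?B - {k}. 1) = int (card ?B) - 1" by simp
    qed
    also have "\<dots> = int (card ?B) * (int (card ?B) - 1)" by simp
    finally show ?thesis by simp
  qed
  then have "(\<Sum>\<beta><2. int (card {k\<in>W. h k = \<beta>}) * (int (card {k\<in>W. h k = \<beta>}) -
      1)) =
     (\<Sum>\<beta><2. \<Sum>k\<in>W. \<Sum>k'\<in>W - {k}. of_bool (h k = \<beta> \<and> h k' = \<beta>))"
         by simp
  also have "\<dots> = (\<Sum>k\<in>W. \<Sum>k'\<in>W - {k}. \<Sum>\<beta><2. of_bool (h k = \<beta> \<and>
      h k' = \<beta>))"
  proof -
    have "(\<Sum>\<beta><2. \<Sum>k\<in>W. \<Sum>k'\<in>W - {k}. of_bool (h k = \<beta> \<and> h k' =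
        \<beta>)) =
      (\<Sum>k\<in>W. \<Sum>\<beta><2. \<Sum>k'\<in>W - {k}. (of_bool (h k = \<beta> \<and> h k' = \<beta>)
          :: int))"
      by (rule sum.swap)
    also have "\<dots> = (\<Sum>k\<in>W. \<Sum>k'\<in>W - {k}. \<Sum>\<beta><2. of_bool (h k = \<beta>
        \<and> h k' = \<beta>))"
      by (intro sum.cong[OF refl] sum.swap)
    finally show ?thesis .
  qed
  also have "\<dots> = (\<Sum>k\<in>W. \<Sum>k'\<in>W - {k}. of_bool (h k = h k'))"
  proof (intro sum.cong refl)
    fix k k' show "(\<Sum>\<beta><2. of_bool (h k = \<beta> \<and> h k' = \<beta>)) = (of_bool (h k = h k')
        :: int)"
      using assms(2)[of k] by (auto simp: less_2_cases_iff numeral_2_eq_2)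
  qed
  finally show ?thesis .
qed

lemma card_split2:
  fixes h :: "nat \<Rightarrow> nat"
  assumes "finite W" "\<And>k. h k < 2"
  shows "(\<Sum>\<beta><2. int (card {k\<in>W. h k = \<beta>})) = int (card W)"
proof -
  have "W = {k\<in>W. h k = 0} \<union> {k\<in>W. h k = 1}" using assms(2) by (auto simp: less_2_cases_iff)
  then have "card W = card {k\<in>W. h k = 0} + card {k\<in>W. h k = 1}"
    using card_Un_disjoint[of "{k\<in>W. h k = 0}" "{k\<in>W. h k = 1}"] assms(1) by force
  then show ?thesis by (simp add: numeral_2_eq_2)
qed

definition hashed :: "nat \<Rightarrow> nat \<Rightarrow> nat \<Rightarrow> nat set \<Rightarrow> nat set" where
  "hashed q r \<beta> W = {k\<in>W. ip (k mod q) r = \<beta>}"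

text \<open>First and second moment of a random halving. The two parity classes add up to x exactly,
  while an ordered pair of distinct elements stays together with probability at most (1 + L / |P|) /
  2 \<le> (1 + 1 / E) / 2. Averaging over \<beta> halves both moments once more. Multiplication by 4
  E clears the denominators and leaves the coefficients of \<open>weight E (Suc c)\<close>.\<close>

lemma sum_weight_hashed_ge:
  assumes W: "W \<subseteq> {..<n}" "n \<le> 2 ^ L" and P: "P \<subseteq> {p. prime p \<and> p \<le> 2 ^ m}"
    and E: "E * L \<le> card P"
  shows "(\<Sum>p\<in>P. \<Sum>r<2 ^ m. \<Sum>\<beta><2. 4 * int E * weight E c (card (hashed p r \<beta> W)))
     \<ge> (\<Sum>p\<in>P. \<Sum>r<(2::nat) ^ m. \<Sum>\<beta><2::nat. weight E (Suc c) (card W))"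
proof -
  have fin: "finite W" using W(1) finite_subset by blast
  have finP: "finite P" by (rule finite_subset[OF P]) (auto intro: finite_subset[of _ "{..2^m}"])
  let ?H = "2 ^ m :: int" and ?x = "int (card W)" and ?N = "int (card P)"
  let ?c = "\<lambda>p r \<beta>. int (card (hashed p r \<beta> W))"
  have 1: "(\<Sum>p\<in>P. \<Sum>r<2 ^ m. \<Sum>\<beta><2. ?c p r \<beta>) = ?N * ?H * ?x"
    unfolding hashed_def by (subst card_split2[OF fin ip_less_2]) simp
  \<comment> \<open>Distinct residues agree on half of the masks, equal ones on all of them.
    Residues are equal only for the primes dividing the difference of k and k', and there are at
    most L of those. \<open>max\<close> and \<open>min\<close> avoid truncated subtraction.\<close>
  have coll: "2 * (\<Sum>p\<in>P. \<Sum>r<2 ^ m. of_bool (ip (k mod p) r = ip (k' mod p) r)) \<le> (?N +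
      int L) * ?H"
    if k: "k \<in> W" "k' \<in> W" "k \<noteq> k'" for k k'
  proof -
    have "2 * (\<Sum>p\<in>P. \<Sum>r<2 ^ m. of_bool (ip (k mod p) r = ip (k' mod p) r)) =
       (\<Sum>p\<in>P. if k mod p = k' mod p then 2 * ?H else ?H)"
      unfolding sum_distrib_left[of 2 _ P]
    proof (intro sum.cong refl)
      fix p assume "p \<in> P"
      then have "prime p" "p \<le> 2 ^ m" using P by auto
      then have "k mod p < 2 ^ m" "k' mod p < 2 ^ m"
        using mod_less_divisor[of p] prime_gt_0_nat by (metis order_less_le_trans)+
      then show "2 * (\<Sum>r<2 ^ m. of_bool (ip (k mod p) r = ip (k' mod p) r)) =
        (if k mod p = k' mod p then 2 * ?H else ?H)" by (rule sum_ip_eq)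
    qed
    also have "\<dots> = (\<Sum>p\<in>P. ?H + ?H * of_bool (k mod p = k' mod p))"
      by (intro sum.cong) auto
    also have "\<dots> = ?N * ?H + ?H * int (card {p\<in>P. k mod p = k' mod p})"
      using finP by (simp add: sum.distrib sum_distrib_left[symmetric] Int_def conj_commute)
    also have "card {p\<in>P. k mod p = k' mod p} \<le> card {p. prime p \<and> p dvd (max k k' - min k k')}"
    proof (rule card_mono)
      have "max k k' - min k k' > 0" using k by auto
      then show "finite {p. prime p \<and> p dvd (max k k' - min k k')}"
        by (auto intro: finite_subset[of _ "{..max k k' - min k k'}"] dest: dvd_imp_le)
      show "{p\<in>P. k mod p = k' mod p} \<subseteq> {p. prime p \<and> p dvd (max k k' - min k k')}"
        using P by (auto simp: max_def min_def mod_eq_dvd_iff_nat) (metis mod_eq_dvd_iff_nat nat_le_linear)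
    qed
    also have "card {p. prime p \<and> p dvd (max k k' - min k k')} \<le> L"
    proof (rule card_primes_dvd_le)
      have "k < 2 ^ L" "k' < 2 ^ L" using k W by auto
      then show "max k k' - min k k' < 2 ^ L" by auto
    qed (use k in auto)
    finally show ?thesis by (simp add: algebra_simps)
  qed
  have "2 * (\<Sum>p\<in>P. \<Sum>r<2 ^ m. \<Sum>\<beta><2. ?c p r \<beta> * (?c p r \<beta> - 1)) =
     2 * (\<Sum>p\<in>P. \<Sum>r<2 ^ m. \<Sum>k\<in>W. \<Sum>k'\<in>W - {k}. of_bool (ip (k mod p) r = ip
         (k' mod p) r))"
    unfolding hashed_def by (subst card_pairs_eq[OF fin ip_less_2]) simp
  also have "\<dots> = (\<Sum>k\<in>W. \<Sum>k'\<in>W - {k}. 2 * (\<Sum>p\<in>P. \<Sum>r<2 ^ m. of_bool (ip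
      (k mod p) r = ip (k' mod p) r)))"
  proof -
    have "(\<Sum>p\<in>P. \<Sum>r<2 ^ m. \<Sum>k\<in>W. \<Sum>k'\<in>W - {k}. of_bool (ip (k mod p) r = ip
        (k' mod p) r)) =
      (\<Sum>p\<in>P. \<Sum>k\<in>W. \<Sum>r<2 ^ m. \<Sum>k'\<in>W - {k}. (of_bool (ip (k mod p) r = ip (k'
          mod p) r) :: int))"
      by (intro sum.cong refl sum.swap)
    also have "\<dots> = (\<Sum>k\<in>W. \<Sum>p\<in>P. \<Sum>r<2 ^ m. \<Sum>k'\<in>W - {k}. of_bool (ip (k
        mod p) r = ip (k' mod p) r))"
      by (rule sum.swap)
    also have "\<dots> = (\<Sum>k\<in>W. \<Sum>p\<in>P. \<Sum>k'\<in>W - {k}. \<Sum>r<2 ^ m. of_bool (ip (k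
        mod p) r = ip (k' mod p) r))"
      by (intro sum.cong refl sum.swap)
    also have "\<dots> = (\<Sum>k\<in>W. \<Sum>k'\<in>W - {k}. \<Sum>p\<in>P. \<Sum>r<2 ^ m. of_bool (ip (k
        mod p) r = ip (k' mod p) r))"
      by (intro sum.cong refl sum.swap)
    finally show ?thesis by (simp only: sum_distrib_left)
  qed
  also have "\<dots> \<le> (\<Sum>k\<in>W. \<Sum>k'\<in>W - {k}. (?N + int L) * ?H)"
    by (intro sum_mono coll) auto
  also have "\<dots> = ?x * (?x - 1) * ((?N + int L) * ?H)"
  proof -
    have "int (card (W - {k})) = ?x - 1" if "k \<in> W" for k
      using card_Suc_Diff1[OF fin that] by linarith
    then show ?thesis by simp
  qed
  finally have 2: "2 * (\<Sum>p\<in>P. \<Sum>r<2 ^ m. \<Sum>\<beta><2. ?c p r \<beta> * (?c p r \<beta> - 1))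
    \<le> ?x * (?x - 1) * ((?N + int L) * ?H)" .
  have x: "?x * (?x - 1) \<ge> 0" by (cases "card W") auto
  let ?S1 = "\<Sum>p\<in>P. \<Sum>r<2 ^ m. \<Sum>\<beta><2. ?c p r \<beta>"
  let ?S2 = "\<Sum>p\<in>P. \<Sum>r<2 ^ m. \<Sum>\<beta><2. ?c p r \<beta> * (?c p r \<beta> - 1)"
  let ?a = "(2 * int E) ^ c" and ?b = "(int E + 1) ^ c"
  have "(\<Sum>p\<in>P. \<Sum>r<2 ^ m. \<Sum>\<beta><2. 4 * int E * weight E c (card (hashed p r \<beta> W))) =
     4 * int E * (?a * ?S1 - ?b * ?S2)"
    unfolding weight_def by (simp only: sum_distrib_left[symmetric] sum_subtractf)
  also have "\<dots> = 4 * int E * ?a * ?S1 - 2 * int E * ?b * (2 * ?S2)" by (simp add: algebra_simps)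
  finally have A: "(\<Sum>p\<in>P. \<Sum>r<2 ^ m. \<Sum>\<beta><2. 4 * int E * weight E c (card (hashed p r
      \<beta> W))) =
     4 * int E * ?a * ?S1 - 2 * int E * ?b * (2 * ?S2)" .
  have "(\<Sum>p\<in>P. \<Sum>r<(2::nat) ^ m. \<Sum>\<beta><2::nat. weight E (Suc c) (card W)) =
      2 * ?H * (?N * (2 * int E * ?a) * ?x - ?b * (?x * (?x - 1)) * (?N * (int E + 1)))"
    by (simp add: weight_def algebra_simps)
  \<comment> \<open>As \<open>E * L \<le> card P\<close>, replacing |P| (E + 1) by E (|P| + L) can
    only decrease the subtracted term.\<close>
  also have "\<dots> \<le> 2 * ?H * (?N * (2 * int E * ?a) * ?x - ?b * (?x * (?x - 1)) * (int E * (?N + int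
      L)))"
  proof -
    have "int E * int L \<le> ?N" using E by (metis of_nat_le_iff of_nat_mult)
    then have "int E * (?N + int L) \<le> ?N * (int E + 1)" by (simp add: algebra_simps)
    moreover have "0 \<le> ?b * (?x * (?x - 1))" by (rule mult_nonneg_nonneg[OF _ x]) simp
    ultimately show ?thesis by (intro mult_left_mono diff_left_mono) auto
  qed
  also have "\<dots> = 4 * int E * ?a * (?N * ?H * ?x) - 2 * int E * ?b * (?x * (?x - 1) * ((?N + int L) * ?H))"
    by (simp add: algebra_simps)
  also have "\<dots> \<le> 4 * int E * ?a * ?S1 - 2 * int E * ?b * (2 * ?S2)"
    unfolding 1 using 2 by (intro diff_left_mono mult_left_mono) auto
  finally show ?thesis unfolding A .
qed

text \<open>If every choice were worse, the strict inequalities summed over primes, masks and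
  parities would contradict the average bound of \<open>sum_weight_hashed_ge\<close> summed over
  V.\<close>

lemma exists_good_hash:
  assumes V: "finite V" "\<And>v. v \<in> V \<Longrightarrow> W v \<subseteq> {..<n}" "n \<le> 2 ^ L"
    and E: "E * L \<le> card {p::nat. prime p \<and> p \<le> 2 ^ m}" and m: "m > 0"
  shows "\<exists>q r \<beta>. 0 < q \<and> q \<le> 2 ^ m \<and> r < 2 ^ m \<and> \<beta> < 2 \<and>
    (\<Sum>v\<in>V. weight E (Suc c) (card (W v))) \<le> 4 * int E * (\<Sum>v\<in>V. weight E c (card
        (hashed q r \<beta> (W v))))"
proof (rule ccontr)
  assume neg: "\<not> ?thesis"
  let ?P = "{p::nat. prime p \<and> p \<le> 2 ^ m}"
  have fin: "finite ?P" by (rule finite_subset[of _ "{..2^m}"]) auto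
  \<comment> \<open>A strict inequality of sums requires a nonempty index set.\<close>
  have "2 \<in> ?P" using m self_le_power[of "2::nat" m] by simp
  then have ne: "?P \<noteq> {}" by blast
  have *: "4 * int E * (\<Sum>v\<in>V. weight E c (card (hashed p r \<beta> (W v)))) < (\<Sum>v\<in>V.
      weight E (Suc c) (card (W v)))"
    if "p \<in> ?P" "r < 2 ^ m" "\<beta> < 2" for p r \<beta>
    using neg that prime_gt_0_nat[of p] not_le by blast
  have "(\<Sum>p\<in>?P. \<Sum>r<2 ^ m. \<Sum>\<beta><2. 4 * int E * (\<Sum>v\<in>V. weight E c (card
      (hashed p r \<beta> (W v)))))
     < (\<Sum>p\<in>?P. \<Sum>r<(2::nat) ^ m. \<Sum>\<beta><2::nat. \<Sum>v\<in>V. weight E (Suc c) (card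
         (W v)))"
    by (intro sum_strict_mono fin ne *) (auto simp: lessThan_empty_iff)
  moreover have "(\<Sum>p\<in>?P. \<Sum>r<2 ^ m. \<Sum>\<beta><2. 4 * int E * (\<Sum>v\<in>V. weight E c
      (card (hashed p r \<beta> (W v))))) =
     (\<Sum>v\<in>V. \<Sum>p\<in>?P. \<Sum>r<2 ^ m. \<Sum>\<beta><2. 4 * int E * weight E c (card (hashed p
         r \<beta> (W v))))"
    unfolding sum_distrib_left by (simp only: sum.swap[of _ V])
  moreover have "(\<Sum>p\<in>?P. \<Sum>r<(2::nat) ^ m. \<Sum>\<beta><2::nat. \<Sum>v\<in>V. weight E (Suc
      c) (card (W v))) =
     (\<Sum>v\<in>V. \<Sum>p\<in>?P. \<Sum>r<(2::nat) ^ m. \<Sum>\<beta><2::nat. weight E (Suc c) (card (W v)))"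
    by (simp only: sum.swap[of _ V])
  moreover have "(\<Sum>v\<in>V. \<Sum>p\<in>?P. \<Sum>r<(2::nat) ^ m. \<Sum>\<beta><2::nat. weight E (Suc
      c) (card (W v))) \<le>
     (\<Sum>v\<in>V. \<Sum>p\<in>?P. \<Sum>r<2 ^ m. \<Sum>\<beta><2. 4 * int E * weight E c (card (hashed p
         r \<beta> (W v))))"
    using assms by (intro sum_mono sum_weight_hashed_ge[of _ n L]) auto
  ultimately show False by linarith
qed

text \<open>With no halving left the potential is x (2 - x), which is positive only at x = 1. A
  positive total therefore certifies pairs with exactly one candidate.\<close>

lemma weight_0_le: "weight E 0 x \<le> of_bool (x = 1)"
proof (cases "x \<le> 2")
  case True
  then have "x = 0 \<or> x = 1 \<or> x = 2" by auto
  then show ?thesis by (auto simp: weight_def)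
next
  case False
  then have "int x * 1 \<le> int x * (int x - 1)" by (intro mult_left_mono) auto
  then show ?thesis using False by (simp add: weight_def)
qed

text \<open>Put y = x / 2^l, so 1/8 \<le> y < 1/4. Relative to (4 E)^l the weight is at least y - (1
  + 1/E)^l y^2 \<ge> y - 2 y^2 \<ge> y / 2 \<ge> 1/16. The upper end of the window lets the linear
  term outweigh the quadratic one, the lower end keeps the result bounded away from 0.\<close>

lemma weight_ge:
  assumes "2 * l \<le> E" "4 * x < 2 ^ l" "2 ^ l \<le> 8 * x"
  shows "(4 * int E) ^ l \<le> 16 * weight E l x"
proof (cases "l = 0")
  \<comment> \<open>The window 4 x < 1 \<le> 8 x is empty.\<close>
  case True with assms show ?thesis by simp
next
  case False
  then have E: "E > 0" using assms(1) by simp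
  define y :: real where "y = real x / 2 ^ l"
  have y: "1 / 8 \<le> y" "y < 1 / 4"
  proof -
    have "real (2 ^ l) \<le> real (8 * x)" using assms(3) by (simp only: of_nat_le_iff)
    then show "1 / 8 \<le> y" by (simp add: y_def field_simps)
    have "real (4 * x) < real (2 ^ l)" using assms(2) by (simp only: of_nat_less_iff)
    then show "y < 1 / 4" by (simp add: y_def field_simps)
  qed
  \<comment> \<open>Bernoulli's inequality gives lower bounds, so it is applied to the inverse 1 -
    1/(E + 1), whose l-th power is at least 1 - l/(E + 1) \<ge> 1/2.\<close>
  have two: "(1 + 1 / real E) ^ l \<le> 2"
  proof -
    have "1 / 2 \<le> 1 + real l * (- (1 / (real E + 1)))"
      using assms(1) E by (simp add: field_simps)
    also have "\<dots> \<le> (1 + - (1 / (real E + 1))) ^ l"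
      using E by (intro Bernoulli_inequality) (simp add: field_simps)
    also have "1 + - (1 / (real E + 1)) = inverse (1 + 1 / real E)" using E by (simp add: field_simps)
    finally have "1 / 2 \<le> inverse ((1 + 1 / real E) ^ l)" by (simp add: power_inverse)
    then show ?thesis using E by (simp add: field_simps add_pos_pos)
  qed
  have x: "real x = y * 2 ^ l" by (simp add: y_def)
  have "real_of_int (weight E l x) = (2 * real E) ^ l * real x - (real E + 1) ^ l * (real x * (real x - 1))"
    by (simp add: weight_def)
  also have "\<dots> \<ge> (2 * real E) ^ l * real x - (real E + 1) ^ l * (real x * real x)"
    by (intro diff_left_mono mult_left_mono) auto
  also have "(2 * real E) ^ l * real x - (real E + 1) ^ l * (real x * real x) =
     (4 * real E) ^ l * (y - (1 + 1 / real E) ^ l * y\<^sup>2)"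
  proof -
    have "(2 * real E) ^ l * real x = (4 * real E) ^ l * y"
    proof -
      have "4 * real E = (2 * real E) * 2" by simp
      then have "(4 * real E) ^ l = (2 * real E) ^ l * 2 ^ l" by (metis power_mult_distrib)
      then show ?thesis by (simp only: x mult_ac)
    qed
    moreover have "(real E + 1) ^ l = real E ^ l * (1 + 1 / real E) ^ l"
      using E by (simp add: power_mult_distrib[symmetric] distrib_left)
    moreover have "4 * real E = (real E * 2) * 2" by simp
    then have "(4 * real E) ^ l = real E ^ l * 2 ^ l * 2 ^ l" by (metis power_mult_distrib)
    ultimately show ?thesis by (simp only: x power2_eq_square right_diff_distrib mult_ac)
  qed
  finally have 1: "(4 * real E) ^ l * (y - (1 + 1 / real E) ^ l * y\<^sup>2) \<le> real_of_int (weight E l x)" .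
  have "(4 * real E) ^ l * (1 / 16) \<le> (4 * real E) ^ l * (y - (1 + 1 / real E) ^ l * y\<^sup>2)"
  proof (intro mult_left_mono)
    have "(1 + 1 / real E) ^ l * y\<^sup>2 \<le> 2 * y\<^sup>2" using two by (intro mult_right_mono) auto
    moreover have "y * y \<le> y * (1 / 4)" using y by (intro mult_left_mono) auto
    ultimately show "1 / 16 \<le> y - (1 + 1 / real E) ^ l * y\<^sup>2"
      using y unfolding power2_eq_square by linarith
  qed simp
  from order_trans[OF this 1] have "(4 * real E) ^ l \<le> 16 * real_of_int (weight E l x)" by linarith
  then have "real_of_int ((4 * int E) ^ l) \<le> real_of_int (16 * weight E l x)" by simp
  then show ?thesis by (simp only: of_int_le_iff)
qed


lemma square_le_power2: "4 \<le> m \<Longrightarrow> m\<^sup>2 \<le> (2::nat) ^ m"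
proof (induction m rule: dec_induct)
  case (step m)
  have "4 * m \<le> m * m" using step by simp
  then have "(Suc m)\<^sup>2 \<le> 2 * m\<^sup>2" using step(1) unfolding power2_eq_square mult_Suc
      mult_Suc_right by linarith
  also have "\<dots> \<le> 2 * 2 ^ m" using step by simp
  finally show ?case by simp
qed simp

text \<open>Write E = 2 L + 4. Too few primes would mean \<open>2 * ?\<pi> \<le> E * E\<close>, and
  \<open>card_primes_ge\<close> would give 2 (2^m - 2) \<le> m E^2. But m^2 \<le> 2^m and E^4 \<le>
  2^m yield m E^2 \<le> 2^m, hence 2^m \<le> 4, although E \<ge> 4 forces m \<ge> 8. This is the
  origin of the fourth power.\<close>

lemma enough_primes:
  assumes "(2 * L + 4) ^ 4 \<le> (2::nat) ^ m"
  shows "(2 * L + 4) * L \<le> card {p::nat. prime p \<and> p \<le> 2 ^ m}" (is "_ \<le> ?\<pi>")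
proof (rule ccontr)
  define E where "E = 2 * L + 4"
  assume "\<not> ?thesis"
  then have "?\<pi> \<le> E * L" by (simp add: E_def)
  then have "2 * ?\<pi> \<le> E * (2 * L)" by simp
  also have "\<dots> \<le> E * E" by (intro mult_left_mono) (simp_all add: E_def)
  finally have pi: "2 * ?\<pi> \<le> E * E" .
  have "(4::nat) ^ 4 \<le> E ^ 4" by (intro power_mono) (simp_all add: E_def)
  then have big: "(2::nat) ^ 8 \<le> 2 ^ m" using assms by (simp add: E_def)
  then have m: "8 \<le> m" using power_le_imp_le_exp[of "2::nat" 8 m] by simp
  have "(m * E\<^sup>2)\<^sup>2 = m\<^sup>2 * E ^ 4" by (simp add: power_mult_distrib)
  also have "\<dots> \<le> 2 ^ m * 2 ^ m" using square_le_power2[of m] m assms by (intro mult_mono) (auto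
      simp: E_def)
  finally have "(m * E\<^sup>2)\<^sup>2 \<le> (2 ^ m)\<^sup>2" by (simp add: power2_eq_square)
  then have 1: "m * E\<^sup>2 \<le> 2 ^ m" by (rule power2_le_imp_le) simp
  have "2 * (2 ^ m - 2) \<le> 2 * (m * ?\<pi>)" using card_primes_ge[of m] by (rule mult_left_mono) simp
  also have "\<dots> = m * (2 * ?\<pi>)" by simp
  also have "\<dots> \<le> m * (E * E)" using pi by (rule mult_left_mono) simp
  also have "\<dots> \<le> 2 ^ m" using 1 by (simp add: power2_eq_square)
  finally show False using big by simp
qed

section \<open>Reachability trees from strong components\<close>

lemma reachable_with_proj_iff:
  assumes "pair_wf_digraph D" "u \<in> pverts D" "v \<in> pverts D"
  shows "reachable (with_proj D) u v \<longleftrightarrow> (u, v) \<in> (parcs D)\<^sup>*"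
proof -
  interpret wf_digraph "with_proj D" using assms(1) by (simp add: wf_digraph_wp_iff)
  show ?thesis using assms(2,3) by (simp add: reachable_conv arcs_ends_conv)
qed

text \<open>At most one arc ends in each vertex and none in the root, so two walks from the root to
  the same vertex agree from their last arc backwards. Existence of the walks is the hypothesis
  \<open>reach\<close>.\<close>

lemma reachability_tree_parents:
  assumes G: "pair_wf_digraph G" "pverts G = {..<n}" and a: "a < n"
    and root: "\<And>u. f a \<noteq> int u + 1"
    and arc: "\<And>u v. v < n \<Longrightarrow> f v = int u + 1 \<Longrightarrow> (u, v) \<in> parcs G"
    and par: "\<And>u v. v < n \<Longrightarrow> f v = int u + 1 \<Longrightarrow> (a, u) \<in> (parcs
        G)\<^sup>*"
    and reach: "\<And>v. v < n \<Longrightarrow> (a, v) \<in> (parcs G)\<^sup>* \<Longrightarrow> (a, v)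
        \<in> {(u, v). v < n \<and> f v = int u + 1}\<^sup>*"
  shows "reachability_tree G a {(u, v). v < n \<and> f v = int u + 1}"
proof -
  define T where "T = {(u, v). v < n \<and> f v = int u + 1}"
  define D where "D = \<lparr>pverts = pverts G, parcs = T\<rparr>"
  have sub: "T \<subseteq> parcs G" using arc by (auto simp: T_def)
  have D: "pair_wf_digraph D"
    using G(1) sub unfolding D_def pair_wf_digraph_def by auto
  have parcs_D: "parcs D = T" by (simp add: D_def)
  interpret W: wf_digraph "with_proj D" using D by (simp add: wf_digraph_wp_iff)
  have mono: "T\<^sup>* \<subseteq> (parcs G)\<^sup>*" by (rule rtrancl_mono[OF sub])
  have verts: "u < n" "v < n" if "(u, v) \<in> T" for u v
    using that sub G unfolding pair_wf_digraph_def by (force simp: T_def)+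
  have R: "reachable (with_proj D) a v \<longleftrightarrow> (a, v) \<in> T\<^sup>*" if "v < n" for v
    using reachable_with_proj_iff[OF D, of a v] that a G(2) by (simp add: D_def)
  have T_reach: "(a, v) \<in> T\<^sup>*" if v: "v = a \<or> v \<in> fst ` T \<union> snd ` T" for v
  proof (cases "v = a")
    case False
    then consider w where "(v, w) \<in> T" | w where "(w, v) \<in> T" using v by auto
    then show ?thesis
    proof cases
      case 1
      then have "(a, v) \<in> (parcs G)\<^sup>*" using par by (auto simp: T_def)
      with 1 verts reach show ?thesis unfolding T_def by blast
    next
      case 2
      then have "(a, w) \<in> (parcs G)\<^sup>*" using par by (auto simp: T_def)
      with 2 verts reach have "(a, w) \<in> T\<^sup>*" unfolding T_def by blast
      with 2 show ?thesis by simp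
    qed
  qed simp
  have uniq: "W.awalk a p v \<Longrightarrow> W.awalk a q v \<Longrightarrow> p = q" for p q v
  proof (induction p arbitrary: q v rule: rev_induct)
    case Nil
    then have v: "v = a" by (simp add: W.awalk_Nil_iff)
    show ?case
    proof (cases q rule: rev_cases)
      case (snoc q' e)
      with Nil v have "W.awalk (W.awlast a q') [e] a" by simp
      then have "e \<in> T" "snd e = a" by (auto simp: W.awalk_simps parcs_D)
      then have "f a = int (fst e) + 1" by (auto simp: T_def)
      with root[of "fst e"] show ?thesis by simp
    qed simp
  next
    case (snoc e p)
    note IH = snoc.IH
    from snoc.prems have 1: "W.awalk a p (W.awlast a p)" "W.awalk (W.awlast a p) [e] v" by simp_all
    then have e: "e \<in> T" "fst e = W.awlast a p" "snd e = v" by (auto simp: W.awalk_simps parcs_D)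
    show ?case
    proof (cases q rule: rev_cases)
      case Nil
      with snoc.prems have "v = a" by (simp add: W.awalk_Nil_iff)
      with e have "f a = int (fst e) + 1" by (auto simp: T_def)
      with root[of "fst e"] show ?thesis by simp
    next
      case q: (snoc q' e')
      with snoc.prems have 2: "W.awalk a q' (W.awlast a q')" "W.awalk (W.awlast a q') [e'] v" by simp_all
      then have e': "e' \<in> T" "fst e' = W.awlast a q'" "snd e' = v" by (auto simp: W.awalk_simps parcs_D)
      have "f v = int (fst e) + 1" "f v = int (fst e') + 1" using e(1,3) e'(1,3) by (auto simp: T_def)
      then have "fst e = fst e'" by simp
      then have "e = e'" using e(3) e'(3) by (simp add: prod_eq_iff)
      then have "W.awlast a p = W.awlast a q'" using e(2) e'(2) by simp
      then have "W.awalk a q' (W.awlast a p)" using 2(1) by (simp only:)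
      from IH[OF 1(1) this] \<open>e = e'\<close> q show ?thesis by (simp only:)
    qed
  qed
  have "\<exists>!p. W.awalk a p v" if "v \<in> {a} \<union> fst ` T \<union> snd ` T" for v
  proof -
    have "(a, v) \<in> T\<^sup>*" using that T_reach by blast
    moreover have "v < n" using that a verts by auto
    ultimately have "\<exists>p. W.awalk a p v" using R W.reachable_awalk by blast
    with uniq show ?thesis by blast
  qed
  then have "arborescence D a"
    unfolding arborescence_def using D a G(2) by (simp add: D_def)
  moreover have "reachable (with_proj D) a t \<longleftrightarrow> reachable (with_proj G) a t" if "t \<in>
      pverts G" for t
    using R[of t] reachable_with_proj_iff[OF G(1), of a t] that a G(2) reach mono
    unfolding T_def by auto
  ultimately show ?thesis
    unfolding reachability_tree_def Let_def using sub unfolding D_def T_def by blast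
qed

section \<open>Strong components\<close>

definition mutual :: "('a \<times> 'a) set \<Rightarrow> 'a \<Rightarrow> 'a \<Rightarrow> bool" where
  "mutual A u v \<longleftrightarrow> (u, v) \<in> A\<^sup>* \<and> (v, u) \<in> A\<^sup>*"

lemma mutual_refl [simp]: "mutual A u u" by (simp add: mutual_def)
lemma mutual_sym: "mutual A u v \<Longrightarrow> mutual A v u" by (simp add: mutual_def)
lemma mutual_trans: "mutual A u v \<Longrightarrow> mutual A v w \<Longrightarrow> mutual A u w" by (auto
    simp: mutual_def)

text \<open>Every vertex on a walk from x to y is reachable from x and reaches y, hence also
  x.\<close>

lemma path_within_component:
  assumes "mutual A x y"
  shows "(x, y) \<in> {(u, v). (u, v) \<in> A \<and> mutual A x u \<and> mutual A x v}\<^sup>*"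
proof -
  have "(x, y) \<in> A\<^sup>*" "(y, x) \<in> A\<^sup>*" using assms by (auto simp: mutual_def)
  then show ?thesis
  proof (induction rule: rtrancl_induct)
    case (step y z)
    from step.hyps(2) step.prems have yx: "(y, x) \<in> A\<^sup>*" by (rule converse_rtrancl_into_rtrancl)
    from step.hyps have "(x, z) \<in> A\<^sup>*" by (rule rtrancl_into_rtrancl)
    with yx step.hyps step.prems have "(y, z) \<in> {(u, v). (u, v) \<in> A \<and> mutual A x u \<and>
        mutual A x v}"
      by (simp add: mutual_def)
    with step.IH[OF yx] show ?case by (rule rtrancl_into_rtrancl)
  qed simp
qed

text \<open>The walk starts outside the component of v and ends inside; the arc is the first one
  whose head lies inside.\<close>

lemma enters_component:
  assumes "(a, v) \<in> A\<^sup>*" "\<not> mutual A a v"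
  shows "\<exists>u w. (a, u) \<in> A\<^sup>* \<and> (u, w) \<in> A \<and> \<not> mutual A u w \<and>
      mutual A w v"
proof -
  have "(a, v) \<in> A\<^sup>*" using assms by simp
  then have "\<not> mutual A a v \<Longrightarrow> ?thesis"
  proof (induction rule: converse_rtrancl_induct)
    case (step x y)
    show ?case
    proof (cases "mutual A y v")
      case True
      with step.prems have "\<not> mutual A x y" using mutual_trans by metis
      with True step show ?thesis by blast
    next
      case False
      with step obtain u w where "(y, u) \<in> A\<^sup>*" "(u, w) \<in> A" "\<not> mutual A u w" "mutual A
          w v" by blast
      with step show ?thesis by (meson converse_rtrancl_into_rtrancl)
    qed
  qed simp
  with assms show ?thesis by simp
qed

section \<open>Following a parent function to a root\<close>

lemma funpow_to_root:
  fixes f :: "'a \<Rightarrow> 'a"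
  assumes "(r, v) \<in> {(f w, w) | w. w \<notin> X}\<^sup>*" "r \<in> X"
  shows "\<exists>k. (f ^^ k) v \<in> X"
  using assms
proof (induction rule: rtrancl_induct)
  case base then show ?case by (intro exI[of _ 0]) simp
next
  case (step y z)
  then obtain k where "(f ^^ k) y \<in> X" by blast
  with step show ?case by (intro exI[of _ "Suc k"]) (auto simp: funpow_swap1)
qed

definition depth :: "('a \<Rightarrow> 'a) \<Rightarrow> 'a set \<Rightarrow> 'a \<Rightarrow> nat" where
  "depth f X v = (LEAST k. (f ^^ k) v \<in> X)"

lemma depth_root: "v \<in> X \<Longrightarrow> depth f X v = 0"
  unfolding depth_def by (rule Least_eq_0) simp

lemma depth_step:
  assumes "\<exists>k. (f ^^ k) v \<in> X" "v \<notin> X"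
  shows "depth f X v = Suc (depth f X (f v))"
proof -
  obtain k where "(f ^^ k) v \<in> X" using assms by blast
  then have "(LEAST k. (f ^^ k) v \<in> X) = Suc (LEAST m. (f ^^ Suc m) v \<in> X)"
    by (rule Least_Suc) (use assms in simp)
  then show ?thesis unfolding depth_def by (simp add: funpow_swap1)
qed

lemma depth_funpow:
  assumes "\<exists>k. (f ^^ k) v \<in> X" "i \<le> depth f X v"
  shows "depth f X ((f ^^ i) v) = depth f X v - i"
  using assms(2)
proof (induction i)
  case (Suc i)
  then have IH: "depth f X ((f ^^ i) v) = depth f X v - i" by simp
  have "(f ^^ i) v \<notin> X" using IH Suc.prems depth_root[of "(f ^^ i) v" X f] by auto
  moreover have "\<exists>k. (f ^^ k) ((f ^^ i) v) \<in> X"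
  proof -
    have "(f ^^ depth f X v) v \<in> X" unfolding depth_def using assms(1) by (rule LeastI_ex)
    then have "(f ^^ (depth f X v - i)) ((f ^^ i) v) \<in> X"
      using Suc.prems by (metis Suc_leD funpow_add le_add_diff_inverse2 o_apply)
    then show ?thesis by blast
  qed
  ultimately have "depth f X ((f ^^ i) v) = Suc (depth f X (f ((f ^^ i) v)))" by (intro depth_step) auto
  with IH show ?case by simp
qed simp

lemma funpow_depth: "\<exists>k. (f ^^ k) v \<in> X \<Longrightarrow> (f ^^ depth f X v) v \<in> X"
  unfolding depth_def by (rule LeastI_ex)

text \<open>The iterates up to the root have pairwise different depths and are therefore distinct.
  This bounds the number of rounds in which \<open>Trees\<close> has to follow a path.\<close>

lemma depth_less_card:
  assumes "\<exists>k. (f ^^ k) v \<in> X" "\<And>i. i \<le> depth f X v \<Longrightarrow> (f ^^ i) v \<in>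
      S" "finite S"
  shows "depth f X v < card S"
proof -
  have "inj_on (\<lambda>i. (f ^^ i) v) {..depth f X v}"
  proof (rule inj_onI)
    fix i j assume "i \<in> {..depth f X v}" "j \<in> {..depth f X v}" "(f ^^ i) v = (f ^^ j) v"
    then show "i = j" using depth_funpow[OF assms(1), of i] depth_funpow[OF assms(1), of j] by auto
  qed
  from card_image[OF this] have "card ((\<lambda>i. (f ^^ i) v) ` {..depth f X v}) = Suc (depth f X v)" by simp
  moreover have "card ((\<lambda>i. (f ^^ i) v) ` {..depth f X v}) \<le> card S"
    using assms(2,3) by (intro card_mono) auto
  ultimately show ?thesis by simp
qed

text \<open>Re-rooting at e. The path from e to r along f becomes a chain of descendants of e, and
  vertices off the path keep their parent under g. Induction along the out-tree from r reaches all
  of C: a vertex of the path met on the way is reached directly from e, any other one through its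
  parent.\<close>

lemma component_tree:
  assumes up: "\<And>i. i < d \<Longrightarrow> t ((f ^^ Suc i) e) = Some ((f ^^ i) e)"
    and final: "(f ^^ d) e = r"
    and out: "\<And>v. v \<in> C \<Longrightarrow> v \<notin> (\<lambda>i. (f ^^ i) e) ` {..d}
        \<Longrightarrow> t v = Some (g v)"
    and tree: "\<And>v. v \<in> C \<Longrightarrow> (r, v) \<in> {(g w, w) | w. w \<in> C \<and> w \<noteq>
        r}\<^sup>*"
    and path: "\<And>i. i \<le> d \<Longrightarrow> (f ^^ i) e \<in> C" and inj: "\<And>i. i < d
        \<Longrightarrow> (f ^^ Suc i) e \<noteq> e"
    and v: "v \<in> C"
  shows "(e, v) \<in> {(u, v). v \<in> C \<and> v \<noteq> e \<and> t v = Some u}\<^sup>*"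
proof -
  let ?T = "{(u, v). v \<in> C \<and> v \<noteq> e \<and> t v = Some u}"
  have P: "(e, (f ^^ i) e) \<in> ?T\<^sup>*" if "i \<le> d" for i
    using that
  proof (induction i)
    case (Suc i)
    then have "((f ^^ i) e, (f ^^ Suc i) e) \<in> ?T" using up[of i] path[of "Suc i"] inj[of i] by auto
    with Suc show ?case by (meson Suc_leD rtrancl_into_rtrancl)
  qed simp
  show ?thesis
    using tree[OF v]
  proof (induction rule: rtrancl_induct)
    case base then show ?case using P[of d] final by simp
  next
    case (step y z)
    show ?case
    proof (cases "z \<in> (\<lambda>i. (f ^^ i) e) ` {..d}")
      case True then show ?thesis using P by auto
    next
      case False
      then have "z \<noteq> e" by (metis atMost_iff funpow_0 image_eqI zero_le)
      with False step out[of z] have "(y, z) \<in> ?T" by auto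
      with step show ?thesis by (meson rtrancl_into_rtrancl)
    qed
  qed
qed

text \<open>All tables are shifted by one. \<open>SP e v\<close> is the parent of v in the tree of
  its component rooted at e, \<open>ENT u r\<close> the head of an arc from u into the component
  represented by r, and \<open>WW a r\<close> the tail of the arc by which the tree of a enters that
  component. The tails lie in strictly earlier components, so the pieces fit together by induction
  along the condensation.\<close>

lemma reachability_forest_from_components:
  fixes R :: "nat \<Rightarrow> nat \<Rightarrow> bool" and SP ENT WW p :: "nat \<Rightarrow> nat
      \<Rightarrow> int"
  assumes G: "pair_wf_digraph G" "pverts G = {..<n}"
    and rep: "\<And>v. v < n \<Longrightarrow> rep v < n \<and> mutual (parcs G) (rep v) v"
      "\<And>u v. u < n \<Longrightarrow> v < n \<Longrightarrow> mutual (parcs G) u v \<Longrightarrow>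
          rep u = rep v"
    and SP: "\<And>e v. e < n \<Longrightarrow> v < n \<Longrightarrow> mutual (parcs G) e v
        \<Longrightarrow> v \<noteq> e \<Longrightarrow>
        \<exists>u. SP e v = int u + 1 \<and> (u, v) \<in> parcs G \<and> mutual (parcs G) u e"
      "\<And>e v. e < n \<Longrightarrow> v < n \<Longrightarrow> mutual (parcs G) e v \<Longrightarrow>
        (e, v) \<in> {(u, v). v < n \<and> v \<noteq> e \<and> mutual (parcs G) e v \<and> SP e v = int u +
            1}\<^sup>*"
    and ENT: "\<And>u r. u < n \<Longrightarrow> r < n \<Longrightarrow> ENT u r > 0 \<Longrightarrow>
        \<exists>e<n. ENT u r = int e + 1 \<and> (u, e) \<in> parcs G \<and> rep e = r \<and> rep u \<noteq> r"
      "\<And>u v. (u, v) \<in> parcs G \<Longrightarrow> rep u \<noteq> rep v \<Longrightarrow> ENT u (rep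
          v) > 0"
    and WW: "\<And>a r. a < n \<Longrightarrow> r < n \<Longrightarrow> \<exists>u<n. (a, u) \<in> (parcs
        G)\<^sup>* \<and> ENT u r > 0 \<Longrightarrow>
        \<exists>u<n. (a, u) \<in> (parcs G)\<^sup>* \<and> ENT u r > 0 \<and> WW a r = int u + 1"
    and p: "\<And>a v. a < n \<Longrightarrow> v < n \<Longrightarrow> p a v =
      (if (a, v) \<notin> (parcs G)\<^sup>* \<or> v = a then 0
       else if (v, a) \<in> (parcs G)\<^sup>* then SP a v
       else if ENT (nat (WW a (rep v) - 1)) (rep v) = int v + 1 then WW a (rep v)
       else SP (nat (ENT (nat (WW a (rep v) - 1)) (rep v) - 1)) v)"
  shows "reachability_forest G (\<lambda>a. {(u, v). v < n \<and> p a v = int u + 1})"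
  unfolding reachability_forest_def
proof
  fix a assume "a \<in> pverts G"
  then have a: "a < n" using G by simp
  let ?A = "parcs G"
  let ?T = "{(u, v). v < n \<and> p a v = int u + 1}"
  have An: "u < n" "v < n" if "(u, v) \<in> ?A" for u v
    using that G unfolding pair_wf_digraph_def by auto
  \<comment> \<open>Both tables are consulted at \<open>rep v\<close>, so one entry arc (u, e)
    governs all vertices w of the component of v.\<close>
  have entry: "\<exists>u e. u < n \<and> e < n \<and> (a, u) \<in> ?A\<^sup>* \<and> (u, e) \<in> ?A
      \<and> mutual ?A e v \<and> rep u \<noteq> rep v \<and>
      (\<forall>w<n. mutual ?A w v \<longrightarrow> p a w = (if w = e then int u + 1 else SP e w))"
    if v: "v < n" "(a, v) \<in> ?A\<^sup>*" "(v, a) \<notin> ?A\<^sup>*" for v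
  proof -
    have "\<not> mutual ?A a v" using v by (simp add: mutual_def)
    then obtain u w where uw: "(a, u) \<in> ?A\<^sup>*" "(u, w) \<in> ?A" "\<not> mutual ?A u w" "mutual ?A w v"
      using enters_component[OF v(2)] by blast
    have r: "rep v < n" "rep w = rep v" 
      using rep(1)[OF v(1)] rep(2)[of w v] uw(4) An(2)[OF uw(2)] v(1) by blast+
    have "rep u \<noteq> rep w" using uw An rep(1)[of u] rep(1)[of w] by (metis mutual_sym mutual_trans)
    then have "ENT u (rep v) > 0" using ENT(2)[OF uw(2)] r by simp
    then obtain u' where u': "u' < n" "(a, u') \<in> ?A\<^sup>*" "ENT u' (rep v) > 0" "WW a (rep v) = int
        u' + 1"
      using WW[OF a r(1)] uw An by blast
    then obtain e where e: "e < n" "ENT u' (rep v) = int e + 1" "(u', e) \<in> ?A" "rep e = rep v" "rep u'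
        \<noteq> rep v"
      using ENT(1)[of u' "rep v"] r by blast
    have ev: "mutual ?A e v" using rep(1)[of e] rep(1)[OF v(1)] e by (metis mutual_sym mutual_trans)
    have "p a w = (if w = e then int u' + 1 else SP e w)" if w: "w < n" "mutual ?A w v" for w
    proof -
      have "rep w = rep v" using rep(2)[OF w(1) v(1) w(2)] .
      moreover have "(v, w) \<in> ?A\<^sup>*" using w(2) by (simp add: mutual_def)
      then have "(a, w) \<in> ?A\<^sup>*" "(w, a) \<notin> ?A\<^sup>*" using v(2,3) rtrancl_trans[of _ _
          ?A] by blast+
      moreover from this have "w \<noteq> a" by blast
      moreover have "nat (WW a (rep v) - 1) = u'" using u'(4) by simp
      moreover have "nat (ENT u' (rep v) - 1) = e" using e(2) by simp
      moreover have "ENT u' (rep v) = int w + 1 \<longleftrightarrow> w = e" using e(2) by auto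
      ultimately show ?thesis unfolding p[OF a w(1)] by (simp only: u'(4) if_False simp_thms)
    qed
    with u' e ev show ?thesis by blast
  qed
  show "reachability_tree G a ?T"
  proof (rule reachability_tree_parents[OF G a])
    show "p a a \<noteq> int u + 1" for u using p[OF a a] by simp
  next
    fix u v assume v: "v < n" and u: "p a v = int u + 1"
    then have *: "(a, v) \<in> ?A\<^sup>*" "v \<noteq> a" using p[OF a v] by (auto split: if_splits)
    have "(u, v) \<in> ?A \<and> (a, u) \<in> ?A\<^sup>*"
    proof (cases "(v, a) \<in> ?A\<^sup>*")
      case True
      with * have "mutual ?A a v" by (simp add: mutual_def)
      with SP(1)[OF a v] * True u p[OF a v] show ?thesis by (auto simp: mutual_def)
    next
      case False
      obtain u' e where e: "u' < n" "e < n" "(a, u') \<in> ?A\<^sup>*" "(u', e) \<in> ?A" "mutual ?A e v"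
        "\<And>w. w < n \<Longrightarrow> mutual ?A w v \<Longrightarrow> p a w = (if w = e then int u' + 1
            else SP e w)"
        using entry[OF v *(1) False] by blast
      show ?thesis
      proof (cases "v = e")
        case True with e(6)[OF v] e u show ?thesis by auto
      next
        case ve: False
        then obtain x where x: "SP e v = int x + 1" "(x, v) \<in> ?A" "mutual ?A x e"
          using SP(1)[OF e(2) v e(5)] by blast
        then have "x = u" using e(6)[OF v] ve u by simp
        moreover have "(a, e) \<in> ?A\<^sup>*" using e by (meson rtrancl_into_rtrancl)
        then have "(a, x) \<in> ?A\<^sup>*" using x unfolding mutual_def by (meson rtrancl_trans)
        ultimately show ?thesis using x by simp
      qed
    qed
    then show "(u, v) \<in> ?A" "(a, u) \<in> ?A\<^sup>*" by simp_all
  next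
    fix v assume v: "v < n" "(a, v) \<in> ?A\<^sup>*"
    then show "(a, v) \<in> ?T\<^sup>*"
    \<comment> \<open>The measure drops from v to the tail u of the entry arc: what reaches u also
      reaches v, and v reaches itself but not u.\<close>
    proof (induction "card {w. w < n \<and> (w, v) \<in> ?A\<^sup>*}" arbitrary: v rule: less_induct)
      case less
      show ?case
      proof (cases "(v, a) \<in> ?A\<^sup>*")
        case True
        with less have m: "mutual ?A a v" by (simp add: mutual_def)
        have "{(u, v). v < n \<and> v \<noteq> a \<and> mutual ?A a v \<and> SP a v = int u + 1} \<subseteq> ?T"
          using p[OF a] by (auto simp: mutual_def)
        from rtrancl_mono[OF this] SP(2)[OF a less.prems(1) m] show ?thesis by blast
      next
        case False
        obtain u e where e: "u < n" "e < n" "(a, u) \<in> ?A\<^sup>*" "(u, e) \<in> ?A" "mutual ?A e v"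
            "rep u \<noteq> rep v"
          "\<And>w. w < n \<Longrightarrow> mutual ?A w v \<Longrightarrow> p a w = (if w = e then int u +
              1 else SP e w)"
          using entry[OF less.prems False] by blast
        have uv: "(u, v) \<in> ?A\<^sup>*" using e(4,5) unfolding mutual_def by (meson
            converse_rtrancl_into_rtrancl)
        then have vu: "(v, u) \<notin> ?A\<^sup>*" using e(1,6) rep(2)[OF e(1) less.prems(1)] by (auto
            simp: mutual_def)
        have "{w. w < n \<and> (w, u) \<in> ?A\<^sup>*} \<subset> {w. w < n \<and> (w, v) \<in> ?A\<^sup>*}"
        proof
          show "{w. w < n \<and> (w, u) \<in> ?A\<^sup>*} \<subseteq> {w. w < n \<and> (w, v) \<in>
              ?A\<^sup>*}" using uv by auto
          show "{w. w < n \<and> (w, u) \<in> ?A\<^sup>*} \<noteq> {w. w < n \<and> (w, v) \<in>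
              ?A\<^sup>*}" using vu less.prems by auto
        qed
        then have "card {w. w < n \<and> (w, u) \<in> ?A\<^sup>*} < card {w. w < n \<and> (w, v) \<in>
            ?A\<^sup>*}"
          by (intro psubset_card_mono) auto
        then have "(a, u) \<in> ?T\<^sup>*" using less.hyps[of u] e by blast
        moreover have "(u, e) \<in> ?T" using e(7)[OF e(2,5)] e(2) by simp
        moreover have "{(u, v). v < n \<and> v \<noteq> e \<and> mutual ?A e v \<and> SP e v = int u + 1}
            \<subseteq> ?T"
        proof clarify
          fix x w assume w: "w < n" "w \<noteq> e" "mutual ?A e w" "SP e w = int x + 1"
          then have "mutual ?A w v" using e(5) mutual_sym mutual_trans by metis
          from e(7)[OF w(1) this] w show "p a w = int x + 1" by simp
        qed
        from rtrancl_mono[OF this] SP(2)[OF e(2) less.prems(1) e(5)] have "(e, v) \<in> ?T\<^sup>*" by blast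
        ultimately show ?thesis by (meson rtrancl_into_rtrancl rtrancl_trans)
      qed
    qed
  qed
qed

section \<open>Transitive closure\<close>

text \<open>The language has no comparison of two values. The denominator is 1 if the values agree
  and larger otherwise, which makes the quotient 0.\<close>

definition Eq :: "expr \<Rightarrow> expr \<Rightarrow> expr" where
  "Eq e f = Div (Const 1) (Add (Const 1) (Mul (Sub e f) (Sub e f)))"

text \<open>Intended for values \<ge> 0, where 1 div (1 + e) is 1 at e = 0 and 0 beyond.\<close>

definition Pos :: "expr \<Rightarrow> expr" where
  "Pos e = Sub (Const 1) (Div (Const 1) (Add (Const 1) e))"

lemma val_Eq [simp]: "val s (Eq e f) = of_bool (val s e = val s f)"
proof (cases "val s e = val s f")
  case False
  then have "0 < (val s e - val s f)\<^sup>2" by simp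
  then have "1 < 1 + (val s e - val s f) * (val s e - val s f)" unfolding power2_eq_square by linarith
  then show ?thesis using False by (simp add: Eq_def div_pos_pos_trivial)
qed (simp add: Eq_def)

lemma val_Pos [simp]: "0 \<le> val s e \<Longrightarrow> val s (Pos e) = of_bool (0 < val s e)"
  by (cases "val s e = 0") (simp_all add: Pos_def div_pos_pos_trivial)

lemma reads_le_Eq [simp]: "reads_le M s (Eq e f) \<longleftrightarrow> reads_le M s e \<and> reads_le M s f"
  by (auto simp: Eq_def)

lemma reads_le_Pos [simp]: "reads_le M s (Pos e) \<longleftrightarrow> reads_le M s e"
  by (auto simp: Pos_def)

lemma weight_Eq [simp]: "val_weight (Eq e f) = 2"
  "cost_weight (Eq e f) = 2 * (cost_weight e + cost_weight f) + 6 * (val_weight e + val_weight f) + 8"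
  by (simp_all add: Eq_def)

lemma weight_Pos [simp]: "val_weight (Pos e) = 4" "cost_weight (Pos e) = cost_weight e + val_weight e + 14"
  by (simp_all add: Pos_def)

lemma of_bool_guard [simp]:
  "0 < of_bool P * (of_bool Q :: int) \<longleftrightarrow> P \<and> Q" "of_bool P * (of_bool Q :: int)
      \<le> 0 \<longleftrightarrow> \<not> (P \<and> Q)"
  "0 < of_bool P * (1 - of_bool Q :: int) \<longleftrightarrow> P \<and> \<not> Q" "of_bool P * (1 -
      of_bool Q :: int) \<le> 0 \<longleftrightarrow> \<not> (P \<and> \<not> Q)"
  by auto

text \<open>The language has no empty statement; array 99 holds no data.\<close>

definition Skip :: prog where "Skip = SetVar 99 (Const 0)"

lemma written_Skip [simp]: "written Skip = {99}" by (simp add: Skip_def)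

lemma runs_Skip: "(\<And>x. Q (s(99 := x))) \<Longrightarrow> runs Skip s (step_cost M) Q"
  unfolding Skip_def by (intro runs_Assign) auto

section \<open>Closure by repeated squaring\<close>

lemma relpow_reflcl_mono: "(x, y) \<in> A ^^ m \<Longrightarrow> m \<le> k \<Longrightarrow> (x, y) \<in>
    (A\<^sup>=) ^^ k"
proof (induction k arbitrary: m y)
  case (Suc k)
  show ?case
  proof (cases "m \<le> k")
    case True
    with Suc have "(x, y) \<in> (A\<^sup>=) ^^ k" by blast
    then show ?thesis by auto
  next
    case False
    with Suc have "(x, y) \<in> A ^^ k O A" by (simp add: le_Suc_eq)
    then obtain z where "(x, z) \<in> A ^^ k" "(z, y) \<in> A" by blast
    with Suc.IH[of z k] show ?thesis by auto
  qed
qed simp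

text \<open>Every reachable pair is joined by a walk of at most \<open>card A\<close> arcs, and
  reflexive steps pad it to exactly k.\<close>

lemma rtrancl_eq_relpow_reflcl:
  assumes "finite A" "card A \<le> k"
  shows "A\<^sup>* = (A\<^sup>=) ^^ k"
proof
  show "A\<^sup>* \<subseteq> (A\<^sup>=) ^^ k"
    using assms relpow_reflcl_mono[where A = A and k = k] by (force simp: rtrancl_finite_eq_relpow)
  show "(A\<^sup>=) ^^ k \<subseteq> A\<^sup>*"
  proof (rule subrelI)
    fix x y assume "(x, y) \<in> (A\<^sup>=) ^^ k"
    from relpow_imp_rtrancl[OF this] show "(x, y) \<in> A\<^sup>*" by simp
  qed
qed

lemma mm_cost_ge: "(Suc n)\<^sup>2 * (16 * step_cost M) \<le> mm_cost n M T"
  by (simp add: mm_cost_def)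

lemma mm_cost_bounds:
  "(Suc n)\<^sup>2 * (5 * step_cost M) \<le> mm_cost n M T" "(Suc n)\<^sup>2 * (6 * step_cost M) \<le>
      mm_cost n M T"
  "Suc n * (3 * step_cost M) \<le> mm_cost n M T" "16 * step_cost M \<le> mm_cost n M T"
proof -
  have 1: "16 * step_cost M \<le> (Suc n)\<^sup>2 * (16 * step_cost M)" by simp
  have "Suc n * 1 \<le> Suc n * Suc n" by (intro mult_left_mono) auto
  then have 2: "Suc n \<le> (Suc n)\<^sup>2" by (simp only: power2_eq_square mult_1_right)
  show "16 * step_cost M \<le> mm_cost n M T" using 1 mm_cost_ge[of n M T] by linarith
  have "Suc n * (3 * step_cost M) \<le> (Suc n)\<^sup>2 * (16 * step_cost M)" using 2 by (intro mult_mono) auto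
  then show "Suc n * (3 * step_cost M) \<le> mm_cost n M T" using mm_cost_ge[of n M T] by linarith
  show "(Suc n)\<^sup>2 * (5 * step_cost M) \<le> mm_cost n M T" "(Suc n)\<^sup>2 * (6 * step_cost M) \<le>
      mm_cost n M T"
    using mm_cost_ge[of n M T] by linarith+
qed

lemma le_cube: "int n ^ 3 \<le> M \<Longrightarrow> int n \<le> M"
proof -
  have "int n \<le> int n ^ 3" by (cases "n = 0") (auto intro: self_le_power)
  then show "int n ^ 3 \<le> M \<Longrightarrow> int n \<le> M" by linarith
qed

text \<open>x + y - x y is the disjunction of bits, so the first matrix is the reflexive adjacency
  matrix. It is squared 2 L times, as the exponent has to reach the number of arcs, which is at most
  n^2 \<le> 2^(2 L).\<close>

definition Closure :: "prog \<Rightarrow> prog" where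
  "Closure mp = Seq (SetVar 4 (Mul (Const 2) (Var 3)))
     (Seq (Fill 5 (Sub (Add (Cell 7) (Eq (Var 90) (Var 91))) (Mul (Cell 7) (Eq (Var 90) (Var 91)))))
     (For 93 4 (Seq (Matmul mp 5 5 6) (Fill 5 (Pos (Cell 6))))))"


lemma runs_Closure:
  assumes mp: "multiplies n mp T" and n: "s 0 0 = int n" "int n ^ 3 \<le> M"
    and A: "A \<subseteq> {..<n} \<times> {..<n}" "mat n (s 7) (\<lambda>i j. of_bool ((i, j) \<in> A))"
    and L: "s 3 0 = int L" "2 * int L \<le> M" "n < 2 ^ L"
  shows "runs (Closure mp) s ((8 * L + 8) * mm_cost n M T) (\<lambda>s'. mat n (s' 5) (\<lambda>i j.
      of_bool ((i, j) \<in> A\<^sup>*)))"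
proof -
  let ?C = "mm_cost n M T" and ?B = "\<lambda>t. (A\<^sup>=) ^^ (2 ^ t)"
  note nM = le_cube[OF n(2)]
  have fin: "finite A" using A(1) finite_subset by blast
  have "card A \<le> card ({..<n} \<times> {..<n})" using A(1) by (intro card_mono) auto
  also have "\<dots> = n * n" by simp
  also have "\<dots> \<le> 2 ^ L * 2 ^ L" using L(3) by (intro mult_mono) auto
  also have "\<dots> = 2 ^ (2 * L)" by (simp add: power_add mult_2)
  finally have final: "A\<^sup>* = ?B (2 * L)" using fin by (intro rtrancl_eq_relpow_reflcl)
  have An: "k < n" if "(i, k) \<in> ?B t" "i < n" for i k t
  proof -
    have "(i, k) \<in> (A\<^sup>=)\<^sup>*" using that(1) by (rule relpow_imp_rtrancl)
    then have "(i, k) \<in> A\<^sup>*" by simp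
    then show ?thesis using that(2) A(1) by (induction rule: rtrancl_induct) auto
  qed
  have sq: "0 < (\<Sum>k<n. of_bool ((i, k) \<in> ?B t) * (of_bool ((k, j) \<in> ?B t) :: int))
      \<longleftrightarrow> (i, j) \<in> ?B (Suc t)"
    (is "0 < ?S \<longleftrightarrow> _") if "i < n" for i j t
  proof -
    have "0 < ?S \<longleftrightarrow> (\<exists>k<n. (i, k) \<in> ?B t \<and> (k, j) \<in> ?B t)"
    proof
      assume "0 < ?S"
      then obtain k where "k < n" "of_bool ((i, k) \<in> ?B t) * (of_bool ((k, j) \<in> ?B t) :: int)
          \<noteq> 0"
        by (metis (no_types, lifting) lessThan_iff less_irrefl sum.neutral)
      then show "\<exists>k<n. (i, k) \<in> ?B t \<and> (k, j) \<in> ?B t" by (auto split: if_splits)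
    next
      assume "\<exists>k<n. (i, k) \<in> ?B t \<and> (k, j) \<in> ?B t"
      then obtain k where "k < n" "(i, k) \<in> ?B t" "(k, j) \<in> ?B t" by blast
      then show "0 < ?S" by (intro sum_pos2[of _ k]) auto
    qed
    also have "\<dots> \<longleftrightarrow> (i, j) \<in> ?B t O ?B t" using An that by blast
    also have "?B t O ?B t = ?B (Suc t)" by (simp add: relpow_add[symmetric] mult_2)
    finally show ?thesis .
  qed
  show ?thesis unfolding Closure_def
  proof (rule runs_Seq)
    show "runs (SetVar 4 (Mul (Const 2) (Var 3))) s (step_cost M) (\<lambda>s1. s1 4 0 = int (2 * L))"
      using L by (intro runs_Assign) auto
    have u: "2 * step_cost M \<le> ?C" using mm_cost_bounds(4)[of M n T] by linarith
    have "step_cost M + (?C + Suc (2 * L) * ((?C + ?C) + 2 * step_cost M)) \<le> ?C + (?C + Suc (2 * L) *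
        ((?C + ?C) + ?C))"
      using u by (intro add_mono mult_left_mono) auto
    also have "\<dots> \<le> (8 * L + 8) * ?C" by (simp add: algebra_simps)
    finally show "step_cost M + (?C + Suc (2 * L) * ((?C + ?C) + 2 * step_cost M)) \<le> (8 * L + 8) * ?C" .
    fix s1 assume s1: "s1 4 0 = int (2 * L)" "\<And>a. a \<notin> written (SetVar 4 (Mul (Const 2) (Var
        3))) \<Longrightarrow> s1 a = s a"
    let ?e = "Sub (Add (Cell 7) (Eq (Var 90) (Var 91))) (Mul (Cell 7) (Eq (Var 90) (Var 91)))"
    let ?body = "Seq (Matmul mp 5 5 6) (Fill 5 (Pos (Cell 6)))"
    show "runs (Seq (Fill 5 ?e) (For 93 4 ?body)) s1 (?C + Suc (2 * L) * ((?C + ?C) + 2 * step_cost M))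
       (\<lambda>s'. mat n (s' 5) (\<lambda>i j. of_bool ((i, j) \<in> A\<^sup>*)))"
    proof (rule runs_Seq[OF _ _ order_refl])
      have "runs (Fill 5 ?e) s1 ((Suc n)\<^sup>2 * (5 * step_cost M)) (\<lambda>s2. mat n (s2 5)
          (\<lambda>i j. of_bool ((i, j) \<in> ?B 0)))"
        by (rule runs_Fill) (use s1 n nM in \<open>auto simp: matD[OF A(2)]\<close>)
      then show "runs (Fill 5 ?e) s1 ?C (\<lambda>s2. mat n (s2 5) (\<lambda>i j. of_bool ((i, j) \<in> ?B 0)))"
        by (rule runs_weaken) (use mm_cost_bounds in auto)
      fix s2 assume s2: "mat n (s2 5) (\<lambda>i j. of_bool ((i, j) \<in> ?B 0))" "\<And>a. a \<notin>
          written (Fill 5 ?e) \<Longrightarrow> s2 a = s1 a"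
      have "runs (For 93 4 ?body) s2 (Suc (2 * L) * ((?C + ?C) + 2 * step_cost M))
         (\<lambda>s'. mat n (s' 5) (\<lambda>i j. of_bool ((i, j) \<in> ?B (2 * L))))"
      proof (rule runs_For[where Inv = "\<lambda>t s'. mat n (s' 5) (\<lambda>i j. of_bool ((i, j) \<in> ?B
          t))"])
        fix t s3 assume t: "mat n (s3 5) (\<lambda>i j. of_bool ((i, j) \<in> ?B t))"
          and f3: "\<And>c. c \<noteq> 93 \<Longrightarrow> c \<notin> written ?body \<Longrightarrow> s3 c
              = s2 c"
        have n3: "s3 0 0 = int n" using f3[of 0] s2(2)[of 0] s1(2)[of 0] n by simp
        show "runs ?body s3 (?C + ?C) (\<lambda>s'. mat n (s' 5) (\<lambda>i j. of_bool ((i, j) \<in> ?B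
            (Suc t))))"
        proof (rule runs_Seq[OF _ _ order_refl])
          show "runs (Matmul mp 5 5 6) s3 ?C (\<lambda>s4. mat n (s4 6)
              (\<lambda>i j. \<Sum>k<n. of_bool ((i, k) \<in> ?B t) * of_bool ((k, j) \<in> ?B t)))"
            by (rule runs_Matmul[OF mp n3 n(2) t _ t]) auto
          fix s4 assume s4: "mat n (s4 6) (\<lambda>i j. \<Sum>k<n. of_bool ((i, k) \<in> ?B t) * of_bool
              ((k, j) \<in> ?B t))"
            "\<And>a. a \<notin> written (Matmul mp 5 5 6) \<Longrightarrow> s4 a = s3 a"
          have n4: "s4 0 0 = int n" using s4(2)[of 0] n3 by simp
          have b: "(\<Sum>k<n. of_bool ((i, k) \<in> ?B t) * of_bool ((k, j) \<in> ?B t)) \<le> M" for i j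
          proof -
            have "(\<Sum>k<n. of_bool ((i, k) \<in> ?B t) * of_bool ((k, j) \<in> ?B t)) \<le> (\<Sum>k<n.
                1::int)"
              by (intro sum_mono) auto
            then show ?thesis using nM by simp
          qed
          have "runs (Fill 5 (Pos (Cell 6))) s4 ((Suc n)\<^sup>2 * (5 * step_cost M))
             (\<lambda>s'. mat n (s' 5) (\<lambda>i j. of_bool ((i, j) \<in> ?B (Suc t))))"
          proof (rule runs_Fill[where s = s4, OF n4 nM])
            fix i j s' assume ij: "i < n" "j < n" "s' 90 0 = int i" "s' 91 0 = int j"
              and f: "\<And>c. c \<noteq> 90 \<Longrightarrow> c \<noteq> 91 \<Longrightarrow> c \<noteq> 5
                  \<Longrightarrow> s' c = s4 c"
            have v: "val s' (Cell 6) = (\<Sum>k<n. of_bool ((i, k) \<in> ?B t) * of_bool ((k, j) \<in> ?B t))"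
              using matD[OF s4(1) ij(1,2)] ij f n4 by simp
            have "0 \<le> val s' (Cell 6)" unfolding v by (intro sum_nonneg) auto
            moreover have "reads_le M s' (Cell 6)" using v ij f n4 nM b calculation by auto
            ultimately show "reads_le M s' (Pos (Cell 6)) \<and> val s' (Pos (Cell 6)) = of_bool ((i, j)
                \<in> ?B (Suc t))"
              using sq[OF ij(1), of t j] unfolding v[symmetric] by (simp only: val_Pos reads_le_Pos simp_thms)
          qed auto
          then show "runs (Fill 5 (Pos (Cell 6))) s4 ?C (\<lambda>s'. mat n (s' 5) (\<lambda>i j. of_bool
              ((i, j) \<in> ?B (Suc t))))"
            by (rule runs_weaken) (use mm_cost_bounds in auto)
        qed
      qed (use s1 s2 L in auto)
      then show "runs (For 93 4 ?body) s2 (Suc (2 * L) * ((?C + ?C) + 2 * step_cost M))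
         (\<lambda>s'. mat n (s' 5) (\<lambda>i j. of_bool ((i, j) \<in> A\<^sup>*)))" unfolding final .
    qed
  qed
qed

section \<open>Representatives, entry arcs and search\<close>

abbreviation At :: "nat \<Rightarrow> expr \<Rightarrow> expr \<Rightarrow> expr" where
  "At a e f \<equiv> Entry a (Add (Mul e (Var 0)) f)"

text \<open>The maximum is what remains after an ascending scan that overwrites its result.\<close>

definition rep_of :: "nat \<Rightarrow> (nat \<times> nat) set \<Rightarrow> nat \<Rightarrow> nat" where
  "rep_of n A v = Max {u. u < n \<and> mutual A u v}"

lemma rep_of_eqI:
  assumes "w < n" "mutual A w v" "\<And>u. u < n \<Longrightarrow> mutual A u v \<Longrightarrow> u \<le> w"
  shows "rep_of n A v = w"
  unfolding rep_of_def by (rule Max_eqI) (use assms in auto)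

lemma rep_of_mutual: "v < n \<Longrightarrow> rep_of n A v < n \<and> mutual A (rep_of n A v) v"
  using Max_in[of "{u. u < n \<and> mutual A u v}"] unfolding rep_of_def by fastforce

lemma rep_of_eq: "mutual A u v \<Longrightarrow> rep_of n A u = rep_of n A v"
  unfolding rep_of_def by (metis mutual_sym mutual_trans)

definition Rep :: prog where
  "Rep = For 94 0 (Seq (SetVar 8 (Var 94)) (Seq
     (For 95 0 (If (Mul (At 5 (Var 95) (Var 94)) (At 5 (Var 94) (Var 95))) (SetVar 8 (Var 95)) Skip))
     (Assign 10 (Var 94) (Var 8))))"

lemma written_Rep [simp]: "written Rep = {8, 10, 94, 95, 99}" by (auto simp: Rep_def)

lemma runs_Rep:
  assumes n: "s 0 0 = int n" "int n \<le> M" and R: "mat n (s 5) (\<lambda>i j. of_bool ((i, j) \<in>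
      A\<^sup>*))"
  shows "runs Rep s ((Suc n)\<^sup>2 * (8 * step_cost M)) (\<lambda>s'. vec n (s' 10) (\<lambda>v. int
      (rep_of n A v)))"
proof -
  let ?u = "step_cost M"
  let ?If = "If (Mul (At 5 (Var 95) (Var 94)) (At 5 (Var 94) (Var 95))) (SetVar 8 (Var 95)) Skip"
  have "runs Rep s (Suc n * ((?u + (Suc n * ((?u + ?u) + 2 * ?u) + ?u)) + 2 * ?u)) (\<lambda>s'. vec n (s'
      10) (\<lambda>v. int (rep_of n A v)))"
    unfolding Rep_def
  proof (rule runs_fill_vec_body[where s = s, OF n])
    fix v s1 assume v: "v < n" "s1 94 0 = int v"
      and f1: "\<And>c. c \<noteq> 94 \<Longrightarrow> c \<notin> written (Seq (SetVar 8 (Var 94)) (Seq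
          (For 95 0 ?If) (Assign 10 (Var 94) (Var 8)))) \<Longrightarrow> s1 c = s c"
    show "runs (Seq (SetVar 8 (Var 94)) (Seq (For 95 0 ?If) (Assign 10 (Var 94) (Var 8)))) s1
      (?u + (Suc n * ((?u + ?u) + 2 * ?u) + ?u)) (\<lambda>s2. s2 10 = (s1 10)(int v := int (rep_of n A v)))"
    proof (rule runs_Seq[OF _ _ order_refl])
      show "runs (SetVar 8 (Var 94)) s1 ?u (\<lambda>s2. s2 8 0 = int v)"
        using v n by (intro runs_Assign) auto
      fix s2 assume s2: "s2 8 0 = int v" "\<And>a. a \<notin> written (SetVar 8 (Var 94)) \<Longrightarrow>
          s2 a = s1 a"
      show "runs (Seq (For 95 0 ?If) (Assign 10 (Var 94) (Var 8))) s2
        (Suc n * ((?u + ?u) + 2 * ?u) + ?u) (\<lambda>s3. s3 10 = (s1 10)(int v := int (rep_of n A v)))"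
      proof (rule runs_Seq[OF _ _ order_refl])
        have n2: "s2 0 0 = int n" using s2(2)[of 0] f1[of 0] n by simp
        have "runs (For 95 0 ?If) s2 (Suc n * ((?u + ?u) + 2 * ?u))
           (\<lambda>s3. \<exists>w. s3 8 0 = int w \<and> w < n \<and> mutual A w v \<and> (\<forall>u<n.
               mutual A u v \<longrightarrow> u \<le> w))"
        proof (rule runs_For[where s = s2 and Inv = "\<lambda>i s3. \<exists>w. s3 8 0 = int w \<and> w < n
            \<and> mutual A w v \<and> (\<forall>u<i. mutual A u v \<longrightarrow> u \<le> w)", OF n2 n(2)])
          fix i s3
          assume i: "i < n" "s3 95 0 = int i"
            and ex: "\<exists>w. s3 8 0 = int w \<and> w < n \<and> mutual A w v \<and> (\<forall>u<i.
                mutual A u v \<longrightarrow> u \<le> w)"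
            and f3: "\<And>c. c \<noteq> 95 \<Longrightarrow> c \<notin> written ?If \<Longrightarrow> s3 c
                = s2 c"
          obtain w where w: "s3 8 0 = int w" "w < n" "mutual A w v" "\<And>u. u < i \<Longrightarrow>
              mutual A u v \<Longrightarrow> u \<le> w"
            using ex by blast
          have 5: "s3 5 = s 5" "s3 0 0 = int n" "s3 94 0 = int v"
            using f3[of 5] s2(2)[of 5] f1[of 5] f3[of 0] n2 f3[of 94] s2(2)[of 94] v by simp_all
          have m: "s3 5 (cell n i v) = of_bool ((i, v) \<in> A\<^sup>*)" "s3 5 (cell n v i) = of_bool ((v,
              i) \<in> A\<^sup>*)"
            using matD[OF R] i v 5 by simp_all
          show "runs ?If s3 (?u + ?u) (\<lambda>s4. \<exists>w. s4 8 0 = int w \<and> w < n \<and> mutual A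
              w v \<and> (\<forall>u<Suc i. mutual A u v \<longrightarrow> u \<le> w))"
          proof (rule runs_If)
            show "reads_le M s3 (Mul (At 5 (Var 95) (Var 94)) (At 5 (Var 94) (Var 95)))"
              using m i v n(2) 5 by simp
            show "runs (SetVar 8 (Var 95)) s3 ?u (\<lambda>s4. \<exists>w. s4 8 0 = int w \<and> w < n
                \<and> mutual A w v \<and> (\<forall>u<Suc i. mutual A u v \<longrightarrow> u \<le> w))"
              if "0 < val s3 (Mul (At 5 (Var 95) (Var 94)) (At 5 (Var 94) (Var 95)))"
            proof -
              have "mutual A i v" using that m i v 5 unfolding mutual_def by (simp split: if_splits)
              then show ?thesis using i n(2) by (intro runs_Assign) (auto intro!: exI[of _ i])
            qed
            show "runs Skip s3 ?u (\<lambda>s4. \<exists>w. s4 8 0 = int w \<and> w < n \<and> mutual A w v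
                \<and> (\<forall>u<Suc i. mutual A u v \<longrightarrow> u \<le> w))"
              if "val s3 (Mul (At 5 (Var 95) (Var 94)) (At 5 (Var 94) (Var 95))) \<le> 0"
            proof -
              have "\<not> mutual A i v" using that m i v 5 unfolding mutual_def by (auto split: if_splits)
              then show ?thesis using w by (intro runs_Skip exI[of _ w]) (auto simp: less_Suc_eq)
            qed
          qed simp
        next
          show "\<exists>w. s2 8 0 = int w \<and> w < n \<and> mutual A w v \<and> (\<forall>u<0. mutual A
              u v \<longrightarrow> u \<le> w)"
            using s2(1) v by (intro exI[of _ v]) simp
        qed auto
        then show "runs (For 95 0 ?If) s2 (Suc n * ((?u + ?u) + 2 * ?u)) (\<lambda>s3. s3 8 0 = int (rep_of
            n A v))"
          by (rule runs_weaken) (use rep_of_eqI in blast)+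
        fix s3 assume s3: "s3 8 0 = int (rep_of n A v)" "\<And>a. a \<notin> written (For 95 0 ?If)
            \<Longrightarrow> s3 a = s2 a"
        have "s3 94 0 = int v" "s3 10 = s1 10" using s3(2)[of 94] s3(2)[of 10] s2(2)[of 94] s2(2)[of 10] v
            by simp_all
        then show "runs (Assign 10 (Var 94) (Var 8)) s3 ?u (\<lambda>s4. s4 10 = (s1 10)(int v := int
            (rep_of n A v)))"
          using s3(1) v n(2) rep_of_mutual[OF v(1), of A] by (intro runs_Assign) auto
      qed
    qed
  qed auto
  then show ?thesis
    by (rule runs_weaken) (auto simp: power2_eq_square algebra_simps)
qed

text \<open>Rows are tails, columns are representatives of the entered components. Later arcs
  overwrite earlier ones, as any head will do. Heads are stored plus one, so 0 means that there is
  no arc.\<close>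

definition Entries :: prog where
  "Entries = Seq (Fill 11 (Const 0))
     (For2 (If (Mul (Cell 7) (Sub (Const 1) (Eq (Entry 10 (Var 90)) (Entry 10 (Var 91)))))
        (Assign 11 (Add (Mul (Var 90) (Var 0)) (Entry 10 (Var 91))) (Add (Var 91) (Const 1))) Skip))"

lemma written_Entries [simp]: "written Entries = {11, 90, 91, 99}" by (auto simp: Entries_def)

lemma runs_Entries:
  assumes n: "s 0 0 = int n" "int n \<le> M"
    and A: "A \<subseteq> {..<n} \<times> {..<n}" "mat n (s 7) (\<lambda>i j. of_bool ((i, j) \<in> A))"
    and rep: "vec n (s 10) (\<lambda>v. int (rep v))" "\<And>v. v < n \<Longrightarrow> rep v < n"
  shows "runs Entries s ((Suc n)\<^sup>2 * (11 * step_cost M)) (\<lambda>s'.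
     (\<forall>u<n. \<forall>r<n. s' 11 (cell n u r) \<noteq> 0 \<longrightarrow>
        (\<exists>e<n. s' 11 (cell n u r) = int e + 1 \<and> (u, e) \<in> A \<and> rep e = r \<and> rep u
            \<noteq> r)) \<and>
     (\<forall>u v. (u, v) \<in> A \<longrightarrow> rep u \<noteq> rep v \<longrightarrow> s' 11 (cell n u
         (rep v)) > 0))"
proof -
  let ?u = "step_cost M"
  let ?b = "Mul (Cell 7) (Sub (Const 1) (Eq (Entry 10 (Var 90)) (Entry 10 (Var 91))))"
  let ?as = "Assign 11 (Add (Mul (Var 90) (Var 0)) (Entry 10 (Var 91))) (Add (Var 91) (Const 1))"
  let ?If = "If ?b ?as Skip"
  define Inv where "Inv D s' \<longleftrightarrow>
     (\<forall>u<n. \<forall>r<n. s' 11 (cell n u r) \<noteq> 0 \<longrightarrow>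
        (\<exists>e<n. s' 11 (cell n u r) = int e + 1 \<and> (u, e) \<in> A \<and> rep e = r \<and> rep u
            \<noteq> r)) \<and>
     (\<forall>u v. (u, v) \<in> D \<longrightarrow> (u, v) \<in> A \<longrightarrow> rep u \<noteq> rep v
         \<longrightarrow> s' 11 (cell n u (rep v)) > 0)"
    for D and s' :: store
  have "runs Entries s ((Suc n)\<^sup>2 * (5 * ?u) + (Suc n)\<^sup>2 * ((?u + ?u) + 4 * ?u)) (Inv ({..<n}
      \<times> {..<n}))"
    unfolding Entries_def
  proof (rule runs_Seq[OF _ _ order_refl])
    show "runs (Fill 11 (Const 0)) s ((Suc n)\<^sup>2 * (5 * ?u)) (\<lambda>s1. mat n (s1 11) (\<lambda>i
        j. 0))"
      by (rule runs_Fill) (use n in auto)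
    fix s1 assume s1: "mat n (s1 11) (\<lambda>i j. 0)" "\<And>a. a \<notin> written (Fill 11 (Const 0))
        \<Longrightarrow> s1 a = s a"
    have n1: "s1 0 0 = int n" using s1(2)[of 0] n by simp
    show "runs (For2 ?If) s1 ((Suc n)\<^sup>2 * ((?u + ?u) + 4 * ?u)) (Inv ({..<n} \<times> {..<n}))"
    proof (rule runs_For2[where s = s1, OF n1 n(2)])
      fix D i j s2
      assume ij: "i < n" "j < n" "s2 90 0 = int i" "s2 91 0 = int j" and I: "Inv D s2"
        and f2: "\<And>c. c \<noteq> 90 \<Longrightarrow> c \<noteq> 91 \<Longrightarrow> c \<notin>
            written ?If \<Longrightarrow> s2 c = s1 c"
      have st: "s2 0 0 = int n" "s2 7 = s 7" "s2 10 = s 10"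
        using f2[of 0] f2[of 7] f2[of 10] s1(2)[of 7] s1(2)[of 10] n1 by simp_all
      have v: "s2 7 (cell n i j) = of_bool ((i, j) \<in> A)" "s2 10 (int i) = int (rep i)" "s2 10 (int j) =
          int (rep j)"
        using matD[OF A(2)] vecD[OF rep(1)] ij st by simp_all
      have r: "rep i < n" "rep j < n" using rep(2) ij by auto
      show "runs ?If s2 (?u + ?u) (Inv (insert (i, j) D))"
      proof (rule runs_If)
        show "reads_le M s2 ?b" using v ij n(2) r st by simp
        show "runs ?as s2 ?u (Inv (insert (i, j) D))" if "0 < val s2 ?b"
        proof -
          have 1: "(i, j) \<in> A" "rep i \<noteq> rep j" using that v ij st by (simp_all split: if_splits)
          show ?thesis
          proof (rule runs_Assign)
            have "Inv (insert (i, j) D) (s2(11 := (s2 11)(cell n i (rep j) := int j + 1)))"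
              unfolding Inv_def
            proof (intro conjI allI impI)
              fix u r' assume ur: "u < n" "r' < n"
                and ne: "(s2(11 := (s2 11)(cell n i (rep j) := int j + 1))) 11 (cell n u r') \<noteq> 0"
              show "\<exists>e<n. (s2(11 := (s2 11)(cell n i (rep j) := int j + 1))) 11 (cell n u r') = int
                  e + 1 \<and> (u, e) \<in> A \<and> rep e = r' \<and> rep u \<noteq> r'"
              proof (cases "u = i \<and> r' = rep j")
                case True with 1 ij show ?thesis by auto
              next
                case False
                then have "cell n u r' \<noteq> cell n i (rep j)" using cell_eq_iff[OF ur(2) r(2)] by blast
                then show ?thesis using I ur ne unfolding Inv_def by simp
              qed
            next
              fix u w assume uw: "(u, w) \<in> insert (i, j) D" "(u, w) \<in> A" "rep u \<noteq> rep w"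
              show "0 < (s2(11 := (s2 11)(cell n i (rep j) := int j + 1))) 11 (cell n u (rep w))"
              \<comment> \<open>Several arcs share a cell, so the split is on the cell rather than
                on the arc; a cell just written is positive in any case.\<close>
              proof (cases "cell n u (rep w) = cell n i (rep j)")
                case False
                with uw have "(u, w) \<in> D" by auto
                with False uw I show ?thesis unfolding Inv_def by simp
              qed simp
            qed
            then show "Inv (insert (i, j) D) (s2(11 := (s2 11)(val s2 (Add (Mul (Var 90) (Var 0)) (Entry 10
                (Var 91))) := val s2 (Add (Var 91) (Const 1)))))"
              using ij v st by simp
          qed (use ij v st n(2) r in auto)
        qed
        show "runs Skip s2 ?u (Inv (insert (i, j) D))" if "val s2 ?b \<le> 0"
        proof -
          have "(i, j) \<notin> A \<or> rep i = rep j" using that v ij st by (auto split: if_splits)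
          then show ?thesis using I by (intro runs_Skip) (auto simp: Inv_def)
        qed
      qed simp
    qed (use s1(1) in \<open>auto simp: Inv_def mat_def\<close>)
  qed
  then show ?thesis
  proof (rule runs_weaken)
    fix s' assume I: "Inv ({..<n} \<times> {..<n}) s'"
    show "(\<forall>u<n. \<forall>r<n. s' 11 (cell n u r) \<noteq> 0 \<longrightarrow>
        (\<exists>e<n. s' 11 (cell n u r) = int e + 1 \<and> (u, e) \<in> A \<and> rep e = r \<and> rep u
            \<noteq> r)) \<and>
     (\<forall>u v. (u, v) \<in> A \<longrightarrow> rep u \<noteq> rep v \<longrightarrow> s' 11 (cell n u
         (rep v)) > 0)"
      using I A(1) unfolding Inv_def by blast
  qed (simp add: algebra_simps)
qed

section \<open>Graph search from all representatives\<close>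

definition spanning_forest :: "(nat \<times> nat) set \<Rightarrow> nat set \<Rightarrow> nat set
    \<Rightarrow> (nat \<Rightarrow> nat) \<Rightarrow> bool" where
  "spanning_forest E X D par \<longleftrightarrow> X \<subseteq> D \<and> (\<forall>v\<in>D - X. (par v, v)
      \<in> E) \<and>
     (\<forall>v\<in>D. \<exists>r\<in>X. (r, v) \<in> {(par w, w) | w. w \<in> D - X}\<^sup>*)"

lemma spanning_forest_insert:
  assumes "spanning_forest E X D par" "u \<in> D" "v \<notin> D" "(u, v) \<in> E"
  shows "spanning_forest E X (insert v D) (par(v := u))"
proof -
  let ?T = "{(par w, w) | w. w \<in> D - X}" and ?T' = "{((par(v := u)) w, w) | w. w \<in> insert v D - X}"
  have "?T \<subseteq> ?T'" using assms(3) by auto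
  then have mono: "?T\<^sup>* \<subseteq> ?T'\<^sup>*" by (rule rtrancl_mono)
  have "(u, v) \<in> ?T'" using assms(1,3) by (auto simp: spanning_forest_def)
  moreover obtain r where "r \<in> X" "(r, u) \<in> ?T\<^sup>*" using assms(1,2) by (auto simp:
      spanning_forest_def)
  ultimately have "\<exists>r\<in>X. (r, v) \<in> ?T'\<^sup>*" using mono by (meson rtrancl_into_rtrancl
      subsetD)
  moreover have "\<exists>r\<in>X. (r, w) \<in> ?T'\<^sup>*" if "w \<in> D" for w
    using that assms(1) mono unfolding spanning_forest_def by blast
  ultimately show ?thesis using assms unfolding spanning_forest_def by auto
qed

text \<open>All representatives are roots at the same time. Array 40 marks discovered and 41 scanned
  vertices, 42 holds the vertex to be scanned plus one, 45 the parents. Each of the n rounds scans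
  one row of the adjacency matrix, which makes the search quadratic.\<close>

definition Search :: prog where
  "Search = Seq (Fill_vec 0 40 (Eq (Entry 10 (Var 92)) (Var 92))) (Seq (Fill_vec 0 41 (Const 0))
     (Seq (Fill_vec 0 45 (Const 0))
     (For 94 0 (Seq (SetVar 42 (Const 0)) (Seq
        (For 95 0 (If (Mul (Entry 40 (Var 95)) (Sub (Const 1) (Entry 41 (Var 95)))) (SetVar 42 (Add (Var
            95) (Const 1))) Skip))
        (If (Var 42) (Seq (Assign 41 (Sub (Var 42) (Const 1)) (Const 1))
            (For 96 0 (If (Mul (At 43 (Sub (Var 42) (Const 1)) (Var 96)) (Sub (Const 1) (Entry 40 (Var 96))))
               (Seq (Assign 40 (Var 96) (Const 1)) (Assign 45 (Var 96) (Sub (Var 42) (Const 1)))) Skip)))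
                   Skip))))))"

lemma written_Search [simp]: "written Search = {40, 41, 42, 45, 92, 94, 95, 96, 99}" by (auto simp: Search_def)

lemma runs_Search:
  assumes n: "s 0 0 = int n" "int n < M"
    and E: "E \<subseteq> {..<n} \<times> {..<n}" "mat n (s 43) (\<lambda>i j. of_bool ((i, j) \<in> E))"
    and rep: "vec n (s 10) (\<lambda>v. int (rep v))" "\<And>v. v < n \<Longrightarrow> rep v < n"
    and X: "X = {v. v < n \<and> rep v = v}" and reach: "\<And>v. v < n \<Longrightarrow> \<exists>r\<in>X.
        (r, v) \<in> E\<^sup>*"
  shows "runs Search s ((Suc n)\<^sup>2 * (25 * step_cost M)) (\<lambda>s'. \<exists>par. vec n (s' 45)
      (\<lambda>v. int (par v)) \<and>
     (\<forall>v<n. par v < n) \<and> spanning_forest E X {..<n} par)"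
proof -
  let ?u = "step_cost M"
  have nM: "int n \<le> M" using n by simp
  have repM: "int (rep v) \<le> M" if "v < n" for v using rep(2)[OF that] n(2) by linarith
  define I where "I D F par s' \<longleftrightarrow> vec n (s' 40) (\<lambda>v. of_bool (v \<in> D)) \<and>
      vec n (s' 41) (\<lambda>v. of_bool (v \<in> F)) \<and>
     vec n (s' 45) (\<lambda>v. int (par v)) \<and> (\<forall>v<n. par v < n) \<and> D \<subseteq> {..<n}
         \<and> spanning_forest E X D par \<and> F \<subseteq> {..<n}"
    for D F :: "nat set" and par and s' :: store
  \<comment> \<open>Every round scans a new vertex unless all discovered ones have been scanned;
    after n rounds both alternatives give F = D.\<close>
  define J where "J i s' \<longleftrightarrow> (\<exists>D F par. I D F par s' \<and> F \<subseteq> D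
      \<and> (i \<le> card F \<or> F = D) \<and>
     (\<forall>u\<in>F. \<forall>v. (u, v) \<in> E \<longrightarrow> v \<in> D))" for i s'
  let ?find = "If (Mul (Entry 40 (Var 95)) (Sub (Const 1) (Entry 41 (Var 95)))) (SetVar 42 (Add (Var 95)
      (Const 1))) Skip"
  let ?vis = "If (Mul (At 43 (Sub (Var 42) (Const 1)) (Var 96)) (Sub (Const 1) (Entry 40 (Var 96))))
               (Seq (Assign 40 (Var 96) (Const 1)) (Assign 45 (Var 96) (Sub (Var 42) (Const 1)))) Skip"
  let ?scan = "If (Var 42) (Seq (Assign 41 (Sub (Var 42) (Const 1)) (Const 1)) (For 96 0 ?vis)) Skip"
  let ?body = "Seq (SetVar 42 (Const 0)) (Seq (For 95 0 ?find) ?scan)"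
  let ?Tf = "Suc n * ((?u + ?u) + 2 * ?u)" and ?Ts = "?u + (?u + Suc n * ((?u + (?u + ?u)) + 2 * ?u))"
  have body: "runs ?body s1 (?u + (?Tf + ?Ts)) (J (Suc i))"
    if J: "J i s1" and st: "s1 0 0 = int n" "s1 43 = s 43" for i s1
  proof -
    obtain D F par where IDF: "I D F par s1" "F \<subseteq> D" "i \<le> card F \<or> F = D"
      "\<And>u v. u \<in> F \<Longrightarrow> (u, v) \<in> E \<Longrightarrow> v \<in> D" using J unfolding
          J_def by blast
    show ?thesis
    proof (rule runs_Seq[OF _ _ order_refl])
      show "runs (SetVar 42 (Const 0)) s1 ?u (\<lambda>s2. s2 42 0 = 0)" by (intro runs_Assign) auto
      fix s2 assume s2: "s2 42 0 = 0" "\<And>a. a \<notin> written (SetVar 42 (Const 0)) \<Longrightarrow>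
          s2 a = s1 a"
      have I2: "I D F par s2" using IDF(1) s2(2) by (simp add: I_def)
      have n2: "s2 0 0 = int n" using s2(2)[of 0] st by simp
      show "runs (Seq (For 95 0 ?find) ?scan) s2 (?Tf + ?Ts) (J (Suc i))"
      proof (rule runs_Seq[OF _ _ order_refl])
        \<comment> \<open>Array 42 stays 0 until a discovered but unscanned vertex is met; a later
          one may replace it.\<close>
        let ?K = "\<lambda>j s'. (s' 42 0 = 0 \<and> (\<forall>v<j. v \<notin> D - F)) \<or> (\<exists>v<n.
            s' 42 0 = int v + 1 \<and> v \<in> D - F)"
        show "runs (For 95 0 ?find) s2 ?Tf (?K n)"
        proof (rule runs_For[where s = s2 and Inv = ?K, OF n2 nM])
          fix j s3 assume j: "j < n" "s3 95 0 = int j" and K: "?K j s3"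
            and f3: "\<And>c. c \<noteq> 95 \<Longrightarrow> c \<notin> written ?find \<Longrightarrow> s3
                c = s2 c"
          have v: "s3 40 (int j) = of_bool (j \<in> D)" "s3 41 (int j) = of_bool (j \<in> F)"
            using I2 f3[of 40] f3[of 41] j unfolding I_def vec_def by simp_all
          show "runs ?find s3 (?u + ?u) (?K (Suc j))"
          proof (rule runs_If)
            show "reads_le M s3 (Mul (Entry 40 (Var 95)) (Sub (Const 1) (Entry 41 (Var 95))))"
              using v j n by simp
            show "runs (SetVar 42 (Add (Var 95) (Const 1))) s3 ?u (?K (Suc j))"
              if "0 < val s3 (Mul (Entry 40 (Var 95)) (Sub (Const 1) (Entry 41 (Var 95))))"
            proof -
              have "j \<in> D - F" using that v j by (auto split: if_splits)
              then show ?thesis using j n by (intro runs_Assign) auto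
            qed
            show "runs Skip s3 ?u (?K (Suc j))"
              if "val s3 (Mul (Entry 40 (Var 95)) (Sub (Const 1) (Entry 41 (Var 95)))) \<le> 0"
            proof -
              have "j \<notin> D - F" using that v j by (auto split: if_splits)
              then show ?thesis using K by (intro runs_Skip) (auto simp: less_Suc_eq)
            qed
          qed simp
        qed (use s2(1) in auto)
        fix s3 assume s3: "?K n s3" "\<And>a. a \<notin> written (For 95 0 ?find) \<Longrightarrow> s3 a = s2 a"
        have I3: "I D F par s3" using I2 s3(2) by (simp add: I_def)
        have n3: "s3 0 0 = int n" "s3 43 = s 43" using s3(2)[of 0] s3(2)[of 43] s2(2)[of 43] st n2 by simp_all
        show "runs ?scan s3 ?Ts (J (Suc i))"
        proof (rule runs_If)
          show "reads_le M s3 (Var 42)" using s3(1) n by auto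
          show "runs Skip s3 (?u + Suc n * ((?u + (?u + ?u)) + 2 * ?u)) (J (Suc i))" if "val s3 (Var 42)
              \<le> 0"
          proof -
            have "\<forall>v<n. v \<notin> D - F" using s3(1) that by auto
            moreover have "D \<subseteq> {..<n}" using I3 by (simp add: I_def)
            ultimately have FD: "F = D" using IDF(2) by blast
            have "runs Skip s3 ?u (J (Suc i))"
            proof (rule runs_Skip)
              fix x
              have "I D F par (s3(99 := x))" using I3 by (simp add: I_def)
              then show "J (Suc i) (s3(99 := x))" unfolding J_def using IDF(2,4) FD by blast
            qed
            then show ?thesis by (rule runs_weaken) auto
          qed
          assume pos: "0 < val s3 (Var 42)"
          then obtain u where u: "u < n" "s3 42 0 = int u + 1" "u \<in> D" "u \<notin> F" using s3(1) by auto
          show "runs (Seq (Assign 41 (Sub (Var 42) (Const 1)) (Const 1)) (For 96 0 ?vis)) s3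
             (?u + Suc n * ((?u + (?u + ?u)) + 2 * ?u)) (J (Suc i))"
          proof (rule runs_Seq[OF _ _ order_refl])
            show "runs (Assign 41 (Sub (Var 42) (Const 1)) (Const 1)) s3 ?u (\<lambda>s4. I D (insert u F)
                par s4)"
              using u n I3 by (intro runs_Assign) (auto simp: I_def vec_def)
            fix s4 assume s4: "I D (insert u F) par s4"
              "\<And>a. a \<notin> written (Assign 41 (Sub (Var 42) (Const 1)) (Const 1)) \<Longrightarrow>
                  s4 a = s3 a"
            have n4: "s4 0 0 = int n" "s4 42 0 = int u + 1" "s4 43 = s 43"
              using s4(2)[of 0] s4(2)[of 42] s4(2)[of 43] n3 u by simp_all
            let ?N = "\<lambda>j s'. \<exists>D' par'. I D' (insert u F) par' s' \<and> D \<subseteq> D'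
                \<and> (\<forall>v<j. (u, v) \<in> E \<longrightarrow> v \<in> D')"
            have "runs (For 96 0 ?vis) s4 (Suc n * ((?u + (?u + ?u)) + 2 * ?u)) (?N n)"
            proof (rule runs_For[where s = s4 and Inv = ?N, OF n4(1) nM])
              fix j s5 assume j: "j < n" "s5 96 0 = int j" and N: "?N j s5"
                and f5: "\<And>c. c \<noteq> 96 \<Longrightarrow> c \<notin> written ?vis \<Longrightarrow>
                    s5 c = s4 c"
              obtain D' par' where D': "I D' (insert u F) par' s5" "D \<subseteq> D'" "\<And>v. v < j
                  \<Longrightarrow> (u, v) \<in> E \<Longrightarrow> v \<in> D'"
                using N by blast
              have st5: "s5 0 0 = int n" "s5 42 0 = int u + 1" "s5 43 = s 43"
                using f5[of 0] f5[of 42] f5[of 43] n4 by simp_all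
              have v: "s5 40 (int j) = of_bool (j \<in> D')" "s5 43 (cell n u j) = of_bool ((u, j) \<in> E)"
                using D'(1) j st5 matD[OF E(2)] u unfolding I_def vec_def by simp_all
              let ?b = "Mul (At 43 (Sub (Var 42) (Const 1)) (Var 96)) (Sub (Const 1) (Entry 40 (Var 96)))"
              show "runs ?vis s5 (?u + (?u + ?u)) (?N (Suc j))"
              proof (rule runs_If)
                show "reads_le M s5 ?b" using v j n u st5 by simp
                show "runs Skip s5 (?u + ?u) (?N (Suc j))" if "val s5 ?b \<le> 0"
                proof -
                  have "(u, j) \<in> E \<longrightarrow> j \<in> D'" using that v j st5 by (auto split:
                      if_splits)
                  then have *: "\<forall>v<Suc j. (u, v) \<in> E \<longrightarrow> v \<in> D'" using D'(3)
                      by (auto simp: less_Suc_eq)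
                  have "runs Skip s5 ?u (?N (Suc j))"
                  proof (rule runs_Skip)
                    fix x
                    have "I D' (insert u F) par' (s5(99 := x))" using D'(1) by (simp add: I_def)
                    then show "?N (Suc j) (s5(99 := x))" using D'(2) * by blast
                  qed
                  then show ?thesis by (rule runs_weaken) auto
                qed
                assume "0 < val s5 ?b"
                then have new: "(u, j) \<in> E" "j \<notin> D'" using v j st5 by (auto split: if_splits)
                show "runs (Seq (Assign 40 (Var 96) (Const 1)) (Assign 45 (Var 96) (Sub (Var 42) (Const
                    1)))) s5 (?u + ?u) (?N (Suc j))"
                proof (rule runs_Seq[OF _ _ order_refl])
                  show "runs (Assign 40 (Var 96) (Const 1)) s5 ?u (\<lambda>s6. s6 40 = (s5 40)(int j := 1))"
                    using j n by (intro runs_Assign) auto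
                  fix s6 assume s6: "s6 40 = (s5 40)(int j := 1)" "\<And>a. a \<notin> written (Assign 40
                      (Var 96) (Const 1)) \<Longrightarrow> s6 a = s5 a"
                  have st6: "s6 96 0 = int j" "s6 42 0 = int u + 1" "s6 41 = s5 41" "s6 45 = s5 45"
                    using s6(2)[of 96] s6(2)[of 42] s6(2)[of 41] s6(2)[of 45] j st5 by simp_all
                  have sf: "spanning_forest E X (insert j D') (par'(j := u))"
                    using D' new u by (intro spanning_forest_insert) (auto simp: I_def)
                  show "runs (Assign 45 (Var 96) (Sub (Var 42) (Const 1))) s6 ?u (?N (Suc j))"
                  proof (rule runs_Assign)
                    have "I (insert j D') (insert u F) (par'(j := u)) (s6(45 := (s6 45)(int j := int u)))"
                      using D'(1) sf st6 s6(1) j u unfolding I_def vec_def by auto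
                    moreover have "\<forall>v<Suc j. (u, v) \<in> E \<longrightarrow> v \<in> insert j D'"
                        using D'(3) by (auto simp: less_Suc_eq)
                    ultimately show "?N (Suc j) (s6(45 := (s6 45)(val s6 (Var 96) := val s6 (Sub (Var 42)
                        (Const 1)))))"
                      using D'(2) st6 by (intro exI[of _ "insert j D'"] exI[of _ "par'(j := u)"]) auto
                  qed (use st6 n j u in auto)
                qed
              qed simp
            next
              show "?N 0 s4" using s4(1) by blast
              show "?N i (s(96 := x))" if "?N i s" for i s x
                using that unfolding I_def by auto
            qed auto
            then show "runs (For 96 0 ?vis) s4 (Suc n * ((?u + (?u + ?u)) + 2 * ?u)) (J (Suc i))"
            proof (rule runs_weaken)
              fix s' assume "?N n s'"
              then obtain D' par' where D': "I D' (insert u F) par' s'" "D \<subseteq> D'" "\<And>v. v < n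
                  \<Longrightarrow> (u, v) \<in> E \<Longrightarrow> v \<in> D'" by blast
              have "F \<subseteq> {..<n}" using I3 by (simp add: I_def)
              then have "finite F" using finite_subset by blast
              then have "card (insert u F) = Suc (card F)" using u by simp
              moreover have "F \<noteq> D" using u by blast
              ultimately have "Suc i \<le> card (insert u F)" using IDF(3) by simp
              moreover have "v \<in> D'" if "w \<in> insert u F" "(w, v) \<in> E" for w v
                using that D' IDF(4) E(1) by blast
              moreover have "insert u F \<subseteq> D'" using u D'(2) IDF(2) by blast
              ultimately show "J (Suc i) s'" unfolding J_def using D'(1) by blast
            qed simp
          qed
        qed simp
      qed
    qed
  qed
  have "runs Search s (Suc n * (3 * ?u) + (Suc n * (3 * ?u) + (Suc n * (3 * ?u) + Suc n * ((?u + (?Tf +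
      ?Ts)) + 2 * ?u)))) (J n)"
    unfolding Search_def
  proof (rule runs_Seq[OF _ _ order_refl])
    show "runs (Fill_vec 0 40 (Eq (Entry 10 (Var 92)) (Var 92))) s (Suc n * (3 * ?u)) (\<lambda>s1. vec n
        (s1 40) (\<lambda>v. of_bool (v \<in> X)))"
      by (rule runs_Fill_vec) (use n rep repM vecD[OF rep(1)] in \<open>auto simp: X\<close>)
    fix s1 assume s1: "vec n (s1 40) (\<lambda>v. of_bool (v \<in> X))"
      "\<And>a. a \<notin> written (Fill_vec 0 40 (Eq (Entry 10 (Var 92)) (Var 92))) \<Longrightarrow> s1 a
          = s a"
    show "runs (Seq (Fill_vec 0 41 (Const 0)) (Seq (Fill_vec 0 45 (Const 0)) (For 94 0 ?body))) s1
      (Suc n * (3 * ?u) + (Suc n * (3 * ?u) + Suc n * ((?u + (?Tf + ?Ts)) + 2 * ?u))) (J n)"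
    proof (rule runs_Seq[OF _ _ order_refl])
      show "runs (Fill_vec 0 41 (Const 0)) s1 (Suc n * (3 * ?u)) (\<lambda>s2. vec n (s2 41) (\<lambda>v. 0))"
        by (rule runs_Fill_vec) (use n s1 in auto)
      fix s2 assume s2: "vec n (s2 41) (\<lambda>v. 0)" "\<And>a. a \<notin> written (Fill_vec 0 41 (Const
          0)) \<Longrightarrow> s2 a = s1 a"
      show "runs (Seq (Fill_vec 0 45 (Const 0)) (For 94 0 ?body)) s2
        (Suc n * (3 * ?u) + Suc n * ((?u + (?Tf + ?Ts)) + 2 * ?u)) (J n)"
      proof (rule runs_Seq[OF _ _ order_refl])
        show "runs (Fill_vec 0 45 (Const 0)) s2 (Suc n * (3 * ?u)) (\<lambda>s3. vec n (s3 45) (\<lambda>v. 0))"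
          by (rule runs_Fill_vec) (use n s1 s2 in auto)
        fix s3 assume s3: "vec n (s3 45) (\<lambda>v. 0)" "\<And>a. a \<notin> written (Fill_vec 0 45
            (Const 0)) \<Longrightarrow> s3 a = s2 a"
        have st3: "s3 0 0 = int n" "s3 43 = s 43" using s3(2) s2(2) s1(2) n by simp_all
        show "runs (For 94 0 ?body) s3 (Suc n * ((?u + (?Tf + ?Ts)) + 2 * ?u)) (J n)"
        proof (rule runs_For[where s = s3 and Inv = J, OF st3(1) nM])
          have "I X {} (\<lambda>v. 0) s3"
            using s1(1) s2 s3 unfolding I_def spanning_forest_def by (auto simp: X vec_def)
          then show "J 0 s3" unfolding J_def by (intro exI[of _ X] exI[of _ "{}"] exI[of _ "\<lambda>v.
              0"]) simp
          show "J i (s(94 := x))" if "J i s" for i s x using that unfolding J_def I_def by simp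
          fix i s4 assume "J i s4" "\<And>c. c \<noteq> 94 \<Longrightarrow> c \<notin> written ?body
              \<Longrightarrow> s4 c = s3 c"
          then show "runs ?body s4 (?u + (?Tf + ?Ts)) (J (Suc i))" using st3 by (intro body) auto
        qed auto
      qed
    qed
  qed
  then show ?thesis
  proof (rule runs_weaken)
    show "Suc n * (3 * ?u) + (Suc n * (3 * ?u) + (Suc n * (3 * ?u) + Suc n * ((?u + (?Tf + ?Ts)) + 2 *
        ?u))) \<le> (Suc n)\<^sup>2 * (25 * ?u)"
      by (simp add: power2_eq_square algebra_simps)
    fix s' assume "J n s'"
    then obtain D F par where *: "I D F par s'" "F \<subseteq> D" "n \<le> card F \<or> F = D"
      "\<And>u v. u \<in> F \<Longrightarrow> (u, v) \<in> E \<Longrightarrow> v \<in> D" unfolding J_def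
          by blast
    have F: "F \<subseteq> {..<n}" "D \<subseteq> {..<n}" "X \<subseteq> D" using * by (auto simp: I_def
        spanning_forest_def)
    have FD: "F = D"
    proof (cases "F = D")
      case False
      then have "card {..<n} \<le> card F" using *(3) by simp
      then have "F = {..<n}" using F(1) by (intro card_seteq) auto
      then show ?thesis using *(2) F by blast
    qed simp
    have "v \<in> D" if v: "v < n" for v
    proof -
      obtain r where r: "r \<in> X" "(r, v) \<in> E\<^sup>*" using reach[OF v] by blast
      from r(2) show ?thesis
        by (induction rule: rtrancl_induct) (use r(1) F *(4) FD in auto)
    qed
    then have "D = {..<n}" using F by auto
    then show "\<exists>par. vec n (s' 45) (\<lambda>v. int (par v)) \<and> (\<forall>v<n. par v < n)
        \<and> spanning_forest E X {..<n} par"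
      using *(1) unfolding I_def by blast
  qed
qed

section \<open>Component trees and output\<close>

text \<open>Row e starts as a copy of the out-trees. The walk from e along the in-tree then makes
  each vertex the parent of its successor. The walk always takes n rounds, which exceeds the depth,
  and idles once it has arrived at a representative.\<close>

definition Trees :: prog where
  "Trees = Seq (Fill 47 (Add (Entry 45 (Var 91)) (Const 1)))
     (For 94 0 (Seq (SetVar 48 (Var 94)) (For 95 0
        (If (Sub (Const 1) (Eq (Entry 10 (Var 48)) (Var 48)))
          (Seq (Assign 47 (Add (Mul (Var 94) (Var 0)) (Entry 46 (Var 48))) (Add (Var 48) (Const 1)))
             (SetVar 48 (Entry 46 (Var 48)))) Skip))))"

lemma written_Trees [simp]: "written Trees = {47, 48, 90, 91, 94, 95, 99}" by (auto simp: Trees_def)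

text \<open>j is the number of path arcs entered so far; all remaining cells still show the out-tree
  g.\<close>

definition tree_row :: "nat \<Rightarrow> (nat \<Rightarrow> nat) \<Rightarrow> (nat \<Rightarrow> nat)
    \<Rightarrow> (int \<Rightarrow> int) \<Rightarrow> nat \<Rightarrow> nat \<Rightarrow> bool" where
  "tree_row n f g S e j \<longleftrightarrow> (\<forall>i<j. S (cell n e ((f ^^ Suc i) e)) = int ((f ^^ i)
      e) + 1) \<and>
     (\<forall>v<n. v \<notin> (\<lambda>i. (f ^^ Suc i) e) ` {..<j} \<longrightarrow> S (cell n e v) = int
         (g v) + 1)"

lemma tree_row_cong:
  assumes "\<And>v. v < n \<Longrightarrow> S (cell n e v) = S' (cell n e v)" "\<And>i. (f ^^ i) e < n"
  shows "tree_row n f g S e j = tree_row n f g S' e j"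
proof -
  have "S (cell n e ((f ^^ Suc i) e)) = S' (cell n e ((f ^^ Suc i) e))" for i using assms by blast
  then show ?thesis unfolding tree_row_def using assms(1) by (simp only: cong: imp_cong)
qed

lemma runs_Trees:
  assumes n: "s 0 0 = int n" "int n < M"
    and rep: "vec n (s 10) (\<lambda>v. int (rep v))" "\<And>v. v < n \<Longrightarrow> rep v < n"
    and X: "X = {v. v < n \<and> rep v = v}"
    and f: "vec n (s 46) (\<lambda>v. int (f v))" "\<And>v. v < n \<Longrightarrow> f v < n" "\<And>v. v <
        n \<Longrightarrow> \<exists>k. (f ^^ k) v \<in> X"
    and g: "vec n (s 45) (\<lambda>v. int (g v))" "\<And>v. v < n \<Longrightarrow> g v < n"
  shows "runs Trees s ((Suc n)\<^sup>2 * (15 * step_cost M)) (\<lambda>s'. \<forall>e<n. tree_row n f g (s'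
      47) e (depth f X e))"
proof -
  let ?u = "step_cost M"
  have nM: "int n \<le> M" using n by simp
  have repM: "int (rep v) \<le> M" if "v < n" for v using rep(2)[OF that] n(2) by linarith
  have fM: "int (f v) \<le> M" if "v < n" for v using f(2)[OF that] n(2) by linarith
  have gM: "int (g v) \<le> M" if "v < n" for v using g(2)[OF that] n(2) by linarith
  have fn: "(f ^^ i) e < n" if "e < n" for i e using that f(2) by (induction i) auto
  let ?b = "Sub (Const 1) (Eq (Entry 10 (Var 48)) (Var 48))"
  let ?as = "Seq (Assign 47 (Add (Mul (Var 94) (Var 0)) (Entry 46 (Var 48))) (Add (Var 48) (Const 1)))
             (SetVar 48 (Entry 46 (Var 48)))"
  let ?If = "If ?b ?as Skip"
  let ?body = "Seq (SetVar 48 (Var 94)) (For 95 0 ?If)"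
  define J where "J e s' \<longleftrightarrow> (\<forall>e'<n. tree_row n f g (s' 47) e' (if e' < e then
      depth f X e' else 0))" for e and s' :: store
  let ?T = "?u + Suc n * ((?u + (?u + ?u)) + 2 * ?u)"
  have body: "runs ?body s1 ?T (J (Suc e))"
    if e: "e < n" "s1 94 0 = int e" and J: "J e s1"
      and st: "s1 0 0 = int n" "s1 10 = s 10" "s1 46 = s 46" for e s1
  proof (rule runs_Seq[OF _ _ order_refl])
    let ?d = "depth f X e"
    have d: "?d < n"
      using depth_less_card[OF f(3)[OF e(1)], of "{..<n}"] fn[OF e(1)] by simp
    show "runs (SetVar 48 (Var 94)) s1 ?u (\<lambda>s2. s2 48 0 = int e)" using e n by (intro runs_Assign) auto
    fix s2 assume s2: "s2 48 0 = int e" "\<And>a. a \<notin> written (SetVar 48 (Var 94)) \<Longrightarrow>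
        s2 a = s1 a"
    have st2: "s2 0 0 = int n" "s2 10 = s 10" "s2 46 = s 46" "s2 94 0 = int e" "s2 47 = s1 47"
      using s2(2) st e by simp_all
    \<comment> \<open>After \<open>?d\<close> steps the walk stands still at the representative,
      hence \<open>min j ?d\<close>. The rows of other vertices are not touched.\<close>
    let ?K = "\<lambda>j s'. s' 48 0 = int ((f ^^ min j ?d) e) \<and> tree_row n f g (s' 47) e (min j ?d) \<and>
       (\<forall>e'<n. e' \<noteq> e \<longrightarrow> (\<forall>v<n. s' 47 (cell n e' v) = s1 47 (cell n
           e' v)))"
    have "runs (For 95 0 ?If) s2 (Suc n * ((?u + (?u + ?u)) + 2 * ?u)) (?K n)"
    proof (rule runs_For[where s = s2 and Inv = ?K, OF st2(1) nM])
      show "?K 0 s2" using s2(1) J e st2 unfolding J_def by auto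
      fix j s3 assume j: "j < n" and K: "?K j s3" and f3: "\<And>c. c \<noteq> 95 \<Longrightarrow> c
          \<notin> written ?If \<Longrightarrow> s3 c = s2 c"
      let ?x = "(f ^^ min j ?d) e"
      have x: "?x < n" "f ?x < n" "s3 48 0 = int ?x" using K fn[OF e(1)] f(2) by auto
      have st3: "s3 0 0 = int n" "s3 10 = s 10" "s3 46 = s 46" "s3 94 0 = int e"
        using f3 st2 by simp_all
      have v: "s3 10 (int ?x) = int (rep ?x)" "s3 46 (int ?x) = int (f ?x)"
        using vecD[OF rep(1) x(1)] vecD[OF f(1) x(1)] st3 by simp_all
      show "runs ?If s3 (?u + (?u + ?u)) (?K (Suc j))"
      proof (rule runs_If)
        show "reads_le M s3 ?b" using v x n repM[OF x(1)] by auto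
        show "runs Skip s3 (?u + ?u) (?K (Suc j))" if "val s3 ?b \<le> 0"
        proof -
          have "?x \<in> X" using that v x unfolding X by (auto split: split_of_bool_asm)
          then have "depth f X ?x = 0" by (rule depth_root)
          then have "?d - min j ?d = 0" using depth_funpow[OF f(3)[OF e(1)], of "min j ?d"] by simp
          then have "min (Suc j) ?d = min j ?d" by auto
          then have "runs Skip s3 ?u (?K (Suc j))" using K by (intro runs_Skip) simp
          then show ?thesis by (rule runs_weaken) auto
        qed
        assume "0 < val s3 ?b"
        then have "?x \<notin> X" using v x unfolding X by (auto split: split_of_bool_asm)
        then have "j < ?d" using funpow_depth[OF f(3)[OF e(1)]] by (metis min.absorb2 not_le)
        then have mj: "min j ?d = j" "min (Suc j) ?d = Suc j" by auto
        show "runs ?as s3 (?u + ?u) (?K (Suc j))"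
        proof (rule runs_Seq[OF _ _ order_refl])
          show "runs (Assign 47 (Add (Mul (Var 94) (Var 0)) (Entry 46 (Var 48))) (Add (Var 48) (Const 1))) s3 ?u
             (\<lambda>s4. s4 47 = (s3 47)(cell n e (f ?x) := int ?x + 1))"
            using x v st3 e n fM[OF x(1)] by (intro runs_Assign) auto
          fix s4 assume s4: "s4 47 = (s3 47)(cell n e (f ?x) := int ?x + 1)"
            "\<And>a. a \<notin> written (Assign 47 (Add (Mul (Var 94) (Var 0)) (Entry 46 (Var 48))) (Add
                (Var 48) (Const 1))) \<Longrightarrow> s4 a = s3 a"
          have st4: "s4 48 0 = int ?x" "s4 46 (int ?x) = int (f ?x)" using s4(2)[of 48] s4(2)[of 46] x v by
              simp_all
          have row: "tree_row n f g (s4 47) e (Suc j)"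
            unfolding tree_row_def
          proof (intro conjI allI impI)
            fix i assume i: "i < Suc j"
            show "s4 47 (cell n e ((f ^^ Suc i) e)) = int ((f ^^ i) e) + 1"
            proof (cases "i = j")
              case True then show ?thesis unfolding s4(1) using mj by simp
            next
              case False
              \<comment> \<open>The two vertices have different depths, so the write of this round
                spares the cells of earlier rounds.\<close>
              have "(f ^^ Suc i) e \<noteq> (f ^^ Suc j) e"
              proof
                assume eq: "(f ^^ Suc i) e = (f ^^ Suc j) e"
                have "i < j" using i False by simp
                have "depth f X ((f ^^ Suc i) e) = ?d - Suc i" "depth f X ((f ^^ Suc j) e) = ?d - Suc j"
                  using \<open>j < ?d\<close> \<open>i < j\<close> by (intro depth_funpow f(3) e(1); simp)+
                then have "?d - Suc i = ?d - Suc j" unfolding eq by (rule trans[OF sym])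
                then show False using \<open>j < ?d\<close> \<open>i < j\<close> by linarith
              qed
              then have "cell n e ((f ^^ Suc i) e) \<noteq> cell n e (f ?x)" using mj by simp
              moreover have "i < j" using i False by simp
              ultimately show ?thesis unfolding s4(1) using K mj unfolding tree_row_def by simp
            qed
          next
            fix w assume w: "w < n" "w \<notin> (\<lambda>i. (f ^^ Suc i) e) ` {..<Suc j}"
            then have "w \<noteq> (f ^^ Suc j) e" "w \<notin> (\<lambda>i. (f ^^ Suc i) e) ` {..<j}" by auto
            then show "s4 47 (cell n e w) = int (g w) + 1" unfolding s4(1) using K mj w(1) unfolding
                tree_row_def by simp
          qed
          have other: "s4 47 (cell n e' w) = s1 47 (cell n e' w)" if "e' < n" "e' \<noteq> e" "w < n" for e' w
          proof -
            have "cell n e' w \<noteq> cell n e (f ?x)" using cell_eq_iff[OF that(3) x(2), of e' e] that(2)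
                by blast
            then show ?thesis unfolding s4(1) using K that by simp
          qed
          show "runs (SetVar 48 (Entry 46 (Var 48))) s4 ?u (?K (Suc j))"
            using st4 x fM[OF x(1)] n row other mj by (intro runs_Assign) auto
        qed
      qed simp
    qed auto
    then show "runs (For 95 0 ?If) s2 (Suc n * ((?u + (?u + ?u)) + 2 * ?u)) (J (Suc e))"
    proof (rule runs_weaken)
      fix s3 :: store assume K: "?K n s3"
      show "J (Suc e) s3" unfolding J_def
      proof (intro allI impI)
        fix e' assume e': "e' < n"
        show "tree_row n f g (s3 47) e' (if e' < Suc e then depth f X e' else 0)"
        proof (cases "e' = e")
          case True then show ?thesis using K d by simp
        next
          case False
          have "tree_row n f g (s3 47) e' k = tree_row n f g (s1 47) e' k" for k
            by (rule tree_row_cong) (use K e' False fn in auto)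
          moreover have "tree_row n f g (s1 47) e' (if e' < e then depth f X e' else 0)" using J e'
              unfolding J_def by blast
          ultimately show ?thesis using False by (simp add: less_Suc_eq)
        qed
      qed
    qed simp
  qed
  have "runs Trees s ((Suc n)\<^sup>2 * (5 * ?u) + Suc n * (?T + 2 * ?u)) (J n)"
    unfolding Trees_def
  proof (rule runs_Seq[OF _ _ order_refl])
    show "runs (Fill 47 (Add (Entry 45 (Var 91)) (Const 1))) s ((Suc n)\<^sup>2 * (5 * ?u)) (\<lambda>s1.
        mat n (s1 47) (\<lambda>e v. int (g v) + 1))"
      by (rule runs_Fill) (use n nM gM vecD[OF g(1)] in auto)
    fix s1 assume s1: "mat n (s1 47) (\<lambda>e v. int (g v) + 1)" "\<And>a. a \<notin> written (Fill 47
        (Add (Entry 45 (Var 91)) (Const 1))) \<Longrightarrow> s1 a = s a"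
    have st1: "s1 0 0 = int n" "s1 10 = s 10" "s1 46 = s 46" using s1(2) n by simp_all
    show "runs (For 94 0 ?body) s1 (Suc n * (?T + 2 * ?u)) (J n)"
    proof (rule runs_For[where s = s1 and Inv = J, OF st1(1) nM])
      show "J 0 s1" using s1(1) unfolding J_def tree_row_def mat_def by simp
      show "J i (s(94 := x))" if "J i s" for i s x using that unfolding J_def by simp
      fix e s2 assume "e < n" "J e s2" "s2 94 0 = int e" "\<And>c. c \<noteq> 94 \<Longrightarrow> c
          \<notin> written ?body \<Longrightarrow> s2 c = s1 c"
      then show "runs ?body s2 ?T (J (Suc e))" using st1 by (intro body) auto
    qed auto
  qed
  then show ?thesis
  proof (rule runs_weaken)
    fix s' assume "J n s'"
    then show "\<forall>e<n. tree_row n f g (s' 47) e (depth f X e)" unfolding J_def by simp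
  qed (simp add: power2_eq_square algebra_simps)
qed

text \<open>Reachability is reflexive, so subtracting the equality test leaves a positive guard
  exactly for reachable v other than a. Arrays 50 and 51 receive the tail and the head of the entry
  arc.\<close>

definition Output :: prog where
  "Output = For2 (If (Sub (Cell 5) (Eq (Var 90) (Var 91)))
     (If (Cell_T 5) (Assign 2 (Add (Mul (Var 90) (Var 0)) (Var 91)) (Cell 47))
        (Seq (SetVar 50 (Sub (At 13 (Var 90) (Entry 10 (Var 91))) (Const 1)))
        (Seq (SetVar 51 (Sub (At 11 (Var 50) (Entry 10 (Var 91))) (Const 1)))
          (If (Eq (Var 51) (Var 91)) (Assign 2 (Add (Mul (Var 90) (Var 0)) (Var 91)) (Add (Var 50) (Const 1)))
             (Assign 2 (Add (Mul (Var 90) (Var 0)) (Var 91)) (At 47 (Var 51) (Var 91)))))))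
     (Assign 2 (Add (Mul (Var 90) (Var 0)) (Var 91)) (Const 0)))"

lemma runs_Output:
  fixes R :: "nat \<Rightarrow> nat \<Rightarrow> bool" and SP ENT WW :: "nat \<Rightarrow> nat
      \<Rightarrow> int"
  assumes n: "s 0 0 = int n" "int n < M"
    and R: "mat n (s 5) (\<lambda>i j. of_bool (R i j))" "\<And>i. R i i"
    and rep: "vec n (s 10) (\<lambda>v. int (rep v))" "\<And>v. v < n \<Longrightarrow> rep v < n"
    and SP: "mat n (s 47) SP" "\<And>e v. e < n \<Longrightarrow> v < n \<Longrightarrow> \<bar>SP e
        v\<bar> \<le> M"
    and ENT: "mat n (s 11) ENT" and WW: "mat n (s 13) WW"
    and wit: "\<And>a v. a < n \<Longrightarrow> v < n \<Longrightarrow> R a v \<Longrightarrow> \<not> R v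
        a \<Longrightarrow>
      \<exists>u<n. WW a (rep v) = int u + 1 \<and> (\<exists>e<n. ENT u (rep v) = int e + 1)"
  shows "runs Output s ((Suc n)\<^sup>2 * (10 * step_cost M)) (\<lambda>s'. mat n (s' 2) (\<lambda>a v.
      if \<not> R a v \<or> v = a then 0
       else if R v a then SP a v
       else if ENT (nat (WW a (rep v) - 1)) (rep v) = int v + 1 then WW a (rep v)
       else SP (nat (ENT (nat (WW a (rep v) - 1)) (rep v) - 1)) v))"
proof -
  let ?u = "step_cost M"
  let ?i = "Add (Mul (Var 90) (Var 0)) (Var 91)"
  have nM: "int n \<le> M" using n by simp
  define p where "p a v = (if \<not> R a v \<or> v = a then 0
       else if R v a then SP a v
       else if ENT (nat (WW a (rep v) - 1)) (rep v) = int v + 1 then WW a (rep v)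
       else SP (nat (ENT (nat (WW a (rep v) - 1)) (rep v) - 1)) v)" for a v
  have "runs Output s ((Suc n)\<^sup>2 * ((?u + (?u + (?u + (?u + (?u + ?u))))) + 4 * ?u)) (\<lambda>s'.
      mat n (s' 2) p)"
    unfolding Output_def
  proof (rule runs_fill_body[where s = s, OF n(1) nM])
    fix a v and s1 :: store
    assume av: "a < n" "v < n" "s1 90 0 = int a" "s1 91 0 = int v"
    let ?as3 = "If (Eq (Var 51) (Var 91)) (Assign 2 ?i (Add (Var 50) (Const 1))) (Assign 2 ?i (At 47 (Var
        51) (Var 91)))"
    let ?as2 = "Seq (SetVar 51 (Sub (At 11 (Var 50) (Entry 10 (Var 91))) (Const 1))) ?as3"
    let ?as1 = "Seq (SetVar 50 (Sub (At 13 (Var 90) (Entry 10 (Var 91))) (Const 1))) ?as2"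
    let ?body = "If (Sub (Cell 5) (Eq (Var 90) (Var 91))) (If (Cell_T 5) (Assign 2 ?i (Cell 47)) ?as1)
        (Assign 2 ?i (Const 0))"
    assume f1: "\<And>c. c \<noteq> 90 \<Longrightarrow> c \<noteq> 91 \<Longrightarrow> c \<notin> written
        ?body \<Longrightarrow> s1 c = s c"
    have st: "s1 0 0 = int n" "s1 5 = s 5" "s1 10 = s 10" "s1 47 = s 47" "s1 11 = s 11" "s1 13 = s 13"
      using f1 n by simp_all
    have r: "rep v < n" using rep(2) av by simp
    have val1: "s1 5 (cell n a v) = of_bool (R a v)" "s1 5 (cell n v a) = of_bool (R v a)"
      "s1 10 (int v) = int (rep v)" "s1 47 (cell n a v) = SP a v" "s1 13 (cell n a (rep v)) = WW a (rep v)"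
      using matD[OF R(1)] matD[OF SP(1)] matD[OF WW] vecD[OF rep(1)] av r st by simp_all
    have rM: "int (rep v) \<le> M" using r n by linarith
    let ?Q = "\<lambda>s2 :: store. s2 2 = (s1 2)(cell n a v := p a v)"
    show "runs ?body s1 (?u + (?u + (?u + (?u + (?u + ?u))))) ?Q"
    proof (rule runs_If)
      show "reads_le M s1 (Sub (Cell 5) (Eq (Var 90) (Var 91)))" using val1 av st n by simp
      show "runs (Assign 2 ?i (Const 0)) s1 (?u + (?u + (?u + (?u + ?u)))) ?Q" if "val s1 (Sub (Cell 5) (Eq
          (Var 90) (Var 91))) \<le> 0"
      proof -
        have "\<not> R a v \<or> v = a" using that val1 av st by (auto split: split_of_bool_asm)
        then have "runs (Assign 2 ?i (Const 0)) s1 ?u ?Q"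
          using av st n by (intro runs_Assign) (auto simp: p_def)
        then show ?thesis by (rule runs_weaken) auto
      qed
      assume "0 < val s1 (Sub (Cell 5) (Eq (Var 90) (Var 91)))"
      then have Rav: "R a v" "v \<noteq> a" using val1 av st R(2) by (auto split: split_of_bool_asm)
      show "runs (If (Cell_T 5) (Assign 2 ?i (Cell 47)) ?as1) s1 (?u + (?u + (?u + (?u + ?u)))) ?Q"
      proof (rule runs_If)
        show "reads_le M s1 (Cell_T 5)" using val1 av st n by simp
        show "runs (Assign 2 ?i (Cell 47)) s1 (?u + (?u + (?u + ?u))) ?Q" if "0 < val s1 (Cell_T 5)"
        proof -
          have "R v a" using that val1 av st by (auto split: split_of_bool_asm)
          then have "runs (Assign 2 ?i (Cell 47)) s1 ?u ?Q"
            using av st n Rav val1 SP(2)[OF av(1,2)] by (intro runs_Assign) (auto simp: p_def)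
          then show ?thesis by (rule runs_weaken) auto
        qed
        assume "val s1 (Cell_T 5) \<le> 0"
        then have Rva: "\<not> R v a" using val1 av st by (auto split: split_of_bool_asm)
        obtain u e where ue: "u < n" "WW a (rep v) = int u + 1" "e < n" "ENT u (rep v) = int e + 1"
          using wit[OF av(1,2) Rav(1) Rva] by blast
        have p: "p a v = (if e = v then int u + 1 else SP e v)" using ue Rav Rva by (auto simp: p_def)
        show "runs ?as1 s1 (?u + (?u + (?u + ?u))) ?Q"
        proof (rule runs_Seq[OF _ _ order_refl])
          show "runs (SetVar 50 (Sub (At 13 (Var 90) (Entry 10 (Var 91))) (Const 1))) s1 ?u (\<lambda>s2.
              s2 50 0 = int u)"
            using av st n val1 ue rM by (intro runs_Assign) auto
          fix s2 assume s2: "s2 50 0 = int u" "\<And>c. c \<notin> written (SetVar 50 (Sub (At 13 (Var 90)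
              (Entry 10 (Var 91))) (Const 1))) \<Longrightarrow> s2 c = s1 c"
          have st2: "s2 0 0 = int n" "s2 10 (int v) = int (rep v)" "s2 11 (cell n u (rep v)) = int e + 1"
              "s2 91 0 = int v"
            "s2 90 0 = int a" "s2 47 = s 47" "s2 2 = s1 2"
            using s2(2) st val1 av matD[OF ENT ue(1) r] ue by simp_all
          show "runs ?as2 s2 (?u + (?u + ?u)) ?Q"
          proof (rule runs_Seq[OF _ _ order_refl])
            show "runs (SetVar 51 (Sub (At 11 (Var 50) (Entry 10 (Var 91))) (Const 1))) s2 ?u (\<lambda>s3.
                s3 51 0 = int e)"
              using st2 s2(1) n ue av rM by (intro runs_Assign) auto
            fix s3 assume s3: "s3 51 0 = int e" "\<And>c. c \<notin> written (SetVar 51 (Sub (At 11 (Var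
                50) (Entry 10 (Var 91))) (Const 1))) \<Longrightarrow> s3 c = s2 c"
            have st3: "s3 0 0 = int n" "s3 91 0 = int v" "s3 90 0 = int a" "s3 47 (cell n e v) = SP e v"
                "s3 2 = s1 2" "s3 50 0 = int u"
              using s3(2) st2 s2(1) matD[OF SP(1) ue(3) av(2)] by simp_all
            show "runs ?as3 s3 (?u + ?u) ?Q"
            proof (rule runs_If)
              show "runs (Assign 2 ?i (Add (Var 50) (Const 1))) s3 ?u ?Q" if "0 < val s3 (Eq (Var 51) (Var 91))"
              proof -
                have "e = v" using that s3(1) st3 by (auto split: split_of_bool_asm)
                then show ?thesis using st3 p n av ue by (intro runs_Assign) auto
              qed
              show "runs (Assign 2 ?i (At 47 (Var 51) (Var 91))) s3 ?u ?Q" if "val s3 (Eq (Var 51) (Var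
                  91)) \<le> 0"
              proof -
                have "e \<noteq> v" using that s3(1) st3 by (auto split: split_of_bool_asm)
                then show ?thesis using st3 s3(1) p n av ue SP(2)[OF ue(3) av(2)] by (intro runs_Assign) auto
              qed
            qed (use st3 s3(1) n av ue in auto)
          qed
        qed
      qed simp
    qed simp
  qed auto
  then show ?thesis unfolding p_def
    by (rule runs_weaken) (auto simp: algebra_simps)
qed

section \<open>Deterministic witnesses for Boolean matrix products\<close>

text \<open>\<open>f < 2 * H * H\<close> encodes the triple of a modulus \<open>q\<close>, a mask
    \<open>r\<close> and a parity \<open>\<beta>\<close>.\<close>

definition hash_step :: "nat \<Rightarrow> nat \<Rightarrow> nat set \<Rightarrow> nat set" where
  "hash_step H f S = hashed (f div (2 * H) + 1) (f div 2 mod H) (f mod 2) S"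

text \<open>Mixed radix digits. The codes cover every modulus from 1 to H, prime or not: this spares
  a primality test, and the primes among the moduli already guarantee a good choice.\<close>

lemma hash_step_surj:
  assumes "0 < q" "q \<le> H" "r < H" "\<beta> < 2"
  shows "\<exists>f < 2 * H * H. hash_step H f = hashed q r \<beta>"
proof (intro exI conjI)
  let ?f = "2 * ((q - 1) * H + r) + \<beta>"
  have "(2 * a + \<beta>) div 2 = a" "(2 * a + \<beta>) mod 2 = \<beta>" for a using assms(4) by presburger+
  then have 1: "?f div 2 = (q - 1) * H + r" "?f mod 2 = \<beta>" by blast+
  have 2: "?f div 2 mod H = r" unfolding 1 using assms(3) by simp
  have "?f div (2 * H) = (?f div 2) div H" by (simp only: div_mult2_eq)
  also have "\<dots> = q - 1" unfolding 1 using assms(3) by simp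
  finally have 3: "?f div (2 * H) + 1 = q" using assms(1) by simp
  show "hash_step H ?f = hashed q r \<beta>" unfolding hash_step_def fun_eq_iff 1(2) 2 3 by simp
  have "(q - 1) * H + r < q * H" using assms by (cases q) auto
  also have "\<dots> \<le> H * H" using assms by simp
  finally have "(q - 1) * H + r + 1 \<le> H * H" by simp
  then have "2 * ((q - 1) * H + r + 1) \<le> 2 * (H * H)" by (rule mult_left_mono) simp
  then show "?f < 2 * H * H" using assms(4) by (simp add: algebra_simps)
qed

text \<open>Besides the relations between n, L, E and m, the assumptions make M dominate the
  products, the number of hash codes, the level thresholds and loop bounds, the coefficients of the
  potential, and its total over all pairs.\<close>

locale witness_setting =
  fixes n L E m T :: nat and M :: int and mp :: prog and P Q :: "nat \<Rightarrow> nat \<Rightarrow> bool"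
  assumes mp: "multiplies n mp T" and cube: "int n ^ 3 \<le> M" and nM: "int n < M"
    and nL: "n < 2 ^ L" and E: "E = 2 * L + 4" and m: "E ^ 4 \<le> 2 ^ m"
    and HM: "2 * 2 ^ m * 2 ^ m \<le> M" and LM: "2 ^ (L + 3) \<le> M" "32 * int L + 3 \<le> M"
    and scoreM: "2 * (2 * int E) ^ (L + 3) * int n ^ 4 \<le> M" and powM: "(2 * int E) ^ (L + 3) \<le> M"
begin

abbreviation H :: nat where "H \<equiv> 2 ^ m"

definition W :: "nat \<Rightarrow> nat \<Rightarrow> nat set" where "W i j = {k. k < n \<and> P i k \<and>
    Q k j}"

text \<open>The part of the store that the programs of this locale only read.\<close>

definition base :: "store \<Rightarrow> bool" where
  "base s \<longleftrightarrow> s 0 0 = int n \<and> mat n (s 5) (\<lambda>i j. of_bool (P i j)) \<and> mat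
      n (s 12) (\<lambda>i j. of_bool (Q i j)) \<and>
     s 22 0 = int H \<and> mat H (s 21) (\<lambda>y r. int (ip y r)) \<and>
     vec (L + 3) (s 24) (\<lambda>i. (2 * int E) ^ i) \<and> vec (L + 3) (s 25) (\<lambda>i. (int E + 1) ^
         i) \<and>
     s 34 0 = int (2 * H * H)"

definition score :: "(nat \<times> nat) set \<Rightarrow> nat \<Rightarrow> nat set \<Rightarrow> int" where
  "score V c S = (\<Sum>i<n. \<Sum>j<n. of_bool ((i, j) \<in> V) * weight E c (card (W i j \<inter> S)))"

lemma finite_W [simp]: "finite (W i j)" by (simp add: W_def)

lemma card_W_le: "card (W i j \<inter> S) \<le> n"
proof -
  have "card (W i j \<inter> S) \<le> card {..<n}" by (intro card_mono) (auto simp: W_def)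
  then show ?thesis by simp
qed

lemma count_eq:
  "(\<Sum>k<n. of_bool (P i k) * of_bool (k \<in> S) * of_bool (Q k j)) = int (card (W i j \<inter> S))"
proof -
  have "(\<Sum>k<n. of_bool (P i k) * of_bool (k \<in> S) * of_bool (Q k j)) = (\<Sum>k<n. of_bool (k \<in>
      W i j \<inter> S) :: int)"
    by (intro sum.cong) (auto simp: W_def)
  also have "\<dots> = int (card ({..<n} \<inter> {k. k \<in> W i j \<inter> S}))" by (subst
      sum_of_bool_eq) auto
  also have "{..<n} \<inter> {k. k \<in> W i j \<inter> S} = W i j \<inter> S" by (auto simp: W_def)
  finally show ?thesis .
qed

lemma pow_le:
  assumes "c < L + 3"
  shows "(2 * int E) ^ c \<le> (2 * int E) ^ (L + 3)" "(int E + 1) ^ c \<le> (2 * int E) ^ c" "0 \<le> (int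
      E + 1) ^ c"
proof -
  show "(2 * int E) ^ c \<le> (2 * int E) ^ (L + 3)" using assms E by (intro power_increasing) auto
  show "(int E + 1) ^ c \<le> (2 * int E) ^ c" using E by (intro power_mono) auto
qed simp

lemma abs_weight_le:
  assumes "c < L + 3" "x \<le> n"
  shows "\<bar>weight E c x\<bar> \<le> 2 * (2 * int E) ^ (L + 3) * int n ^ 2"
proof -
  note p = pow_le[OF assms(1)]
  have n2: "int x \<le> int n ^ 2"
  proof -
    have "int x \<le> int n" using assms by simp
    also have "\<dots> \<le> int n ^ 2" by (cases "n = 0") (auto intro: self_le_power)
    finally show ?thesis .
  qed
  have x: "\<bar>int x * (int x - 1)\<bar> \<le> int n ^ 2"
  proof (cases "x = 0")
    case False
    then have "int x * (int x - 1) \<le> int n * int n" using assms by (intro mult_mono) auto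
    then show ?thesis using False by (simp add: power2_eq_square)
  qed simp
  have "\<bar>weight E c x\<bar> \<le> \<bar>(2 * int E) ^ c * int x\<bar> + \<bar>(int E + 1) ^ c * (int x
      * (int x - 1))\<bar>"
    unfolding weight_def by linarith
  also have "\<dots> = (2 * int E) ^ c * int x + (int E + 1) ^ c * \<bar>int x * (int x - 1)\<bar>"
    using p by (simp add: abs_mult)
  also have "\<dots> \<le> (2 * int E) ^ (L + 3) * int n ^ 2 + (2 * int E) ^ (L + 3) * int n ^ 2"
    using p n2 x by (intro add_mono mult_mono) auto
  finally show ?thesis by linarith
qed

lemma sum_abs_score:
  assumes "c < L + 3"
  shows "(\<Sum>i<n. \<Sum>j<n. \<bar>of_bool ((i, j) \<in> V) * weight E c (card (W i j \<inter>
      S))\<bar>) \<le> M"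
proof -
  have "(\<Sum>i<n. \<Sum>j<n. \<bar>of_bool ((i, j) \<in> V) * weight E c (card (W i j \<inter> S))\<bar>)
     \<le> (\<Sum>i<n. \<Sum>j<n. 2 * (2 * int E) ^ (L + 3) * int n ^ 2)"
    using abs_weight_le[OF assms card_W_le] by (intro sum_mono) auto
  also have "\<dots> = 2 * (2 * int E) ^ (L + 3) * int n ^ 4" by (simp add: power2_eq_square power4_eq_xxxx)
  finally show ?thesis using scoreM by simp
qed

lemma abs_score_le: "c < L + 3 \<Longrightarrow> \<bar>score V c S\<bar> \<le> M"
proof -
  assume c: "c < L + 3"
  have "\<bar>score V c S\<bar> \<le> (\<Sum>i<n. \<bar>\<Sum>j<n. of_bool ((i, j) \<in> V) * weight E c
      (card (W i j \<inter> S))\<bar>)"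
    unfolding score_def by (rule sum_abs)
  also have "\<dots> \<le> (\<Sum>i<n. \<Sum>j<n. \<bar>of_bool ((i, j) \<in> V) * weight E c (card (W i j
      \<inter> S))\<bar>)"
    by (intro sum_mono sum_abs)
  finally show ?thesis using sum_abs_score[OF c, of V S] by linarith
qed

lemma m_pos: "0 < m"
proof (rule ccontr)
  assume "\<not> 0 < m"
  then have "E ^ 4 \<le> 1" using m by simp
  moreover have "4 ^ 4 \<le> E ^ 4" using E by (intro power_mono) auto
  ultimately show False by simp
qed

lemma score_eq_sum:
  assumes "V \<subseteq> {..<n} \<times> {..<n}"
  shows "score V c S = (\<Sum>v\<in>V. weight E c (card (W (fst v) (snd v) \<inter> S)))"
proof -
  have "score V c S = (\<Sum>v\<in>{..<n} \<times> {..<n}. of_bool (v \<in> V) * weight E c (card (W (fst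
      v) (snd v) \<inter> S)))"
    unfolding score_def by (simp only: sum.cartesian_product case_prod_unfold prod.collapse)
  also have "\<dots> = (\<Sum>v\<in>V. of_bool (v \<in> V) * weight E c (card (W (fst v) (snd v) \<inter> S)))"
    using assms by (intro sum.mono_neutral_right) auto
  finally show ?thesis by simp
qed

lemma exists_good_step:
  assumes V: "V \<subseteq> {..<n} \<times> {..<n}"
  shows "\<exists>f < 2 * H * H. score V (Suc c) S \<le> 4 * int E * score V c (hash_step H f S)"
proof -
  have fin: "finite V" using V finite_subset by blast
  have "E * L \<le> card {p::nat. prime p \<and> p \<le> 2 ^ m}" using enough_primes[of L m] m unfolding E
      by blast
  moreover have "n \<le> 2 ^ L" using nL by simp
  ultimately obtain q r \<beta> where q: "0 < q" "q \<le> H" "r < H" "\<beta> < 2" and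
    *: "(\<Sum>v\<in>V. weight E (Suc c) (card (W (fst v) (snd v) \<inter> S))) \<le>
      4 * int E * (\<Sum>v\<in>V. weight E c (card (hashed q r \<beta> (W (fst v) (snd v) \<inter> S))))"
    using exists_good_hash[OF fin, of "\<lambda>v. W (fst v) (snd v) \<inter> S" n L E m c] m_pos by (auto
        simp: W_def)
  obtain f where f: "f < 2 * H * H" "hash_step H f = hashed q r \<beta>" using hash_step_surj[OF q] by blast
  have "hashed q r \<beta> (X \<inter> S) = X \<inter> hashed q r \<beta> S" for X by (auto simp: hashed_def)
  with * f show ?thesis by (intro exI[of _ f]) (simp add: score_eq_sum[OF V])
qed

text \<open>With l halvings in all, this is the number that remains after round t, that is, the
  index of the potential by which a candidate of this round is judged.\<close>

abbreviation Rem :: expr where "Rem \<equiv> Sub (Sub (Var 26) (Const 1)) (Var 32)"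

text \<open>The code in 33 is decoded into modulus 37, mask 38 and parity 39; remainders are formed
  with \<open>Div\<close>. Array 17 is the thinned candidate set and 35 its score. Residues are
  below H, so their inner product with the mask can be read from table 21.\<close>

definition Try :: prog where
  "Try = Seq (SetVar 37 (Add (Div (Var 33) (Mul (Const 2) (Var 22))) (Const 1)))
     (Seq (SetVar 38 (Sub (Div (Var 33) (Const 2)) (Mul (Var 22) (Div (Div (Var 33) (Const 2)) (Var 22)))))
     (Seq (SetVar 39 (Sub (Var 33) (Mul (Const 2) (Div (Var 33) (Const 2)))))
     (Seq (Fill_vec 0 17 (Mul (Entry 16 (Var 92))
        (Eq (Entry 21 (Add (Mul (Sub (Var 92) (Mul (Var 37) (Div (Var 92) (Var 37)))) (Var 22)) (Var 38)))
            (Var 39))))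
     (Seq (Fill 18 (Mul (Cell 5) (Entry 17 (Var 91))))
     (Seq (Matmul mp 18 12 19)
     (Sum_cells 35 (Mul (Cell 15) (Sub (Mul (Entry 24 Rem) (Cell 19))
        (Mul (Entry 25 Rem) (Mul (Cell 19) (Sub (Cell 19) (Const 1))))))))))))"

lemma written_Try [simp]: "a < 100 \<Longrightarrow> a \<in> written Try \<longleftrightarrow> a \<in> {17,
    18, 19, 35, 37, 38, 39, 90, 91, 92}"
  by (auto simp: Try_def)

abbreviation C :: nat where "C \<equiv> mm_cost n M T"

lemma runs_Try:
  assumes base: "base s" and f: "f < 2 * H * H" "s 33 0 = int f"
    and S: "vec n (s 16) (\<lambda>k. of_bool (k \<in> S))" and V: "mat n (s 15) (\<lambda>i j. of_bool
        ((i, j) \<in> V))"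
    and l: "l < L + 3" "s 26 0 = int l" and t: "t < l" "s 32 0 = int t"
  shows "runs Try s (5 * C) (\<lambda>s'. vec n (s' 17) (\<lambda>k. of_bool (k \<in> hash_step H f S)) \<and>
     s' 35 0 = score V (l - 1 - t) (hash_step H f S))"
proof -
  let ?u = "step_cost M" and ?S = "hash_step H f S" and ?c = "l - 1 - t"
  let ?q = "f div (2 * H) + 1" and ?r = "f div 2 mod H" and ?\<beta> = "f mod 2"
  have fM: "int f \<le> M"
  proof -
    have "int f \<le> int (2 * H * H)" using f(1) by (intro of_nat_mono) simp
    then show ?thesis using HM by simp
  qed
  have H0: "1 \<le> int H" by simp
  have HM': "int H \<le> M"
  proof -
    have "(2::int) ^ m * 1 \<le> 2 ^ m * 2 ^ m" by (intro mult_left_mono) auto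
    moreover have "(0::int) \<le> 2 ^ m * 2 ^ m" by simp
    ultimately have "(2::int) ^ m \<le> M" using HM unfolding mult.assoc by linarith
    then show ?thesis by simp
  qed
  have qH: "?q \<le> H" "?r < H"
  proof -
    have "f div (2 * H) < H" using f(1) by (intro less_mult_imp_div_less) (simp add: ac_simps)
    then show "?q \<le> H" by simp
  qed simp
  have qM: "int ?q \<le> M" "int ?r \<le> M" using qH HM' by (metis of_nat_le_iff order_trans less_imp_le_nat)+
  have b: "s 0 0 = int n" "s 22 0 = int H" "mat H (s 21) (\<lambda>y r. int (ip y r))"
    "mat n (s 5) (\<lambda>i j. of_bool (P i j))" "mat n (s 12) (\<lambda>i j. of_bool (Q i j))"
    "vec (L + 3) (s 24) (\<lambda>i. (2 * int E) ^ i)" "vec (L + 3) (s 25) (\<lambda>i. (int E + 1) ^ i)"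
    using base by (simp_all add: base_def)
  have n1: "1 \<le> M" using nM by linarith
  let ?p7 = "Sum_cells 35 (Mul (Cell 15) (Sub (Mul (Entry 24 Rem) (Cell 19))
        (Mul (Entry 25 Rem) (Mul (Cell 19) (Sub (Cell 19) (Const 1))))))"
  let ?p6 = "Matmul mp 18 12 19"
  let ?p5 = "Fill 18 (Mul (Cell 5) (Entry 17 (Var 91)))"
  let ?p4 = "Fill_vec 0 17 (Mul (Entry 16 (Var 92))
        (Eq (Entry 21 (Add (Mul (Sub (Var 92) (Mul (Var 37) (Div (Var 92) (Var 37)))) (Var 22)) (Var 38)))
            (Var 39)))"
  let ?p3 = "SetVar 39 (Sub (Var 33) (Mul (Const 2) (Div (Var 33) (Const 2))))"
  let ?p2 = "SetVar 38 (Sub (Div (Var 33) (Const 2)) (Mul (Var 22) (Div (Div (Var 33) (Const 2)) (Var 22))))"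
  let ?p1 = "SetVar 37 (Add (Div (Var 33) (Mul (Const 2) (Var 22))) (Const 1))"
  let ?Q = "\<lambda>s'. vec n (s' 17) (\<lambda>k. of_bool (k \<in> ?S)) \<and> s' 35 0 = score V ?c ?S"
  have "runs Try s (?u + (?u + (?u + (C + (C + (C + C)))))) ?Q"
    unfolding Try_def
  proof (rule runs_Seq[OF _ _ order_refl])
    have "int f div (2 * int H) = int (f div (2 * H))" by (simp add: zdiv_int)
    then show "runs ?p1 s ?u (\<lambda>s1. s1 37 0 = int ?q)" using f b fM HM' by (intro runs_Assign) auto
    fix s1 assume s1: "s1 37 0 = int ?q" "\<And>a. a \<notin> written ?p1 \<Longrightarrow> s1 a = s a"
    show "runs (Seq ?p2 (Seq ?p3 (Seq ?p4 (Seq ?p5 (Seq ?p6 ?p7))))) s1 (?u + (?u + (C + (C + (C + C))))) ?Q"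
    proof (rule runs_Seq[OF _ _ order_refl])
      have "int f div 2 - int H * (int f div 2 div int H) = int ?r"
        by (simp add: zdiv_int zmod_int minus_mult_div_eq_mod)
      then show "runs ?p2 s1 ?u (\<lambda>s2. s2 38 0 = int ?r)" using f b fM HM' s1(2) by (intro
          runs_Assign) auto
      fix s2 assume s2: "s2 38 0 = int ?r" "\<And>a. a \<notin> written ?p2 \<Longrightarrow> s2 a = s1 a"
      show "runs (Seq ?p3 (Seq ?p4 (Seq ?p5 (Seq ?p6 ?p7)))) s2 (?u + (C + (C + (C + C)))) ?Q"
      proof (rule runs_Seq[OF _ _ order_refl])
        have "int f - 2 * (int f div 2) = int ?\<beta>" by (simp add: zmod_int minus_mult_div_eq_mod)
        then show "runs ?p3 s2 ?u (\<lambda>s3. s3 39 0 = int ?\<beta>)" using f b fM HM' s1(2) s2(2) by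
            (intro runs_Assign) auto
        fix s3 assume s3: "s3 39 0 = int ?\<beta>" "\<And>a. a \<notin> written ?p3 \<Longrightarrow> s3 a
            = s2 a"
        have st3: "s3 37 0 = int ?q" "s3 38 0 = int ?r" "s3 0 0 = int n" "s3 22 0 = int H" "s3 21 = s 21"
            "s3 16 = s 16"
          "s3 5 = s 5" "s3 12 = s 12" "s3 15 = s 15" "s3 24 = s 24" "s3 25 = s 25" "s3 26 0 = int l" "s3 32
              0 = int t"
          using s1 s2 s3 b l t by simp_all
        show "runs (Seq ?p4 (Seq ?p5 (Seq ?p6 ?p7))) s3 (C + (C + (C + C))) ?Q"
        proof (rule runs_Seq[OF _ _ order_refl])
          have "runs ?p4 s3 (Suc n * (3 * ?u)) (\<lambda>s4. vec n (s4 17) (\<lambda>k. of_bool (k \<in> ?S)))"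
          proof (rule runs_Fill_vec)
            fix k s' assume k: "k < n" "s' 92 0 = int k" and f': "\<And>c. c \<noteq> 92 \<Longrightarrow>
                c \<noteq> 17 \<Longrightarrow> s' c = s3 c"
            have kq: "int k - int ?q * (int k div int ?q) = int (k mod ?q)" by (simp only: zmod_int
                minus_mult_div_eq_mod)
            have "k mod ?q < H" using qH(1) mod_less_divisor[of ?q k] by linarith
            then have ipv: "s' 21 (int (k mod ?q) * int H + int ?r) = int (ip (k mod ?q) ?r)"
              using matD[OF b(3) _ qH(2)] f'[of 21] st3 by simp
            have v16: "s' 16 (int k) = of_bool (k \<in> S)" using vecD[OF S k(1)] f'[of 16] st3 by simp
            have st': "s' 37 0 = int ?q" "s' 38 0 = int ?r" "s' 22 0 = int H" "s' 39 0 = int ?\<beta>"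
              using f' st3 s3(1) by simp_all
            have ip1: "int (ip (k mod ?q) ?r) \<le> 1" using ip_less_2[of "k mod ?q" ?r] by linarith
            let ?e = "Entry 21 (Add (Mul (Sub (Var 92) (Mul (Var 37) (Div (Var 92) (Var 37)))) (Var 22))
                (Var 38))"
            have ve: "val s' ?e = int (ip (k mod ?q) ?r)" using ipv kq k st' by (simp only: val.simps)
            have re: "reads_le M s' ?e"
              unfolding reads_le.simps using ve ip1 k st' nM HM' qM n1 by (auto simp del: of_nat_add
                  of_nat_Suc of_nat_mult)
            have "val s' (Mul (Entry 16 (Var 92)) (Eq ?e (Var 39))) = of_bool (k \<in> ?S)"
              unfolding val.simps(5) val_Eq ve using v16 k st'
              by (auto simp: hash_step_def hashed_def)
            moreover have "reads_le M s' (Mul (Entry 16 (Var 92)) (Eq ?e (Var 39)))"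
              unfolding reads_le.simps(5) reads_le_Eq using re v16 k st' n1 nM by auto
            ultimately show "reads_le M s' (Mul (Entry 16 (Var 92)) (Eq ?e (Var 39))) \<and>
              val s' (Mul (Entry 16 (Var 92)) (Eq ?e (Var 39))) = of_bool (k \<in> ?S)" by blast
          qed (use st3 nM in auto)
          then show "runs ?p4 s3 C (\<lambda>s4. vec n (s4 17) (\<lambda>k. of_bool (k \<in> ?S)))"
            by (rule runs_weaken) (use mm_cost_bounds in auto)
          fix s4 assume s4: "vec n (s4 17) (\<lambda>k. of_bool (k \<in> ?S))" "\<And>a. a \<notin> written
              ?p4 \<Longrightarrow> s4 a = s3 a"
          show "runs (Seq ?p5 (Seq ?p6 ?p7)) s4 (C + (C + C)) ?Q"
          proof (rule runs_Seq[OF _ _ order_refl])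
            have "runs ?p5 s4 ((Suc n)\<^sup>2 * (5 * ?u)) (\<lambda>s5. mat n (s5 18) (\<lambda>i k.
                of_bool (P i k) * of_bool (k \<in> ?S)))"
              by (rule runs_Fill) (use st3 s4 nM n1 matD[OF b(4)] vecD[OF s4(1)] in auto)
            then show "runs ?p5 s4 C (\<lambda>s5. mat n (s5 18) (\<lambda>i k. of_bool (P i k) * of_bool
                (k \<in> ?S)))"
              by (rule runs_weaken) (use mm_cost_bounds in auto)
            fix s5 assume s5: "mat n (s5 18) (\<lambda>i k. of_bool (P i k) * of_bool (k \<in> ?S))"
                "\<And>a. a \<notin> written ?p5 \<Longrightarrow> s5 a = s4 a"
            show "runs (Seq ?p6 ?p7) s5 (C + C) ?Q"
            proof (rule runs_Seq[OF _ _ order_refl])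
              have n5: "s5 0 0 = int n" "s5 12 = s 12" using s5(2) s4(2) st3 by simp_all
              have Q5: "mat n (s5 12) (\<lambda>i j. of_bool (Q i j))" using b n5 by simp
              have "runs ?p6 s5 C (\<lambda>s6. mat n (s6 19) (\<lambda>i j. \<Sum>k<n. of_bool (P i k) *
                  of_bool (k \<in> ?S) * of_bool (Q k j)))"
                by (rule runs_Matmul[OF mp n5(1) cube s5(1) _ Q5]) auto
              then show "runs ?p6 s5 C (\<lambda>s6. mat n (s6 19) (\<lambda>i j. int (card (W i j \<inter>
                  ?S))))" by (simp only: count_eq)
              fix s6 assume s6: "mat n (s6 19) (\<lambda>i j. int (card (W i j \<inter> ?S)))" "\<And>a. a
                  \<notin> written ?p6 \<Longrightarrow> s6 a = s5 a"
              have st6: "s6 0 0 = int n" "s6 15 = s 15" "s6 24 = s 24" "s6 25 = s 25" "s6 26 0 = int l" "s6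
                  32 0 = int t" "s6 17 = s4 17"
                using s6(2) s5(2) s4(2) st3 by simp_all
              have c: "?c < L + 3" using l t by simp
              have ci: "int l - 1 - int t = int ?c" using t by simp
              have pw: "s6 24 (int ?c) = (2 * int E) ^ ?c" "s6 25 (int ?c) = (int E + 1) ^ ?c"
                using vecD[OF b(6) c] vecD[OF b(7) c] st6 by simp_all
              have pwM: "\<bar>(2 * int E) ^ ?c\<bar> \<le> M" "\<bar>(int E + 1) ^ ?c\<bar> \<le> M" using
                  pow_le[OF c] powM by simp_all
              have "runs ?p7 s6 ((Suc n)\<^sup>2 * (6 * ?u)) (\<lambda>s7. s7 35 0 = (\<Sum>i<n. \<Sum>j<n.
                  of_bool ((i, j) \<in> V) * weight E ?c (card (W i j \<inter> ?S))))"
              proof (rule runs_Sum_cells)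
                fix i j s' assume ij: "i < n" "j < n" "s' 90 0 = int i" "s' 91 0 = int j"
                  and f': "\<And>c. c \<noteq> 90 \<Longrightarrow> c \<noteq> 91 \<Longrightarrow> c
                      \<noteq> 35 \<Longrightarrow> s' c = s6 c"
                have rem: "val s' Rem = int ?c" "reads_le M s' Rem" using f' st6 ci l t LM by simp_all
                have x: "val s' (Cell 19) = int (card (W i j \<inter> ?S))" "reads_le M s' (Cell 19)"
                  using matD[OF s6(1) ij(1,2)] ij f' st6 card_W_le[of i j ?S] nM by simp_all
                have v: "val s' (Cell 15) = of_bool ((i, j) \<in> V)" "reads_le M s' (Cell 15)"
                  using matD[OF V ij(1,2)] ij f' st6 nM n1 by simp_all
                have p: "val s' (Entry 24 Rem) = (2 * int E) ^ ?c" "val s' (Entry 25 Rem) = (int E + 1) ^ ?c"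
                  "reads_le M s' (Entry 24 Rem)" "reads_le M s' (Entry 25 Rem)"
                  using rem pw pwM f'[of 24] f'[of 25] by simp_all
                show "reads_le M s' (Mul (Cell 15) (Sub (Mul (Entry 24 Rem) (Cell 19)) (Mul (Entry 25 Rem)
                    (Mul (Cell 19) (Sub (Cell 19) (Const 1)))))) \<and>
                  val s' (Mul (Cell 15) (Sub (Mul (Entry 24 Rem) (Cell 19)) (Mul (Entry 25 Rem) (Mul (Cell
                      19) (Sub (Cell 19) (Const 1)))))) =
                  of_bool ((i, j) \<in> V) * weight E ?c (card (W i j \<inter> ?S))"
                  unfolding reads_le.simps(3-5) val.simps(3-5) p(1,2) x(1) v(1) weight_def
                  using p x v by (simp only: reads_le.simps(1) val.simps(1) simp_thms)
              qed (use st6 nM sum_abs_score[OF c] in auto)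
              then show "runs ?p7 s6 C ?Q"
                by (rule runs_weaken) (use mm_cost_bounds s4(1) st6 in \<open>auto simp: score_def\<close>)
            qed
          qed
        qed
      qed
    qed
  qed
  then show ?thesis
  proof (rule runs_weaken)
    show "?u + (?u + (?u + (C + (C + (C + C))))) \<le> 5 * C" using mm_cost_bounds(4)[of M n T] by linarith
  qed simp
qed

text \<open>Scores may be negative, so the initial 0 in 36 cannot serve as a minimum; the guard
  accepts the first candidate unconditionally and later ones only if they are strictly
  better.\<close>

definition Best :: prog where
  "Best = Seq (SetVar 36 (Const 0)) (For 33 34 (Seq Try
     (If (Add (Mul (Sub (Var 35) (Var 36)) (Sub (Const 1) (Eq (Var 33) (Const 0)))) (Eq (Var 33) (Const 0)))
        (Seq (SetVar 36 (Var 35)) (Fill_vec 0 20 (Entry 17 (Var 92)))) Skip)))"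

lemma written_Best [simp]:
  "a < 100 \<Longrightarrow> a \<in> written Best \<longleftrightarrow> a \<in> {17, 18, 19, 20, 33, 35,
      36, 37, 38, 39, 90, 91, 92, 99}"
  by (auto simp: Best_def)

lemma runs_Best:
  assumes base: "base s" 
    and S: "vec n (s 16) (\<lambda>k. of_bool (k \<in> S))"
    and V: "mat n (s 15) (\<lambda>i j. of_bool ((i, j) \<in> V))" "V \<subseteq> {..<n} \<times> {..<n}"
    and l: "l < L + 3" "s 26 0 = int l" and t: "t < l" "s 32 0 = int t"
  shows "runs Best s ((2 * H * H + 1) * (9 * C)) (\<lambda>s'. \<exists>S'. vec n (s' 20) (\<lambda>k.
      of_bool (k \<in> S')) \<and>
     score V (l - t) S \<le> 4 * int E * score V (l - Suc t) S')"
proof -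
  let ?u = "step_cost M" and ?c = "l - 1 - t" and ?N = "2 * H * H"
  have c: "?c < L + 3" using l by simp
  define J where "J f s' \<longleftrightarrow> \<bar>s' 36 0\<bar> \<le> M \<and> (0 < f \<longrightarrow>
      (\<exists>b<f. s' 36 0 = score V ?c (hash_step H b S) \<and>
     vec n (s' 20) (\<lambda>k. of_bool (k \<in> hash_step H b S)) \<and> (\<forall>f'<f. score V ?c
         (hash_step H f' S) \<le> s' 36 0)))" for f and s' :: store
  let ?g = "Add (Mul (Sub (Var 35) (Var 36)) (Sub (Const 1) (Eq (Var 33) (Const 0)))) (Eq (Var 33) (Const 0))"
  let ?upd = "Seq (SetVar 36 (Var 35)) (Fill_vec 0 20 (Entry 17 (Var 92)))"
  let ?body = "Seq Try (If ?g ?upd Skip)"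
  have NM: "int ?N \<le> M" using HM by simp
  have n1: "1 \<le> M" using nM by linarith
  have "runs Best s (?u + Suc ?N * ((5 * C + (?u + (?u + C))) + 2 * ?u)) (J ?N)"
    unfolding Best_def
  proof (rule runs_Seq[OF _ _ order_refl])
    show "runs (SetVar 36 (Const 0)) s ?u (\<lambda>s1. s1 36 0 = 0)" by (intro runs_Assign) auto
    fix s1 assume s1: "s1 36 0 = 0" "\<And>a. a \<notin> written (SetVar 36 (Const 0)) \<Longrightarrow> s1
        a = s a"
    have base1: "base s1" using base s1(2) by (simp add: base_def)
    then have N1: "s1 34 0 = int ?N" by (simp add: base_def)
    have st1: "s1 16 = s 16" "s1 15 = s 15" "s1 26 = s 26" "s1 32 = s 32" using s1(2) by simp_all
    show "runs (For 33 34 ?body) s1 (Suc ?N * ((5 * C + (?u + (?u + C))) + 2 * ?u)) (J ?N)"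
    proof (rule runs_For[where s = s1 and Inv = J, OF N1 NM])
      show "J 0 s1" using s1(1) n1 by (simp add: J_def)
      show "J i (s'(33 := x))" if "J i s'" for i s' x using that unfolding J_def by simp
      fix f s2 assume f: "f < ?N" "J f s2" "s2 33 0 = int f"
        and f2: "\<And>c. c \<noteq> 33 \<Longrightarrow> c \<notin> written ?body \<Longrightarrow> s2 c =
            s1 c"
      have base2: "base s2" using base1 f2 by (simp add: base_def)
      have st2: "s2 16 = s 16" "s2 15 = s 15" "s2 26 = s 26" "s2 32 = s 32" using f2 st1 by simp_all
      let ?S = "hash_step H f S"
      show "runs ?body s2 (5 * C + (?u + (?u + C))) (J (Suc f))"
      proof (rule runs_Seq[OF _ _ order_refl])
        show "runs Try s2 (5 * C) (\<lambda>s3. vec n (s3 17) (\<lambda>k. of_bool (k \<in> ?S)) \<and> s3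
            35 0 = score V ?c ?S)"
          by (rule runs_Try[OF base2 f(1,3) _ _ l(1) _ t(1)]) (use st2 S V l t in simp_all)
        fix s3 assume s3: "vec n (s3 17) (\<lambda>k. of_bool (k \<in> ?S)) \<and> s3 35 0 = score V ?c ?S"
            "\<And>a. a \<notin> written Try \<Longrightarrow> s3 a = s2 a"
        have st3: "s3 36 = s2 36" "s3 20 = s2 20" "s3 33 0 = int f" "s3 0 0 = int n"
          using s3(2) f base2 by (simp_all add: base_def)
        have J3: "J f s3" using f(2) st3 by (simp add: J_def)
        have fM: "int f \<le> M" using f(1) NM by linarith
        have sc: "\<bar>s3 35 0\<bar> \<le> M" using s3(1) abs_score_le[OF c] by simp
        have M36: "\<bar>s3 36 0\<bar> \<le> M" using J3 by (simp add: J_def)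
        show "runs (If ?g ?upd Skip) s3 (?u + (?u + C)) (J (Suc f))"
        proof (rule runs_If)
          show "reads_le M s3 ?g" using st3 sc M36 fM by simp
          show "runs Skip s3 (?u + C) (J (Suc f))" if g: "val s3 ?g \<le> 0"
          proof -
            have "0 < f" "s3 35 0 \<le> s3 36 0" using g st3 by (auto split: split_of_bool_asm)
            then have "runs Skip s3 ?u (J (Suc f))"
              using J3 s3(1) by (intro runs_Skip) (auto simp: J_def less_Suc_eq)
            then show ?thesis by (rule runs_weaken) auto
          qed
          assume g: "0 < val s3 ?g"
          then have better: "f = 0 \<or> s3 36 0 < s3 35 0" using st3 by (auto split: split_of_bool_asm)
          show "runs ?upd s3 (?u + C) (J (Suc f))"
          proof (rule runs_Seq[OF _ _ order_refl])
            show "runs (SetVar 36 (Var 35)) s3 ?u (\<lambda>s4. s4 36 0 = score V ?c ?S)" using sc s3(1) by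
                (intro runs_Assign) auto
            fix s4 assume s4: "s4 36 0 = score V ?c ?S" "\<And>a. a \<notin> written (SetVar 36 (Var 35))
                \<Longrightarrow> s4 a = s3 a"
            have 17: "vec n (s4 17) (\<lambda>k. of_bool (k \<in> ?S))" "s4 0 0 = int n" using s3(1) s4(2)
                st3 by simp_all
            have "runs (Fill_vec 0 20 (Entry 17 (Var 92))) s4 (Suc n * (3 * ?u)) (\<lambda>s5. vec n (s5
                20) (\<lambda>k. of_bool (k \<in> ?S)))"
              by (rule runs_Fill_vec) (use 17 nM n1 vecD[OF 17(1)] in auto)
            then show "runs (Fill_vec 0 20 (Entry 17 (Var 92))) s4 C (J (Suc f))"
            proof (rule runs_weaken)
              fix s5 assume s5: "vec n (s5 20) (\<lambda>k. of_bool (k \<in> ?S))" "\<And>a. a \<notin>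
                  written (Fill_vec 0 20 (Entry 17 (Var 92))) \<Longrightarrow> s5 a = s4 a"
              have 36: "s5 36 0 = score V ?c ?S" using s5(2)[of 36] s4 by simp
              have "score V ?c (hash_step H f' S) \<le> score V ?c ?S" if "f' < Suc f" for f'
              proof (cases "f' = f")
                case False
                then have "f' < f" using that by simp
                then have "score V ?c (hash_step H f' S) \<le> s3 36 0" using J3 unfolding J_def by auto
                then show ?thesis using better \<open>f' < f\<close> s3(1) by simp
              qed simp
              then show "J (Suc f) s5" unfolding J_def 36 using s5(1) abs_score_le[OF c] by blast
            qed (use mm_cost_bounds in simp)
          qed
        qed simp
      qed
    qed auto
  qed
  then show ?thesis
  proof (rule runs_weaken)
    have u: "16 * ?u \<le> C" by (rule mm_cost_bounds(4))
    have "?u + Suc ?N * ((5 * C + (?u + (?u + C))) + 2 * ?u) \<le> C + Suc ?N * (8 * C)"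
      using u by (intro add_mono mult_left_mono) auto
    also have "\<dots> \<le> (?N + 1) * (9 * C)" by (simp add: algebra_simps)
    finally show "?u + Suc ?N * ((5 * C + (?u + (?u + C))) + 2 * ?u) \<le> (?N + 1) * (9 * C)" .
    fix s' assume J: "J ?N s'"
    obtain f where f: "f < ?N" "score V (Suc ?c) S \<le> 4 * int E * score V ?c (hash_step H f S)"
      using exists_good_step[OF V(2), of ?c S] by blast
    obtain b where b: "s' 36 0 = score V ?c (hash_step H b S)" "vec n (s' 20) (\<lambda>k. of_bool (k \<in>
        hash_step H b S))"
      "\<And>f'. f' < ?N \<Longrightarrow> score V ?c (hash_step H f' S) \<le> s' 36 0"
      using J f(1) unfolding J_def by auto
    have "4 * int E * score V ?c (hash_step H f S) \<le> 4 * int E * score V ?c (hash_step H b S)"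
      using b(3)[OF f(1)] unfolding b(1) by (intro mult_left_mono) auto
    moreover have "Suc ?c = l - t" "?c = l - Suc t" using t by auto
    ultimately show "\<exists>S'. vec n (s' 20) (\<lambda>k. of_bool (k \<in> S')) \<and> score V (l - t) S
        \<le> 4 * int E * score V (l - Suc t) S'"
      using f(2) b(2) by (intro exI[of _ "hash_step H b S"]) auto
  qed
qed

text \<open>One run of \<open>Best\<close> per halving. Each may scale the potential by 4 E, which
  accumulates to (4 E)^l.\<close>

definition Isolate :: prog where
  "Isolate = Seq (Fill_vec 0 16 (Const 1)) (For 32 26 (Seq Best (Fill_vec 0 16 (Entry 20 (Var 92)))))"

lemma written_Isolate [simp]:
  "a < 100 \<Longrightarrow> a \<in> written Isolate \<longleftrightarrow> a \<in> {16, 17, 18, 19, 20, 32,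
      33, 35, 36, 37, 38, 39, 90, 91, 92, 99}"
  by (auto simp: Isolate_def)

lemma runs_Isolate:
  assumes base: "base s"
    and V: "mat n (s 15) (\<lambda>i j. of_bool ((i, j) \<in> V))" "V \<subseteq> {..<n} \<times> {..<n}"
    and l: "l < L + 3" "s 26 0 = int l"
  shows "runs Isolate s ((L + 4) * (2 * H * H + 1) * (11 * C)) (\<lambda>s'. \<exists>S. vec n (s' 16)
      (\<lambda>k. of_bool (k \<in> S)) \<and>
     score V l {..<n} \<le> (4 * int E) ^ l * score V 0 S)"
proof -
  let ?u = "step_cost M" and ?N = "2 * H * H"
  have lM: "int l \<le> M" using l(1) LM(2) by linarith
  have n1: "1 \<le> M" using nM by linarith
  define J where "J t s' \<longleftrightarrow> (\<exists>S. vec n (s' 16) (\<lambda>k. of_bool (k \<in> S))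
      \<and>
     score V l {..<n} \<le> (4 * int E) ^ t * score V (l - t) S)" for t and s' :: store
  let ?body = "Seq Best (Fill_vec 0 16 (Entry 20 (Var 92)))"
  have "runs Isolate s (C + Suc l * (((?N + 1) * (9 * C) + C) + 2 * ?u)) (J l)"
    unfolding Isolate_def
  proof (rule runs_Seq[OF _ _ order_refl])
    have n0: "s 0 0 = int n" using base by (simp add: base_def)
    have "runs (Fill_vec 0 16 (Const 1)) s (Suc n * (3 * ?u)) (\<lambda>s1. vec n (s1 16) (\<lambda>k.
        of_bool (k \<in> {..<n})))"
      by (rule runs_Fill_vec) (use n0 nM in auto)
    then show "runs (Fill_vec 0 16 (Const 1)) s C (\<lambda>s1. vec n (s1 16) (\<lambda>k. of_bool (k \<in>
        {..<n})))"
      by (rule runs_weaken) (use mm_cost_bounds in auto)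
    fix s1 assume s1: "vec n (s1 16) (\<lambda>k. of_bool (k \<in> {..<n}))" "\<And>a. a \<notin> written
        (Fill_vec 0 16 (Const 1)) \<Longrightarrow> s1 a = s a"
    have base1: "base s1" using base s1(2) by (simp add: base_def)
    have st1: "s1 26 0 = int l" "s1 15 = s 15" using s1(2) l by simp_all
    show "runs (For 32 26 ?body) s1 (Suc l * (((?N + 1) * (9 * C) + C) + 2 * ?u)) (J l)"
    proof (rule runs_For[where s = s1 and Inv = J, OF st1(1) lM])
      show "J 0 s1" unfolding J_def using s1(1) by (intro exI[of _ "{..<n}"]) simp
      show "J i (s'(32 := x))" if "J i s'" for i s' x using that unfolding J_def by simp
      fix t s2 assume t: "t < l" "J t s2" "s2 32 0 = int t"
        and f2: "\<And>c. c \<noteq> 32 \<Longrightarrow> c \<notin> written ?body \<Longrightarrow> s2 c =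
            s1 c"
      have base2: "base s2" using base1 f2 by (simp add: base_def)
      have st2: "s2 26 0 = int l" "s2 15 = s 15" using f2 st1 by simp_all
      obtain S where S: "vec n (s2 16) (\<lambda>k. of_bool (k \<in> S))" "score V l {..<n} \<le> (4 * int
          E) ^ t * score V (l - t) S"
        using t(2) unfolding J_def by blast
      show "runs ?body s2 ((?N + 1) * (9 * C) + C) (J (Suc t))"
      proof (rule runs_Seq[OF _ _ order_refl])
        show "runs Best s2 ((?N + 1) * (9 * C)) (\<lambda>s'. \<exists>S'. vec n (s' 20) (\<lambda>k.
            of_bool (k \<in> S')) \<and>
           score V (l - t) S \<le> 4 * int E * score V (l - Suc t) S')"
          by (rule runs_Best[OF base2 S(1) _ V(2) l(1) st2(1) t(1,3)]) (use V st2 in simp)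
        fix s3 assume ex: "\<exists>S'. vec n (s3 20) (\<lambda>k. of_bool (k \<in> S')) \<and>
           score V (l - t) S \<le> 4 * int E * score V (l - Suc t) S'"
          and f3: "\<And>a. a \<notin> written Best \<Longrightarrow> s3 a = s2 a"
        obtain S' where S': "vec n (s3 20) (\<lambda>k. of_bool (k \<in> S'))" "score V (l - t) S \<le> 4 *
            int E * score V (l - Suc t) S'"
          using ex by blast
        have n3: "s3 0 0 = int n" using f3[of 0] base2 by (simp add: base_def)
        have "runs (Fill_vec 0 16 (Entry 20 (Var 92))) s3 (Suc n * (3 * ?u)) (\<lambda>s4. vec n (s4 16)
            (\<lambda>k. of_bool (k \<in> S')))"
          by (rule runs_Fill_vec) (use n3 nM n1 vecD[OF S'(1)] in auto)
        then show "runs (Fill_vec 0 16 (Entry 20 (Var 92))) s3 C (J (Suc t))"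
        proof (rule runs_weaken)
          fix s4 :: store assume s4: "vec n (s4 16) (\<lambda>k. of_bool (k \<in> S'))"
          have "(4 * int E) ^ t * score V (l - t) S \<le> (4 * int E) ^ t * (4 * int E * score V (l - Suc
              t) S')"
            using S'(2) by (intro mult_left_mono) auto
          then have "score V l {..<n} \<le> (4 * int E) ^ Suc t * score V (l - Suc t) S'"
            using S(2) by (simp only: power_Suc2 mult.assoc)
          then show "J (Suc t) s4" unfolding J_def using s4 by blast
        qed (use mm_cost_bounds in simp)
      qed
    qed auto
  qed
  then show ?thesis
  proof (rule runs_weaken)
    have u: "16 * ?u \<le> C" by (rule mm_cost_bounds(4))
    have "C + Suc l * (((?N + 1) * (9 * C) + C) + 2 * ?u) \<le> C + Suc l * (((?N + 1) * (9 * C) + C) + C)"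
      using u by (intro add_mono mult_left_mono) auto
    also have "\<dots> \<le> C + (L + 3) * ((?N + 1) * (11 * C))"
      using l(1) by (intro add_mono mult_mono) (auto simp: algebra_simps)
    also have "\<dots> \<le> (L + 4) * (?N + 1) * (11 * C)" by (simp add: algebra_simps)
    finally show "C + Suc l * (((?N + 1) * (9 * C) + C) + 2 * ?u) \<le> (L + 4) * (?N + 1) * (11 * C)" .
    fix s' assume "J l s'"
    then show "\<exists>S. vec n (s' 16) (\<lambda>k. of_bool (k \<in> S)) \<and> score V l {..<n} \<le> (4
        * int E) ^ l * score V 0 S"
      unfolding J_def by simp
  qed
qed

text \<open>At the start every pair of V has weight at least (4 E)^l / 16 by
  \<open>weight_ge\<close>. The hypothesis on S transports this to the final potential, where by
  \<open>weight_0_le\<close> a pair contributes at most 1, and that only if it has exactly one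
  witness in S.\<close>

lemma isolated_fraction:
  assumes V: "V \<subseteq> {..<n} \<times> {..<n}" and l: "l < L + 3"
    and lev: "\<And>i j. (i, j) \<in> V \<Longrightarrow> 4 * card (W i j) < 2 ^ l \<and> 2 ^ l \<le> 8 *
        card (W i j)"
    and S: "score V l {..<n} \<le> (4 * int E) ^ l * score V 0 S"
  shows "card V \<le> 16 * card {(i, j) \<in> V. card (W i j \<inter> S) = 1}"
proof -
  have fin: "finite V" using V finite_subset by blast
  have Wn: "W i j \<inter> {..<n} = W i j" for i j by (auto simp: W_def)
  have "int (card V) * (4 * int E) ^ l = (\<Sum>v\<in>V. (4 * int E) ^ l)" by simp
  also have "\<dots> \<le> (\<Sum>v\<in>V. 16 * weight E l (card (W (fst v) (snd v))))"
    using lev l E by (intro sum_mono weight_ge) auto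
  also have "\<dots> = 16 * score V l {..<n}" unfolding score_eq_sum[OF V] Wn by (simp only: sum_distrib_left)
  also have "\<dots> \<le> 16 * ((4 * int E) ^ l * score V 0 S)" using S by simp
  also have "\<dots> = (4 * int E) ^ l * (16 * score V 0 S)" by simp
  finally have "(4 * int E) ^ l * int (card V) \<le> (4 * int E) ^ l * (16 * score V 0 S)" by (simp only:
      mult.commute)
  moreover have "0 < (4 * int E) ^ l" using E by simp
  ultimately have 1: "int (card V) \<le> 16 * score V 0 S" by (simp only: mult_le_cancel_left_pos)
  have "score V 0 S \<le> (\<Sum>v\<in>V. of_bool (card (W (fst v) (snd v) \<inter> S) = 1))"
    unfolding score_eq_sum[OF V] by (intro sum_mono weight_0_le)
  also have "\<dots> = int (card (V \<inter> {v. card (W (fst v) (snd v) \<inter> S) = 1}))"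
    using fin by (subst sum_of_bool_eq) auto
  also have "V \<inter> {v. card (W (fst v) (snd v) \<inter> S) = 1} = {(i, j) \<in> V. card (W i j
      \<inter> S) = 1}" by auto
  finally show ?thesis using 1 by linarith
qed

section \<open>Resolving the pairs of one level\<close>

definition valid :: "(nat \<Rightarrow> nat \<Rightarrow> int) \<Rightarrow> bool" where
  "valid w \<longleftrightarrow> (\<forall>i<n. \<forall>j<n. w i j = 0 \<or> (\<exists>k\<in>W i j. w i j
      = int k + 1))"

text \<open>The dyadic windows 2^l / 8 \<le> x < 2^l / 4 are those of \<open>weight_ge\<close>.
  Every positive number of witnesses falls into exactly one of them.\<close>

definition open_pairs :: "nat \<Rightarrow> (nat \<Rightarrow> nat \<Rightarrow> int) \<Rightarrow> (nat
    \<times> nat) set" where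
  "open_pairs l w = {(i, j). i < n \<and> j < n \<and> w i j = 0 \<and> 4 * card (W i j) < 2 ^ l \<and> 2 ^
      l \<le> 8 * card (W i j)}"

lemma card_W_le_n: "card (W i j) \<le> n"
  using card_W_le[of i j UNIV] by simp

lemma isolated_index:
  "(\<Sum>k<n. of_bool (P i k) * of_bool (k \<in> S) * int k * of_bool (Q k j)) = (\<Sum>k\<in>W i j
      \<inter> S. int k)"
proof -
  have "(\<Sum>k<n. of_bool (P i k) * of_bool (k \<in> S) * int k * of_bool (Q k j)) =
      (\<Sum>k<n. if k \<in> W i j \<inter> S then int k else 0)"
    by (intro sum.cong) (auto simp: W_def)
  also have "\<dots> = (\<Sum>k\<in>{..<n} \<inter> (W i j \<inter> S). int k)" by (simp only:
      sum.inter_restrict[OF finite_lessThan])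
  also have "{..<n} \<inter> (W i j \<inter> S) = W i j \<inter> S" by (auto simp: W_def)
  finally show ?thesis .
qed

text \<open>Array 27 holds 2^l. For naturals, b < a is tested by a div (b + 1) > 0, as in
  \<open>div_Suc_pos\<close>; this gives both ends of the window.\<close>

definition Mark :: prog where
  "Mark = Fill 15 (Mul (Sub (Const 1) (Pos (Cell 13))) (Mul (Pos (Div (Var 27) (Add (Mul (Const 4) (Cell
      14)) (Const 1))))
     (Sub (Const 1) (Pos (Div (Var 27) (Add (Mul (Const 8) (Cell 14)) (Const 1)))))))"

text \<open>Array 19 counts the witnesses in S and 6 adds up their indices; if the count is 1, the
  sum is the witness. Pairs of other levels are updated as well, which keeps the table
  valid.\<close>

definition Extract :: prog where
  "Extract = Seq (Fill 18 (Mul (Cell 5) (Entry 16 (Var 91)))) (Seq (Matmul mp 18 12 19)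
     (Seq (Fill 18 (Mul (Cell 18) (Var 91))) (Seq (Matmul mp 18 12 6)
     (Fill 13 (Add (Mul (Eq (Cell 19) (Const 1)) (Add (Cell 6) (Const 1)))
        (Mul (Sub (Const 1) (Eq (Cell 19) (Const 1))) (Cell 13)))))))"

lemma written_Mark [simp]: "written Mark = {15, 90, 91}" by (auto simp: Mark_def)

lemma written_Extract [simp]: "a < 100 \<Longrightarrow> a \<in> written Extract \<longleftrightarrow> a
    \<in> {6, 13, 18, 19, 90, 91}"
  by (auto simp: Extract_def)

lemma div_Suc_pos: "0 < int a div (int b + 1) \<longleftrightarrow> b < a"
proof -
  have "int a div (int b + 1) = int (a div (b + 1))" by (simp add: zdiv_int add.commute)
  moreover have "0 < a div (b + 1) \<longleftrightarrow> b < a" by (simp add: div_greater_zero_iff Suc_le_eq)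
  ultimately show ?thesis by simp
qed

lemma valid_bounds: "valid w \<Longrightarrow> i < n \<Longrightarrow> j < n \<Longrightarrow> 0 \<le> w i
    j \<and> w i j \<le> int n"
  unfolding valid_def W_def by fastforce

lemma runs_Mark:
  assumes n: "s 0 0 = int n" and c: "mat n (s 14) (\<lambda>i j. int (card (W i j)))" and w: "mat n (s 13)
      w" "valid w"
    and l: "s 27 0 = 2 ^ l" "l < L + 3"
  shows "runs Mark s C (\<lambda>s'. mat n (s' 15) (\<lambda>i j. of_bool ((i, j) \<in> open_pairs l w)))"
proof -
  have lM: "\<bar>(2::int) ^ l\<bar> \<le> M"
  proof -
    have "(2::int) ^ l \<le> 2 ^ (L + 3)" using l(2) by (intro power_increasing) auto
    then have "(2::int) ^ l \<le> M" using LM(1) by (rule order_trans)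
    then show ?thesis by simp
  qed
  have "runs Mark s ((Suc n)\<^sup>2 * (5 * step_cost M)) (\<lambda>s'. mat n (s' 15) (\<lambda>i j.
      of_bool ((i, j) \<in> open_pairs l w)))"
    unfolding Mark_def
  proof (rule runs_Fill)
    fix i j s' assume ij: "i < n" "j < n" "s' 90 0 = int i" "s' 91 0 = int j"
      and f: "\<And>c. c \<noteq> 90 \<Longrightarrow> c \<noteq> 91 \<Longrightarrow> c \<noteq> 15
          \<Longrightarrow> s' c = s c"
    let ?c = "card (W i j)"
    let ?a = "Div (Var 27) (Add (Mul (Const 4) (Cell 14)) (Const 1))" and ?b = "Div (Var 27) (Add (Mul
        (Const 8) (Cell 14)) (Const 1))"
    have 13: "val s' (Cell 13) = w i j" "reads_le M s' (Cell 13)"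
      using matD[OF w(1) ij(1,2)] ij f n valid_bounds[OF w(2) ij(1,2)] nM by simp_all
    have 14: "val s' (Cell 14) = int ?c" "reads_le M s' (Cell 14)"
      using matD[OF c ij(1,2)] ij f n card_W_le_n[of i j] nM by simp_all
    have 27: "val s' (Var 27) = int (2 ^ l)" "reads_le M s' (Var 27)" using l f lM by simp_all
    have a: "val s' ?a = int (2 ^ l) div (int (4 * ?c) + 1)" "val s' ?b = int (2 ^ l) div (int (8 * ?c) + 1)"
      using 14 27 by simp_all
    have nn: "0 \<le> val s' ?a" "0 \<le> val s' ?b" unfolding a by (simp_all add: pos_imp_zdiv_nonneg_iff)
    have pos: "0 < val s' ?a \<longleftrightarrow> 4 * ?c < 2 ^ l" "0 < val s' ?b \<longleftrightarrow> 8 *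
        ?c < 2 ^ l"
      unfolding a div_Suc_pos by simp_all
    have r: "reads_le M s' ?a" "reads_le M s' ?b" using 14 27 by simp_all
    have w0: "0 \<le> val s' (Cell 13)" "0 < val s' (Cell 13) \<longleftrightarrow> w i j \<noteq> 0" using
        13 valid_bounds[OF w(2) ij(1,2)] by auto
    show "reads_le M s' (Mul (Sub (Const 1) (Pos (Cell 13))) (Mul (Pos ?a) (Sub (Const 1) (Pos ?b)))) \<and>
      val s' (Mul (Sub (Const 1) (Pos (Cell 13))) (Mul (Pos ?a) (Sub (Const 1) (Pos ?b)))) = of_bool ((i,
          j) \<in> open_pairs l w)"
      unfolding val.simps(1,4,5) reads_le.simps(1,4,5) reads_le_Pos val_Pos[OF nn(1)] val_Pos[OF nn(2)]
          val_Pos[OF w0(1)] pos w0(2)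
      using r 13(2) ij by (auto simp: open_pairs_def)
  qed (use n nM in auto)
  then show ?thesis by (rule runs_weaken) (use mm_cost_bounds in auto)
qed

lemma runs_Extract:
  assumes base: "base s" and S: "vec n (s 16) (\<lambda>k. of_bool (k \<in> S))" and w: "mat n (s 13) w"
      "valid w"
  shows "runs Extract s (5 * C) (\<lambda>s'. mat n (s' 13) (\<lambda>i j. if card (W i j \<inter> S) = 1
      then (\<Sum>k\<in>W i j \<inter> S. int k) + 1 else w i j))"
proof -
  let ?u = "step_cost M"
  have b: "s 0 0 = int n" "mat n (s 5) (\<lambda>i j. of_bool (P i j))" "mat n (s 12) (\<lambda>i j.
      of_bool (Q i j))"
    using base by (simp_all add: base_def)
  have n1: "1 \<le> M" using nM by linarith
  let ?w = "\<lambda>i j. if card (W i j \<inter> S) = 1 then (\<Sum>k\<in>W i j \<inter> S. int k) + 1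
      else w i j"
  let ?p1 = "Fill 18 (Mul (Cell 5) (Entry 16 (Var 91)))" and ?p2 = "Matmul mp 18 12 19"
  let ?p3 = "Fill 18 (Mul (Cell 18) (Var 91))" and ?p4 = "Matmul mp 18 12 6"
  let ?p5 = "Fill 13 (Add (Mul (Eq (Cell 19) (Const 1)) (Add (Cell 6) (Const 1)))
        (Mul (Sub (Const 1) (Eq (Cell 19) (Const 1))) (Cell 13)))"
  have "runs Extract s (C + (C + (C + (C + C)))) (\<lambda>s'. mat n (s' 13) ?w)"
    unfolding Extract_def
  proof (rule runs_Seq[OF _ _ order_refl])
    have "runs ?p1 s ((Suc n)\<^sup>2 * (5 * ?u)) (\<lambda>s5. mat n (s5 18) (\<lambda>i k. of_bool (P i
        k) * of_bool (k \<in> S)))"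
      by (rule runs_Fill) (use b nM n1 matD[OF b(2)] vecD[OF S] in auto)
    then show "runs ?p1 s C (\<lambda>s5. mat n (s5 18) (\<lambda>i k. of_bool (P i k) * of_bool (k \<in> S)))"
      by (rule runs_weaken) (use mm_cost_bounds in auto)
    fix s1 assume s1: "mat n (s1 18) (\<lambda>i k. of_bool (P i k) * of_bool (k \<in> S))" "\<And>a. a
        \<notin> written ?p1 \<Longrightarrow> s1 a = s a"
    have st1: "s1 0 0 = int n" "mat n (s1 12) (\<lambda>i j. of_bool (Q i j))" using s1(2) b by simp_all
    show "runs (Seq ?p2 (Seq ?p3 (Seq ?p4 ?p5))) s1 (C + (C + (C + C))) (\<lambda>s'. mat n (s' 13) ?w)"
    proof (rule runs_Seq[OF _ _ order_refl])
      have "runs ?p2 s1 C (\<lambda>s6. mat n (s6 19) (\<lambda>i j. \<Sum>k<n. of_bool (P i k) * of_bool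
          (k \<in> S) * of_bool (Q k j)))"
        by (rule runs_Matmul[OF mp st1(1) cube s1(1) _ st1(2)]) auto
      then show "runs ?p2 s1 C (\<lambda>s6. mat n (s6 19) (\<lambda>i j. int (card (W i j \<inter> S))))"
          by (simp only: count_eq)
      fix s2 assume s2: "mat n (s2 19) (\<lambda>i j. int (card (W i j \<inter> S)))" "\<And>a. a \<notin>
          written ?p2 \<Longrightarrow> s2 a = s1 a"
      have st2: "s2 0 0 = int n" "mat n (s2 12) (\<lambda>i j. of_bool (Q i j))"
        "mat n (s2 18) (\<lambda>i k. of_bool (P i k) * of_bool (k \<in> S))" "s2 13 = s 13" using s2(2) s1
            st1 by simp_all
      show "runs (Seq ?p3 (Seq ?p4 ?p5)) s2 (C + (C + C)) (\<lambda>s'. mat n (s' 13) ?w)"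
      proof (rule runs_Seq[OF _ _ order_refl])
        have "runs ?p3 s2 ((Suc n)\<^sup>2 * (5 * ?u)) (\<lambda>s5. mat n (s5 18) (\<lambda>i k. of_bool
            (P i k) * of_bool (k \<in> S) * int k))"
          by (rule runs_Fill) (use st2 nM n1 matD[OF st2(3)] in auto)
        then show "runs ?p3 s2 C (\<lambda>s5. mat n (s5 18) (\<lambda>i k. of_bool (P i k) * of_bool (k
            \<in> S) * int k))"
          by (rule runs_weaken) (use mm_cost_bounds in auto)
        fix s3 assume s3: "mat n (s3 18) (\<lambda>i k. of_bool (P i k) * of_bool (k \<in> S) * int k)"
            "\<And>a. a \<notin> written ?p3 \<Longrightarrow> s3 a = s2 a"
        have st3: "s3 0 0 = int n" "mat n (s3 12) (\<lambda>i j. of_bool (Q i j))"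
          "mat n (s3 19) (\<lambda>i j. int (card (W i j \<inter> S)))" "s3 13 = s 13" using s3(2) s2 st2
              by simp_all
        show "runs (Seq ?p4 ?p5) s3 (C + C) (\<lambda>s'. mat n (s' 13) ?w)"
        proof (rule runs_Seq[OF _ _ order_refl])
          have "runs ?p4 s3 C (\<lambda>s6. mat n (s6 6) (\<lambda>i j. \<Sum>k<n. of_bool (P i k) *
              of_bool (k \<in> S) * int k * of_bool (Q k j)))"
            by (rule runs_Matmul[OF mp st3(1) cube s3(1) _ st3(2)]) auto
          then show "runs ?p4 s3 C (\<lambda>s6. mat n (s6 6) (\<lambda>i j. \<Sum>k\<in>W i j \<inter> S.
              int k))" by (simp only: isolated_index)
          fix s4 assume s4: "mat n (s4 6) (\<lambda>i j. \<Sum>k\<in>W i j \<inter> S. int k)" "\<And>a. a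
              \<notin> written ?p4 \<Longrightarrow> s4 a = s3 a"
          have st4: "s4 0 0 = int n" "mat n (s4 19) (\<lambda>i j. int (card (W i j \<inter> S)))" "mat n
              (s4 13) w" using s4(2) st3 w by simp_all
          have sumM: "\<bar>\<Sum>k\<in>W i j \<inter> S. int k\<bar> \<le> M" if "i < n" for i j
          proof -
            have "(\<Sum>k\<in>W i j \<inter> S. int k) \<le> (\<Sum>k\<in>W i j \<inter> S. int n)" by
                (intro sum_mono) (auto simp: W_def)
            also have "\<dots> \<le> int n * int n" using card_W_le[of i j S] by (simp add: mult_right_mono)
            also have "\<dots> * 1 \<le> int n * int n * int n" using that by (intro mult_left_mono) auto
            finally have "(\<Sum>k\<in>W i j \<inter> S. int k) \<le> M" using cube by (simp add:
                power3_eq_cube)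
            moreover have "0 \<le> (\<Sum>k\<in>W i j \<inter> S. int k)" by (intro sum_nonneg) auto
            ultimately show ?thesis by linarith
          qed
          have "runs ?p5 s4 ((Suc n)\<^sup>2 * (5 * ?u)) (\<lambda>s'. mat n (s' 13) ?w)"
          proof (rule runs_Fill)
            fix i j s' assume ij: "i < n" "j < n" "s' 90 0 = int i" "s' 91 0 = int j" "s' 13 (cell n i j) =
                s4 13 (cell n i j)"
              and f: "\<And>c. c \<noteq> 90 \<Longrightarrow> c \<noteq> 91 \<Longrightarrow> c \<noteq>
                  13 \<Longrightarrow> s' c = s4 c"
            have 13: "val s' (Cell 13) = w i j" "reads_le M s' (Cell 13)"
              using matD[OF st4(3) ij(1,2)] ij f st4 valid_bounds[OF w(2) ij(1,2)] nM by simp_all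
            have 19: "val s' (Cell 19) = int (card (W i j \<inter> S))" "reads_le M s' (Cell 19)"
              using matD[OF st4(2) ij(1,2)] ij f st4 card_W_le[of i j S] nM by simp_all
            have 6: "val s' (Cell 6) = (\<Sum>k\<in>W i j \<inter> S. int k)" "reads_le M s' (Cell 6)"
              using matD[OF s4(1) ij(1,2)] ij f st4 sumM[OF ij(1), of j] nM by simp_all
            have eq: "int (card (W i j \<inter> S)) = 1 \<longleftrightarrow> card (W i j \<inter> S) = 1"
                by linarith
            show "reads_le M s' (Add (Mul (Eq (Cell 19) (Const 1)) (Add (Cell 6) (Const 1))) (Mul (Sub
                (Const 1) (Eq (Cell 19) (Const 1))) (Cell 13))) \<and>
              val s' (Add (Mul (Eq (Cell 19) (Const 1)) (Add (Cell 6) (Const 1))) (Mul (Sub (Const 1) (Eq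
                  (Cell 19) (Const 1))) (Cell 13))) = ?w i j"
              unfolding val.simps(1,3,4,5) reads_le.simps(1,3,4,5) reads_le_Eq val_Eq 13(1) 19(1) 6(1) eq
              using 13(2) 19(2) 6(2) by auto
          qed (use st4 nM in auto)
          then show "runs ?p5 s4 C (\<lambda>s'. mat n (s' 13) ?w)"
            by (rule runs_weaken) (use mm_cost_bounds in auto)
        qed
      qed
    qed
  qed
  then show ?thesis by (rule runs_weaken) auto
qed

definition Repeat :: prog where "Repeat = Seq Mark (Seq Isolate Extract)"

lemma written_Repeat [simp]:
  "a < 100 \<Longrightarrow> a \<in> written Repeat \<longleftrightarrow>
     a \<in> {6, 13, 15, 16, 17, 18, 19, 20, 32, 33, 35, 36, 37, 38, 39, 90, 91, 92, 99}"
  by (auto simp: Repeat_def)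

lemma finite_open_pairs: "finite (open_pairs l w)" "open_pairs l w \<subseteq> {..<n} \<times> {..<n}"
proof -
  show "open_pairs l w \<subseteq> {..<n} \<times> {..<n}" by (auto simp: open_pairs_def)
  then show "finite (open_pairs l w)" using finite_subset by blast
qed

text \<open>The isolated pairs receive a witness and leave \<open>open_pairs\<close>; they make up
  at least a sixteenth of it.\<close>

lemma runs_Repeat:
  assumes base: "base s" and c: "mat n (s 14) (\<lambda>i j. int (card (W i j)))" and w: "mat n (s 13) w"
      "valid w"
    and l: "s 27 0 = 2 ^ l" "s 26 0 = int l" "l < L + 3"
  shows "runs Repeat s ((L + 4) * (2 * H * H + 1) * (17 * C)) (\<lambda>s'. \<exists>w'. mat n (s' 13) w'
      \<and> valid w' \<and>
     (\<forall>i<n. \<forall>j<n. w i j \<noteq> 0 \<longrightarrow> w' i j \<noteq> 0) \<and> 16 * card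
         (open_pairs l w') \<le> 15 * card (open_pairs l w))"
proof -
  let ?V = "open_pairs l w" and ?N = "2 * H * H"
  let ?Q = "\<lambda>s'. \<exists>w'. mat n (s' 13) w' \<and> valid w' \<and>
     (\<forall>i<n. \<forall>j<n. w i j \<noteq> 0 \<longrightarrow> w' i j \<noteq> 0) \<and> 16 * card
         (open_pairs l w') \<le> 15 * card ?V"
  have n0: "s 0 0 = int n" using base by (simp add: base_def)
  have "runs Repeat s (C + ((L + 4) * (?N + 1) * (11 * C) + 5 * C)) ?Q"
    unfolding Repeat_def
  proof (rule runs_Seq[OF _ _ order_refl])
    show "runs Mark s C (\<lambda>s'. mat n (s' 15) (\<lambda>i j. of_bool ((i, j) \<in> ?V)))"
      by (rule runs_Mark[OF n0 c w l(1,3)])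
    fix s1 assume s1: "mat n (s1 15) (\<lambda>i j. of_bool ((i, j) \<in> ?V))" "\<And>a. a \<notin>
        written Mark \<Longrightarrow> s1 a = s a"
    have base1: "base s1" using base s1(2) by (simp add: base_def)
    have st1: "s1 26 0 = int l" "s1 13 = s 13" using s1(2) l by simp_all
    show "runs (Seq Isolate Extract) s1 ((L + 4) * (?N + 1) * (11 * C) + 5 * C) ?Q"
    proof (rule runs_Seq[OF _ _ order_refl])
      show "runs Isolate s1 ((L + 4) * (?N + 1) * (11 * C)) (\<lambda>s'. \<exists>S. vec n (s' 16)
          (\<lambda>k. of_bool (k \<in> S)) \<and>
        score ?V l {..<n} \<le> (4 * int E) ^ l * score ?V 0 S)"
        by (rule runs_Isolate[OF base1 s1(1) finite_open_pairs(2) l(3) st1(1)])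
      fix s2 assume ex: "\<exists>S. vec n (s2 16) (\<lambda>k. of_bool (k \<in> S)) \<and> score ?V l
          {..<n} \<le> (4 * int E) ^ l * score ?V 0 S"
        and f2: "\<And>a. a \<notin> written Isolate \<Longrightarrow> s2 a = s1 a"
      obtain S where S: "vec n (s2 16) (\<lambda>k. of_bool (k \<in> S))" "score ?V l {..<n} \<le> (4 * int
          E) ^ l * score ?V 0 S"
        using ex by blast
      have base2: "base s2" using base1 f2 by (simp add: base_def)
      have w2: "mat n (s2 13) w" using f2 st1 w by simp
      let ?w = "\<lambda>i j. if card (W i j \<inter> S) = 1 then (\<Sum>k\<in>W i j \<inter> S. int k) + 1
          else w i j"
      have single: "\<exists>k\<in>W i j. ?w i j = int k + 1" if 1: "card (W i j \<inter> S) = 1" for i j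
      proof -
        obtain k where "W i j \<inter> S = {k}" using card_1_singletonE[OF 1] by blast
        then show ?thesis using 1 by auto
      qed
      have valid: "valid ?w" unfolding valid_def
      proof (intro allI impI)
        fix i j assume "i < n" "j < n"
        then show "?w i j = 0 \<or> (\<exists>k\<in>W i j. ?w i j = int k + 1)"
          using single[of i j] w(2) unfolding valid_def by (cases "card (W i j \<inter> S) = 1") auto
      qed
      have keep: "?w i j \<noteq> 0" if "w i j \<noteq> 0" for i j using single[of i j] that by (cases
          "card (W i j \<inter> S) = 1") auto
      have "16 * card (open_pairs l ?w) \<le> 15 * card ?V"
      proof -
        let ?I = "{(i, j) \<in> ?V. card (W i j \<inter> S) = 1}"
        have I: "card ?V \<le> 16 * card ?I"
          by (rule isolated_fraction[OF finite_open_pairs(2) l(3) _ S(2)]) (auto simp: open_pairs_def)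
        have "open_pairs l ?w \<subseteq> ?V - ?I" using keep single by (fastforce simp: open_pairs_def)
        then have "card (open_pairs l ?w) \<le> card (?V - ?I)" using finite_open_pairs(1) by (intro
            card_mono) auto
        also have "\<dots> = card ?V - card ?I" using finite_open_pairs(1) by (intro card_Diff_subset)
            (auto intro: finite_subset[OF _ finite_open_pairs(1)])
        finally show ?thesis using I by linarith
      qed
      with valid keep have *: "\<And>s'. mat n (s' 13) ?w \<Longrightarrow> ?Q s'" by blast
      show "runs Extract s2 (5 * C) ?Q"
        using runs_Extract[OF base2 S(1) w2 w(2)] by (rule runs_weaken) (use * in auto)
    qed
  qed
  then show ?thesis
  proof (rule runs_weaken)
    have "6 * C * 1 \<le> 6 * C * ((L + 4) * (?N + 1))" by (intro mult_left_mono) auto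
    then show "C + ((L + 4) * (?N + 1) * (11 * C) + 5 * C) \<le> (L + 4) * (?N + 1) * (17 * C)"
      by (simp add: algebra_simps)
  qed
qed

text \<open>The constant 32 is chosen so that 4 * 15^32 \<le> 16^32. Then 32 L rounds with factor
  15/16 bring at most n^2 < 4^L pairs below one.\<close>

lemma open_pairs_eventually_empty:
  assumes "16 ^ (32 * L) * card (open_pairs l w') \<le> 15 ^ (32 * L) * card (open_pairs l w)"
  shows "open_pairs l w' = {}"
proof (rule ccontr)
  assume "open_pairs l w' \<noteq> {}"
  then have "1 \<le> card (open_pairs l w')" using finite_open_pairs(1) by (simp add: Suc_le_eq card_gt_0_iff)
  then have "16 ^ (32 * L) * 1 \<le> 16 ^ (32 * L) * card (open_pairs l w')" by (intro mult_left_mono) auto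
  also note assms
  also have "15 ^ (32 * L) * card (open_pairs l w) \<le> 15 ^ (32 * L) * (n * n)"
  proof (intro mult_left_mono)
    have "card (open_pairs l w) \<le> card ({..<n} \<times> {..<n})" using finite_open_pairs(2) by (intro
        card_mono) auto
    then show "card (open_pairs l w) \<le> n * n" by simp
  qed simp
  also have "\<dots> < 15 ^ (32 * L) * (2 ^ L * 2 ^ L)"
    using nL by (intro mult_strict_left_mono mult_strict_mono) auto
  also have "\<dots> = (15 ^ 32 * 4) ^ L"
  proof -
    have "(2::nat) ^ L * 2 ^ L = 4 ^ L" by (simp flip: power_mult_distrib)
    then show ?thesis by (simp only: power_mult power_mult_distrib)
  qed
  also have "\<dots> \<le> (16 ^ 32) ^ L" by (intro power_mono) simp_all
  finally show False by (simp only: power_mult mult_1_right less_irrefl)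
qed

definition Level :: prog where "Level = Seq (For 30 31 Repeat) (SetVar 27 (Mul (Const 2) (Var 27)))"

lemma written_Level [simp]:
  "a < 100 \<Longrightarrow> a \<in> written Level \<longleftrightarrow>
     a \<in> {6, 13, 15, 16, 17, 18, 19, 20, 27, 30, 32, 33, 35, 36, 37, 38, 39, 90, 91, 92, 99}"
  by (auto simp: Level_def)

definition level_cost :: nat where "level_cost = (32 * L + 1) * ((L + 4) * (2 * H * H + 1) * (19 * C))"

lemma runs_Level:
  assumes base: "base s" and c: "mat n (s 14) (\<lambda>i j. int (card (W i j)))" and w: "mat n (s 13) w"
      "valid w"
    and l: "s 27 0 = 2 ^ l" "s 26 0 = int l" "l < L + 3" and r: "s 31 0 = int (32 * L)"
  shows "runs Level s level_cost (\<lambda>s'. s' 27 0 = 2 ^ Suc l \<and> (\<exists>w'. mat n (s' 13) w'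
      \<and> valid w' \<and>
     (\<forall>i<n. \<forall>j<n. w i j \<noteq> 0 \<longrightarrow> w' i j \<noteq> 0) \<and> open_pairs l
         w' = {}))"
proof -
  let ?u = "step_cost M" and ?B = "(L + 4) * (2 * H * H + 1) * (17 * C)"
  define J where "J t s' \<longleftrightarrow> (\<exists>w'. mat n (s' 13) w' \<and> valid w' \<and>
      (\<forall>i<n. \<forall>j<n. w i j \<noteq> 0 \<longrightarrow> w' i j \<noteq> 0) \<and>
     16 ^ t * card (open_pairs l w') \<le> 15 ^ t * card (open_pairs l w))" for t and s' :: store
  have RM: "int (32 * L) \<le> M" using LM by simp
  have "runs Level s (Suc (32 * L) * (?B + 2 * ?u) + ?u) (\<lambda>s'. s' 27 0 = 2 ^ Suc l \<and> J (32 *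
      L) s')"
    unfolding Level_def
  proof (rule runs_Seq[OF _ _ order_refl])
    show "runs (For 30 31 Repeat) s (Suc (32 * L) * (?B + 2 * ?u)) (J (32 * L))"
    proof (rule runs_For[where s = s and Inv = J, OF r RM])
      show "J 0 s" unfolding J_def using w by (intro exI[of _ w]) simp
      show "J i (s'(30 := x))" if "J i s'" for i s' x using that unfolding J_def by simp
      fix t s1 assume t: "J t s1" and f1: "\<And>c. c \<noteq> 30 \<Longrightarrow> c \<notin> written
          Repeat \<Longrightarrow> s1 c = s c"
      obtain w1 where w1: "mat n (s1 13) w1" "valid w1" "\<And>i j. i < n \<Longrightarrow> j < n
          \<Longrightarrow> w i j \<noteq> 0 \<Longrightarrow> w1 i j \<noteq> 0"
        "16 ^ t * card (open_pairs l w1) \<le> 15 ^ t * card (open_pairs l w)" using t unfolding J_def by blast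
      have base1: "base s1" using base f1 by (simp add: base_def)
      have st1: "mat n (s1 14) (\<lambda>i j. int (card (W i j)))" "s1 27 0 = 2 ^ l" "s1 26 0 = int l"
          using f1 c l by simp_all
      from runs_Repeat[OF base1 st1(1) w1(1,2) st1(2,3) l(3)] show "runs Repeat s1 ?B (J (Suc t))"
      proof (rule runs_weaken)
        fix s2 :: store assume "\<exists>w'. mat n (s2 13) w' \<and> valid w' \<and> (\<forall>i<n.
            \<forall>j<n. w1 i j \<noteq> 0 \<longrightarrow> w' i j \<noteq> 0) \<and>
          16 * card (open_pairs l w') \<le> 15 * card (open_pairs l w1)"
        then obtain w2 where w2: "mat n (s2 13) w2" "valid w2" "\<And>i j. i < n \<Longrightarrow> j < n
            \<Longrightarrow> w1 i j \<noteq> 0 \<Longrightarrow> w2 i j \<noteq> 0"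
          "16 * card (open_pairs l w2) \<le> 15 * card (open_pairs l w1)" by blast
        have "16 ^ Suc t * card (open_pairs l w2) = 16 ^ t * (16 * card (open_pairs l w2))" by simp
        also have "\<dots> \<le> 16 ^ t * (15 * card (open_pairs l w1))" using w2(4) by (rule
            mult_left_mono) simp
        also have "\<dots> = 15 * (16 ^ t * card (open_pairs l w1))" by simp
        also have "\<dots> \<le> 15 * (15 ^ t * card (open_pairs l w))" using w1(4) by (rule
            mult_left_mono) simp
        finally have "16 ^ Suc t * card (open_pairs l w2) \<le> 15 ^ Suc t * card (open_pairs l w)" by simp
        then show "J (Suc t) s2" unfolding J_def using w2(1-3) w1(3) by blast
      qed simp
    qed auto
    fix s1 assume s1: "J (32 * L) s1" "\<And>a. a \<notin> written (For 30 31 Repeat) \<Longrightarrow> s1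
        a = s a"
    have 27: "s1 27 0 = 2 ^ l" using s1(2)[of 27] l by simp
    have "(2::int) ^ l \<le> 2 ^ (L + 3)" using l(3) by (intro power_increasing) auto
    then have "(2::int) ^ l \<le> M" using LM(1) by (rule order_trans)
    then have lM: "\<bar>(2::int) ^ l\<bar> \<le> M" by simp
    have "J (32 * L) (s1(27 := x))" for x using s1(1) unfolding J_def by simp
    then show "runs (SetVar 27 (Mul (Const 2) (Var 27))) s1 ?u (\<lambda>s'. s' 27 0 = 2 ^ Suc l \<and> J
        (32 * L) s')"
      using 27 lM by (intro runs_Assign) auto
  qed
  then show ?thesis
  proof (rule runs_weaken)
    let ?X = "(L + 4) * (2 * H * H + 1)"
    have u: "16 * ?u \<le> C" by (rule mm_cost_bounds(4))
    have X: "C * 1 \<le> C * ?X" by (intro mult_left_mono) auto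
    have "Suc (32 * L) * (?B + 2 * ?u) + ?u \<le> Suc (32 * L) * (?B + 2 * ?u) + Suc (32 * L) * ?u" by simp
    also have "\<dots> = Suc (32 * L) * (?B + 3 * ?u)" by (simp add: algebra_simps)
    also have "\<dots> \<le> Suc (32 * L) * (?X * (19 * C))"
    proof (rule mult_left_mono)
      have "3 * ?u \<le> C * ?X" using u X by linarith
      moreover have "?X * (19 * C) = ?B + 2 * (C * ?X)" by (simp add: algebra_simps)
      ultimately show "?B + 3 * ?u \<le> ?X * (19 * C)" by linarith
    qed simp
    finally show "Suc (32 * L) * (?B + 2 * ?u) + ?u \<le> level_cost" by (simp add: level_cost_def)
    fix s' assume "s' 27 0 = 2 ^ Suc l \<and> J (32 * L) s'"
    then show "s' 27 0 = 2 ^ Suc l \<and> (\<exists>w'. mat n (s' 13) w' \<and> valid w' \<and>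
       (\<forall>i<n. \<forall>j<n. w i j \<noteq> 0 \<longrightarrow> w' i j \<noteq> 0) \<and> open_pairs
           l w' = {})"
      unfolding J_def using open_pairs_eventually_empty by blast
  qed
qed

definition Witness :: prog where
  "Witness = Seq (Matmul mp 5 12 14) (Seq (Fill 13 (Const 0)) (Seq (SetVar 27 (Const 1)) (For 26 29 Level)))"

lemma written_Witness [simp]:
  "a < 100 \<Longrightarrow> a \<in> written Witness \<longleftrightarrow>
     a \<in> {6, 13, 14, 15, 16, 17, 18, 19, 20, 26, 27, 30, 32, 33, 35, 36, 37, 38, 39, 90, 91, 92, 99}"
  by (auto simp: Witness_def)

lemma runs_Witness:
  assumes base: "base s" and r: "s 31 0 = int (32 * L)" "s 29 0 = int (L + 3)"
  shows "runs Witness s ((L + 4) * (level_cost + 4 * C)) (\<lambda>s'. \<exists>w. mat n (s' 13) w \<and>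
      valid w \<and>
     (\<forall>i<n. \<forall>j<n. W i j \<noteq> {} \<longrightarrow> w i j \<noteq> 0))"
proof -
  let ?u = "step_cost M"
  define J where "J l s' \<longleftrightarrow> s' 27 0 = 2 ^ l \<and> (\<exists>w. mat n (s' 13) w \<and>
      valid w \<and> (\<forall>l'<l. open_pairs l' w = {}))"
    for l and s' :: store
  have b: "s 0 0 = int n" "mat n (s 5) (\<lambda>i j. of_bool (P i j))" "mat n (s 12) (\<lambda>i j.
      of_bool (Q i j))"
    using base by (simp_all add: base_def)
  have "runs Witness s (C + (C + (?u + Suc (L + 3) * (level_cost + 2 * ?u)))) (J (L + 3))"
    unfolding Witness_def
  proof (rule runs_Seq[OF _ _ order_refl])
    have eq: "(\<Sum>k<n. of_bool (P i k) * of_bool (Q k j)) = int (card (W i j))" for i j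
      using count_eq[of i UNIV j] by simp
    have "runs (Matmul mp 5 12 14) s C (\<lambda>s1. mat n (s1 14) (\<lambda>i j. \<Sum>k<n. of_bool (P i
        k) * of_bool (Q k j)))"
      by (rule runs_Matmul[OF mp b(1) cube b(2) _ b(3)]) auto
    then show "runs (Matmul mp 5 12 14) s C (\<lambda>s1. mat n (s1 14) (\<lambda>i j. int (card (W i
        j))))" by (simp only: eq)
    fix s1 assume s1: "mat n (s1 14) (\<lambda>i j. int (card (W i j)))" "\<And>a. a \<notin> written
        (Matmul mp 5 12 14) \<Longrightarrow> s1 a = s a"
    have base1: "base s1" using base s1(2) by (simp add: base_def)
    have r1: "s1 31 0 = int (32 * L)" "s1 29 0 = int (L + 3)" using s1(2) r by simp_all
    show "runs (Seq (Fill 13 (Const 0)) (Seq (SetVar 27 (Const 1)) (For 26 29 Level))) s1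
        (C + (?u + Suc (L + 3) * (level_cost + 2 * ?u))) (J (L + 3))"
    proof (rule runs_Seq[OF _ _ order_refl])
      have "runs (Fill 13 (Const 0)) s1 ((Suc n)\<^sup>2 * (5 * ?u)) (\<lambda>s2. mat n (s2 13)
          (\<lambda>i j. 0))"
        by (rule runs_Fill) (use base1 nM in \<open>auto simp: base_def\<close>)
      then show "runs (Fill 13 (Const 0)) s1 C (\<lambda>s2. mat n (s2 13) (\<lambda>i j. 0))"
        by (rule runs_weaken) (use mm_cost_bounds in auto)
      fix s2 assume s2: "mat n (s2 13) (\<lambda>i j. 0)" "\<And>a. a \<notin> written (Fill 13 (Const 0))
          \<Longrightarrow> s2 a = s1 a"
      have base2: "base s2" using base1 s2(2) by (simp add: base_def)
      have r2: "s2 31 0 = int (32 * L)" "s2 29 0 = int (L + 3)" "s2 14 = s1 14" using s2(2) r1 by simp_all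
      show "runs (Seq (SetVar 27 (Const 1)) (For 26 29 Level)) s2 (?u + Suc (L + 3) * (level_cost + 2 *
          ?u)) (J (L + 3))"
      proof (rule runs_Seq[OF _ _ order_refl])
        show "runs (SetVar 27 (Const 1)) s2 ?u (\<lambda>s3. s3 27 0 = 1)" by (intro runs_Assign) auto
        fix s3 assume s3: "s3 27 0 = 1" "\<And>a. a \<notin> written (SetVar 27 (Const 1))
            \<Longrightarrow> s3 a = s2 a"
        have base3: "base s3" using base2 s3(2) by (simp add: base_def)
        have r3: "s3 31 0 = int (32 * L)" "s3 29 0 = int (L + 3)" "s3 14 = s1 14" "s3 13 = s2 13" using
            s3(2) r2 by simp_all
        have LM3: "int (L + 3) \<le> M" using LM by simp
        show "runs (For 26 29 Level) s3 (Suc (L + 3) * (level_cost + 2 * ?u)) (J (L + 3))"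
        proof (rule runs_For[where s = s3 and Inv = J, OF r3(2) LM3])
          show "J 0 s3" unfolding J_def using s3(1) r3 s2(1) by (auto simp: valid_def intro!: exI[of _
              "\<lambda>i j. 0"])
          show "J i (s'(26 := x))" if "J i s'" for i s' x using that unfolding J_def by simp
          fix l s4 assume l: "l < L + 3" "J l s4" "s4 26 0 = int l"
            and f4: "\<And>c. c \<noteq> 26 \<Longrightarrow> c \<notin> written Level \<Longrightarrow> s4
                c = s3 c"
          have base4: "base s4" using base3 f4 by (simp add: base_def)
          have r4: "s4 31 0 = int (32 * L)" "mat n (s4 14) (\<lambda>i j. int (card (W i j)))" using f4 r3
              s1(1) by simp_all
          obtain w where w: "s4 27 0 = 2 ^ l" "mat n (s4 13) w" "valid w" "\<And>l'. l' < l
              \<Longrightarrow> open_pairs l' w = {}"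
            using l(2) unfolding J_def by blast
          from runs_Level[OF base4 r4(2) w(2,3,1) l(3,1) r4(1)] show "runs Level s4 level_cost (J (Suc l))"
          proof (rule runs_weaken)
            fix s5 :: store assume "s5 27 0 = 2 ^ Suc l \<and> (\<exists>w'. mat n (s5 13) w' \<and> valid
                w' \<and>
              (\<forall>i<n. \<forall>j<n. w i j \<noteq> 0 \<longrightarrow> w' i j \<noteq> 0) \<and>
                  open_pairs l w' = {})"
            then obtain w' where w': "s5 27 0 = 2 ^ Suc l" "mat n (s5 13) w'" "valid w'"
              "\<And>i j. i < n \<Longrightarrow> j < n \<Longrightarrow> w i j \<noteq> 0
                  \<Longrightarrow> w' i j \<noteq> 0" "open_pairs l w' = {}" by blast
            \<comment> \<open>Resolved pairs stay resolved, so levels emptied earlier remain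
              empty.\<close>
            have "open_pairs l' w' \<subseteq> open_pairs l' w" for l' using w'(4) by (fastforce simp:
                open_pairs_def)
            then have "\<forall>l'<Suc l. open_pairs l' w' = {}" using w(4) w'(5) by (fastforce simp:
                less_Suc_eq)
            then show "J (Suc l) s5" unfolding J_def using w'(1-3) by blast
          qed simp
        qed auto
      qed
    qed
  qed
  then show ?thesis
  proof (rule runs_weaken)
    have u: "16 * ?u \<le> C" by (rule mm_cost_bounds(4))
    have "C + (C + (?u + Suc (L + 3) * (level_cost + 2 * ?u))) \<le> C + (C + (C + (L + 4) * (level_cost + C)))"
      using u by (intro add_mono mult_mono) auto
    also have "\<dots> \<le> (L + 4) * (level_cost + 4 * C)" by (simp add: algebra_simps)
    finally show "C + (C + (?u + Suc (L + 3) * (level_cost + 2 * ?u))) \<le> (L + 4) * (level_cost + 4 * C)" .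
    fix s' assume "J (L + 3) s'"
    then obtain w where w: "mat n (s' 13) w" "valid w" "\<And>l. l < L + 3 \<Longrightarrow> open_pairs l w
        = {}" unfolding J_def by blast
    have "w i j \<noteq> 0" if ij: "i < n" "j < n" "W i j \<noteq> {}" for i j
    proof
      assume "w i j = 0"
      \<comment> \<open>The level of a pair is the bit length of 4 x. As x \<le> n < 2^L it is at
        most L + 2, which explains the number of levels.\<close>
      let ?x = "card (W i j)" and ?l = "floorlog 2 (4 * card (W i j))"
      have x: "0 < ?x" using ij(3) by (simp add: card_gt_0_iff)
      have fl: "2 ^ (?l - 1) \<le> 4 * ?x" "4 * ?x < 2 ^ ?l" using floorlog_bounds[of "4 * ?x" 2] x by auto
      have l0: "0 < ?l" using x by (simp add: floorlog_eq_zero_iff neq0_conv[symmetric] del: neq0_conv)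
      have "4 * ?x < 2 ^ (L + 2)" using card_W_le_n[of i j] nL by (simp add: power_add)
      then have "?l < L + 3" using floorlog_leI[of "4 * ?x" 2 "L + 2"] by simp
      moreover have "(2::nat) ^ ?l = 2 * 2 ^ (?l - 1)" using l0 by (metis Suc_diff_1 power_Suc)
      then have "(i, j) \<in> open_pairs ?l w" using fl ij \<open>w i j = 0\<close> by (simp add:
          open_pairs_def)
      ultimately show False using w(3) by blast
    qed
    with w(1,2) show "\<exists>w. mat n (s' 13) w \<and> valid w \<and> (\<forall>i<n. \<forall>j<n. W i j
        \<noteq> {} \<longrightarrow> w i j \<noteq> 0)" by blast
  qed
qed

end

section \<open>Parameters\<close>

definition logn :: "nat \<Rightarrow> nat" where "logn n = floorlog 2 n"
definition expo :: "nat \<Rightarrow> nat" where "expo n = 2 * logn n + 4"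
text \<open>Minimality keeps 2^m below twice the fourth power and thus the number of hash functions
  polylogarithmic.\<close>

definition hbits :: "nat \<Rightarrow> nat" where "hbits n = (LEAST m. expo n ^ 4 \<le> 2 ^ m)"
text \<open>Dominates every array entry that the program reads.\<close>

definition vbound :: "nat \<Rightarrow> int" where
  "vbound n = (int n + 1) ^ 3 + 2 * 2 ^ hbits n * 2 ^ hbits n + 2 ^ (logn n + 3) + (32 * int (logn n) + 3) +
     2 * (2 * int (expo n)) ^ (logn n + 3) * (int n + 1) ^ 4"

lemma less_power_logn: "i < logn n \<longleftrightarrow> 2 ^ i \<le> n"
  unfolding logn_def using floorlog_le_iff[of 2 n i] by (auto simp: not_le not_less)

lemma hbits_least: "i < hbits n \<longleftrightarrow> 2 ^ i < expo n ^ 4"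
proof -
  have "expo n ^ 4 \<le> 2 ^ (expo n ^ 4)" by (simp add: less_imp_le)
  then have *: "expo n ^ 4 \<le> 2 ^ hbits n" unfolding hbits_def by (rule LeastI)
  show ?thesis
  proof
    assume "i < hbits n"
    then show "2 ^ i < expo n ^ 4" unfolding hbits_def using not_less_Least not_le by blast
  next
    assume i: "2 ^ i < expo n ^ 4"
    show "i < hbits n"
    proof (rule ccontr)
      assume "\<not> i < hbits n"
      then have "(2::nat) ^ hbits n \<le> 2 ^ i" by (intro power_increasing) auto
      with * i show False by linarith
    qed
  qed
qed

lemma vbound_facts:
  shows "int n < vbound n" "int n ^ 3 \<le> vbound n" "2 * 2 ^ hbits n * 2 ^ hbits n \<le> vbound n"
    "2 ^ (logn n + 3) \<le> vbound n" "32 * int (logn n) + 3 \<le> vbound n"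
    "2 * (2 * int (expo n)) ^ (logn n + 3) * int n ^ 4 \<le> vbound n" "(2 * int (expo n)) ^ (logn n + 3)
        \<le> vbound n"
proof -
  let ?a = "(int n + 1) ^ 3" and ?b = "2 * 2 ^ hbits n * 2 ^ hbits n :: int" and ?c = "2 ^ (logn n + 3) :: int"
  let ?p = "(2 * int (expo n)) ^ (logn n + 3)"
  have nn: "0 \<le> ?a" "0 \<le> ?b" "0 \<le> ?c" "0 \<le> ?p" by simp_all
  have n1: "1 \<le> (int n + 1) ^ 4" by simp
  have e: "2 * ?p * int n ^ 4 \<le> 2 * ?p * (int n + 1) ^ 4" by (intro mult_left_mono power_mono) auto
  have e0: "0 \<le> 2 * ?p * (int n + 1) ^ 4" by simp
  have "?p * 1 \<le> 2 * ?p * (int n + 1) ^ 4" using n1 nn by (intro mult_mono) auto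
  then have p: "?p \<le> 2 * ?p * (int n + 1) ^ 4" by simp
  have n3: "int n ^ 3 \<le> ?a" by (intro power_mono) auto
  have n1: "int n < ?a" using self_le_power[of "int n + 1" 3] by simp
  note * = nn e0 vbound_def[of n]
  show "int n < vbound n" using n1 * by linarith
  show "int n ^ 3 \<le> vbound n" using n3 * by linarith
  show "?b \<le> vbound n" using * by linarith
  show "?c \<le> vbound n" using * by linarith
  show "32 * int (logn n) + 3 \<le> vbound n" using * by linarith
  show "2 * ?p * int n ^ 4 \<le> vbound n" using e * by linarith
  show "?p \<le> vbound n" using p * by linarith
qed

lemma less_2_power_logn: "n < 2 ^ logn n"
  using less_power_logn[of "logn n" n] by simp

lemma expo_le_hash: "expo n ^ 4 \<le> 2 ^ hbits n"
  using hbits_least[of "hbits n" n] by simp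

lemma witness_settingI:
  assumes "multiplies n mp T"
  shows "witness_setting n (logn n) (expo n) (hbits n) T (vbound n) mp"
  using assms vbound_facts[of n] less_2_power_logn[of n] expo_le_hash[of n]
  by unfold_locales (auto simp: expo_def)

section \<open>Computing the parameters\<close>

definition Log :: prog where
  "Log = Seq (SetVar 3 (Const 0)) (Seq (SetVar 9 (Const 1)) (While (Sub (Add (Var 0) (Const 1)) (Var 9))
     (Seq (SetVar 9 (Mul (Const 2) (Var 9))) (SetVar 3 (Add (Var 3) (Const 1))))))"

lemma written_Log [simp]: "written Log = {3, 9}" by (auto simp: Log_def)

lemma runs_Log:
  assumes n: "s 0 0 = int n"
  shows "runs Log s ((3 * logn n + 3) * step_cost (vbound n)) (\<lambda>s'. s' 3 0 = int (logn n))"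
proof -
  let ?M = "vbound n" and ?u = "step_cost (vbound n)"
  have pM: "(2::int) ^ i \<le> ?M" if "i \<le> logn n" for i
  proof -
    have "(2::int) ^ i \<le> 2 ^ (logn n + 3)" using that by (intro power_increasing) auto
    then show ?thesis using vbound_facts(4)[of n] by linarith
  qed
  let ?w = "While (Sub (Add (Var 0) (Const 1)) (Var 9))
     (Seq (SetVar 9 (Mul (Const 2) (Var 9))) (SetVar 3 (Add (Var 3) (Const 1))))"
  let ?J = "\<lambda>i s'. s' 0 0 = int n \<and> s' 9 0 = 2 ^ i \<and> s' 3 0 = int i"
  have "runs Log s (?u + (?u + (logn n * ((?u + ?u) + ?u) + ?u))) (?J (logn n))"
    unfolding Log_def
  proof (rule runs_Seq[OF _ _ order_refl])
    show "runs (SetVar 3 (Const 0)) s ?u (\<lambda>s1. s1 3 0 = 0)" by (intro runs_Assign) auto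
    fix s1 assume s1: "s1 3 0 = 0" "\<And>a. a \<notin> written (SetVar 3 (Const 0)) \<Longrightarrow> s1 a
        = s a"
    show "runs (Seq (SetVar 9 (Const 1)) ?w) s1 (?u + (logn n * ((?u + ?u) + ?u) + ?u)) (?J (logn n))"
    proof (rule runs_Seq[OF _ _ order_refl])
      show "runs (SetVar 9 (Const 1)) s1 ?u (\<lambda>s2. s2 9 0 = 1)" by (intro runs_Assign) auto
      fix s2 assume s2: "s2 9 0 = 1" "\<And>a. a \<notin> written (SetVar 9 (Const 1)) \<Longrightarrow> s2
          a = s1 a"
      show "runs ?w s2 (logn n * ((?u + ?u) + ?u) + ?u) (?J (logn n))"
      proof (rule runs_While[where Inv = ?J])
        show "?J 0 s2" using s1 s2 n by simp
        show "reads_le ?M s' (Sub (Add (Var 0) (Const 1)) (Var 9)) \<and>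
          (0 < val s' (Sub (Add (Var 0) (Const 1)) (Var 9))) = (i < logn n)"
          if "i \<le> logn n" "?J i s'" for i s'
        proof -
          have "(2::int) ^ i \<le> int n \<longleftrightarrow> 2 ^ i \<le> n" by (metis of_nat_le_iff
              of_nat_numeral of_nat_power)
          then have "0 < int n + 1 - 2 ^ i \<longleftrightarrow> i < logn n" unfolding less_power_logn by
              linarith
          then show ?thesis using that pM[OF that(1)] vbound_facts(1)[of n] by simp
        qed
        fix i and s' :: store assume i: "i < logn n" "?J i s'"
        show "runs (Seq (SetVar 9 (Mul (Const 2) (Var 9))) (SetVar 3 (Add (Var 3) (Const 1)))) s' (?u + ?u)
            (?J (Suc i))"
        proof (rule runs_Seq[OF _ _ order_refl])
          show "runs (SetVar 9 (Mul (Const 2) (Var 9))) s' ?u (\<lambda>s3. s3 9 0 = 2 ^ Suc i)"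
            using i pM[of i] by (intro runs_Assign) auto
          fix s3 assume s3: "s3 9 0 = 2 ^ Suc i" "\<And>a. a \<notin> written (SetVar 9 (Mul (Const 2) (Var
              9))) \<Longrightarrow> s3 a = s' a"
          show "runs (SetVar 3 (Add (Var 3) (Const 1))) s3 ?u (?J (Suc i))"
            using s3 i vbound_facts(5)[of n] by (intro runs_Assign) auto
        qed
      qed simp
    qed
  qed
  then show ?thesis by (rule runs_weaken) (auto simp: algebra_simps)
qed

definition Hash_size :: prog where
  "Hash_size = Seq (SetVar 23 (Add (Mul (Const 2) (Var 3)) (Const 4))) (Seq (SetVar 22 (Const 1))
     (While (Sub (Mul (Mul (Var 23) (Var 23)) (Mul (Var 23) (Var 23))) (Var 22)) (SetVar 22 (Mul (Const 2)
         (Var 22)))))"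

lemma written_Hash_size [simp]: "written Hash_size = {22, 23}" by (auto simp: Hash_size_def)

lemma expo_le_vbound: "int (expo n) \<le> vbound n"
proof -
  have "2 * int (expo n) \<le> (2 * int (expo n)) ^ (logn n + 3)" by (intro self_le_power) (auto simp: expo_def)
  then show ?thesis using vbound_facts(7)[of n] by linarith
qed

lemma hash_le_vbound: "2 ^ hbits n \<le> vbound n"
proof -
  have "(2::int) ^ hbits n * 1 \<le> 2 ^ hbits n * 2 ^ hbits n" by (intro mult_left_mono) auto
  moreover have "(0::int) \<le> 2 ^ hbits n * 2 ^ hbits n" by simp
  ultimately show ?thesis using vbound_facts(3)[of n] unfolding mult.assoc by linarith
qed

lemma runs_Hash_size:
  assumes L: "s 3 0 = int (logn n)"
  shows "runs Hash_size s ((2 * hbits n + 3) * step_cost (vbound n)) (\<lambda>s'. s' 23 0 = int (expo n)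
      \<and> s' 22 0 = 2 ^ hbits n)"
proof -
  let ?M = "vbound n" and ?u = "step_cost (vbound n)"
  let ?w = "While (Sub (Mul (Mul (Var 23) (Var 23)) (Mul (Var 23) (Var 23))) (Var 22)) (SetVar 22 (Mul
      (Const 2) (Var 22)))"
  let ?J = "\<lambda>i s'. s' 23 0 = int (expo n) \<and> s' 22 0 = 2 ^ i"
  have pM: "(2::int) ^ i \<le> ?M" if "i \<le> hbits n" for i
  proof -
    have "(2::int) ^ i \<le> 2 ^ hbits n" using that by (intro power_increasing) auto
    then show ?thesis using hash_le_vbound[of n] by linarith
  qed
  have "runs Hash_size s (?u + (?u + (hbits n * (?u + ?u) + ?u))) (?J (hbits n))"
    unfolding Hash_size_def
  proof (rule runs_Seq[OF _ _ order_refl])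
    show "runs (SetVar 23 (Add (Mul (Const 2) (Var 3)) (Const 4))) s ?u (\<lambda>s1. s1 23 0 = int (expo n))"
      using L vbound_facts(5)[of n] by (intro runs_Assign) (auto simp: expo_def)
    fix s1 assume s1: "s1 23 0 = int (expo n)"
      "\<And>a. a \<notin> written (SetVar 23 (Add (Mul (Const 2) (Var 3)) (Const 4))) \<Longrightarrow> s1
          a = s a"
    show "runs (Seq (SetVar 22 (Const 1)) ?w) s1 (?u + (hbits n * (?u + ?u) + ?u)) (?J (hbits n))"
    proof (rule runs_Seq[OF _ _ order_refl])
      show "runs (SetVar 22 (Const 1)) s1 ?u (\<lambda>s2. s2 22 0 = 1)" by (intro runs_Assign) auto
      fix s2 assume s2: "s2 22 0 = 1" "\<And>a. a \<notin> written (SetVar 22 (Const 1)) \<Longrightarrow>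
          s2 a = s1 a"
      show "runs ?w s2 (hbits n * (?u + ?u) + ?u) (?J (hbits n))"
      proof (rule runs_While[where Inv = ?J])
        show "?J 0 s2" using s1 s2 by simp
        show "reads_le ?M s' (Sub (Mul (Mul (Var 23) (Var 23)) (Mul (Var 23) (Var 23))) (Var 22)) \<and>
          (0 < val s' (Sub (Mul (Mul (Var 23) (Var 23)) (Mul (Var 23) (Var 23))) (Var 22))) = (i < hbits n)"
          if "i \<le> hbits n" "?J i s'" for i s'
        proof -
          have "(2::int) ^ i < int (expo n) ^ 4 \<longleftrightarrow> 2 ^ i < expo n ^ 4"
            by (metis of_nat_less_iff of_nat_numeral of_nat_power)
          then have "0 < int (expo n) * int (expo n) * (int (expo n) * int (expo n)) - 2 ^ i
              \<longleftrightarrow> i < hbits n"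
            unfolding hbits_least by (simp add: power4_eq_xxxx mult.assoc)
          then show ?thesis using that pM[OF that(1)] expo_le_vbound[of n] by simp
        qed
        show "runs (SetVar 22 (Mul (Const 2) (Var 22))) s' ?u (?J (Suc i))" if "i < hbits n" "?J i s'" for i s'
          using that pM[of i] by (intro runs_Assign) auto
      qed simp
    qed
  qed
  then show ?thesis by (rule runs_weaken) (auto simp: algebra_simps)
qed

definition Powers :: prog where
  "Powers = Seq (SetVar 24 (Const 1)) (Seq (SetVar 25 (Const 1)) (For 94 29
     (Seq (Assign 24 (Add (Var 94) (Const 1)) (Mul (Entry 24 (Var 94)) (Mul (Const 2) (Var 23))))
        (Assign 25 (Add (Var 94) (Const 1)) (Mul (Entry 25 (Var 94)) (Add (Var 23) (Const 1)))))))"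

lemma written_Powers [simp]: "written Powers = {24, 25, 94}" by (auto simp: Powers_def)

lemma runs_Powers:
  assumes L: "s 29 0 = int (logn n + 3)" and E: "s 23 0 = int (expo n)"
  shows "runs Powers s ((4 * logn n + 18) * step_cost (vbound n)) (\<lambda>s'. vec (logn n + 3) (s' 24)
      (\<lambda>i. (2 * int (expo n)) ^ i) \<and>
     vec (logn n + 3) (s' 25) (\<lambda>i. (int (expo n) + 1) ^ i))"
proof -
  let ?M = "vbound n" and ?u = "step_cost (vbound n)" and ?E = "int (expo n)"
  let ?body = "Seq (Assign 24 (Add (Var 94) (Const 1)) (Mul (Entry 24 (Var 94)) (Mul (Const 2) (Var 23))))
        (Assign 25 (Add (Var 94) (Const 1)) (Mul (Entry 25 (Var 94)) (Add (Var 23) (Const 1))))"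
  let ?J = "\<lambda>i s'. \<forall>c\<le>i. s' 24 (int c) = (2 * ?E) ^ c \<and> s' 25 (int c) = (?E + 1) ^ c"
  have pM: "(2 * ?E) ^ i \<le> ?M" "(?E + 1) ^ i \<le> ?M" if "i < logn n + 3" for i
  proof -
    have "(2 * ?E) ^ i \<le> (2 * ?E) ^ (logn n + 3)" using that by (intro power_increasing) (auto simp:
        expo_def)
    then show "(2 * ?E) ^ i \<le> ?M" using vbound_facts(7)[of n] by linarith
    moreover have "(?E + 1) ^ i \<le> (2 * ?E) ^ i" by (intro power_mono) (auto simp: expo_def)
    ultimately show "(?E + 1) ^ i \<le> ?M" by linarith
  qed
  have LM: "int (logn n + 3) \<le> ?M" using vbound_facts(5)[of n] by simp
  have "runs Powers s (?u + (?u + Suc (logn n + 3) * ((?u + ?u) + 2 * ?u))) (?J (logn n + 3))"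
    unfolding Powers_def
  proof (rule runs_Seq[OF _ _ order_refl])
    show "runs (SetVar 24 (Const 1)) s ?u (\<lambda>s1. s1 24 0 = 1)" by (intro runs_Assign) auto
    fix s1 assume s1: "s1 24 0 = 1" "\<And>a. a \<notin> written (SetVar 24 (Const 1)) \<Longrightarrow> s1
        a = s a"
    show "runs (Seq (SetVar 25 (Const 1)) (For 94 29 ?body)) s1 (?u + Suc (logn n + 3) * ((?u + ?u) + 2 *
        ?u)) (?J (logn n + 3))"
    proof (rule runs_Seq[OF _ _ order_refl])
      show "runs (SetVar 25 (Const 1)) s1 ?u (\<lambda>s2. s2 25 0 = 1)" by (intro runs_Assign) auto
      fix s2 assume s2: "s2 25 0 = 1" "\<And>a. a \<notin> written (SetVar 25 (Const 1)) \<Longrightarrow>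
          s2 a = s1 a"
      have st2: "s2 29 0 = int (logn n + 3)" "s2 23 0 = ?E" using s1 s2 L E by simp_all
      show "runs (For 94 29 ?body) s2 (Suc (logn n + 3) * ((?u + ?u) + 2 * ?u)) (?J (logn n + 3))"
      proof (rule runs_For[where s = s2 and Inv = ?J, OF st2(1) LM])
        show "?J 0 s2" using s1 s2 by simp
        fix i s3 assume i: "i < logn n + 3" "?J i s3" "s3 94 0 = int i"
          and f3: "\<And>c. c \<noteq> 94 \<Longrightarrow> c \<notin> written ?body \<Longrightarrow> s3 c
              = s2 c"
        have 23: "s3 23 0 = ?E" using f3 st2 by simp
        have iM: "int i \<le> ?M" using i(1) LM by linarith
        show "runs ?body s3 (?u + ?u) (?J (Suc i))"
        proof (rule runs_Seq[OF _ _ order_refl])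
          show "runs (Assign 24 (Add (Var 94) (Const 1)) (Mul (Entry 24 (Var 94)) (Mul (Const 2) (Var
              23)))) s3 ?u
             (\<lambda>s4. s4 24 = (s3 24)(int i + 1 := (2 * ?E) ^ Suc i))"
            using i pM(1)[OF i(1)] 23 expo_le_vbound[of n] iM by (intro runs_Assign) (auto simp: mult.commute)
          fix s4 assume s4: "s4 24 = (s3 24)(int i + 1 := (2 * ?E) ^ Suc i)"
            "\<And>a. a \<notin> written (Assign 24 (Add (Var 94) (Const 1)) (Mul (Entry 24 (Var 94)) (Mul
                (Const 2) (Var 23)))) \<Longrightarrow> s4 a = s3 a"
          have st4: "s4 94 0 = int i" "s4 23 0 = ?E" "s4 25 = s3 25" using s4(2) i 23 by simp_all
          show "runs (Assign 25 (Add (Var 94) (Const 1)) (Mul (Entry 25 (Var 94)) (Add (Var 23) (Const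
              1)))) s4 ?u (?J (Suc i))"
          proof (rule runs_Assign)
            show "?J (Suc i) (s4(25 := (s4 25)(val s4 (Add (Var 94) (Const 1)) := val s4 (Mul (Entry 25
                (Var 94)) (Add (Var 23) (Const 1))))))"
              using i(2) s4(1) st4 by (auto simp: le_Suc_eq mult.commute)
          qed (use st4 i iM pM(2)[OF i(1)] expo_le_vbound[of n] in auto)
        qed
      qed auto
    qed
  qed
  then show ?thesis by (rule runs_weaken) (auto simp: algebra_simps vec_def)
qed

text \<open>The table is filled by \<open>ip_rec\<close>. The entry at (y div 2, r div 2) has been
  computed before, except that (0, 0) refers to itself; this cell is therefore set in
  advance.\<close>

definition Parity_table :: prog where
  "Parity_table = Seq (SetVar 21 (Const 0)) (For 94 22 (For 95 22 (Seq
     (SetVar 52 (Add (Entry 21 (Add (Mul (Div (Var 94) (Const 2)) (Var 22)) (Div (Var 95) (Const 2))))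
       (Mul (Sub (Var 94) (Mul (Const 2) (Div (Var 94) (Const 2)))) (Sub (Var 95) (Mul (Const 2) (Div (Var
           95) (Const 2)))))))
     (Assign 21 (Add (Mul (Var 94) (Var 22)) (Var 95)) (Sub (Var 52) (Mul (Const 2) (Div (Var 52) (Const
         2))))))))"

lemma written_Parity_table [simp]: "written Parity_table = {21, 52, 94, 95}" by (auto simp: Parity_table_def)

lemma runs_Parity_table:
  assumes H: "s 22 0 = 2 ^ hbits n"
  shows "runs Parity_table s ((2 ^ hbits n + 1)\<^sup>2 * (7 * step_cost (vbound n))) (\<lambda>s'. mat (2
      ^ hbits n) (s' 21) (\<lambda>y r. int (ip y r)))"
proof -
  let ?M = "vbound n" and ?u = "step_cost (vbound n)"
  define H where "H = (2::nat) ^ hbits n"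
  have H0: "0 < H" by (simp add: H_def)
  have HM: "int H \<le> ?M" using hash_le_vbound[of n] by (simp add: H_def)
  have M2: "2 \<le> ?M" using vbound_facts(5)[of n] by linarith
  have sH: "s 22 0 = int H" using H by (simp add: H_def)
  let ?x = "Add (Entry 21 (Add (Mul (Div (Var 94) (Const 2)) (Var 22)) (Div (Var 95) (Const 2))))
       (Mul (Sub (Var 94) (Mul (Const 2) (Div (Var 94) (Const 2)))) (Sub (Var 95) (Mul (Const 2) (Div (Var
           95) (Const 2)))))"
  let ?as = "Assign 21 (Add (Mul (Var 94) (Var 22)) (Var 95)) (Sub (Var 52) (Mul (Const 2) (Div (Var 52)
      (Const 2))))"
  let ?body = "Seq (SetVar 52 ?x) ?as"
  let ?J = "\<lambda>y s'. s' 21 0 = 0 \<and> (\<forall>y'<y. \<forall>r<H. s' 21 (cell H y' r) = int (ip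
      y' r))"
  have "runs Parity_table s (?u + Suc H * (Suc H * ((?u + ?u) + 2 * ?u) + 2 * ?u)) (?J H)"
    unfolding Parity_table_def
  proof (rule runs_Seq[OF _ _ order_refl])
    show "runs (SetVar 21 (Const 0)) s ?u (\<lambda>s1. s1 21 0 = 0)" by (intro runs_Assign) auto
    fix s1 assume s1: "s1 21 0 = 0" "\<And>a. a \<notin> written (SetVar 21 (Const 0)) \<Longrightarrow> s1
        a = s a"
    have H1: "s1 22 0 = int H" using s1(2) sH by simp
    show "runs (For 94 22 (For 95 22 ?body)) s1 (Suc H * (Suc H * ((?u + ?u) + 2 * ?u) + 2 * ?u)) (?J H)"
    proof (rule runs_For[where s = s1 and Inv = ?J, OF H1 HM])
      show "?J 0 s1" using s1(1) by simp
      fix y s2 assume y: "y < H" "?J y s2" "s2 94 0 = int y"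
        and f2: "\<And>c. c \<noteq> 94 \<Longrightarrow> c \<notin> written (For 95 22 ?body)
            \<Longrightarrow> s2 c = s1 c"
      have H2: "s2 22 0 = int H" using f2 H1 by simp
      let ?K = "\<lambda>r s'. ?J y s' \<and> (\<forall>r'<r. s' 21 (cell H y r') = int (ip y r'))"
      have "runs (For 95 22 ?body) s2 (Suc H * ((?u + ?u) + 2 * ?u)) (?K H)"
      proof (rule runs_For[where s = s2 and Inv = ?K, OF H2 HM])
        show "?K 0 s2" using y(2) by simp
        fix r s3 assume r: "r < H" "?K r s3" "s3 95 0 = int r"
          and f3: "\<And>c. c \<noteq> 95 \<Longrightarrow> c \<notin> written ?body \<Longrightarrow> s3 c
              = s2 c"
        have st3: "s3 22 0 = int H" "s3 94 0 = int y" using f3 H2 y by simp_all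
        have old: "s3 21 (cell H (y div 2) (r div 2)) = int (ip (y div 2) (r div 2))"
        proof (cases "y = 0")
          case True
          show ?thesis
          proof (cases "r = 0")
            case True with \<open>y = 0\<close> r(2) show ?thesis by simp
          next
            case False
            then have "r div 2 < r" by simp
            with True r(2) show ?thesis by simp
          qed
        next
          case False
          then have "y div 2 < y" "r div 2 < H" using r(1) by auto
          with r(2) show ?thesis by blast
        qed
        let ?z = "ip (y div 2) (r div 2) + (y mod 2) * (r mod 2)"
        have dv: "int y div 2 = int (y div 2)" "int r div 2 = int (r div 2)" by (simp_all add: zdiv_int)
        have md: "int y - 2 * (int (y div 2)) = int (y mod 2)" "int r - 2 * (int (r div 2)) = int (r mod 2)"
          by (simp_all add: zdiv_int zmod_int minus_mult_div_eq_mod)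
        have vx: "val s3 ?x = int ?z"
          unfolding val.simps using st3 r(3) old by (simp only: dv md val.simps of_nat_add of_nat_mult)
        have z2: "int ?z \<le> 2"
        proof -
          have "(y mod 2) * (r mod 2) \<le> 1 * 1" by (intro mult_mono) auto
          then have "?z \<le> 2" using ip_less_2[of "y div 2" "r div 2"] by linarith
          then show ?thesis by linarith
        qed
        have ip1: "int (ip (y div 2) (r div 2)) \<le> ?M" using ip_less_2[of "y div 2" "r div 2"] M2 by linarith
        have yM: "int y \<le> ?M" "int r \<le> ?M" using y r HM by linarith+
        show "runs ?body s3 (?u + ?u) (?K (Suc r))"
        proof (rule runs_Seq[OF _ _ order_refl])
          show "runs (SetVar 52 ?x) s3 ?u (\<lambda>s4. s4 52 0 = int ?z)"
          proof (rule runs_Assign)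
            show "reads_le ?M s3 ?x" using st3 r(3) old ip1 yM HM by (simp add: dv)
            show "(s3(52 := (s3 52)(val s3 (Const 0) := val s3 ?x))) 52 0 = int ?z" unfolding vx by simp
          qed simp_all
          fix s4 assume s4: "s4 52 0 = int ?z" "\<And>a. a \<notin> written (SetVar 52 ?x)
              \<Longrightarrow> s4 a = s3 a"
          have st4: "s4 22 0 = int H" "s4 94 0 = int y" "s4 95 0 = int r" "s4 21 = s3 21" using s4(2) st3 r
              by simp_all
          have "int ?z - 2 * (int ?z div 2) = int (ip y r)"
            by (subst ip_rec) (simp only: minus_mult_div_eq_mod zmod_int of_nat_numeral)
          then have v: "val s4 (Sub (Var 52) (Mul (Const 2) (Div (Var 52) (Const 2)))) = int (ip y r)"
            using s4(1) by (simp only: val.simps)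
          show "runs ?as s4 ?u (?K (Suc r))"
          proof (rule runs_Assign)
            have i: "val s4 (Add (Mul (Var 94) (Var 22)) (Var 95)) = cell H y r" using st4 by simp
            \<comment> \<open>The only cell with index 0 lies in row 0, so a write there keeps the
              value 0 that the invariant demands.\<close>
            have 0: "ip y r = 0" if "cell H y r = 0"
            proof -
              have "int y * int H = 0" using that by (metis add_nonneg_eq_0_iff of_nat_0_le_iff
                  mult_nonneg_nonneg)
              then show ?thesis using H0 by simp
            qed
            show "?K (Suc r) (s4(21 := (s4 21)(val s4 (Add (Mul (Var 94) (Var 22)) (Var 95)) :=
                val s4 (Sub (Var 52) (Mul (Const 2) (Div (Var 52) (Const 2)))))))"
              unfolding v i st4(4) using r(1,2) 0 y(1) by (auto simp: cell_eq_iff less_Suc_eq)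
            show "reads_le ?M s4 (Sub (Var 52) (Mul (Const 2) (Div (Var 52) (Const 2))))"
              using s4(1) z2 M2 by (simp del: of_nat_add of_nat_mult)
          qed (use st4 yM HM in auto)
        qed
      qed auto
      then show "runs (For 95 22 ?body) s2 (Suc H * ((?u + ?u) + 2 * ?u)) (?J (Suc y))"
        by (rule runs_weaken) (auto simp: less_Suc_eq)
    qed auto
  qed
  then show ?thesis
    unfolding H_def[symmetric] by (rule runs_weaken) (auto simp: mat_def power2_eq_square algebra_simps)
qed

text \<open>L + 3 is formed in two steps, with constants whose bit lengths are among
  \<open>bits_simps\<close>.\<close>

definition Params :: prog where
  "Params = Seq Log (Seq Hash_size (Seq (SetVar 34 (Mul (Const 2) (Mul (Var 22) (Var 22))))
     (Seq (SetVar 29 (Add (Var 3) (Const 2))) (Seq (SetVar 29 (Add (Var 29) (Const 1)))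
     (Seq (SetVar 31 (Mul (Const 32) (Var 3))) (Seq Powers Parity_table))))))"

lemma written_Params [simp]: "written Params = {3, 9, 21, 22, 23, 24, 25, 29, 31, 34, 52, 94, 95}"
  by (auto simp: Params_def)

definition params_cost :: "nat \<Rightarrow> nat" where
  "params_cost n = 7 * logn n + 2 * hbits n + 30 + (2 ^ hbits n + 1)\<^sup>2 * 7"

lemma runs_Params:
  assumes n: "s 0 0 = int n"
  shows "runs Params s (params_cost n * step_cost (vbound n)) (\<lambda>s'. s' 3 0 = int (logn n) \<and> s'
      22 0 = 2 ^ hbits n \<and>
     s' 34 0 = 2 * 2 ^ hbits n * 2 ^ hbits n \<and> s' 29 0 = int (logn n + 3) \<and> s' 31 0 = int (32 *
         logn n) \<and>
     vec (logn n + 3) (s' 24) (\<lambda>i. (2 * int (expo n)) ^ i) \<and> vec (logn n + 3) (s' 25)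
         (\<lambda>i. (int (expo n) + 1) ^ i) \<and>
     mat (2 ^ hbits n) (s' 21) (\<lambda>y r. int (ip y r)))" (is "runs _ _ _ ?Q")
proof -
  let ?M = "vbound n" and ?u = "step_cost (vbound n)"
  note LM = vbound_facts(5)[of n]
  let ?T1 = "(3 * logn n + 3) * ?u" and ?T2 = "(2 * hbits n + 3) * ?u" and ?T3 = "(4 * logn n + 18) * ?u"
  let ?T4 = "(2 ^ hbits n + 1)\<^sup>2 * (7 * ?u)"
  let ?p3 = "SetVar 34 (Mul (Const 2) (Mul (Var 22) (Var 22)))" and ?p4 = "SetVar 29 (Add (Var 3) (Const 2))"
  let ?p5 = "SetVar 29 (Add (Var 29) (Const 1))" and ?p6 = "SetVar 31 (Mul (Const 32) (Var 3))"
  have "runs Params s (?T1 + (?T2 + (?u + (?u + (?u + (?u + (?T3 + ?T4))))))) ?Q"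
    unfolding Params_def
  proof (rule runs_Seq[OF runs_Log[where s = s, OF n] _ order_refl])
    fix s1 assume s1: "s1 3 0 = int (logn n)" "\<And>a. a \<notin> written Log \<Longrightarrow> s1 a = s a"
    show "runs (Seq Hash_size (Seq ?p3 (Seq ?p4 (Seq ?p5 (Seq ?p6 (Seq Powers Parity_table)))))) s1
       (?T2 + (?u + (?u + (?u + (?u + (?T3 + ?T4)))))) ?Q"
    proof (rule runs_Seq[OF runs_Hash_size[where s = s1, OF s1(1)] _ order_refl])
      fix s2 assume s2: "s2 23 0 = int (expo n) \<and> s2 22 0 = 2 ^ hbits n" "\<And>a. a \<notin> written
          Hash_size \<Longrightarrow> s2 a = s1 a"
      show "runs (Seq ?p3 (Seq ?p4 (Seq ?p5 (Seq ?p6 (Seq Powers Parity_table))))) s2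
         (?u + (?u + (?u + (?u + (?T3 + ?T4))))) ?Q"
      proof (rule runs_Seq[OF _ _ order_refl])
        show "runs ?p3 s2 ?u (\<lambda>s3. s3 34 0 = 2 * 2 ^ hbits n * 2 ^ hbits n)"
          using s2(1) hash_le_vbound[of n] by (intro runs_Assign) auto
        fix s3 assume s3: "s3 34 0 = 2 * 2 ^ hbits n * 2 ^ hbits n" "\<And>a. a \<notin> written ?p3
            \<Longrightarrow> s3 a = s2 a"
        show "runs (Seq ?p4 (Seq ?p5 (Seq ?p6 (Seq Powers Parity_table)))) s3 (?u + (?u + (?u + (?T3 +
            ?T4)))) ?Q"
        proof (rule runs_Seq[OF _ _ order_refl])
          show "runs ?p4 s3 ?u (\<lambda>s4. s4 29 0 = int (logn n + 2))" using s1 s2(2) s3(2) LM by (intro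
              runs_Assign) auto
          fix s4 assume s4: "s4 29 0 = int (logn n + 2)" "\<And>a. a \<notin> written ?p4 \<Longrightarrow>
              s4 a = s3 a"
          show "runs (Seq ?p5 (Seq ?p6 (Seq Powers Parity_table))) s4 (?u + (?u + (?T3 + ?T4))) ?Q"
          proof (rule runs_Seq[OF _ _ order_refl])
            show "runs ?p5 s4 ?u (\<lambda>s5. s5 29 0 = int (logn n + 3))" using s4 LM by (intro
                runs_Assign) auto
            fix s5 assume s5: "s5 29 0 = int (logn n + 3)" "\<And>a. a \<notin> written ?p5
                \<Longrightarrow> s5 a = s4 a"
            show "runs (Seq ?p6 (Seq Powers Parity_table)) s5 (?u + (?T3 + ?T4)) ?Q"
            proof (rule runs_Seq[OF _ _ order_refl])
              show "runs ?p6 s5 ?u (\<lambda>s6. s6 31 0 = int (32 * logn n))"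
                using s1 s2(2) s3(2) s4(2) s5(2) LM by (intro runs_Assign) auto
              fix s6 assume s6: "s6 31 0 = int (32 * logn n)" "\<And>a. a \<notin> written ?p6
                  \<Longrightarrow> s6 a = s5 a"
              have st6: "s6 29 0 = int (logn n + 3)" "s6 23 0 = int (expo n)" "s6 22 0 = 2 ^ hbits n" "s6 3
                  0 = int (logn n)"
                "s6 34 0 = 2 * 2 ^ hbits n * 2 ^ hbits n"
                using s1 s2 s3 s4(2) s5 s6(2) by simp_all
              show "runs (Seq Powers Parity_table) s6 (?T3 + ?T4) ?Q"
              proof (rule runs_Seq[OF runs_Powers[where s = s6, OF st6(1,2)] _ order_refl])
                fix s7 assume s7: "vec (logn n + 3) (s7 24) (\<lambda>i. (2 * int (expo n)) ^ i) \<and> vec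
                    (logn n + 3) (s7 25) (\<lambda>i. (int (expo n) + 1) ^ i)"
                  "\<And>a. a \<notin> written Powers \<Longrightarrow> s7 a = s6 a"
                have "s7 22 0 = 2 ^ hbits n" using s7(2) st6 by simp
                from runs_Parity_table[where s = s7, OF this] show "runs Parity_table s7 ?T4 ?Q"
                  by (rule runs_weaken) (use s6 s7 st6 in simp_all)
              qed
            qed
          qed
        qed
      qed
    qed
  qed
  then show ?thesis by (rule runs_weaken) (auto simp: params_cost_def algebra_simps)
qed

section \<open>The reachability forest program\<close>

definition inner_arcs :: "nat \<Rightarrow> (nat \<times> nat) set \<Rightarrow> (nat \<times> nat) set" where
  "inner_arcs n A = {(u, v) \<in> A. rep_of n A u = rep_of n A v}"

definition reps :: "nat \<Rightarrow> (nat \<times> nat) set \<Rightarrow> nat set" where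
  "reps n A = {v. v < n \<and> rep_of n A v = v}"

lemma rep_of_eq_iff: "u < n \<Longrightarrow> v < n \<Longrightarrow> rep_of n A u = rep_of n A v
    \<longleftrightarrow> mutual A u v"
  using rep_of_mutual[of u n A] rep_of_mutual[of v n A] rep_of_eq[of A u v n] by (metis mutual_sym mutual_trans)

lemma rep_of_in_reps: "v < n \<Longrightarrow> rep_of n A v \<in> reps n A"
  using rep_of_mutual[of v n A] rep_of_eq_iff[of "rep_of n A v" n v A] by (auto simp: reps_def)

lemma inner_arcs_connected:
  assumes "mutual A x y"
  shows "(x, y) \<in> (inner_arcs n A)\<^sup>*"
proof -
  have "{(u, v). (u, v) \<in> A \<and> mutual A x u \<and> mutual A x v} \<subseteq> inner_arcs n A"
    unfolding inner_arcs_def using rep_of_eq[of A _ _ n] mutual_trans[of A] mutual_sym[of A] by blast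
  from rtrancl_mono[OF this] path_within_component[OF assms] show ?thesis by blast
qed

text \<open>Both directions are needed: searching the arcs yields the out-trees, searching the
  converse arcs the in-trees.\<close>

lemma reps_reach:
  assumes "v < n"
  shows "\<exists>r\<in>reps n A. (r, v) \<in> (inner_arcs n A)\<^sup>*" "\<exists>r\<in>reps n A. (r, v)
      \<in> ((inner_arcs n A)\<inverse>)\<^sup>*"
proof -
  have m: "mutual A (rep_of n A v) v" "mutual A v (rep_of n A v)" using rep_of_mutual[OF assms, of A]
      mutual_sym by auto
  show "\<exists>r\<in>reps n A. (r, v) \<in> (inner_arcs n A)\<^sup>*"
    using inner_arcs_connected[OF m(1)] rep_of_in_reps[OF assms] by blast
  have "(rep_of n A v, v) \<in> ((inner_arcs n A)\<inverse>)\<^sup>*"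
    using inner_arcs_connected[OF m(2), of n] by (simp add: rtrancl_converse)
  then show "\<exists>r\<in>reps n A. (r, v) \<in> ((inner_arcs n A)\<inverse>)\<^sup>*" using
      rep_of_in_reps[OF assms] by blast
qed

lemma spanning_forest_funpow:
  assumes "spanning_forest E X {..<n} f" "v < n"
  shows "\<exists>k. (f ^^ k) v \<in> X"
proof -
  obtain r where r: "r \<in> X" "(r, v) \<in> {(f w, w) | w. w \<in> {..<n} - X}\<^sup>*"
    using assms unfolding spanning_forest_def by blast
  have "{(f w, w) | w. w \<in> {..<n} - X} \<subseteq> {(f w, w) | w. w \<notin> X}" by auto
  from rtrancl_mono[OF this] r show ?thesis using funpow_to_root[of r v f X] by blast
qed

text \<open>f is a forest of converse arcs, so its iterates from e follow arcs of A, inside the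
  component, to the representative. Taking each vertex as the parent of the next turns this walk
  into the trunk of the tree rooted at e, to which g adds the remaining vertices.\<close>

lemma component_trees:
  assumes A: "A \<subseteq> {..<n} \<times> {..<n}" and f: "spanning_forest ((inner_arcs n A)\<inverse>)
      (reps n A) {..<n} f" "\<And>v. v < n \<Longrightarrow> f v < n"
    and g: "spanning_forest (inner_arcs n A) (reps n A) {..<n} g"
    and row: "tree_row n f g S e (depth f (reps n A) e)" and e: "e < n"
  shows "\<And>v. v < n \<Longrightarrow> mutual A e v \<Longrightarrow> v \<noteq> e \<Longrightarrow>
      \<exists>u. S (cell n e v) = int u + 1 \<and> (u, v) \<in> A \<and> mutual A u e"
    and "\<And>v. v < n \<Longrightarrow> mutual A e v \<Longrightarrow>
      (e, v) \<in> {(u, v). v < n \<and> v \<noteq> e \<and> mutual A e v \<and> S (cell n e v) = int u +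
          1}\<^sup>*"
proof -
  let ?X = "reps n A" and ?d = "depth f (reps n A) e" and ?r = "rep_of n A"
  let ?p = "\<lambda>i. (f ^^ i) e"
  have ex: "\<exists>k. ?p k \<in> ?X" using spanning_forest_funpow[OF f(1) e] .
  have pn: "?p i < n" for i using e f(2) by (induction i) auto
  have notX: "?p i \<notin> ?X" if "i < ?d" for i
    using depth_funpow[OF ex, of i] depth_root[of "?p i" ?X f] that by auto
  have arc: "(?p i, ?p (Suc i)) \<in> inner_arcs n A" if "i < ?d" for i
    using notX[OF that] pn[of i] f(1) unfolding spanning_forest_def by auto
  have rep: "?r (?p i) = ?r e" if "i \<le> ?d" for i
    using that
  proof (induction i)
    case (Suc i)
    then show ?case using arc[of i] by (simp add: inner_arcs_def)
  qed simp
  have mp: "mutual A e (?p i)" if "i \<le> ?d" for i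
    using rep[OF that] rep_of_eq_iff[OF e pn[of i], of A] by simp
  have final: "?p ?d = ?r e" using funpow_depth[OF ex] rep[of ?d] by (simp add: reps_def)
  have r1: "S (cell n e (?p (Suc i))) = int (?p i) + 1" if "i < ?d" for i using row that unfolding
      tree_row_def by blast
  have r2: "S (cell n e v) = int (g v) + 1" if "v < n" "v \<notin> ?p ` {..?d}" for v
  proof -
    have "v \<notin> (\<lambda>i. ?p (Suc i)) ` {..<?d}"
    proof
      assume "v \<in> (\<lambda>i. ?p (Suc i)) ` {..<?d}"
      then obtain i where "i < ?d" "v = ?p (Suc i)" by auto
      then have "v \<in> ?p ` {..?d}" by (intro image_eqI[of _ _ "Suc i"]) auto
      with that(2) show False by blast
    qed
    with row that(1) show ?thesis unfolding tree_row_def by blast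
  qed
  have garc: "(g v, v) \<in> inner_arcs n A" if "v < n" "v \<notin> ?X" for v
    using g that unfolding spanning_forest_def by auto
  show "\<exists>u. S (cell n e v) = int u + 1 \<and> (u, v) \<in> A \<and> mutual A u e" if v: "v < n"
      "mutual A e v" "v \<noteq> e" for v
  proof (cases "v \<in> ?p ` {..?d}")
    case True
    then obtain j where j: "j \<le> ?d" "v = ?p j" by auto
    then obtain i where i: "j = Suc i" using v(3) by (cases j) auto
    then have "i < ?d" using j by simp
    then show ?thesis using r1[of i] arc[of i] mp[of i] j i mutual_sym[of A e "?p i"]
      by (intro exI[of _ "?p i"]) (auto simp: inner_arcs_def)
  next
    case False
    have "v \<notin> ?X"
    proof
      assume "v \<in> ?X"
      then have "v = ?r e" using rep_of_eq_iff[OF e v(1), of A] v(2) by (simp add: reps_def)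
      then have "v = ?p ?d" using final by simp
      with False show False by blast
    qed
    from garc[OF v(1) this] have a: "(g v, v) \<in> A" "?r (g v) = ?r v" by (auto simp: inner_arcs_def)
    then have "g v < n" using A by auto
    then have "mutual A (g v) v" using a(2) rep_of_eq_iff[of "g v" n v A] v(1) by simp
    then have "mutual A (g v) e" using v(2) mutual_sym mutual_trans by metis
    with r2[OF v(1) False] a(1) show ?thesis by blast
  qed
  \<comment> \<open>\<open>component_tree\<close> works with optional parents; nonpositive cells
    become \<open>None\<close>, so that the conversion by \<open>nat\<close> loses nothing.\<close>
  let ?C = "{v. v < n \<and> mutual A e v}" and ?t = "\<lambda>v. if 0 < S (cell n e v) then Some (nat (S
      (cell n e v) - 1)) else None"
  show "(e, v) \<in> {(u, v). v < n \<and> v \<noteq> e \<and> mutual A e v \<and> S (cell n e v) = int u +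
      1}\<^sup>*" if v: "v < n" "mutual A e v" for v
  proof -
    have "(e, v) \<in> {(u, v). v \<in> ?C \<and> v \<noteq> e \<and> ?t v = Some u}\<^sup>*"
    proof (rule component_tree[where d = ?d and f = f and g = g and r = "?r e"])
      show "?t (?p (Suc i)) = Some (?p i)" if "i < ?d" for i using r1[OF that] by simp
      show "?p ?d = ?r e" by (rule final)
      show "?t v = Some (g v)" if "v \<in> ?C" "v \<notin> ?p ` {..?d}" for v using r2[of v] that by simp
      show "?p i \<in> ?C" if "i \<le> ?d" for i using mp[OF that] pn[of i] by simp
      show "?p (Suc i) \<noteq> e" if "i < ?d" for i
      proof
        assume eq: "?p (Suc i) = e"
        have "depth f ?X (?p (Suc i)) = ?d - Suc i" using that by (intro depth_funpow ex) simp
        with eq that show False by simp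
      qed
      show "v \<in> ?C" using v by simp
      fix w assume w: "w \<in> ?C"
      then obtain r where r: "r \<in> ?X" "(r, w) \<in> {(g w, w) | w. w \<in> {..<n} - ?X}\<^sup>*"
        using g unfolding spanning_forest_def by blast
      have "?r w = ?r r \<and> (r, w) \<in> {(g x, x) | x. x < n \<and> ?r x = ?r r \<and> x \<noteq>
          r}\<^sup>*"
        using r(2)
      proof (induction rule: rtrancl_induct)
        case (step y z)
        then have z: "z < n" "z \<notin> ?X" "y = g z" by auto
        with garc[of z] step.IH have "?r z = ?r r" by (simp add: inner_arcs_def)
        moreover have "z \<noteq> r" using z(2) r(1) by blast
        ultimately show ?case using step.IH z by (auto intro: rtrancl_into_rtrancl)
      qed simp
      moreover have "?r r = r" using r(1) by (simp add: reps_def)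
      moreover have "?r w = ?r e" using w rep_of_eq[of A e w n] by simp
      moreover have "{(g x, x) | x. x < n \<and> ?r x = ?r e \<and> x \<noteq> ?r e} \<subseteq> {(g w, w)
          | w. w \<in> ?C \<and> w \<noteq> ?r e}"
        by (auto simp: rep_of_eq_iff[OF e, symmetric])
      note rtrancl_mono[OF this]
      ultimately show "(?r e, w) \<in> {(g w, w) | w. w \<in> ?C \<and> w \<noteq> ?r e}\<^sup>*" by auto
    qed
    moreover have "{(u, v). v \<in> ?C \<and> v \<noteq> e \<and> ?t v = Some u} \<subseteq>
       {(u, v). v < n \<and> v \<noteq> e \<and> mutual A e v \<and> S (cell n e v) = int u + 1}"
      by (auto split: if_splits)
    from rtrancl_mono[OF this] calculation show ?thesis by blast
  qed
qed

text \<open>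
  Arrays: 0 size, 1 input, 2 output, 3 logarithm of the size, 5 reachability, 7 adjacency,
  10 representatives, 11 heads of entry arcs (plus one), 12 its support, 13 witnesses (plus one),
  14 numbers of witnesses, 15 pairs of the current level, 16 candidate set, 21 parity table,
  22 number of moduli and masks, 24 and 25 coefficients of the potential, 43 arcs for the search,
  45 out-trees, 46 in-trees, 47 component trees (plus one), 90 to 99 loop variables.
\<close>

definition Main :: "prog \<Rightarrow> prog" where
  "Main mp = Seq (Fill 7 (Cell 1)) (Seq Params (Seq (Closure mp) (Seq Rep (Seq Entries
     (Seq (Fill 12 (Pos (Cell 11))) (Seq (witness_setting.Witness mp)
     (Seq (Fill 43 (Mul (Cell_T 7) (Eq (Entry 10 (Var 90)) (Entry 10 (Var 91))))) (Seq Search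
     (Seq (Fill_vec 0 46 (Entry 45 (Var 92)))
     (Seq (Fill 43 (Mul (Cell 7) (Eq (Entry 10 (Var 90)) (Entry 10 (Var 91))))) (Seq Search
     (Seq Trees Output))))))))))))"

definition main_cost :: "nat \<Rightarrow> nat \<Rightarrow> nat" where
  "main_cost n T = (params_cost n + 8 * logn n + 30 + (logn n + 4) * ((32 * logn n + 1) *
     ((logn n + 4) * (2 * 2 ^ hbits n * 2 ^ hbits n + 1) * 19) + 4)) * mm_cost n (vbound n) T"

lemma written_Closure [simp]: "a < 100 \<Longrightarrow> a \<in> written (Closure mp) \<longleftrightarrow>
    a \<in> {4, 5, 6, 90, 91, 93}"
  by (auto simp: Closure_def)

lemma runs_Main:
  assumes mp: "multiplies n mp T" and G: "pair_wf_digraph G" "pverts G = {..<n}"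
    and n: "s 0 0 = int n" and adj: "mat n (s 1) (\<lambda>i j. of_bool ((i, j) \<in> parcs G))"
  shows "runs (Main mp) s (main_cost n T) (\<lambda>s'. reachability_forest G
     (\<lambda>a. {(u, v). v < n \<and> s' 2 (cell n a v) = int u + 1}))"
proof -
  let ?M = "vbound n" and ?u = "step_cost (vbound n)" and ?C = "mm_cost n (vbound n) T" and ?L = "logn n"
  define A where "A = parcs G"
  let ?rep = "rep_of n A" and ?X = "reps n A" and ?E = "inner_arcs n A"
  have A: "A \<subseteq> {..<n} \<times> {..<n}" using G unfolding A_def pair_wf_digraph_def by auto
  have nM: "int n < ?M" "int n \<le> ?M" "int n ^ 3 \<le> ?M" "1 \<le> ?M"
    using vbound_facts(1)[of n] vbound_facts(2)[of n] by linarith+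
  have repn: "?rep v < n" if "v < n" for v using rep_of_mutual[OF that, of A] by simp
  have repM: "int (?rep v) \<le> ?M" if "v < n" for v using repn[OF that] nM by linarith
  have En: "?E \<subseteq> {..<n} \<times> {..<n}" "?E\<inverse> \<subseteq> {..<n} \<times> {..<n}" using
      A by (auto simp: inner_arcs_def)
  \<comment> \<open>Quadratic work is absorbed into multiples of the cost of a matrix
    product.\<close>
  have Nu: "(Suc n)\<^sup>2 * (k * ?u) \<le> j * ?C" if "k \<le> 16 * j" for k j
  proof -
    have "(Suc n)\<^sup>2 * (k * ?u) \<le> (Suc n)\<^sup>2 * (16 * j * ?u)" using that by (intro
        mult_left_mono mult_right_mono) auto
    also have "\<dots> = j * ((Suc n)\<^sup>2 * (16 * ?u))" by simp
    also have "\<dots> \<le> j * ?C" using mm_cost_ge[of n ?M T] by (intro mult_left_mono) auto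
    finally show ?thesis .
  qed
  have mat_E: "runs (Fill 43 (Mul e (Eq (Entry 10 (Var 90)) (Entry 10 (Var 91))))) s1 ?C (\<lambda>s2. mat
      n (s2 43) (\<lambda>i j. of_bool ((i, j) \<in> F)))"
    if e: "e = Cell 7 \<and> F = ?E \<or> e = Cell_T 7 \<and> F = ?E\<inverse>" and s1: "s1 0 0 = int n"
        "mat n (s1 7) (\<lambda>i j. of_bool ((i, j) \<in> A))"
      "vec n (s1 10) (\<lambda>v. int (?rep v))" for e F s1
  proof -
    have "runs (Fill 43 (Mul e (Eq (Entry 10 (Var 90)) (Entry 10 (Var 91))))) s1 ((Suc n)\<^sup>2 * (5 *
        ?u)) (\<lambda>s2. mat n (s2 43) (\<lambda>i j. of_bool ((i, j) \<in> F)))"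
    proof (rule runs_Fill)
      fix i j s' assume ij: "i < n" "j < n" "s' 90 0 = int i" "s' 91 0 = int j"
        and f: "\<And>c. c \<noteq> 90 \<Longrightarrow> c \<noteq> 91 \<Longrightarrow> c \<noteq> 43
            \<Longrightarrow> s' c = s1 c"
      have v: "s' 7 (cell n i j) = of_bool ((i, j) \<in> A)" "s' 7 (cell n j i) = of_bool ((j, i) \<in> A)"
        "s' 10 (int i) = int (?rep i)" "s' 10 (int j) = int (?rep j)" "s' 0 0 = int n"
        using matD[OF s1(2)] vecD[OF s1(3)] ij f s1(1) by simp_all
      show "reads_le ?M s' (Mul e (Eq (Entry 10 (Var 90)) (Entry 10 (Var 91)))) \<and>
         val s' (Mul e (Eq (Entry 10 (Var 90)) (Entry 10 (Var 91)))) = of_bool ((i, j) \<in> F)"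
        using e
      proof
        assume "e = Cell 7 \<and> F = ?E"
        then show ?thesis using v ij nM repM[OF ij(1)] repM[OF ij(2)] by (auto simp: inner_arcs_def)
      next
        assume "e = Cell_T 7 \<and> F = ?E\<inverse>"
        then show ?thesis using v ij nM repM[OF ij(1)] repM[OF ij(2)] by (auto simp: inner_arcs_def)
      qed
    qed (use s1 nM e in auto)
    then show ?thesis by (rule runs_weaken) (use mm_cost_bounds in auto)
  qed
  let ?W = "witness_setting.Witness mp"
  \<comment> \<open>The first search runs on the transposed arcs. Its parents are moved to 46 before
    the second search, on the arcs themselves, overwrites 45.\<close>
  let ?p8 = "Fill 43 (Mul (Cell_T 7) (Eq (Entry 10 (Var 90)) (Entry 10 (Var 91))))"
  let ?p10 = "Fill_vec 0 46 (Entry 45 (Var 92))"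
  let ?p11 = "Fill 43 (Mul (Cell 7) (Eq (Entry 10 (Var 90)) (Entry 10 (Var 91))))"
  let ?Q = "\<lambda>s'. reachability_forest G (\<lambda>a. {(u, v). v < n \<and> s' 2 (cell n a v) = int u
      + 1})"
  let ?K = "(32 * ?L + 1) * ((?L + 4) * (2 * 2 ^ hbits n * 2 ^ hbits n + 1) * (19 * ?C))"
  let ?TW = "(?L + 4) * (?K + 4 * ?C)"
  let ?T8 = "?C + (2 * ?C + (?C + (?C + (2 * ?C + (?C + ?C)))))"
  \<comment> \<open>Stated for arbitrary tables \<open>ENT\<close> and \<open>WW\<close>, hence
    independent of how the witnesses were found.\<close>
  have tail: "runs (Seq ?p8 (Seq Search (Seq ?p10 (Seq ?p11 (Seq Search (Seq Trees Output)))))) s0 ?T8 ?Q"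
    if st: "s0 0 0 = int n" "mat n (s0 7) (\<lambda>i j. of_bool ((i, j) \<in> A))" "mat n (s0 5)
        (\<lambda>i j. of_bool ((i, j) \<in> A\<^sup>*))"
      "vec n (s0 10) (\<lambda>v. int (?rep v))"
      and ENT: "mat n (s0 11) ENT" "\<And>u r. u < n \<Longrightarrow> r < n \<Longrightarrow> ENT u r
          \<noteq> 0 \<Longrightarrow>
        \<exists>e<n. ENT u r = int e + 1 \<and> (u, e) \<in> A \<and> ?rep e = r \<and> ?rep u \<noteq> r"
        "\<And>u v. (u, v) \<in> A \<Longrightarrow> ?rep u \<noteq> ?rep v \<Longrightarrow> ENT u (?rep
            v) > 0"
      and WW: "mat n (s0 13) WW" "\<And>a r. a < n \<Longrightarrow> r < n \<Longrightarrow> \<exists>u<n.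
          (a, u) \<in> A\<^sup>* \<and> ENT u r > 0 \<Longrightarrow>
        \<exists>u<n. (a, u) \<in> A\<^sup>* \<and> ENT u r > 0 \<and> WW a r = int u + 1"
    for s0 ENT WW
  proof (rule runs_Seq[OF _ _ order_refl])
    show "runs ?p8 s0 ?C (\<lambda>s1. mat n (s1 43) (\<lambda>i j. of_bool ((i, j) \<in> ?E\<inverse>)))"
      by (rule mat_E) (use st in auto)
    fix s1 assume s1: "mat n (s1 43) (\<lambda>i j. of_bool ((i, j) \<in> ?E\<inverse>))" "\<And>a. a
        \<notin> written ?p8 \<Longrightarrow> s1 a = s0 a"
    have st1: "s1 0 0 = int n" "vec n (s1 10) (\<lambda>v. int (?rep v))" using s1(2) st by simp_all
    show "runs (Seq Search (Seq ?p10 (Seq ?p11 (Seq Search (Seq Trees Output))))) s1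
        (2 * ?C + (?C + (?C + (2 * ?C + (?C + ?C))))) ?Q"
    proof (rule runs_Seq[OF _ _ order_refl])
      show "runs Search s1 (2 * ?C) (\<lambda>s'. \<exists>par. vec n (s' 45) (\<lambda>v. int (par v))
          \<and> (\<forall>v<n. par v < n) \<and> spanning_forest (?E\<inverse>) ?X {..<n} par)"
        using runs_Search[where s = s1, OF st1(1) nM(1) En(2) s1(1) st1(2) repn reps_def reps_reach(2)]
        by (rule runs_weaken) (use Nu[of 25 2] in auto)
      fix s2 assume ex: "\<exists>par. vec n (s2 45) (\<lambda>v. int (par v)) \<and> (\<forall>v<n. par v
          < n) \<and> spanning_forest (?E\<inverse>) ?X {..<n} par"
        and f2: "\<And>a. a \<notin> written Search \<Longrightarrow> s2 a = s1 a"
      obtain f where f: "vec n (s2 45) (\<lambda>v. int (f v))" "\<And>v. v < n \<Longrightarrow> f v < n"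
          "spanning_forest (?E\<inverse>) ?X {..<n} f"
        using ex by blast
      have fM: "int (f v) \<le> ?M" if "v < n" for v using f(2)[OF that] nM by linarith
      have st2: "s2 0 0 = int n" using f2 st1 by simp
      show "runs (Seq ?p10 (Seq ?p11 (Seq Search (Seq Trees Output)))) s2 (?C + (?C + (2 * ?C + (?C + ?C)))) ?Q"
      proof (rule runs_Seq[OF _ _ order_refl])
        have "runs ?p10 s2 (Suc n * (3 * ?u)) (\<lambda>s3. vec n (s3 46) (\<lambda>v. int (f v)))"
          by (rule runs_Fill_vec) (use st2 nM fM vecD[OF f(1)] in auto)
        then show "runs ?p10 s2 ?C (\<lambda>s3. vec n (s3 46) (\<lambda>v. int (f v)))"
          by (rule runs_weaken) (use mm_cost_bounds in auto)
        fix s3 assume s3: "vec n (s3 46) (\<lambda>v. int (f v))" "\<And>a. a \<notin> written ?p10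
            \<Longrightarrow> s3 a = s2 a"
        have st3: "s3 0 0 = int n" "mat n (s3 7) (\<lambda>i j. of_bool ((i, j) \<in> A))" "vec n (s3 10)
            (\<lambda>v. int (?rep v))"
          using s3(2) f2 s1(2) st by simp_all
        show "runs (Seq ?p11 (Seq Search (Seq Trees Output))) s3 (?C + (2 * ?C + (?C + ?C))) ?Q"
        proof (rule runs_Seq[OF _ _ order_refl])
          show "runs ?p11 s3 ?C (\<lambda>s4. mat n (s4 43) (\<lambda>i j. of_bool ((i, j) \<in> ?E)))"
            by (rule mat_E) (use st3 in auto)
          fix s4 assume s4: "mat n (s4 43) (\<lambda>i j. of_bool ((i, j) \<in> ?E))" "\<And>a. a \<notin>
              written ?p11 \<Longrightarrow> s4 a = s3 a"
          have st4: "s4 0 0 = int n" "vec n (s4 10) (\<lambda>v. int (?rep v))" using s4(2) st3 by simp_all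
          show "runs (Seq Search (Seq Trees Output)) s4 (2 * ?C + (?C + ?C)) ?Q"
          proof (rule runs_Seq[OF _ _ order_refl])
            show "runs Search s4 (2 * ?C) (\<lambda>s'. \<exists>par. vec n (s' 45) (\<lambda>v. int (par
                v)) \<and> (\<forall>v<n. par v < n) \<and> spanning_forest ?E ?X {..<n} par)"
              using runs_Search[where s = s4, OF st4(1) nM(1) En(1) s4(1) st4(2) repn reps_def reps_reach(1)]
              by (rule runs_weaken) (use Nu[of 25 2] in auto)
            fix s5 assume ex5: "\<exists>par. vec n (s5 45) (\<lambda>v. int (par v)) \<and> (\<forall>v<n.
                par v < n) \<and> spanning_forest ?E ?X {..<n} par"
              and f5: "\<And>a. a \<notin> written Search \<Longrightarrow> s5 a = s4 a"
            obtain g where g: "vec n (s5 45) (\<lambda>v. int (g v))" "\<And>v. v < n \<Longrightarrow> g v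
                < n" "spanning_forest ?E ?X {..<n} g"
              using ex5 by blast
            have st5: "s5 0 0 = int n" "vec n (s5 10) (\<lambda>v. int (?rep v))" "vec n (s5 46)
                (\<lambda>v. int (f v))"
              using f5 st4 s4(2) s3(1) by simp_all
            show "runs (Seq Trees Output) s5 (?C + ?C) ?Q"
            proof (rule runs_Seq[OF _ _ order_refl])
              show "runs Trees s5 ?C (\<lambda>s'. \<forall>e<n. tree_row n f g (s' 47) e (depth f ?X e))"
                using runs_Trees[where s = s5, OF st5(1) nM(1) st5(2) repn reps_def st5(3) f(2)
                    spanning_forest_funpow[OF f(3)] g(1,2)]
                by (rule runs_weaken) (use Nu[of 15 1] in auto)
              fix s6 assume s6: "\<forall>e<n. tree_row n f g (s6 47) e (depth f ?X e)" "\<And>a. a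
                  \<notin> written Trees \<Longrightarrow> s6 a = s5 a"
              have st6: "s6 0 0 = int n" "mat n (s6 5) (\<lambda>i j. of_bool ((i, j) \<in> A\<^sup>*))"
                  "vec n (s6 10) (\<lambda>v. int (?rep v))"
                "mat n (s6 11) ENT" "mat n (s6 13) WW"
                using s6(2) f5 s4(2) s3(2) f2 s1(2) st ENT(1) WW(1) by simp_all
              define SP where "SP e v = s6 47 (cell n e v)" for e v
              have SPm: "mat n (s6 47) SP" by (simp add: mat_def SP_def)
              have row: "tree_row n f g (s6 47) e (depth f ?X e)" if "e < n" for e using s6(1) that by blast
              have fn: "(f ^^ i) e < n" if "e < n" for i e using that f(2) by (induction i) auto
              have SPM: "\<bar>SP e v\<bar> \<le> ?M" if ev: "e < n" "v < n" for e v
              proof -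
                have "\<exists>x<n. SP e v = int x + 1"
                proof (cases "v \<in> (\<lambda>i. (f ^^ Suc i) e) ` {..<depth f ?X e}")
                  case True
                  then obtain i where "i < depth f ?X e" "v = (f ^^ Suc i) e" by auto
                  then have "SP e v = int ((f ^^ i) e) + 1" using row[OF ev(1)] unfolding tree_row_def
                      SP_def by blast
                  then show ?thesis using fn[OF ev(1)] by blast
                next
                  case False
                  then have "SP e v = int (g v) + 1" using row[OF ev(1)] ev(2) unfolding tree_row_def
                      SP_def by blast
                  then show ?thesis using g(2)[OF ev(2)] by blast
                qed
                then show ?thesis using nM(1) by auto
              qed
              have wit: "\<exists>u<n. WW a (?rep v) = int u + 1 \<and> (\<exists>e<n. ENT u (?rep v) = int
                  e + 1)"
                if av: "a < n" "v < n" "(a, v) \<in> A\<^sup>*" "(v, a) \<notin> A\<^sup>*" for a v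
              proof -
                have "\<not> mutual A a v" using av by (simp add: mutual_def)
                then obtain x w where xw: "(a, x) \<in> A\<^sup>*" "(x, w) \<in> A" "\<not> mutual A x w"
                    "mutual A w v"
                  using enters_component[OF av(3)] by blast
                have xn: "x < n" "w < n" using xw(2) A by auto
                have "?rep x \<noteq> ?rep w" using rep_of_eq_iff[OF xn, of A] xw(3) by simp
                then have "ENT x (?rep w) > 0" using ENT(3)[OF xw(2)] by simp
                moreover have "?rep w = ?rep v" using rep_of_eq[OF xw(4)] .
                ultimately obtain y where y: "y < n" "ENT y (?rep v) > 0" "WW a (?rep v) = int y + 1"
                  using WW(2)[OF av(1) repn[OF av(2)]] xn(1) xw(1) by auto
                then obtain e where "e < n" "ENT y (?rep v) = int e + 1" using ENT(2)[OF y(1) repn[OF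
                    av(2)]] by force
                with y show ?thesis by blast
              qed
              have "runs Output s6 ((Suc n)\<^sup>2 * (10 * ?u)) (\<lambda>s'. mat n (s' 2) (\<lambda>a v.
                if (a, v) \<notin> A\<^sup>* \<or> v = a then 0
                else if (v, a) \<in> A\<^sup>* then SP a v
                else if ENT (nat (WW a (?rep v) - 1)) (?rep v) = int v + 1 then WW a (?rep v)
                else SP (nat (ENT (nat (WW a (?rep v) - 1)) (?rep v) - 1)) v))"
                by (rule runs_Output[where s = s6, OF st6(1) nM(1) st6(2) _ st6(3) repn SPm SPM st6(4,5)
                    wit]) auto
              then show "runs Output s6 ?C ?Q"
              proof (rule runs_weaken)
                show "(Suc n)\<^sup>2 * (10 * ?u) \<le> ?C" using Nu[of 10 1] by simp
                fix s7 assume s7: "mat n (s7 2) (\<lambda>a v.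
                  if (a, v) \<notin> A\<^sup>* \<or> v = a then 0
                  else if (v, a) \<in> A\<^sup>* then SP a v
                  else if ENT (nat (WW a (?rep v) - 1)) (?rep v) = int v + 1 then WW a (?rep v)
                  else SP (nat (ENT (nat (WW a (?rep v) - 1)) (?rep v) - 1)) v)"
                show "?Q s7"
                proof (rule reachability_forest_from_components[where rep = ?rep and SP = SP and ENT = ENT
                    and WW = WW, OF G, folded A_def])
                  show "?rep v < n \<and> mutual A (?rep v) v" if "v < n" for v using rep_of_mutual[OF that] .
                  show "?rep u = ?rep v" if "mutual A u v" for u v using rep_of_eq[OF that] .
                  show "\<exists>u. SP e v = int u + 1 \<and> (u, v) \<in> A \<and> mutual A u e" if "e <
                      n" "v < n" "mutual A e v" "v \<noteq> e" for e v
                    unfolding SP_def using component_trees(1)[OF A f(3,2) g(3) row[OF that(1)] that(1)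
                        that(2-4)] .
                  show "(e, v) \<in> {(u, v). v < n \<and> v \<noteq> e \<and> mutual A e v \<and> SP e v =
                      int u + 1}\<^sup>*"
                    if "e < n" "v < n" "mutual A e v" for e v
                    unfolding SP_def using component_trees(2)[OF A f(3,2) g(3) row[OF that(1)] that(1)
                        that(2-3)] .
                  show "\<exists>e<n. ENT u r = int e + 1 \<and> (u, e) \<in> A \<and> ?rep e = r \<and>
                      ?rep u \<noteq> r" if "u < n" "r < n" "0 < ENT u r" for u r
                    using ENT(2)[OF that(1,2)] that(3) by simp
                  show "0 < ENT u (?rep v)" if "(u, v) \<in> A" "?rep u \<noteq> ?rep v" for u v using
                      ENT(3)[OF that] .
                  show "\<exists>u<n. (a, u) \<in> A\<^sup>* \<and> 0 < ENT u r \<and> WW a r = int u + 1"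
                    if "a < n" "r < n" "\<exists>u<n. (a, u) \<in> A\<^sup>* \<and> 0 < ENT u r" for a r
                        using WW(2)[OF that] .
                qed (rule matD[OF s7])
              qed
            qed
          qed
        qed
      qed
    qed
  qed
  have "runs (Main mp) s (?C + (params_cost n * ?u + ((8 * ?L + 8) * ?C + (?C + (?C + (?C + (?TW +
      ?T8))))))) ?Q"
    unfolding Main_def
  proof (rule runs_Seq[OF _ _ order_refl])
    have "runs (Fill 7 (Cell 1)) s ((Suc n)\<^sup>2 * (5 * ?u)) (\<lambda>s1. mat n (s1 7) (\<lambda>i j.
        of_bool ((i, j) \<in> A)))"
    proof (rule runs_Fill)
      fix i j s' assume ij: "i < n" "j < n" "s' 90 0 = int i" "s' 91 0 = int j"
        and f: "\<And>c. c \<noteq> 90 \<Longrightarrow> c \<noteq> 91 \<Longrightarrow> c \<noteq> 7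
            \<Longrightarrow> s' c = s c"
      have "s' 1 (cell n i j) = of_bool ((i, j) \<in> A)" using matD[OF adj ij(1,2)] f[of 1] by (simp add:
          A_def)
      then have "s' (Suc 0) (cell n i j) = of_bool ((i, j) \<in> A)" by simp
      then show "reads_le ?M s' (Cell 1) \<and> val s' (Cell 1) = of_bool ((i, j) \<in> A)"
        using ij f[of 0] n nM by simp
    qed (use n nM in auto)
    then show "runs (Fill 7 (Cell 1)) s ?C (\<lambda>s1. mat n (s1 7) (\<lambda>i j. of_bool ((i, j) \<in> A)))"
      by (rule runs_weaken) (use mm_cost_bounds in auto)
    fix s1 assume s1: "mat n (s1 7) (\<lambda>i j. of_bool ((i, j) \<in> A))" "\<And>a. a \<notin> written
        (Fill 7 (Cell 1)) \<Longrightarrow> s1 a = s a"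
    have n1: "s1 0 0 = int n" using s1(2) n by simp
    let ?r3 = "Seq (Closure mp) (Seq Rep (Seq Entries (Seq (Fill 12 (Pos (Cell 11))) (Seq ?W
      (Seq ?p8 (Seq Search (Seq ?p10 (Seq ?p11 (Seq Search (Seq Trees Output))))))))))"
    show "runs (Seq Params ?r3) s1 (params_cost n * ?u + ((8 * ?L + 8) * ?C + (?C + (?C + (?C + (?TW +
        ?T8)))))) ?Q"
    proof (rule runs_Seq[OF runs_Params[where s = s1, OF n1] _ order_refl])
      fix s2 assume par: "s2 3 0 = int ?L \<and> s2 22 0 = 2 ^ hbits n \<and>
         s2 34 0 = 2 * 2 ^ hbits n * 2 ^ hbits n \<and> s2 29 0 = int (?L + 3) \<and> s2 31 0 = int (32 *
             ?L) \<and>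
         vec (?L + 3) (s2 24) (\<lambda>i. (2 * int (expo n)) ^ i) \<and> vec (?L + 3) (s2 25) (\<lambda>i.
             (int (expo n) + 1) ^ i) \<and>
         mat (2 ^ hbits n) (s2 21) (\<lambda>y r. int (ip y r))"
        and f2: "\<And>a. a \<notin> written Params \<Longrightarrow> s2 a = s1 a"
      have st2: "s2 0 0 = int n" "mat n (s2 7) (\<lambda>i j. of_bool ((i, j) \<in> A))" "s2 3 0 = int ?L"
          using f2 n1 s1(1) par by simp_all
      have L2: "2 * int ?L \<le> ?M" using vbound_facts(5)[of n] by linarith
      show "runs ?r3 s2 ((8 * ?L + 8) * ?C + (?C + (?C + (?C + (?TW + ?T8))))) ?Q"
      proof (rule runs_Seq[OF runs_Closure[where s = s2, OF mp st2(1) nM(3) A st2(2,3) L2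
          less_2_power_logn] _ order_refl])
        fix s3 assume s3: "mat n (s3 5) (\<lambda>i j. of_bool ((i, j) \<in> A\<^sup>*))" "\<And>a. a
            \<notin> written (Closure mp) \<Longrightarrow> s3 a = s2 a"
        have n3: "s3 0 0 = int n" using s3(2) st2 by simp
        show "runs (Seq Rep (Seq Entries (Seq (Fill 12 (Pos (Cell 11))) (Seq ?W
          (Seq ?p8 (Seq Search (Seq ?p10 (Seq ?p11 (Seq Search (Seq Trees Output)))))))))) s3 (?C + (?C +
              (?C + (?TW + ?T8)))) ?Q"
        proof (rule runs_Seq[OF _ _ order_refl])
          show "runs Rep s3 ?C (\<lambda>s'. vec n (s' 10) (\<lambda>v. int (?rep v)))"
            using runs_Rep[where s = s3, OF n3 nM(2) s3(1)] by (rule runs_weaken) (use Nu[of 8 1] in auto)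
          fix s4 assume s4: "vec n (s4 10) (\<lambda>v. int (?rep v))" "\<And>a. a \<notin> written Rep
              \<Longrightarrow> s4 a = s3 a"
          have st4: "s4 0 0 = int n" "mat n (s4 7) (\<lambda>i j. of_bool ((i, j) \<in> A))" using s4(2)
              s3(2) st2 n3 by simp_all
          show "runs (Seq Entries (Seq (Fill 12 (Pos (Cell 11))) (Seq ?W
            (Seq ?p8 (Seq Search (Seq ?p10 (Seq ?p11 (Seq Search (Seq Trees Output))))))))) s4 (?C + (?C +
                (?TW + ?T8))) ?Q"
          proof (rule runs_Seq[OF _ _ order_refl])
            let ?QE = "\<lambda>s'. (\<forall>u<n. \<forall>r<n. s' 11 (cell n u r) \<noteq> 0 \<longrightarrow>
               (\<exists>e<n. s' 11 (cell n u r) = int e + 1 \<and> (u, e) \<in> A \<and> ?rep e = r \<and>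
                   ?rep u \<noteq> r)) \<and>
               (\<forall>u v. (u, v) \<in> A \<longrightarrow> ?rep u \<noteq> ?rep v \<longrightarrow> s'
                   11 (cell n u (?rep v)) > 0)"
            show "runs Entries s4 ?C ?QE"
              using runs_Entries[where s = s4, OF st4(1) nM(2) A st4(2) s4(1) repn] by (rule runs_weaken)
                  (use Nu[of 11 1] in auto)
            fix s5 assume QE: "?QE s5" and f5: "\<And>a. a \<notin> written Entries \<Longrightarrow> s5 a
                = s4 a"
            define ENT where "ENT u r = s5 11 (cell n u r)" for u r
            have E1: "\<exists>e<n. ENT u r = int e + 1 \<and> (u, e) \<in> A \<and> ?rep e = r \<and> ?rep
                u \<noteq> r"
              if "u < n" "r < n" "ENT u r \<noteq> 0" for u r using QE that unfolding ENT_def by blast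
            have E2: "ENT u (?rep v) > 0" if "(u, v) \<in> A" "?rep u \<noteq> ?rep v" for u v using QE
                that unfolding ENT_def by blast
            have Em: "mat n (s5 11) ENT" by (simp add: mat_def ENT_def)
            have Eb: "0 \<le> ENT u r" "ENT u r \<le> ?M" if "u < n" "r < n" for u r
              using E1[OF that] nM(1) by (cases "ENT u r = 0"; force)+
            have n5: "s5 0 0 = int n" using f5 st4 by simp
            show "runs (Seq (Fill 12 (Pos (Cell 11))) (Seq ?W
               (Seq ?p8 (Seq Search (Seq ?p10 (Seq ?p11 (Seq Search (Seq Trees Output)))))))) s5 (?C + (?TW
                   + ?T8)) ?Q"
            proof (rule runs_Seq[OF _ _ order_refl])
              have "runs (Fill 12 (Pos (Cell 11))) s5 ((Suc n)\<^sup>2 * (5 * ?u)) (\<lambda>s6. mat n (s6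
                  12) (\<lambda>i j. of_bool (ENT i j > 0)))"
              proof (rule runs_Fill)
                fix i j s' assume ij: "i < n" "j < n" "s' 90 0 = int i" "s' 91 0 = int j"
                  and f: "\<And>c. c \<noteq> 90 \<Longrightarrow> c \<noteq> 91 \<Longrightarrow> c
                      \<noteq> 12 \<Longrightarrow> s' c = s5 c"
                have v: "val s' (Cell 11) = ENT i j" using ij f n5 by (simp add: ENT_def)
                then have "reads_le ?M s' (Cell 11)" using Eb[OF ij(1,2)] ij f n5 nM by simp
                moreover have "0 \<le> val s' (Cell 11)" unfolding v using Eb[OF ij(1,2)] by simp
                ultimately show "reads_le ?M s' (Pos (Cell 11)) \<and> val s' (Pos (Cell 11)) = of_bool
                    (ENT i j > 0)"
                  using v by (simp only: val_Pos reads_le_Pos simp_thms)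
              qed (use n5 nM in auto)
              then show "runs (Fill 12 (Pos (Cell 11))) s5 ?C (\<lambda>s6. mat n (s6 12) (\<lambda>i j.
                  of_bool (ENT i j > 0)))"
                by (rule runs_weaken) (use mm_cost_bounds in auto)
              fix s6 assume s6: "mat n (s6 12) (\<lambda>i j. of_bool (ENT i j > 0))" "\<And>a. a \<notin>
                  written (Fill 12 (Pos (Cell 11))) \<Longrightarrow> s6 a = s5 a"
              interpret WS: witness_setting n ?L "expo n" "hbits n" T ?M mp "\<lambda>i k. (i, k) \<in>
                  A\<^sup>*" "\<lambda>k j. ENT k j > 0"
                by (rule witness_settingI[OF mp])
              have b6: "WS.base s6"
              proof -
                have eq: "s6 22 = s2 22" "s6 21 = s2 21" "s6 24 = s2 24" "s6 25 = s2 25" "s6 34 = s2 34"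
                    "s6 5 = s3 5"
                  using s6(2) f5 s4(2) s3(2) by simp_all
                have "s6 0 0 = int n" using s6(2) n5 by simp
                moreover have "s6 34 0 = int (2 * 2 ^ hbits n * 2 ^ hbits n)" "s6 22 0 = int (2 ^ hbits n)"
                  using par eq by simp_all
                ultimately show ?thesis unfolding WS.base_def eq using s6(1) s3(1) par by blast
              qed
              have r6: "s6 31 0 = int (32 * ?L)" "s6 29 0 = int (?L + 3)" using s6(2) f5 s4(2) s3(2) par by
                  simp_all
              have cost: "WS.level_cost = ?K" by (simp add: WS.level_cost_def)
              show "runs (Seq ?W (Seq ?p8 (Seq Search (Seq ?p10 (Seq ?p11 (Seq Search (Seq Trees
                  Output))))))) s6 (?TW + ?T8) ?Q"
              proof (rule runs_Seq[OF WS.runs_Witness[OF b6 r6, unfolded cost] _ order_refl])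
                fix s7 assume ex: "\<exists>w. mat n (s7 13) w \<and> WS.valid w \<and> (\<forall>i<n.
                    \<forall>j<n. WS.W i j \<noteq> {} \<longrightarrow> w i j \<noteq> 0)"
                  and f7: "\<And>a. a \<notin> written ?W \<Longrightarrow> s7 a = s6 a"
                obtain w where w: "mat n (s7 13) w" "WS.valid w" "\<And>i j. i < n \<Longrightarrow> j < n
                    \<Longrightarrow> WS.W i j \<noteq> {} \<Longrightarrow> w i j \<noteq> 0"
                  using ex by blast
                have st7: "s7 0 0 = int n" "mat n (s7 7) (\<lambda>i j. of_bool ((i, j) \<in> A))" "mat n
                    (s7 5) (\<lambda>i j. of_bool ((i, j) \<in> A\<^sup>*))"
                  "vec n (s7 10) (\<lambda>v. int (?rep v))" "mat n (s7 11) ENT"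
                  using f7 s6(2) f5 s4 s3 st4 Em n5 by simp_all
                have wit: "\<exists>u<n. (a, u) \<in> A\<^sup>* \<and> ENT u r > 0 \<and> w a r = int u + 1"
                  if ar: "a < n" "r < n" "\<exists>u<n. (a, u) \<in> A\<^sup>* \<and> ENT u r > 0" for a r
                proof -
                  have "WS.W a r \<noteq> {}" using ar(3) by (auto simp: WS.W_def)
                  then have "w a r \<noteq> 0" using w(3) ar by blast
                  then obtain k where "k \<in> WS.W a r" "w a r = int k + 1" using w(2) ar unfolding
                      WS.valid_def by blast
                  then show ?thesis by (auto simp: WS.W_def)
                qed
                show "runs (Seq ?p8 (Seq Search (Seq ?p10 (Seq ?p11 (Seq Search (Seq Trees Output)))))) s7
                    ?T8 ?Q"
                  by (rule tail[OF st7 E1 E2 w(1) wit])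
              qed
            qed
          qed
        qed
      qed
    qed
  qed
  then show ?thesis
  proof (rule runs_weaken)
    have "?u \<le> ?C" using mm_cost_bounds(4)[of ?M n T] by linarith
    then have "params_cost n * ?u \<le> params_cost n * ?C" by (rule mult_left_mono) simp
    then have "?C + (params_cost n * ?u + ((8 * ?L + 8) * ?C + (?C + (?C + (?C + (?TW + ?T8)))))) \<le>
       ?C + (params_cost n * ?C + ((8 * ?L + 8) * ?C + (?C + (?C + (?C + (?TW + ?T8))))))" by (simp only:
           add_le_cancel_left add_le_cancel_right)
    also have "\<dots> \<le> main_cost n T"
      unfolding main_cost_def by (simp add: algebra_simps)
    finally show "?C + (params_cost n * ?u + ((8 * ?L + 8) * ?C + (?C + (?C + (?C + (?TW + ?T8)))))) \<le>
        main_cost n T" .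
  qed
qed

section \<open>Asymptotics\<close>

definition polylog :: "(nat \<Rightarrow> nat) \<Rightarrow> bool" where
  "polylog f \<longleftrightarrow> (\<exists>k::nat. (\<lambda>n. real (f n)) \<in> O(\<lambda>n. ln (real
      n) ^ k))"

lemma ln_power_mono: "k \<le> k' \<Longrightarrow> (\<lambda>n. ln (real n) ^ k) \<in> O(\<lambda>n. ln
    (real n) ^ k')"
proof (rule bigoI[where c = 1])
  assume k: "k \<le> k'"
  have "eventually (\<lambda>n. 1 \<le> ln (real n)) sequentially" by real_asymp
  then show "eventually (\<lambda>n. norm (ln (real n) ^ k) \<le> 1 * norm (ln (real n) ^ k')) sequentially"
    by eventually_elim (use k in \<open>auto simp: power_abs[symmetric] intro!: power_increasing\<close>)
qed

lemma polylog_const [intro]: "polylog (\<lambda>n. c)"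
  unfolding polylog_def by (intro exI[of _ 0]) simp

lemma polylog_add [intro]:
  assumes "polylog f" "polylog g"
  shows "polylog (\<lambda>n. f n + g n)"
proof -
  obtain k l where "(\<lambda>n. real (f n)) \<in> O(\<lambda>n. ln (real n) ^ k)" "(\<lambda>n. real (g
      n)) \<in> O(\<lambda>n. ln (real n) ^ l)"
    using assms unfolding polylog_def by blast
  then have "(\<lambda>n. real (f n)) \<in> O(\<lambda>n. ln (real n) ^ max k l)" "(\<lambda>n. real (g n))
      \<in> O(\<lambda>n. ln (real n) ^ max k l)"
    using landau_o.big_trans[OF _ ln_power_mono] by (metis max.cobounded1 max.cobounded2)+
  from sum_in_bigo(1)[OF this] show ?thesis unfolding polylog_def by auto
qed

lemma polylog_mult [intro]:
  assumes "polylog f" "polylog g"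
  shows "polylog (\<lambda>n. f n * g n)"
proof -
  obtain k l where "(\<lambda>n. real (f n)) \<in> O(\<lambda>n. ln (real n) ^ k)" "(\<lambda>n. real (g
      n)) \<in> O(\<lambda>n. ln (real n) ^ l)"
    using assms unfolding polylog_def by blast
  from landau_o.big.mult[OF this] have "(\<lambda>n. real (f n * g n)) \<in> O(\<lambda>n. ln (real n) ^ (k
      + l))"
    by (simp add: power_add)
  then show ?thesis unfolding polylog_def by blast
qed

lemma polylog_power [intro]: "polylog f \<Longrightarrow> polylog (\<lambda>n. f n ^ k)"
  by (induction k) auto

lemma polylog_le:
  assumes "polylog g" "\<And>n. f n \<le> g n"
  shows "polylog f"
proof -
  obtain k where k: "(\<lambda>n. real (g n)) \<in> O(\<lambda>n. ln (real n) ^ k)" using assms unfolding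
      polylog_def by blast
  have "(\<lambda>n. real (f n)) \<in> O(\<lambda>n. real (g n))" using assms(2) by (intro bigoI[where c =
      1]) auto
  from landau_o.big_trans[OF this k] show ?thesis unfolding polylog_def by blast
qed

lemma polylog_logn: "polylog logn"
proof -
  have "(\<lambda>n. real (logn n)) \<in> O(\<lambda>n. log 2 (real n) + 1)"
  proof (rule bigoI[where c = 1])
    have "eventually (\<lambda>n::nat. 0 < n) sequentially" by (rule eventually_gt_at_top)
    then show "eventually (\<lambda>n. norm (real (logn n)) \<le> 1 * norm (log 2 (real n) + 1)) sequentially"
    proof eventually_elim
      case (elim n)
      then have "0 \<le> log 2 (real n)" by simp
      moreover from this have "real (nat \<lfloor>log 2 (real n)\<rfloor>) \<le> log 2 (real n)" by (simp
          add: of_nat_nat)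
      ultimately show ?case using elim by (simp add: logn_def floorlog_def)
    qed
  qed
  also have "(\<lambda>n. log 2 (real n) + 1) \<in> O(\<lambda>n. ln (real n) ^ 1)" by real_asymp
  finally show ?thesis unfolding polylog_def by blast
qed

lemma polylog_expo: "polylog expo"
  unfolding expo_def[abs_def] by (intro polylog_add polylog_mult polylog_const polylog_logn)

text \<open>By minimality of \<open>hbits\<close> the preceding power of two is still below the
  fourth power of \<open>expo\<close>.\<close>

lemma polylog_hash: "polylog (\<lambda>n. 2 ^ hbits n)"
proof (rule polylog_le)
  show "polylog (\<lambda>n. 2 * expo n ^ 4)" by (intro polylog_mult polylog_power polylog_const polylog_expo)
  show "2 ^ hbits n \<le> 2 * expo n ^ 4" for n
  proof (cases "hbits n")
    case (Suc i)
    then have "2 ^ i < expo n ^ 4" using hbits_least[of i n] by simp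
    then show ?thesis using Suc by simp
  qed (simp add: expo_def)
qed

lemma polylog_hbits: "polylog hbits"
  by (rule polylog_le[OF polylog_hash]) (simp add: less_imp_le)

lemma bits_power: "bits (x ^ k) \<le> k * bits x + 2"
proof (induction k)
  case (Suc k) then show ?case using bits_mult[of x "x ^ k"] by simp
qed simp

text \<open>Crude, but applied only to quantities that are polylogarithmic themselves.\<close>

lemma bits_of_nat_le: "bits (int x) \<le> x + 1"
  using bits_le_iff[of "int x" x] by (simp add: of_nat_less_two_power)

lemma bits_Suc_le: "bits (int n + 1) \<le> logn n + 2"
proof -
  have "int n + 1 \<le> int (2 ^ logn n)" using less_2_power_logn[of n] by linarith
  then have "\<bar>int n + 1\<bar> < 2 ^ Suc (logn n)" by simp
  then show ?thesis using bits_le_iff[of "int n + 1" "Suc (logn n)"] by simp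
qed

lemma polylog_bits_Suc: "polylog (\<lambda>n. bits (int n + 1))"
  by (rule polylog_le[OF polylog_add[OF polylog_logn polylog_const] bits_Suc_le])

lemma polylog_bits_int: "polylog (\<lambda>n. bits (int n))"
  by (rule polylog_le[OF polylog_bits_Suc]) (auto intro: bits_mono)

lemma polylog_bits_of_nat: "polylog f \<Longrightarrow> polylog (\<lambda>n. bits (int (f n)))"
  by (rule polylog_le[OF polylog_add[OF _ polylog_const] bits_of_nat_le])

lemma polylog_bits_add: "polylog (\<lambda>n. bits (f n)) \<Longrightarrow> polylog (\<lambda>n. bits (g
    n)) \<Longrightarrow> polylog (\<lambda>n. bits (f n + g n))"
  by (rule polylog_le[OF polylog_add, OF _ _ bits_add])

lemma polylog_bits_mult: "polylog (\<lambda>n. bits (f n)) \<Longrightarrow> polylog (\<lambda>n. bits (g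
    n)) \<Longrightarrow> polylog (\<lambda>n. bits (f n * g n))"
  by (rule polylog_le[OF polylog_add, OF _ _ bits_mult])

lemma polylog_bits_power: "polylog (\<lambda>n. bits (f n)) \<Longrightarrow> polylog k \<Longrightarrow>
    polylog (\<lambda>n. bits (f n ^ k n))"
  by (rule polylog_le[OF polylog_add[OF polylog_mult polylog_const] bits_power])

text \<open>\<open>vbound\<close> is built from numbers of polylogarithmic bit length by sums,
  products and powers with polylogarithmic exponents; each of these operations keeps the bit length
  polylogarithmic.\<close>

lemma polylog_step_cost: "polylog (\<lambda>n. step_cost (vbound n))"
proof -
  have 1: "polylog (\<lambda>n. bits ((int n + 1) ^ c))" for c
    by (rule polylog_bits_power[OF polylog_bits_Suc polylog_const])
  have 2: "polylog (\<lambda>n. bits (2 ^ hbits n))" "polylog (\<lambda>n. logn n + 3)"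
    by (intro polylog_bits_power polylog_const polylog_add polylog_logn polylog_hbits)+
  have 3: "polylog (\<lambda>n. bits (2 ^ (logn n + 3)))" "polylog (\<lambda>n. bits ((2 * int (expo n)) ^
      (logn n + 3)))"
    using 2(2) by (intro polylog_bits_power polylog_bits_mult polylog_bits_of_nat polylog_expo
        polylog_const; assumption)+
  have 4: "polylog (\<lambda>n. bits (32 * int (logn n) + 3))"
    by (intro polylog_bits_add polylog_bits_mult polylog_bits_of_nat polylog_logn polylog_const)
  have "polylog (\<lambda>n. bits (vbound n))"
    unfolding vbound_def
    by (rule polylog_bits_add[OF polylog_bits_add[OF polylog_bits_add[OF polylog_bits_add]]])
      (intro 1 4 3(1) polylog_bits_mult[OF polylog_bits_mult] 2(1) 3(2) polylog_const)+
  then show ?thesis unfolding step_cost_def by (intro polylog_mult polylog_const)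
qed

lemma soft_O_polylog_mult:
  assumes "polylog q" "f \<in> soft_O g"
  shows "(\<lambda>n. real (q n) * f n) \<in> soft_O g"
proof -
  obtain k l where "(\<lambda>n. real (q n)) \<in> O(\<lambda>n. ln (real n) ^ k)" "f \<in> O(\<lambda>n. g
      n * ln (real n) ^ l)"
    using assms unfolding polylog_def soft_O_def by blast
  from landau_o.big.mult[OF this] have "(\<lambda>n. real (q n) * f n) \<in> O(\<lambda>n. g n * ln (real
      n) ^ (k + l))"
    by (simp add: power_add mult_ac)
  then show ?thesis unfolding soft_O_def by blast
qed

lemma soft_O_add:
  assumes "f \<in> soft_O g" "f' \<in> soft_O g"
  shows "(\<lambda>n. f n + f' n) \<in> soft_O g"
proof -
  obtain k l where *: "f \<in> O(\<lambda>n. g n * ln (real n) ^ k)" "f' \<in> O(\<lambda>n. g n * ln (real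
      n) ^ l)"
    using assms unfolding soft_O_def by blast
  have mono: "(\<lambda>n. g n * ln (real n) ^ i) \<in> O(\<lambda>n. g n * ln (real n) ^ max k l)" if "i
      \<le> max k l" for i
    using ln_power_mono[OF that] by (intro landau_o.big.mult) auto
  have "f \<in> O(\<lambda>n. g n * ln (real n) ^ max k l)" "f' \<in> O(\<lambda>n. g n * ln (real n) ^ max
      k l)"
    using landau_o.big_trans[OF *(1) mono] landau_o.big_trans[OF *(2) mono] by simp_all
  from sum_in_bigo(1)[OF this] show ?thesis unfolding soft_O_def by blast
qed

lemma soft_O_abs: "f \<in> soft_O g \<Longrightarrow> (\<lambda>n. \<bar>f n\<bar>) \<in> soft_O g"
  unfolding soft_O_def by simp

lemma soft_O_bigo: "f \<in> O(g) \<Longrightarrow> f \<in> soft_O g"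
  unfolding soft_O_def by (intro UN_I[of 0]) auto

lemma soft_O_mono:
  assumes "g \<in> O(h)" "f \<in> soft_O g"
  shows "f \<in> soft_O h"
proof -
  obtain k where k: "f \<in> O(\<lambda>n. g n * ln (real n) ^ k)" using assms(2) unfolding soft_O_def by blast
  have "(\<lambda>n. g n * ln (real n) ^ k) \<in> O(\<lambda>n. h n * ln (real n) ^ k)"
    using assms(1) by (intro landau_o.big.mult) auto
  from landau_o.big_trans[OF k this] show ?thesis unfolding soft_O_def by blast
qed

lemma powr_bigo_mono:
  assumes "w \<le> w'"
  shows "(\<lambda>n. real n powr w) \<in> O(\<lambda>n. real n powr w')"
proof (rule bigoI[where c = 1])
  have "eventually (\<lambda>n::nat. 1 \<le> n) sequentially" by (rule eventually_ge_at_top)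
  then show "eventually (\<lambda>n. norm (real n powr w) \<le> 1 * norm (real n powr w')) sequentially"
    by eventually_elim (use assms in \<open>auto intro: powr_mono\<close>)
qed

text \<open>An assignment changes at most one cell and takes at least one time unit.\<close>

lemma exec_card_changed: "exec P s t s' \<Longrightarrow> finite {i. s' a i \<noteq> s a i} \<and> card {i.
    s' a i \<noteq> s a i} \<le> t"
proof (induction rule: exec.induct)
  case (Assign b e f s)
  let ?D = "{i. (s(b := (s b)(val s e := val s f))) a i \<noteq> s a i}"
  have "?D \<subseteq> {val s e}" by (auto split: if_splits)
  then show ?case using card_mono[of "{val s e}" ?D] finite_subset[of ?D "{val s e}"] by simp
next
  case (Seq P s t s' Q u s'')
  have sub: "{i. s'' a i \<noteq> s a i} \<subseteq> {i. s' a i \<noteq> s a i} \<union> {i. s'' a i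
      \<noteq> s' a i}" by auto
  have "card {i. s'' a i \<noteq> s a i} \<le> card ({i. s' a i \<noteq> s a i} \<union> {i. s'' a i
      \<noteq> s' a i})"
    using Seq by (intro card_mono[OF _ sub]) auto
  also have "\<dots> \<le> t + u" using Seq card_Un_le[of "{i. s' a i \<noteq> s a i}" "{i. s'' a i
      \<noteq> s' a i}"] by linarith
  finally show ?case using Seq finite_subset[OF sub] by auto
next
  case (WhileTrue s b P t s' u s'')
  have sub: "{i. s'' a i \<noteq> s a i} \<subseteq> {i. s' a i \<noteq> s a i} \<union> {i. s'' a i
      \<noteq> s' a i}" by auto
  have "card {i. s'' a i \<noteq> s a i} \<le> card ({i. s' a i \<noteq> s a i} \<union> {i. s'' a i
      \<noteq> s' a i})"
    using WhileTrue by (intro card_mono[OF _ sub]) auto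
  also have "\<dots> \<le> t + u" using WhileTrue card_Un_le[of "{i. s' a i \<noteq> s a i}" "{i. s'' a i
      \<noteq> s' a i}"] by linarith
  finally show ?case using WhileTrue finite_subset[OF sub] by auto
qed auto

section \<open>Bounds on the admissible exponents\<close>

lemma matmul_solvable_multiplies:
  assumes "matmul_solvable_in B"
  shows "\<exists>P. \<exists>T\<in>B. \<forall>n. multiplies n P (nat \<lfloor>T n\<rfloor>)"
proof -
  let ?inst = "\<lambda>n (X, Y). \<forall>i<n. \<forall>j<n. \<bar>X i j\<bar> \<le> int n ^ 1 \<and>
      \<bar>Y i j\<bar> \<le> int n ^ 1"
  let ?inp = "\<lambda>n (X, Y) s. s 0 0 = int n \<and> holds_matrix s 1 n X \<and> holds_matrix s 2 n Y"
  let ?out = "\<lambda>n (X, Y) s. holds_matrix s 3 n (\<lambda>i j. \<Sum>k<n. X i k * Y k j)"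
  have "solvable_in ?inst ?inp ?out B" using assms unfolding matmul_solvable_in_def by (rule spec)
  then obtain P T where T: "T \<in> B"
    and P: "\<And>n x s. ?inst n x \<Longrightarrow> ?inp n x s \<Longrightarrow> \<exists>t s'. exec P s t
        s' \<and> real t \<le> T n \<and> ?out n x s'"
    unfolding solvable_in_def by blast
  have "multiplies n P (nat \<lfloor>T n\<rfloor>)" for n
    unfolding multiplies_def
  proof (intro allI impI)
    fix f g and s :: store
    assume "\<forall>i<n. \<forall>j<n. \<bar>f i j\<bar> \<le> int n \<and> \<bar>g i j\<bar> \<le> int n"
        "s 0 0 = int n" "mat n (s 1) f" "mat n (s 2) g"
    then obtain t s' where t: "exec P s t s'" "real t \<le> T n" "mat n (s' 3) (\<lambda>i j. \<Sum>k<n. f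
        i k * g k j)"
      using P[of n "(f, g)" s] by (auto simp: holds_matrix_iff_mat)
    have "int t \<le> \<lfloor>T n\<rfloor>" using t(2) by (simp add: le_floor_iff)
    then have "t \<le> nat \<lfloor>T n\<rfloor>" by linarith
    with t show "runs P s (nat \<lfloor>T n\<rfloor>) (\<lambda>s'. mat n (s' 3) (\<lambda>i j. \<Sum>k<n.
        f i k * g k j))"
      unfolding runs_def by blast
  qed
  with T show ?thesis by blast
qed

text \<open>Nothing is assumed about the rest of the initial store, so the output array may be full
  of ones while zero factors force n^2 zeros into it. Below exponent 2 a power of the logarithm
  cannot make up for this.\<close>

lemma matmul_exponent_ge_2:
  assumes "matmul_solvable_in (soft_O (\<lambda>n. real n powr w))"
  shows "2 \<le> w"
proof (rule ccontr)
  assume w: "\<not> 2 \<le> w"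
  obtain P T where T: "T \<in> soft_O (\<lambda>n. real n powr w)" and P: "\<And>n. multiplies n P (nat
      \<lfloor>T n\<rfloor>)"
    using matmul_solvable_multiplies[OF assms] by blast
  have ge: "real (n ^ 2) \<le> \<bar>T n\<bar>" for n
  proof -
    define s :: store where "s a i = (if a = 0 then int n else if a = 3 then 1 else 0)" for a i
    have "runs P s (nat \<lfloor>T n\<rfloor>) (\<lambda>s'. mat n (s' 3) (\<lambda>i j. \<Sum>k<n. 0 * 0))"
      by (rule P[of n, unfolded multiplies_def, rule_format]) (auto simp: s_def mat_def)
    then obtain t s' where t: "exec P s t s'" "t \<le> nat \<lfloor>T n\<rfloor>" "mat n (s' 3) (\<lambda>i
        j. 0)"
      unfolding runs_def by auto
    have "inj_on (\<lambda>(i, j). cell n i j) ({..<n} \<times> {..<n})"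
      by (rule inj_onI) (auto simp: cell_eq_iff)
    then have "card ((\<lambda>(i, j). cell n i j) ` ({..<n} \<times> {..<n})) = n ^ 2"
      by (simp add: card_image power2_eq_square)
    moreover have "(\<lambda>(i, j). cell n i j) ` ({..<n} \<times> {..<n}) \<subseteq> {i. s' 3 i \<noteq>
        s 3 i}"
      using t(3) by (auto simp: s_def mat_def)
    then have "card ((\<lambda>(i, j). cell n i j) ` ({..<n} \<times> {..<n})) \<le> card {i. s' 3 i
        \<noteq> s 3 i}"
      using exec_card_changed[OF t(1), of 3] by (intro card_mono) auto
    ultimately have "n ^ 2 \<le> nat \<lfloor>T n\<rfloor>" using exec_card_changed[OF t(1), of 3] t(2) by
        linarith
    then have "real (n ^ 2) \<le> real (nat \<lfloor>T n\<rfloor>)" by (rule of_nat_mono)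
    also have "\<dots> \<le> \<bar>T n\<bar>" by linarith
    finally show ?thesis .
  qed
  obtain k where k: "T \<in> O(\<lambda>n. real n powr w * ln (real n) ^ k)" using T unfolding soft_O_def
      by blast
  have "(\<lambda>n. real (n ^ 2)) \<in> O(T)"
  proof (rule bigoI[where c = 1])
    have "norm (real (n ^ 2)) \<le> 1 * norm (T n)" for n using ge[of n] by simp
    then show "eventually (\<lambda>n. norm (real (n ^ 2)) \<le> 1 * norm (T n)) sequentially" by simp
  qed
  also note k
  also have "(\<lambda>n. real n powr w * ln (real n) ^ k) \<in> o(\<lambda>n. real (n ^ 2))"
    using w by real_asymp
  finally have "(\<lambda>n. real (n ^ 2)) \<in> o(\<lambda>n. real (n ^ 2))" .
  then have "eventually (\<lambda>n. real (n ^ 2) = 0) sequentially" by (simp add: landau_o.small_refl_iff)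
  moreover have "eventually (\<lambda>n::nat. 0 < n) sequentially" by (rule eventually_gt_at_top)
  ultimately have "eventually (\<lambda>n::nat. False) sequentially" by eventually_elim auto
  then show False by simp
qed

text \<open>Provides an admissible exponent. Without one, the infimum defining \<open>omega\<close>
  would range over the empty set and say nothing about matrix products.\<close>

definition Naive :: prog where
  "Naive = For2 (Seq (SetVar 5 (Const 0)) (Seq
     (For 92 0 (SetVar 5 (Add (Var 5) (Mul (At 1 (Var 90) (Var 92)) (At 2 (Var 92) (Var 91))))))
     (Assign 3 (Add (Mul (Var 90) (Var 0)) (Var 91)) (Var 5))))"

lemma runs_Naive:
  fixes X Y :: "nat \<Rightarrow> nat \<Rightarrow> int"
  assumes n: "s 0 0 = int n" "int n \<le> M" and X: "mat n (s 1) X" and Y: "mat n (s 2) Y"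
    and B: "\<And>i j. i < n \<Longrightarrow> j < n \<Longrightarrow> \<bar>X i j\<bar> \<le> B \<and>
        \<bar>Y i j\<bar> \<le> B" "B \<le> M" "int n * (B * B) \<le> M"
  shows "runs Naive s (Suc n ^ 3 * (9 * step_cost M)) (\<lambda>s'. mat n (s' 3) (\<lambda>i j. \<Sum>k<n.
      X i k * Y k j))"
proof -
  let ?u = "step_cost M"
  let ?in = "SetVar 5 (Add (Var 5) (Mul (At 1 (Var 90) (Var 92)) (At 2 (Var 92) (Var 91))))"
  have partial: "\<bar>\<Sum>k<r. X i k * Y k j\<bar> \<le> M" if "r \<le> n" "i < n" "j < n" for r i j
  proof -
    have "\<bar>\<Sum>k<r. X i k * Y k j\<bar> \<le> (\<Sum>k<r. \<bar>X i k * Y k j\<bar>)" by (rule sum_abs)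
    also have "\<dots> \<le> (\<Sum>k<r. B * B)"
    proof (rule sum_mono)
      fix k assume "k \<in> {..<r}"
      then have "\<bar>X i k\<bar> \<le> B" "\<bar>Y k j\<bar> \<le> B" using B(1) that by auto
      then show "\<bar>X i k * Y k j\<bar> \<le> B * B" unfolding abs_mult by (intro mult_mono) auto
    qed
    also have "\<dots> = int r * (B * B)" by simp
    also have "\<dots> \<le> int n * (B * B)" using that by (intro mult_right_mono) auto
    finally show ?thesis using B(3) by linarith
  qed
  have "runs Naive s ((Suc n)\<^sup>2 * ((?u + (Suc n * (?u + 2 * ?u) + ?u)) + 4 * ?u)) (\<lambda>s'. mat n
      (s' 3) (\<lambda>i j. \<Sum>k<n. X i k * Y k j))"
    unfolding Naive_def
  proof (rule runs_fill_body[where s = s, OF n])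
    fix i j s1
    assume ij: "i < n" "j < n" "s1 90 0 = int i" "s1 91 0 = int j"
      and f1: "\<And>c. c \<noteq> 90 \<Longrightarrow> c \<noteq> 91 \<Longrightarrow> c \<notin> written
          (Seq (SetVar 5 (Const 0)) (Seq (For 92 0 ?in) (Assign 3 (Add (Mul (Var 90) (Var 0)) (Var 91))
          (Var 5)))) \<Longrightarrow> s1 c = s c"
    show "runs (Seq (SetVar 5 (Const 0)) (Seq (For 92 0 ?in) (Assign 3 (Add (Mul (Var 90) (Var 0)) (Var
        91)) (Var 5)))) s1
      (?u + (Suc n * (?u + 2 * ?u) + ?u)) (\<lambda>s''. s'' 3 = (s1 3)(cell n i j := \<Sum>k<n. X i k * Y
          k j))"
    proof (rule runs_Seq[OF _ _ order_refl])
      show "runs (SetVar 5 (Const 0)) s1 ?u (\<lambda>s2. s2 5 0 = 0)" by (intro runs_Assign) auto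
      fix s2 assume s2: "s2 5 0 = 0" "\<And>a. a \<notin> written (SetVar 5 (Const 0)) \<Longrightarrow> s2
          a = s1 a"
      have n2: "s2 0 0 = int n" using s2(2)[of 0] f1[of 0] n by simp
      show "runs (Seq (For 92 0 ?in) (Assign 3 (Add (Mul (Var 90) (Var 0)) (Var 91)) (Var 5))) s2
        (Suc n * (?u + 2 * ?u) + ?u) (\<lambda>s''. s'' 3 = (s1 3)(cell n i j := \<Sum>k<n. X i k * Y k j))"
      proof (rule runs_Seq[OF _ _ order_refl])
        show "runs (For 92 0 ?in) s2 (Suc n * (?u + 2 * ?u)) (\<lambda>s3. s3 5 0 = (\<Sum>k<n. X i k * Y k j))"
        proof (rule runs_For[where s = s2 and Inv = "\<lambda>r s3. s3 5 0 = (\<Sum>k<r. X i k * Y k j)",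
            OF n2 n(2)])
          fix r s3 assume r: "r < n" "s3 5 0 = (\<Sum>k<r. X i k * Y k j)" "s3 92 0 = int r"
            and f3: "\<And>c. c \<noteq> 92 \<Longrightarrow> c \<notin> written ?in \<Longrightarrow> s3 c
                = s2 c"
          have st: "s3 0 0 = int n" "s3 90 0 = int i" "s3 91 0 = int j"
            using f3[of 0] f3[of 90] f3[of 91] s2(2)[of 90] s2(2)[of 91] n2 ij by simp_all
          have 1: "s3 1 (cell n i r) = X i r" using f3[of 1] s2(2)[of 1] f1[of 1] matD[OF X ij(1) r(1)] by simp
          have 2: "s3 2 (cell n r j) = Y r j" using f3[of 2] s2(2)[of 2] f1[of 2] matD[OF Y r(1) ij(2)] by simp
          have v: "val s3 (At 1 (Var 90) (Var 92)) = X i r" "val s3 (At 2 (Var 92) (Var 91)) = Y r j"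
            unfolding val.simps st r(3) 1 2 by simp_all
          have b: "\<bar>X i r\<bar> \<le> M" "\<bar>Y r j\<bar> \<le> M" using B(1)[OF ij(1) r(1)] B(1)[OF
              r(1) ij(2)] B(2) by linarith+
          have reads: "reads_le M s3 (At 1 (Var 90) (Var 92))" "reads_le M s3 (At 2 (Var 92) (Var 91))"
            unfolding reads_le.simps val.simps st r(3) 1 2 using b n ij r by auto
          show "runs ?in s3 ?u (\<lambda>s4. s4 5 0 = (\<Sum>k<Suc r. X i k * Y k j))"
          proof (rule runs_Assign)
            show "reads_le M s3 (Add (Var 5) (Mul (At 1 (Var 90) (Var 92)) (At 2 (Var 92) (Var 91))))"
              unfolding reads_le.simps(3,5) using reads r(2) partial[of r i j] r(1) ij by simp
            have "val s3 (Add (Var 5) (Mul (At 1 (Var 90) (Var 92)) (At 2 (Var 92) (Var 91)))) =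
                (\<Sum>k<Suc r. X i k * Y k j)"
              unfolding val.simps(3,5) v using r(2) by simp
            then show "(s3(5 := (s3 5)(val s3 (Const 0) := val s3 (Add (Var 5) (Mul (At 1 (Var 90) (Var
                92)) (At 2 (Var 92) (Var 91))))))) 5 0 =
              (\<Sum>k<Suc r. X i k * Y k j)" by (simp only: val.simps(1) fun_upd_same)
          qed simp_all
        qed (use s2(1) in auto)
        fix s3 assume s3: "s3 5 0 = (\<Sum>k<n. X i k * Y k j)" "\<And>a. a \<notin> written (For 92 0 ?in)
            \<Longrightarrow> s3 a = s2 a"
        have "s3 0 0 = int n" "s3 90 0 = int i" "s3 91 0 = int j" "s3 3 = s1 3"
          using s3(2) s2(2) n2 ij by simp_all
        then show "runs (Assign 3 (Add (Mul (Var 90) (Var 0)) (Var 91)) (Var 5)) s3 ?u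
           (\<lambda>s''. s'' 3 = (s1 3)(cell n i j := \<Sum>k<n. X i k * Y k j))"
          using s3(1) partial[of n i j] ij n by (intro runs_Assign) auto
      qed
    qed
  qed auto
  then show ?thesis
    by (rule runs_weaken) (auto simp: power2_eq_square power3_eq_cube algebra_simps)
qed

lemma matmul_solvable_cubic: "matmul_solvable_in (soft_O (\<lambda>n. real n powr 3))"
  unfolding matmul_solvable_in_def solvable_in_def
proof (intro allI)
  fix c :: nat
  define M where "M n = int n + int n ^ c + int n * (int n ^ c * int n ^ c)" for n
  define T where "T n = real (Suc n ^ 3 * (9 * step_cost (M n)))" for n
  have "polylog (\<lambda>n. bits (M n))"
    unfolding M_def by (intro polylog_bits_add polylog_bits_mult polylog_bits_power polylog_bits_int
        polylog_const)
  then have pl: "polylog (\<lambda>n. 9 * step_cost (M n))" unfolding step_cost_def by (intro polylog_mult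
      polylog_const)
  have "(\<lambda>n. real (Suc n ^ 3)) \<in> O(\<lambda>n. real n powr 3)" by real_asymp
  from soft_O_polylog_mult[OF pl soft_O_bigo[OF this]]
  have T: "T \<in> soft_O (\<lambda>n. real n powr 3)" unfolding T_def by (simp add: mult_ac)
  show "\<exists>P. \<exists>T\<in>soft_O (\<lambda>n. real n powr 3). \<forall>n x s.
       (case x of (X, Y) \<Rightarrow> \<forall>i<n. \<forall>j<n. \<bar>X i j\<bar> \<le> int n ^ c \<and>
           \<bar>Y i j\<bar> \<le> int n ^ c) \<longrightarrow>
       (case x of (X, Y) \<Rightarrow> \<lambda>s. s 0 0 = int n \<and> holds_matrix s 1 n X \<and>
           holds_matrix s 2 n Y) s \<longrightarrow>
       (\<exists>t s'. exec P s t s' \<and> real t \<le> T n \<and>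
          (case x of (X, Y) \<Rightarrow> \<lambda>s. holds_matrix s 3 n (\<lambda>i j. \<Sum>k<n. X i k *
              Y k j)) s')"
  proof (intro exI[of _ Naive] bexI[OF _ T] allI impI)
    fix n and x :: "(nat \<Rightarrow> nat \<Rightarrow> int) \<times> (nat \<Rightarrow> nat \<Rightarrow>
        int)" and s :: store
    assume b: "case x of (X, Y) \<Rightarrow> \<forall>i<n. \<forall>j<n. \<bar>X i j\<bar> \<le> int n ^ c
        \<and> \<bar>Y i j\<bar> \<le> int n ^ c"
      and s: "(case x of (X, Y) \<Rightarrow> \<lambda>s. s 0 0 = int n \<and> holds_matrix s 1 n X \<and>
          holds_matrix s 2 n Y) s"
    obtain X Y where x: "x = (X, Y)" by (cases x)
    have nn: "0 \<le> int n ^ c" "0 \<le> int n * (int n ^ c * int n ^ c)" by simp_all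
    have le: "int n \<le> M n" "int n ^ c \<le> M n" "int n * (int n ^ c * int n ^ c) \<le> M n"
      using nn unfolding M_def by linarith+
    have "runs Naive s (Suc n ^ 3 * (9 * step_cost (M n))) (\<lambda>s'. mat n (s' 3) (\<lambda>i j.
        \<Sum>k<n. X i k * Y k j))"
      using b s le unfolding x by (intro runs_Naive[where B = "int n ^ c"]) (auto simp: holds_matrix_iff_mat)
    then obtain t s' where "exec Naive s t s'" "t \<le> Suc n ^ 3 * (9 * step_cost (M n))" "mat n (s' 3)
        (\<lambda>i j. \<Sum>k<n. X i k * Y k j)"
      unfolding runs_def by blast
    moreover from this(2) have "real t \<le> T n" unfolding T_def by (rule of_nat_mono)
    ultimately show "\<exists>t s'. exec Naive s t s' \<and> real t \<le> T n \<and>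
          (case x of (X, Y) \<Rightarrow> \<lambda>s. holds_matrix s 3 n (\<lambda>i j. \<Sum>k<n. X i k *
              Y k j)) s'"
      unfolding x by (auto simp: holds_matrix_iff_mat)
  qed
qed

text \<open>The cost is a polylogarithmic factor times the time of one product plus quadratic work.
  The latter fits into the same bound because 2 \<le> w.\<close>

lemma forest_from_matmul:
  assumes "matmul_solvable_in (soft_O (\<lambda>n. real n powr w))"
  shows "reachability_forest_solvable_in (soft_O (\<lambda>n. real n powr w))"
proof -
  obtain mp T where T: "T \<in> soft_O (\<lambda>n. real n powr w)" and mp: "\<And>n. multiplies n mp (nat
      \<lfloor>T n\<rfloor>)"
    using matmul_solvable_multiplies[OF assms] by blast
  have w: "2 \<le> w" using assms by (rule matmul_exponent_ge_2)
  define q where "q n = params_cost n + 8 * logn n + 30 + (logn n + 4) * ((32 * logn n + 1) *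
     ((logn n + 4) * (2 * 2 ^ hbits n * 2 ^ hbits n + 1) * 19) + 4)" for n
  have q: "polylog q"
    unfolding q_def params_cost_def
    by (intro polylog_add polylog_mult polylog_power polylog_const polylog_logn polylog_hbits polylog_hash)
  \<comment> \<open>T may be negative somewhere; its absolute value still dominates
    \<open>nat \<lfloor>T n\<rfloor>\<close>.\<close>
  define U where "U n = real (q n) * (\<bar>T n\<bar> + real (16 * step_cost (vbound n)) * real ((Suc
      n)\<^sup>2))" for n
  have "(\<lambda>n. real ((Suc n)\<^sup>2)) \<in> O(\<lambda>n. real n powr 2)" by real_asymp
  then have "(\<lambda>n. real ((Suc n)\<^sup>2)) \<in> soft_O (\<lambda>n. real n powr w)"
    using soft_O_mono[OF powr_bigo_mono[OF w]] soft_O_bigo by blast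
  then have U: "U \<in> soft_O (\<lambda>n. real n powr w)"
    unfolding U_def
    by (intro soft_O_polylog_mult[OF q] soft_O_add soft_O_abs[OF T] soft_O_polylog_mult polylog_mult
        polylog_const polylog_step_cost)
  have cost: "real (main_cost n (nat \<lfloor>T n\<rfloor>)) \<le> U n" for n
  proof -
    have "main_cost n (nat \<lfloor>T n\<rfloor>) = q n * (nat \<lfloor>T n\<rfloor> + 16 * step_cost
        (vbound n) * (Suc n)\<^sup>2)"
      by (simp add: main_cost_def q_def mm_cost_def mult_ac)
    moreover have "real (nat \<lfloor>T n\<rfloor>) \<le> \<bar>T n\<bar>" by linarith
    ultimately show ?thesis
      unfolding U_def by (simp only: of_nat_mult of_nat_add) (intro mult_left_mono add_right_mono; simp)
  qed
  show ?thesis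
    unfolding reachability_forest_solvable_in_def solvable_in_def
  proof (intro exI[of _ "Main mp"] bexI[OF _ U] allI impI)
    fix n G and s :: store
    assume G: "pair_wf_digraph G \<and> pverts G = {..<n}"
      and s: "s 0 0 = int n \<and> holds_matrix s 1 n (\<lambda>u v. if (u, v) \<in> parcs G then 1 else 0)"
    have "mat n (s 1) (\<lambda>u v. of_bool ((u, v) \<in> parcs G))"
      using s unfolding holds_matrix_iff_mat by (simp add: mat_def)
    then have "runs (Main mp) s (main_cost n (nat \<lfloor>T n\<rfloor>)) (\<lambda>s'. reachability_forest G
       (\<lambda>a. {(u, v). v < n \<and> s' 2 (cell n a v) = int u + 1}))"
      using G s mp by (intro runs_Main) auto
    then obtain t s' where "exec (Main mp) s t s'" "t \<le> main_cost n (nat \<lfloor>T n\<rfloor>)"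
      and forest: "reachability_forest G (\<lambda>a. {(u, v). v < n \<and> s' 2 (cell n a v) = int u + 1})"
      unfolding runs_def by blast
    moreover from this(2) have "real t \<le> U n" using cost[of n] by linarith
    moreover have "reachability_forest G (\<lambda>a. {(u, v). v < n \<and> s' 2 (int (a * n + v)) = int u
        + 1})"
      using forest by simp
    ultimately show "\<exists>t s'. exec (Main mp) s t s' \<and> real t \<le> U n \<and>
       reachability_forest G (\<lambda>a. {(u, v). v < n \<and> s' 2 (int (a * n + v)) = int u + 1})" by blast
  qed
qed

text \<open>An infimum need not be attained. The bound is therefore given for every exponent above
  \<open>omega\<close>, and for \<open>omega\<close> itself if matrix multiplication attains it. In
  the first case some admissible w lies below omega + \<epsilon>, and its bound is weakened.\<close>

theorem theorem7p17:
  shows "(\<forall>\<epsilon>>0. reachability_forest_solvable_in (soft_O (\<lambda>n. real n powr (omega +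
      \<epsilon>)))) \<and>
         (matmul_solvable_in (soft_O (\<lambda>n. real n powr omega)) \<longrightarrow>
            reachability_forest_solvable_in (soft_O (\<lambda>n. real n powr omega)))"
proof (intro conjI allI impI)
  fix \<epsilon> :: real
  assume "0 < \<epsilon>"
  then have "Inf {w. matmul_solvable_in (soft_O (\<lambda>n. real n powr w))} < omega + \<epsilon>" by
      (simp add: omega_def)
  then obtain w where w: "matmul_solvable_in (soft_O (\<lambda>n. real n powr w))" "w < omega + \<epsilon>"
    using cInf_lessD[of "{w. matmul_solvable_in (soft_O (\<lambda>n. real n powr w))}"]
        matmul_solvable_cubic by blast
  have "soft_O (\<lambda>n. real n powr w) \<subseteq> soft_O (\<lambda>n. real n powr (omega + \<epsilon>))"
    using soft_O_mono[OF powr_bigo_mono] w(2) by (meson less_imp_le subsetI)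
  with forest_from_matmul[OF w(1)] show "reachability_forest_solvable_in (soft_O (\<lambda>n. real n powr
      (omega + \<epsilon>)))"
    unfolding reachability_forest_solvable_in_def solvable_in_def by blast
qed (rule forest_from_matmul)

end
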